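(* Let $d\in\{1,2,3\}$, let $\Omega\subset\mathbb{R}^d$ be a bounded Lipschitz domain with a conforming simplicial initial triangulation $\mathcal T_0$, let $f,g\in L^2(\Omega)$ and $\boldsymbol f,\boldsymbol g\in[L^2(\Omega)]^d$, and let $A\colon\Omega\to\mathbb{R}^{d\times d}_{\rm sym}$ and $b\colon\Omega\times\mathbb{R}\to\mathbb{R}$. Assume the following. (RHS) If $d\ge2$, there is $p>d$ such that $\boldsymbol f,\boldsymbol g\in[L^p(\Omega)]^d$ and $f,g\in L^q(\Omega)$, where $1/q:=1/p+1/d$; moreover $\boldsymbol f|_T,\boldsymbol g|_T\in H({\rm div},T)$ and $\boldsymbol f|_T\cdot\boldsymbol n,\boldsymbol g|_T\cdot\boldsymbol n\in L^2(\partial T)$ for all $T\in\mathcal T_0$. (ELL) $A\in L^\infty(\Omega;\mathbb{R}^{d\times d}_{\rm sym})$ with $0<\mu_0:=\inf_{x\in\Omega}\lambda_{\min}(A(x))\le\mu_1:=\sup_{x\in\Omega}\lambda_{\max}(A(x))<\infty$; moreover $A|_T\in W^{1,\infty}(T)$ for all $T\in\mathcal T_0$. (CAR) For all $j\in\mathbb{N}_0$, $x\mapsto\partial_\xi^j b(x,\xi)$ is measurable on $\Omega$ for every $\xi\in\mathbb{R}$, and $\xi\mapsto\partial_\xi^j b(x,\xi)$ is smooth for every $x\in\Omega$. (MON) $b'(x,\xi):=\partial_\xi b(x,\xi)\ge0$ and $b(x,0)=0$ for all $x\in\Omega$, $\xi\in\mathbb{R}$. (CGC) There are $n\in\mathbb{N}$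 with $n\ge2$ (and $n\le3$ if $d=3$) and $R>0$ such that $|\partial_\xi^k b(x,\xi)|\le R(1+|\xi|^{n-k})$ for all $x\in\Omega$, $\xi\in\mathbb{R}$, $0\le k\le n$. Let $u_\ell$ and $z_\ell[u_\ell]$, $\ell\in\mathbb{N}_0$, be the discrete primal and dual solutions generated by the adaptive algorithm described in the context (with any $0<\theta\le1$, $1\le C_{\rm mark}\le\infty$), and suppose that $\|z[u]-z_\ell[u_\ell]\|_A\to0$ as $\ell\to\infty$. Then, for all $0<\delta<1$, there exists $\ell_0\in\mathbb{N}$ such that for all $\ell\ge\ell_0$ and all $k\in\mathbb{N}_0$, $$\big[\|u-u_{\ell+k}\|_A^2+\|z[u]-z_{\ell+k}[u_{\ell+k}]\|_A^2\big]+\big[\|u_{\ell+k}-u_\ell\|_A^2+\|z_{\ell+k}[u_{\ell+k}]-z_\ell[u_\ell]\|_A^2\big]\le\frac{1}{1-\delta}\big[\|u-u_\ell\|_A^2+\|z[u]-z_\ell[u_\ell]\|_A^2\big].$$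
   Context: Notation: $\langle v,w\rangle:=\int_\Omega vw\,dx$; $b(v)$ denotes $x\mapsto b(x,v(x))$, likewise $b'(v)$; $a(v,w):=\langle A\nabla v,\nabla w\rangle$, $\|v\|_A:=a(v,v)^{1/2}$; $G(v):=\langle g,v\rangle+\langle\boldsymbol g,\nabla v\rangle$. Meshes and spaces: mesh refinement is newest vertex bisection (NVB; bisection if $d=1$). $\mathbb{T}$ is the set of all triangulations obtained from $\mathcal T_0$ by finitely many NVB refinement steps; ${\tt refine}(\mathcal T_H,\mathcal M_H)$ is the coarsest NVB refinement of $\mathcal T_H$ in which all elements of $\mathcal M_H\subseteq\mathcal T_H$ have been refined. For a fixed degree $m\in\mathbb{N}$ and $\mathcal T_H\in\mathbb{T}$, $\mathcal X_H:=\{v\in H^1_0(\Omega):v|_T\text{ polynomial of degree}\le m\ \forall T\in\mathcal T_H\}$. Problems: $u\in H^1_0(\Omega)$ is the unique solution of $a(u,v)+\langle b(u),v\rangle=\langle f,v\rangle+\langle\boldsymbol f,\nabla v\rangle$ for all $v\in H^1_0(\Omega)$, and $u_H\in\mathcal X_H$ the unique solution of the same equation with $H^1_0(\Omega)$ replaced by $\mathcal X_H$. For $w\in H^1_0(\Omega)$, $z[w]\in H^1_0(\Omega)$ is the unique solution of $a(z[w],v)+\langle b'(w)z[w],v\rangle=G(v)$ for all $v\in H^1_0(\Omega)$, and $z_H[w]\in\mathcal X_H$ the unique solution of the same equation with $H^1_0(\Omega)$ replaced by $\mathcal X_H$. Estimators: with $h_T:=|T|^{1/d}$, $\boldsymbol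 n$ the outer unit normal and $[\![\cdot]\!]$ the jump across interior facets ($[\![\cdot]\!]:=0$ if $d=1$), for $T\in\mathcal T_H$, $v_H\in\mathcal X_H$, $\eta_H(T,v_H)^2:=h_T^2\|f+{\rm div}(A\nabla v_H-\boldsymbol f)-b(v_H)\|_{L^2(T)}^2+h_T\|[\![(A\nabla v_H-\boldsymbol f)\cdot\boldsymbol n]\!]\|_{L^2(\partial T\cap\Omega)}^2$, $\zeta_H(w;T,v_H)^2:=h_T^2\|g+{\rm div}(A\nabla v_H-\boldsymbol g)-b'(w)v_H\|_{L^2(T)}^2+h_T\|[\![(A\nabla v_H-\boldsymbol g)\cdot\boldsymbol n]\!]\|_{L^2(\partial T\cap\Omega)}^2$. For $\mathcal U\subseteq\mathcal T_H$: $\eta_H(\mathcal U,v_H)^2:=\sum_{T\in\mathcal U}\eta_H(T,v_H)^2$, $\zeta_H(\mathcal U,z_H[w])^2:=\sum_{T\in\mathcal U}\zeta_H(w;T,z_H[w])^2$; $\eta_H(v_H):=\eta_H(\mathcal T_H,v_H)$, $\zeta_H(z_H[w]):=\zeta_H(\mathcal T_H,z_H[w])$, $\zeta_H(T,z_H[w]):=\zeta_H(w;T,z_H[w])$. Adaptive algorithm: input $0<\theta\le1$, $C_{\rm mark}\ge1$, $\mathcal T_0$. For $\ell=0,1,2,\dots$ (subscript $\ell$ refers to $\mathcal T_\ell$): (i) compute $u_\ell$, $z_\ell[u_\ell]\in\mathcal X_\ell$; (ii) compute $\eta_\ell(T,u_\ell)$ and $\zeta_\ell(T,z_\ell[u_\ell])$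 for all $T\in\mathcal T_\ell$; (iii) determine sets $\overline{\mathcal M}{}_\ell^{u},\overline{\mathcal M}{}_\ell^{uz}\subseteq\mathcal T_\ell$ of, up to the multiplicative constant $C_{\rm mark}$, minimal cardinality (no cardinality restriction if $C_{\rm mark}=\infty$) such that $\theta\,\eta_\ell(u_\ell)^2\le\eta_\ell(\overline{\mathcal M}{}_\ell^{u},u_\ell)^2$ and $\theta[\eta_\ell(u_\ell)^2+\zeta_\ell(z_\ell[u_\ell])^2]\le\eta_\ell(\overline{\mathcal M}{}_\ell^{uz},u_\ell)^2+\zeta_\ell(\overline{\mathcal M}{}_\ell^{uz},z_\ell[u_\ell])^2$, respectively; (iv) select $\mathcal M_\ell^u\subseteq\overline{\mathcal M}{}_\ell^u$ and $\mathcal M_\ell^{uz}\subseteq\overline{\mathcal M}{}_\ell^{uz}$ with $\#\mathcal M_\ell^u=\#\mathcal M_\ell^{uz}=\min\{\#\overline{\mathcal M}{}_\ell^u,\#\overline{\mathcal M}{}_\ell^{uz}\}$; (v) set $\mathcal M_\ell:=\mathcal M_\ell^u\cup\mathcal M_\ell^{uz}$ and $\mathcal T_{\ell+1}:={\tt refine}(\mathcal T_\ell,\mathcal M_\ell)$. *)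

theory Defs
  imports "HOL-Analysis.Analysis"
begin

section \<open>Lebesgue and Sobolev spaces\<close>

text \<open>
  Elements of function spaces are represented by functions on the whole Euclidean space, of which
  only the values almost everywhere on the set in question matter.
\<close>

definition Lp :: "real \<Rightarrow> 'a measure \<Rightarrow> ('a \<Rightarrow> 'b::euclidean_space) set" where
  "Lp p M = {f \<in> borel_measurable M. integrable M (\<lambda>x. norm (f x) powr p)}"

definition Linf :: "'a measure \<Rightarrow> ('a \<Rightarrow> 'b::euclidean_space) set" where
  "Linf M = {f \<in> borel_measurable M. \<exists>C. AE x in M. norm (f x) \<le> C}"

definition grad :: "(real^'d \<Rightarrow> real) \<Rightarrow> real^'d \<Rightarrow> real^'d" where
  "grad f x = (\<chi> i. frechet_derivative f (at x) (axis i 1))"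

primrec Ck :: "nat \<Rightarrow> (real^'d \<Rightarrow> real) \<Rightarrow> bool" where
  "Ck 0 f \<longleftrightarrow> continuous_on UNIV f"
| "Ck (Suc k) f \<longleftrightarrow> (\<forall>x. f differentiable (at x)) \<and> (\<forall>i. Ck k (\<lambda>x. grad f x $ i))"

definition test_functions :: "(real^'d) set \<Rightarrow> (real^'d \<Rightarrow> real) set" where
  "test_functions U =
     {\<phi>. (\<forall>k. Ck k \<phi>) \<and> compact (closure {x. \<phi> x \<noteq> 0}) \<and> closure {x. \<phi> x \<noteq> 0} \<subseteq> U}"

definition is_weak_grad :: "(real^'d) set \<Rightarrow> (real^'d \<Rightarrow> real) \<Rightarrow> (real^'d \<Rightarrow> real^'d) \<Rightarrow> bool" where
  "is_weak_grad U v G \<longleftrightarrow> (\<forall>\<phi>\<in>test_functions U. \<forall>i.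
     (LINT x|lebesgue_on U. v x * grad \<phi> x $ i) = - (LINT x|lebesgue_on U. G x $ i * \<phi> x))"

definition is_weak_div :: "(real^'d) set \<Rightarrow> (real^'d \<Rightarrow> real^'d) \<Rightarrow> (real^'d \<Rightarrow> real) \<Rightarrow> bool" where
  "is_weak_div U F q \<longleftrightarrow> (\<forall>\<phi>\<in>test_functions U.
     (LINT x|lebesgue_on U. F x \<bullet> grad \<phi> x) = - (LINT x|lebesgue_on U. q x * \<phi> x))"

definition H1 :: "(real^'d) set \<Rightarrow> (real^'d \<Rightarrow> real) set" where
  "H1 U = {v \<in> Lp 2 (lebesgue_on U). \<exists>G\<in>Lp 2 (lebesgue_on U). is_weak_grad U v G}"

definition wgrad :: "(real^'d) set \<Rightarrow> (real^'d \<Rightarrow> real) \<Rightarrow> real^'d \<Rightarrow> real^'d" where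
  "wgrad U v = (SOME G. G \<in> Lp 2 (lebesgue_on U) \<and> is_weak_grad U v G)"

definition H1_norm :: "(real^'d) set \<Rightarrow> (real^'d \<Rightarrow> real) \<Rightarrow> real" where
  "H1_norm U v =
     sqrt ((LINT x|lebesgue_on U. (v x)\<^sup>2) + (LINT x|lebesgue_on U. (norm (wgrad U v x))\<^sup>2))"

definition H10 :: "(real^'d) set \<Rightarrow> (real^'d \<Rightarrow> real) set" where
  "H10 U = {v \<in> H1 U. \<exists>\<phi>::nat \<Rightarrow> real^'d \<Rightarrow> real. (\<forall>k. \<phi> k \<in> test_functions U) \<and>
     (\<lambda>k. H1_norm U (\<lambda>x. v x - \<phi> k x)) \<longlonglongrightarrow> 0}"

definition Hdiv :: "(real^'d) set \<Rightarrow> (real^'d \<Rightarrow> real^'d) set" where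
  "Hdiv U = {F \<in> Lp 2 (lebesgue_on U). \<exists>q\<in>Lp 2 (lebesgue_on U). is_weak_div U F q}"

definition wdiv :: "(real^'d) set \<Rightarrow> (real^'d \<Rightarrow> real^'d) \<Rightarrow> real^'d \<Rightarrow> real" where
  "wdiv U F = (SOME q. q \<in> Lp 2 (lebesgue_on U) \<and> is_weak_div U F q)"

definition W1inf :: "(real^'d) set \<Rightarrow> (real^'d \<Rightarrow> real) set" where
  "W1inf U = {v \<in> Linf (lebesgue_on U). \<exists>G\<in>Linf (lebesgue_on U). is_weak_grad U v G}"


section \<open>Lipschitz domains\<close>

text \<open>Near each boundary point, the domain is, in direction of some unit vector \<open>e\<close>, the strict
  epigraph of a Lipschitz function on the hyperplane orthogonal to \<open>e\<close>.\<close>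

definition lipschitz_domain :: "(real^'d) set \<Rightarrow> bool" where
  "lipschitz_domain \<Omega> \<longleftrightarrow> open \<Omega> \<and> connected \<Omega> \<and> \<Omega> \<noteq> {} \<and>
     (\<forall>x\<in>frontier \<Omega>. \<exists>U e C \<gamma>. open U \<and> x \<in> U \<and> norm e = 1 \<and> C-lipschitz_on {w. w \<bullet> e = 0} \<gamma> \<and>
        \<Omega> \<inter> U = {y \<in> U. \<gamma> (y - (y \<bullet> e) *\<^sub>R e) < y \<bullet> e})"


section \<open>Meshes and newest vertex bisection\<close>

text \<open>
  A tagged simplex consists of the ordered list of its vertices \<open>z\<^sub>0, \<dots>, z\<^sub>d\<close> and a type in
  \<open>{0, \<dots>, d - 1}\<close>; its refinement edge is the one between \<open>z\<^sub>0\<close> and \<open>z\<^sub>d\<close>. The bisection rule is the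
  one of Maubach, in the form of Stevenson (Math. Comp. 77, 2008); for \<open>d = 2\<close> the refinement
  edge of a child is the edge opposite to the new vertex, and for \<open>d = 1\<close> this is plain bisection.
\<close>

type_synonym 'a tsimplex = "'a list \<times> nat"

definition simp_set :: "(real^'d) tsimplex \<Rightarrow> (real^'d) set" where
  "simp_set T = convex hull (set (fst T))"

definition is_tsimplex :: "(real^'d) tsimplex \<Rightarrow> bool" where
  "is_tsimplex T \<longleftrightarrow> length (fst T) = CARD('d) + 1 \<and> distinct (fst T) \<and>
     \<not> affine_dependent (set (fst T)) \<and> snd T < CARD('d)"

definition children :: "(real^'d) tsimplex \<Rightarrow> (real^'d) tsimplex set" where
  "children T =
     (let zs = fst T; \<gamma> = snd T;
          mid = midpoint (hd zs) (last zs);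
          inner = butlast (tl zs);
          \<gamma>' = (\<gamma> + 1) mod CARD('d)
      in {(hd zs # mid # inner, \<gamma>'),
          (last zs # mid # take \<gamma> inner @ rev (drop \<gamma> inner), \<gamma>')})"

definition conforming_mesh :: "(real^'d) set \<Rightarrow> (real^'d) tsimplex set \<Rightarrow> bool" where
  "conforming_mesh \<Omega> M \<longleftrightarrow> finite M \<and> (\<forall>T\<in>M. is_tsimplex T) \<and> inj_on simp_set M \<and>
     triangulation (simp_set ` M) \<and> \<Union> (simp_set ` M) = closure \<Omega>"

definition bisect_step :: "(real^'d) tsimplex set \<Rightarrow> (real^'d) tsimplex set \<Rightarrow> bool" where
  "bisect_step M M' \<longleftrightarrow> (\<exists>T\<in>M. M' = (M - {T}) \<union> children T)"

definition nvb_refinements :: "(real^'d) set \<Rightarrow> (real^'d) tsimplex set \<Rightarrow> (real^'d) tsimplex set set" where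
  "nvb_refinements \<Omega> M = {M'. bisect_step\<^sup>*\<^sup>* M M' \<and> conforming_mesh \<Omega> M'}"

text \<open>
  A relation rather than a function: in dimension three, existence of the coarsest
  refinement is only guaranteed for suitably tagged initial meshes.
\<close>

definition is_refine ::
  "(real^'d) set \<Rightarrow> (real^'d) tsimplex set \<Rightarrow> (real^'d) tsimplex set \<Rightarrow> (real^'d) tsimplex set \<Rightarrow> bool" where
  "is_refine \<Omega> M marked M' \<longleftrightarrow>
     M' \<in> nvb_refinements \<Omega> M \<and> M' \<inter> marked = {} \<and>
     (\<forall>M''\<in>nvb_refinements \<Omega> M. M'' \<inter> marked = {} \<longrightarrow> M'' \<in> nvb_refinements \<Omega> M')"

definition polys :: "nat \<Rightarrow> (real^'d \<Rightarrow> real) set" where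
  "polys m = {p. \<exists>c::('d \<Rightarrow> nat) \<Rightarrow> real.
     p = (\<lambda>x. \<Sum>\<alpha> | sum \<alpha> UNIV \<le> m. c \<alpha> * (\<Prod>i\<in>UNIV. (x $ i) ^ \<alpha> i))}"

definition fem_space ::
  "(real^'d) set \<Rightarrow> nat \<Rightarrow> (real^'d) tsimplex set \<Rightarrow> (real^'d \<Rightarrow> real) set" where
  "fem_space \<Omega> m M =
     {v \<in> H10 \<Omega>. \<forall>T\<in>M. \<exists>p\<in>polys m. AE x in lebesgue_on (simp_set T). v x = p x}"


section \<open>Surface measure, normal traces and normal jumps\<close>

text \<open>
  On a flat facet, the \<open>(d - 1)\<close>-dimensional measure of a set equals the \<open>d\<close>-dimensional volume of
  the prism of height \<open>1\<close> over that set. The surface measure is therefore obtained by projecting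
  Lebesgue measure on the prism orthogonally onto the facet (for \<open>d = 1\<close>: a unit point mass).
\<close>

definition facet_normal :: "(real^'d) set \<Rightarrow> real^'d" where
  "facet_normal E = (SOME n. norm n = 1 \<and> (\<forall>x\<in>E. \<forall>y\<in>E. n \<bullet> (x - y) = 0))"

definition surface_measure :: "(real^'d) set \<Rightarrow> (real^'d) measure" where
  "surface_measure E =
     (let n = facet_normal E; x0 = (SOME x. x \<in> E)
      in distr (lebesgue_on {y + t *\<^sub>R n | y t. y \<in> E \<and> 0 \<le> t \<and> t \<le> 1}) borel
               (\<lambda>x. x - (n \<bullet> (x - x0)) *\<^sub>R n))"

text \<open>
  For smooth \<open>F\<close>, this is the integral over the boundary of \<open>K\<close> of \<open>(F \<bullet> n) * \<phi>\<close>, where \<open>n\<close> is the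
  outer unit normal. For \<open>F\<close> in \<open>Hdiv (interior K)\<close>, it defines the normal trace of \<open>F\<close>.
\<close>

definition green_form :: "(real^'d) set \<Rightarrow> (real^'d \<Rightarrow> real^'d) \<Rightarrow> (real^'d \<Rightarrow> real) \<Rightarrow> real" where
  "green_form K F \<phi> =
     (LINT x|lebesgue_on (interior K). F x \<bullet> grad \<phi> x) +
     (LINT x|lebesgue_on (interior K). wdiv (interior K) F x * \<phi> x)"

definition normal_trace_L2 :: "(real^'d) set \<Rightarrow> (real^'d \<Rightarrow> real^'d) \<Rightarrow> bool" where
  "normal_trace_L2 K F \<longleftrightarrow> (\<exists>q::real^'d \<Rightarrow> real.
     (\<forall>E. E facet_of K \<longrightarrow> q \<in> Lp 2 (surface_measure E)) \<and>
     (\<forall>\<phi>\<in>test_functions UNIV.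
        green_form K F \<phi> = (\<Sum>E | E facet_of K. LINT x|surface_measure E. q x * \<phi> x)))"

text \<open>
  The jump across the common facet \<open>E = K \<inter> K'\<close> is the sum of the two outer normal traces. It is
  defined as a sum, since on facets inside an element of the initial mesh the normal traces
  of an \<open>Hdiv\<close> field from either side need not be square integrable individually (while their
  sum vanishes). Test functions supported in the interior of \<open>K \<union> K'\<close> see no other facet.
\<close>

definition normal_jump ::
  "(real^'d) set \<Rightarrow> (real^'d) set \<Rightarrow> (real^'d \<Rightarrow> real^'d) \<Rightarrow> real^'d \<Rightarrow> real" where
  "normal_jump K K' F = (SOME q. q \<in> Lp 2 (surface_measure (K \<inter> K')) \<and>
     (\<forall>\<phi>\<in>test_functions (interior (K \<union> K')).
        (LINT x|surface_measure (K \<inter> K'). q x * \<phi> x) = green_form K F \<phi> + green_form K' F \<phi>))"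


section \<open>The model problem\<close>

definition eigenvalues :: "real^'d^'d \<Rightarrow> real set" where
  "eigenvalues B = {\<mu>. \<exists>v. v \<noteq> 0 \<and> B *v v = \<mu> *\<^sub>R v}"

definition lambda_min :: "real^'d^'d \<Rightarrow> real" where
  "lambda_min B = Min (eigenvalues B)"

definition lambda_max :: "real^'d^'d \<Rightarrow> real" where
  "lambda_max B = Max (eigenvalues B)"

definition assm_RHS ::
  "(real^'d) set \<Rightarrow> (real^'d) tsimplex set \<Rightarrow> (real^'d \<Rightarrow> real) \<Rightarrow> (real^'d \<Rightarrow> real^'d) \<Rightarrow>
   (real^'d \<Rightarrow> real) \<Rightarrow> (real^'d \<Rightarrow> real^'d) \<Rightarrow> bool" where
  "assm_RHS \<Omega> T0 f ff g gg \<longleftrightarrow>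
     (CARD('d) \<ge> 2 \<longrightarrow>
       (\<exists>p q::real. p > real CARD('d) \<and> 1 / q = 1 / p + 1 / real CARD('d) \<and>
          ff \<in> Lp p (lebesgue_on \<Omega>) \<and> gg \<in> Lp p (lebesgue_on \<Omega>) \<and>
          f \<in> Lp q (lebesgue_on \<Omega>) \<and> g \<in> Lp q (lebesgue_on \<Omega>)) \<and>
       (\<forall>T\<in>T0. ff \<in> Hdiv (interior (simp_set T)) \<and> gg \<in> Hdiv (interior (simp_set T)) \<and>
          normal_trace_L2 (simp_set T) ff \<and> normal_trace_L2 (simp_set T) gg))"

definition assm_ELL ::
  "(real^'d) set \<Rightarrow> (real^'d) tsimplex set \<Rightarrow> (real^'d \<Rightarrow> real^'d^'d) \<Rightarrow> bool" where
  "assm_ELL \<Omega> T0 A \<longleftrightarrow>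
     A \<in> Linf (lebesgue_on \<Omega>) \<and> (\<forall>x\<in>\<Omega>. transpose (A x) = A x) \<and>
     (let \<mu>0 = (INF x\<in>\<Omega>. ereal (lambda_min (A x)));
          \<mu>1 = (SUP x\<in>\<Omega>. ereal (lambda_max (A x)))
      in 0 < \<mu>0 \<and> \<mu>0 \<le> \<mu>1 \<and> \<mu>1 < \<infinity>) \<and>
     (\<forall>T\<in>T0. \<forall>i j. (\<lambda>x. A x $ i $ j) \<in> W1inf (interior (simp_set T)))"

definition assm_CAR :: "(real^'d) set \<Rightarrow> (real^'d \<Rightarrow> real \<Rightarrow> real) \<Rightarrow> bool" where
  "assm_CAR \<Omega> b \<longleftrightarrow>
     (\<forall>j \<xi>. (\<lambda>x. (deriv ^^ j) (b x) \<xi>) \<in> borel_measurable (lebesgue_on \<Omega>)) \<and>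
     (\<forall>x\<in>\<Omega>. \<forall>j \<xi>. (deriv ^^ j) (b x) differentiable (at \<xi>))"

definition assm_MON :: "(real^'d) set \<Rightarrow> (real^'d \<Rightarrow> real \<Rightarrow> real) \<Rightarrow> bool" where
  "assm_MON \<Omega> b \<longleftrightarrow> (\<forall>x\<in>\<Omega>. (\<forall>\<xi>. deriv (b x) \<xi> \<ge> 0) \<and> b x 0 = 0)"

definition assm_CGC :: "(real^'d) set \<Rightarrow> (real^'d \<Rightarrow> real \<Rightarrow> real) \<Rightarrow> bool" where
  "assm_CGC \<Omega> b \<longleftrightarrow> (\<exists>n R. n \<ge> 2 \<and> (CARD('d) = 3 \<longrightarrow> n \<le> 3) \<and> R > 0 \<and>
     (\<forall>x\<in>\<Omega>. \<forall>\<xi>. \<forall>k\<le>n. \<bar>(deriv ^^ k) (b x) \<xi>\<bar> \<le> R * (1 + \<bar>\<xi>\<bar> ^ (n - k))))"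

definition a_form ::
  "(real^'d) set \<Rightarrow> (real^'d \<Rightarrow> real^'d^'d) \<Rightarrow> (real^'d \<Rightarrow> real) \<Rightarrow> (real^'d \<Rightarrow> real) \<Rightarrow> real" where
  "a_form \<Omega> A v w = (LINT x|lebesgue_on \<Omega>. (A x *v wgrad \<Omega> v x) \<bullet> wgrad \<Omega> w x)"

definition norm_A ::
  "(real^'d) set \<Rightarrow> (real^'d \<Rightarrow> real^'d^'d) \<Rightarrow> (real^'d \<Rightarrow> real) \<Rightarrow> real" where
  "norm_A \<Omega> A v = sqrt (a_form \<Omega> A v v)"

definition load ::
  "(real^'d) set \<Rightarrow> (real^'d \<Rightarrow> real) \<Rightarrow> (real^'d \<Rightarrow> real^'d) \<Rightarrow> (real^'d \<Rightarrow> real) \<Rightarrow> real" where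
  "load \<Omega> f ff v =
     (LINT x|lebesgue_on \<Omega>. f x * v x) + (LINT x|lebesgue_on \<Omega>. ff x \<bullet> wgrad \<Omega> v x)"

definition primal_solution ::
  "(real^'d) set \<Rightarrow> (real^'d \<Rightarrow> real^'d^'d) \<Rightarrow> (real^'d \<Rightarrow> real \<Rightarrow> real) \<Rightarrow>
   (real^'d \<Rightarrow> real) \<Rightarrow> (real^'d \<Rightarrow> real^'d) \<Rightarrow>
   (real^'d \<Rightarrow> real) set \<Rightarrow> (real^'d \<Rightarrow> real) \<Rightarrow> bool" where
  "primal_solution \<Omega> A b f ff X u \<longleftrightarrow> u \<in> X \<and>
     (\<forall>v\<in>X. a_form \<Omega> A u v + (LINT x|lebesgue_on \<Omega>. b x (u x) * v x) = load \<Omega> f ff v)"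

definition dual_solution ::
  "(real^'d) set \<Rightarrow> (real^'d \<Rightarrow> real^'d^'d) \<Rightarrow> (real^'d \<Rightarrow> real \<Rightarrow> real) \<Rightarrow>
   (real^'d \<Rightarrow> real) \<Rightarrow> (real^'d \<Rightarrow> real^'d) \<Rightarrow>
   (real^'d \<Rightarrow> real) set \<Rightarrow> (real^'d \<Rightarrow> real) \<Rightarrow> (real^'d \<Rightarrow> real) \<Rightarrow> bool" where
  "dual_solution \<Omega> A b g gg X w z \<longleftrightarrow> z \<in> X \<and>
     (\<forall>v\<in>X. a_form \<Omega> A z v + (LINT x|lebesgue_on \<Omega>. deriv (b x) (w x) * z x * v x) =
        load \<Omega> g gg v)"


section \<open>Error estimators and the adaptive algorithm\<close>

text \<open>
  Square of the residual indicator on \<open>T\<close> with data \<open>r\<close>, \<open>F\<close> and zero-order term \<open>c\<close>. The facets of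
  \<open>T\<close> inside the domain are those shared with another element of the mesh.
\<close>

definition indicator_sq ::
  "(real^'d) set \<Rightarrow> (real^'d) tsimplex set \<Rightarrow> (real^'d \<Rightarrow> real^'d^'d) \<Rightarrow> (real^'d \<Rightarrow> real) \<Rightarrow>
   (real^'d \<Rightarrow> real^'d) \<Rightarrow> (real^'d \<Rightarrow> real) \<Rightarrow> (real^'d \<Rightarrow> real) \<Rightarrow> (real^'d) tsimplex \<Rightarrow> real" where
  "indicator_sq \<Omega> M A r F c v T =
     (let K = simp_set T;
          h = measure lebesgue K powr (1 / real CARD('d));
          flux = (\<lambda>x. A x *v wgrad \<Omega> v x - F x)
      in h\<^sup>2 * (LINT x|lebesgue_on (interior K). (r x + wdiv (interior K) flux x - c x)\<^sup>2) +
         h * (if CARD('d) = 1 then 0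
              else \<Sum>T' | T' \<in> M \<and> T' \<noteq> T \<and> (K \<inter> simp_set T') facet_of K.
                     LINT x|surface_measure (K \<inter> simp_set T').
                       (normal_jump K (simp_set T') flux x)\<^sup>2))"

definition eta_sq ::
  "(real^'d) set \<Rightarrow> (real^'d \<Rightarrow> real^'d^'d) \<Rightarrow> (real^'d \<Rightarrow> real \<Rightarrow> real) \<Rightarrow>
   (real^'d \<Rightarrow> real) \<Rightarrow> (real^'d \<Rightarrow> real^'d) \<Rightarrow>
   (real^'d) tsimplex set \<Rightarrow> (real^'d \<Rightarrow> real) \<Rightarrow> (real^'d) tsimplex \<Rightarrow> real" where
  "eta_sq \<Omega> A b f ff M v T = indicator_sq \<Omega> M A f ff (\<lambda>x. b x (v x)) v T"

definition zeta_sq ::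
  "(real^'d) set \<Rightarrow> (real^'d \<Rightarrow> real^'d^'d) \<Rightarrow> (real^'d \<Rightarrow> real \<Rightarrow> real) \<Rightarrow>
   (real^'d \<Rightarrow> real) \<Rightarrow> (real^'d \<Rightarrow> real^'d) \<Rightarrow>
   (real^'d) tsimplex set \<Rightarrow> (real^'d \<Rightarrow> real) \<Rightarrow> (real^'d \<Rightarrow> real) \<Rightarrow> (real^'d) tsimplex \<Rightarrow> real" where
  "zeta_sq \<Omega> A b g gg M w v T = indicator_sq \<Omega> M A g gg (\<lambda>x. deriv (b x) (w x) * v x) v T"

definition doerfler :: "real \<Rightarrow> ('t \<Rightarrow> real) \<Rightarrow> 't set \<Rightarrow> 't set \<Rightarrow> bool" where
  "doerfler \<theta> e M S \<longleftrightarrow> S \<subseteq> M \<and> \<theta> * (\<Sum>T\<in>M. e T) \<le> (\<Sum>T\<in>S. e T)"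

text \<open>The case \<open>C = \<infinity>\<close> is separated because \<open>\<infinity> * 0 = 0\<close> for extended reals.\<close>

definition quasi_minimal_doerfler ::
  "real \<Rightarrow> ereal \<Rightarrow> ('t \<Rightarrow> real) \<Rightarrow> 't set \<Rightarrow> 't set \<Rightarrow> bool" where
  "quasi_minimal_doerfler \<theta> C e M S \<longleftrightarrow> doerfler \<theta> e M S \<and>
     (C = \<infinity> \<or> (\<forall>S'. doerfler \<theta> e M S' \<longrightarrow> ereal (real (card S)) \<le> C * ereal (real (card S'))))"

definition adaptive_run ::
  "(real^'d) set \<Rightarrow> (real^'d) tsimplex set \<Rightarrow> nat \<Rightarrow> (real^'d \<Rightarrow> real^'d^'d) \<Rightarrow> (real^'d \<Rightarrow> real \<Rightarrow> real) \<Rightarrow>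
   (real^'d \<Rightarrow> real) \<Rightarrow> (real^'d \<Rightarrow> real^'d) \<Rightarrow> (real^'d \<Rightarrow> real) \<Rightarrow> (real^'d \<Rightarrow> real^'d) \<Rightarrow>
   real \<Rightarrow> ereal \<Rightarrow> (nat \<Rightarrow> (real^'d) tsimplex set) \<Rightarrow>
   (nat \<Rightarrow> real^'d \<Rightarrow> real) \<Rightarrow> (nat \<Rightarrow> real^'d \<Rightarrow> real) \<Rightarrow> bool" where
  "adaptive_run \<Omega> T0 m A b f ff g gg \<theta> Cmark M u z \<longleftrightarrow>
     M 0 = T0 \<and>
     (\<forall>l. primal_solution \<Omega> A b f ff (fem_space \<Omega> m (M l)) (u l) \<and>
          dual_solution \<Omega> A b g gg (fem_space \<Omega> m (M l)) (u l) (z l) \<and>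
          (\<exists>Mu' Muz' Mu Muz.
             quasi_minimal_doerfler \<theta> Cmark (eta_sq \<Omega> A b f ff (M l) (u l)) (M l) Mu' \<and>
             quasi_minimal_doerfler \<theta> Cmark
               (\<lambda>T. eta_sq \<Omega> A b f ff (M l) (u l) T + zeta_sq \<Omega> A b g gg (M l) (u l) (z l) T)
               (M l) Muz' \<and>
             Mu \<subseteq> Mu' \<and> Muz \<subseteq> Muz' \<and>
             card Mu = min (card Mu') (card Muz') \<and> card Muz = min (card Mu') (card Muz') \<and>
             is_refine \<Omega> (M l) (Mu \<union> Muz) (M (Suc l))))"

end

theory Submission
  imports Defs
begin

text \<open>Put \<open>e\<^sub>l = u - u\<^sub>l\<close> and \<open>E\<^sub>l = z - z\<^sub>l\<close>. Expanding squares, the claim says that \<open>a(e\<^sub>m, w)\<close> and \<open>a(E\<^sub>m, w)\<close>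
  are small relative to the product of the norms for discrete \<open>w\<close>.

  The Galerkin solutions \<open>u\<^sub>l\<close> minimise a convex energy over nested spaces, so they form a Cauchy sequence.
  If they do not converge to \<open>u\<close>, then the right-hand side has a positive limit while the increments
  vanish, and the claim is trivial.

  Otherwise, Galerkin orthogonality gives \<open>B(e\<^sub>m, y) = O(norm e\<^sub>m\<^sup>2)\<close> for discrete \<open>y\<close> and the linearised form
  \<open>B(v, w) = a(v, w) + (b'(u) v, w)\<close>. Every bounded functional is represented on the closure of the union
  of the discrete spaces, up to \<open>\<epsilon>\<close>, by \<open>B\<close> with a discrete \<open>y\<close>; hence \<open>e\<^sub>m / norm e\<^sub>m\<close> tends weakly to zero, and
  strongly in \<open>L\<^sup>p\<close> by Rellich's theorem. Since \<open>a(e\<^sub>m, w) = - (b(u) - b(u\<^sub>m), w)\<close> for \<open>w\<close> in the \<open>m\<close>-th discrete space, and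
  \<open>b\<close> has subcritical growth, Hoelder's inequality shows that this is \<open>o(norm e\<^sub>m) * norm w\<close>. The dual
  errors are treated in the same way, with an additional term which is small because \<open>e\<^sub>m\<close> is.

  The subcritical Sobolev embedding and its compactness both follow by telescoping averages over
  dyadic cubes: by the Poincare inequality, consecutive averages at level \<open>j\<close> differ by an amount whose \<open>L\<^sup>p\<close>
  norm decays geometrically in \<open>j\<close>.\<close>

section \<open>Integral inequalities\<close>

text \<open>The assumed convergence concerns the dual errors only. The union of the discrete spaces
  can have a closure smaller than the whole space, and then the primal approximations may approach a
  Galerkin solution other than \<open>u\<close>; hence the split by the limit of their error norms.
  In the convergent case the errors lie in that closure as limits of discrete differences, and this
  is all that the Riesz argument asks of it.

  The exponent \<open>k + 3\<close> comes from Hoelder's inequality with four factors: the power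
  \<open>k\<close> of the weight 1 + |u| + |v| and three further functions. With b'' growing of
  order \<open>k\<close> this covers the difference of b (weight, error, test function), its
  quadratic remainder (error, error, test function) and the coupling of the dual to the primal error
  (primal error, dual solution, test function). In three dimensions \<open>k = 1\<close>: the space
  L^4 lies strictly below the critical L^6 and just accommodates n = 3. Taking k + 3 = 2 q even
  keeps powers nonnegative. Strict subcriticality, as an inequality between integers, is what yields
  a full factor 2^(-j) per dyadic level.\<close>

lemma convex_antiderivative:
  fixes h :: "real \<Rightarrow> real"
  assumes mono: "mono h" and deriv: "\<And>t. (g has_real_derivative h t) (at t)"
  shows "h s * (t - s) \<le> g t - g s"
proof (cases s t rule: linorder_cases)
  case less
  then obtain \<xi> where "s < \<xi>" "\<xi> < t" "g t - g s = (t - s) * h \<xi>"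
    using MVT2[of s t g h] deriv by blast
  moreover have "h s \<le> h \<xi>" using mono \<open>s < \<xi>\<close> by (simp add: monoD)
  ultimately show ?thesis using less by (simp add: mult.commute mult_left_mono)
next
  case greater
  then obtain \<xi> where "t < \<xi>" "\<xi> < s" "g s - g t = (s - t) * h \<xi>"
    using MVT2[of t s g h] deriv by blast
  moreover have "(s - t) * h \<xi> \<le> (s - t) * h s"
    using mono \<open>\<xi> < s\<close> greater by (intro mult_left_mono) (simp_all add: monoD)
  ultimately show ?thesis by (simp add: algebra_simps)
qed simp

text \<open>The potential \<open>B x\<close> below is an antiderivative chosen separately for every
  \<open>x\<close>; as a limit of sums of values of \<open>b\<close> it becomes measurable in
  \<open>x\<close>. The tangent inequality traps each increment of \<open>g\<close> between the left
  and the right endpoint term, also for negative \<open>t\<close>.\<close>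

lemma riemann_sum_antiderivative:
  fixes h :: "real \<Rightarrow> real"
  assumes mono: "mono h" and h0: "h 0 = 0"
    and deriv: "\<And>t. (g has_real_derivative h t) (at t)" and g0: "g 0 = 0"
  shows "(\<lambda>N. \<Sum>i<N. h (real i * t / real N) * (t / real N)) \<longlonglongrightarrow> g t"
proof -
  define S where "S N = (\<Sum>i<N. h (real i * t / real N) * (t / real N))" for N
  have conv: "h r * (s - r) \<le> g s - g r" for r s
    using convex_antiderivative[OF mono deriv] .
  \<comment> \<open>Left and right sums differ by the two boundary terms only, and the one at 0
    vanishes because of \<open>h 0 = 0\<close>.\<close>
  have b1: "S N \<le> g t \<and> g t \<le> S N + h t * t / real N" if "N > 0" for N
  proof
    let ?r = "\<lambda>i. real i * t / real N"
    have step: "?r (Suc i) - ?r i = t / real N" for i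
      by (simp add: algebra_simps add_divide_distrib)
    have tel: "(\<Sum>i<N. g (?r (Suc i)) - g (?r i)) = g t"
      using sum_lessThan_telescope[of "\<lambda>i. g (?r i)" N] g0 that by simp
    have "S N \<le> (\<Sum>i<N. g (?r (Suc i)) - g (?r i))"
      unfolding S_def
    proof (rule sum_mono)
      fix i show "h (?r i) * (t / real N) \<le> g (?r (Suc i)) - g (?r i)"
        using conv[of "?r i" "?r (Suc i)"] unfolding step .
    qed
    then show "S N \<le> g t" unfolding tel .
    have "(\<Sum>i<N. g (?r (Suc i)) - g (?r i)) \<le> (\<Sum>i<N. h (?r (Suc i)) * (t / real N))"
    proof (rule sum_mono)
      fix i
      have "h (?r (Suc i)) * (?r i - ?r (Suc i)) \<le> g (?r i) - g (?r (Suc i))" by (rule conv)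
      then show "g (?r (Suc i)) - g (?r i) \<le> h (?r (Suc i)) * (t / real N)"
        unfolding step[of i, symmetric] by (simp add: algebra_simps)
    qed
    also have "\<dots> = (\<Sum>i<Suc N. h (?r i) * (t / real N)) - h (?r 0) * (t / real N)"
      unfolding sum.lessThan_Suc_shift by simp
    also have "\<dots> = S N + h t * t / real N" using that by (simp add: S_def h0)
    finally show "g t \<le> S N + h t * t / real N" unfolding tel .
  qed
  have "(\<lambda>N. h t * t / real N) \<longlonglongrightarrow> 0" by (rule lim_const_over_n)
  then have low: "(\<lambda>N. g t - h t * t / real N) \<longlonglongrightarrow> g t"
    using tendsto_diff[OF tendsto_const[of "g t"], of "\<lambda>N. h t * t / real N" 0] by simp
  have ev: "\<forall>\<^sub>F N in sequentially. N > (0::nat)" by (rule eventually_gt_at_top)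
  have "S \<longlonglongrightarrow> g t"
  proof (rule real_tendsto_sandwich[OF _ _ low tendsto_const])
    show "\<forall>\<^sub>F N in sequentially. g t - h t * t / real N \<le> S N"
      using ev
    proof eventually_elim
      case (elim N) then show ?case using b1[of N] by linarith
    qed
    show "\<forall>\<^sub>F N in sequentially. S N \<le> g t"
      using ev
    proof eventually_elim
      case (elim N) then show ?case using b1[of N] by linarith
    qed
  qed
  then show ?thesis by (simp add: S_def[abs_def])
qed

text \<open>All four factors are replaced by their maximum, whose power is one of the summands. This
  crude form of Young's inequality is the source of the constant 4 in the Hoelder estimate
  below.\<close>

lemma prod_le_sum_powers:
  fixes s x y w :: real
  assumes "0 \<le> s" "0 \<le> x" "0 \<le> y" "0 \<le> w"
  shows "s ^ k * x * y * w \<le> s ^ (k + 3) + x ^ (k + 3) + y ^ (k + 3) + w ^ (k + 3)"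
proof -
  define t where "t = max (max s x) (max y w)"
  have t: "s \<le> t" "x \<le> t" "y \<le> t" "w \<le> t" by (auto simp: t_def)
  have "s ^ k * x * y * w \<le> t ^ k * t * t * t"
    using assms t by (intro mult_mono power_mono) auto
  also have "\<dots> = t ^ (k + 3)" by (simp add: power_add power3_eq_cube mult.assoc)
  also have "\<dots> \<le> s ^ (k + 3) + x ^ (k + 3) + y ^ (k + 3) + w ^ (k + 3)"
  proof -
    have "t \<in> {s, x, y, w}" by (auto simp: t_def max_def)
    moreover have "0 \<le> s ^ (k + 3)" "0 \<le> x ^ (k + 3)" "0 \<le> y ^ (k + 3)" "0 \<le> w ^ (k + 3)"
      using assms by simp_all
    ultimately show ?thesis by (elim insertE emptyE) (simp_all del: power_Suc)
  qed
  finally show ?thesis .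
qed

text \<open>An upper bound \<open>r\<close> for the p-norm, phrased without p-th roots.
  Integrability is part of it because the integral of a non-integrable function is 0 by
  convention.\<close>

definition Lp_le :: "'a measure \<Rightarrow> nat \<Rightarrow> ('a \<Rightarrow> real) \<Rightarrow> real \<Rightarrow> bool" where
  "Lp_le M p f r \<longleftrightarrow> f \<in> borel_measurable M \<and> integrable M (\<lambda>x. \<bar>f x\<bar> ^ p) \<and>
     0 \<le> r \<and> (LINT x|M. \<bar>f x\<bar> ^ p) \<le> r ^ p"

lemma Lp_le_mono: "Lp_le M p f r \<Longrightarrow> r \<le> r' \<Longrightarrow> Lp_le M p f r'"
  unfolding Lp_le_def by (meson order_trans power_mono)

lemma Lp_le_abs: "Lp_le M p f r \<Longrightarrow> Lp_le M p (\<lambda>x. \<bar>f x\<bar>) r"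
  unfolding Lp_le_def by auto

lemma abs_add_power_le:
  fixes x y :: real
  shows "\<bar>x + y\<bar> ^ p \<le> 2 ^ p * (\<bar>x\<bar> ^ p + \<bar>y\<bar> ^ p)"
proof -
  have "\<bar>x + y\<bar> ^ p \<le> (2 * max \<bar>x\<bar> \<bar>y\<bar>) ^ p" by (intro power_mono) auto
  also have "\<dots> = 2 ^ p * max \<bar>x\<bar> \<bar>y\<bar> ^ p" by (simp add: power_mult_distrib)
  also have "\<dots> \<le> 2 ^ p * (\<bar>x\<bar> ^ p + \<bar>y\<bar> ^ p)" by (intro mult_left_mono) (auto simp: max_def)
  finally show ?thesis .
qed

text \<open>The factor 2 replaces Minkowski's inequality: |f + g| is at most twice the larger of |f|
  and |g|, and r^p + s^p <= (r + s)^p.\<close>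

lemma Lp_le_add:
  assumes f: "Lp_le M p f r" and g: "Lp_le M p g s"
  shows "Lp_le M p (\<lambda>x. f x + g x) (2 * (r + s))"
proof -
  have [measurable]: "f \<in> borel_measurable M" "g \<in> borel_measurable M"
    and i: "integrable M (\<lambda>x. \<bar>f x\<bar> ^ p)" "integrable M (\<lambda>x. \<bar>g x\<bar> ^ p)"
    and rs: "0 \<le> r" "0 \<le> s" "(LINT x|M. \<bar>f x\<bar> ^ p) \<le> r ^ p" "(LINT x|M. \<bar>g x\<bar> ^ p) \<le> s ^ p"
    using f g by (auto simp: Lp_le_def)
  have int: "integrable M (\<lambda>x. \<bar>f x + g x\<bar> ^ p)"
    by (rule Bochner_Integration.integrable_bound[of M "\<lambda>x. 2 ^ p * (\<bar>f x\<bar> ^ p + \<bar>g x\<bar> ^ p)"])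
      (use i abs_add_power_le in auto)
  have "(LINT x|M. \<bar>f x + g x\<bar> ^ p) \<le> (LINT x|M. 2 ^ p * (\<bar>f x\<bar> ^ p + \<bar>g x\<bar> ^ p))"
    by (intro integral_mono int) (use i abs_add_power_le in auto)
  also have "\<dots> = 2 ^ p * ((LINT x|M. \<bar>f x\<bar> ^ p) + (LINT x|M. \<bar>g x\<bar> ^ p))"
    using i by simp
  also have "\<dots> \<le> 2 ^ p * (r ^ p + s ^ p)"
    using rs by (intro mult_left_mono add_mono) auto
  finally have *: "(LINT x|M. \<bar>f x + g x\<bar> ^ p) \<le> 2 ^ p * (r ^ p + s ^ p)" .
  show ?thesis
  proof (cases p)
    case 0
    \<comment> \<open>For exponent 0 the inequality r^p + s^p <= (r + s)^p fails, but all integrands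
      and all bounds are then equal to 1.\<close>
    then show ?thesis using rs i f g unfolding Lp_le_def by auto
  next
    case (Suc q)
    have "r ^ q \<le> (r + s) ^ q" "s ^ q \<le> (r + s) ^ q" using rs by (auto intro: power_mono)
    then have "r * r ^ q + s * s ^ q \<le> r * (r + s) ^ q + s * (r + s) ^ q"
      using rs by (intro add_mono mult_left_mono) auto
    then have "r ^ p + s ^ p \<le> (r + s) ^ p" by (simp add: Suc distrib_right)
    then have "2 ^ p * (r ^ p + s ^ p) \<le> (2 * (r + s)) ^ p"
      by (metis mult_left_mono power_mult_distrib zero_le_numeral zero_le_power)
    with * int rs show ?thesis unfolding Lp_le_def by auto
  qed
qed

text \<open>The quantity 1 + m stands in for the p-th root of the measure m, since m <= (1 + m)^p
  for every positive integer p.\<close>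

lemma Lp_le_const:
  assumes "finite_measure M" "p \<noteq> 0"
  shows "Lp_le M p (\<lambda>x. c) (\<bar>c\<bar> * (1 + measure M (space M)))"
proof -
  interpret finite_measure M by fact
  have "measure M (space M) \<le> (1 + measure M (space M)) ^ p"
    using self_le_power[of "1 + measure M (space M)" p] assms(2) by (smt (verit) measure_nonneg not_gr0)
  then have "measure M (space M) * \<bar>c\<bar> ^ p \<le> (1 + measure M (space M)) ^ p * \<bar>c\<bar> ^ p"
    by (intro mult_right_mono) auto
  then show ?thesis unfolding Lp_le_def by (simp add: power_mult_distrib mult.commute)
qed

text \<open>Hoelder's inequality up to the factor 4: after division by their norm bounds all four
  functions have power integrals at most 1, and the pointwise bound by a sum of powers is
  integrated.\<close>

lemma integral_mult_le_Lp:
  assumes s: "Lp_le M (k + 3) s \<alpha>" "\<alpha> > 0" and x: "Lp_le M (k + 3) x \<beta>"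
    and y: "Lp_le M (k + 3) y \<gamma>" and w: "Lp_le M (k + 3) w \<delta>"
  shows "integrable M (\<lambda>t. \<bar>s t\<bar> ^ k * \<bar>x t\<bar> * \<bar>y t\<bar> * \<bar>w t\<bar>)" (is "integrable M ?f")
    and "(LINT t|M. \<bar>s t\<bar> ^ k * \<bar>x t\<bar> * \<bar>y t\<bar> * \<bar>w t\<bar>) \<le> 4 * \<alpha> ^ k * \<beta> * \<gamma> * \<delta>"
proof -
  let ?p = "k + 3"
  have [measurable]: "s \<in> borel_measurable M" "x \<in> borel_measurable M" "y \<in> borel_measurable M"
    "w \<in> borel_measurable M" and int[simp]: "integrable M (\<lambda>t. \<bar>s t\<bar> ^ ?p)"
    "integrable M (\<lambda>t. \<bar>x t\<bar> ^ ?p)" "integrable M (\<lambda>t. \<bar>y t\<bar> ^ ?p)" "integrable M (\<lambda>t. \<bar>w t\<bar> ^ ?p)"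
    and nn: "0 \<le> \<beta>" "0 \<le> \<gamma>" "0 \<le> \<delta>"
    using s x y w by (auto simp: Lp_le_def)
  show if': "integrable M ?f"
    by (rule Bochner_Integration.integrable_bound
        [of M "\<lambda>t. \<bar>s t\<bar> ^ ?p + \<bar>x t\<bar> ^ ?p + \<bar>y t\<bar> ^ ?p + \<bar>w t\<bar> ^ ?p"])
      (intro Bochner_Integration.integrable_add int, measurable, intro AE_I2, unfold real_norm_def,
       rule order_trans[OF _ abs_ge_self], simp add: abs_mult prod_le_sum_powers del: power_Suc)
  have norm1: "(LINT t|M. (\<bar>f t\<bar> / r) ^ ?p) \<le> 1" if "Lp_le M ?p f r'" "r' \<le> r" "0 < r" for f r r'
  proof -
    have "(LINT t|M. \<bar>f t\<bar> ^ ?p) \<le> r ^ ?p" using Lp_le_mono[OF that(1,2)] by (simp add: Lp_le_def)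
    then show ?thesis using that(3) by (simp add: power_divide)
  qed
  \<comment> \<open>The bounds \<beta>, \<gamma>, \<delta> may vanish, so each is enlarged by
    \<epsilon> before dividing; \<epsilon> tends to 0 at the end.\<close>
  have pos: "(LINT t|M. ?f t) \<le> 4 * \<alpha> ^ k * (\<beta> + \<epsilon>) * (\<gamma> + \<epsilon>) * (\<delta> + \<epsilon>)" if "\<epsilon> > 0" for \<epsilon>
  proof -
    let ?b = "\<beta> + \<epsilon>" and ?c = "\<gamma> + \<epsilon>" and ?d = "\<delta> + \<epsilon>"
    have p: "0 < ?b" "0 < ?c" "0 < ?d" using nn that by auto
    have eq: "?f t = (\<alpha> ^ k * ?b * ?c * ?d) * ((\<bar>s t\<bar> / \<alpha>) ^ k * (\<bar>x t\<bar> / ?b) * (\<bar>y t\<bar> / ?c) * (\<bar>w t\<bar> / ?d))" for t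
      using p s(2) by (simp add: power_divide)
    have "(LINT t|M. ?f t) \<le> (LINT t|M. (\<alpha> ^ k * ?b * ?c * ?d) * 
        ((\<bar>s t\<bar> / \<alpha>) ^ ?p + (\<bar>x t\<bar> / ?b) ^ ?p + (\<bar>y t\<bar> / ?c) ^ ?p + (\<bar>w t\<bar> / ?d) ^ ?p))"
    proof (rule integral_mono[OF if'])
      show "integrable M (\<lambda>t. (\<alpha> ^ k * ?b * ?c * ?d) * 
        ((\<bar>s t\<bar> / \<alpha>) ^ ?p + (\<bar>x t\<bar> / ?b) ^ ?p + (\<bar>y t\<bar> / ?c) ^ ?p + (\<bar>w t\<bar> / ?d) ^ ?p))"
        unfolding power_divide by (intro integrable_mult_right Bochner_Integration.integrable_add integrable_divide int)
      fix t
      show "?f t \<le> (\<alpha> ^ k * ?b * ?c * ?d) * 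
        ((\<bar>s t\<bar> / \<alpha>) ^ ?p + (\<bar>x t\<bar> / ?b) ^ ?p + (\<bar>y t\<bar> / ?c) ^ ?p + (\<bar>w t\<bar> / ?d) ^ ?p)"
        unfolding eq[of t] using p s(2) by (intro mult_left_mono prod_le_sum_powers) auto
    qed
    also have "\<dots> = (\<alpha> ^ k * ?b * ?c * ?d) * ((LINT t|M. (\<bar>s t\<bar> / \<alpha>) ^ ?p) + (LINT t|M. (\<bar>x t\<bar> / ?b) ^ ?p)
         + (LINT t|M. (\<bar>y t\<bar> / ?c) ^ ?p) + (LINT t|M. (\<bar>w t\<bar> / ?d) ^ ?p))"
      unfolding power_divide
      by (simp only: integral_mult_right_zero Bochner_Integration.integral_add[OF Bochner_Integration.integrable_add]
          Bochner_Integration.integral_add Bochner_Integration.integrable_add integrable_divide int)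
    also have "\<dots> \<le> (\<alpha> ^ k * ?b * ?c * ?d) * (1 + 1 + 1 + 1)"
      using s(2) p that
      by (intro mult_left_mono add_mono norm1[OF s(1)] norm1[OF x] norm1[OF y] norm1[OF w]) auto
    finally show ?thesis by (simp add: algebra_simps)
  qed
  have lim: "((\<lambda>\<epsilon>. 4 * \<alpha> ^ k * (\<beta> + \<epsilon>) * (\<gamma> + \<epsilon>) * (\<delta> + \<epsilon>)) \<longlongrightarrow>
      4 * \<alpha> ^ k * (\<beta> + 0) * (\<gamma> + 0) * (\<delta> + 0)) (at_right 0)"
    by (intro tendsto_intros)
  have "(LINT t|M. ?f t) \<le> 4 * \<alpha> ^ k * (\<beta> + 0) * (\<gamma> + 0) * (\<delta> + 0)"
    by (rule tendsto_lowerbound[OF lim])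
      (simp_all add: eventually_mono[OF eventually_at_right_less pos])
  then show "(LINT t|M. ?f t) \<le> 4 * \<alpha> ^ k * \<beta> * \<gamma> * \<delta>" by simp
qed

section \<open>Galerkin approximation of a semilinear problem\<close>

locale psd_form =
  fixes V :: "('a \<Rightarrow> real) set" and a :: "('a \<Rightarrow> real) \<Rightarrow> ('a \<Rightarrow> real) \<Rightarrow> real"
  assumes V_nonempty: "V \<noteq> {}"
    and V_add: "v \<in> V \<Longrightarrow> w \<in> V \<Longrightarrow> (\<lambda>x. v x + w x) \<in> V"
    and V_scale: "v \<in> V \<Longrightarrow> (\<lambda>x. c * v x) \<in> V"
    and sym: "v \<in> V \<Longrightarrow> w \<in> V \<Longrightarrow> a v w = a w v"
    and add_left: "v \<in> V \<Longrightarrow> w \<in> V \<Longrightarrow> y \<in> V \<Longrightarrow> a (\<lambda>x. v x + w x) y = a v y + a w y"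
    and scale_left: "v \<in> V \<Longrightarrow> y \<in> V \<Longrightarrow> a (\<lambda>x. c * v x) y = c * a v y"
    and nonneg: "v \<in> V \<Longrightarrow> 0 \<le> a v v"
begin

definition nrm :: "('a \<Rightarrow> real) \<Rightarrow> real" where
  "nrm v = sqrt (a v v)"

lemma nrm_nonneg: "v \<in> V \<Longrightarrow> 0 \<le> nrm v"
  by (simp add: nrm_def nonneg)

lemma nrm_square: "v \<in> V \<Longrightarrow> (nrm v)\<^sup>2 = a v v"
  by (simp add: nrm_def nonneg)

lemma V_diff:
  assumes "v \<in> V" "w \<in> V"
  shows "(\<lambda>x. v x - w x) \<in> V"
proof -
  have "(\<lambda>x. v x + - 1 * w x) \<in> V" by (intro V_add V_scale assms)
  then show ?thesis by (simp only: mult_minus1 add_uminus_conv_diff)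
qed

lemma diff_left:
  assumes "v \<in> V" "w \<in> V" "y \<in> V"
  shows "a (\<lambda>x. v x - w x) y = a v y - a w y"
proof -
  have "a (\<lambda>x. v x + - 1 * w x) y = a v y + a (\<lambda>x. - 1 * w x) y"
    by (intro add_left V_scale assms)
  also have "a (\<lambda>x. - 1 * w x) y = - 1 * a w y" by (intro scale_left assms)
  finally show ?thesis by (simp only: mult_minus1 add_uminus_conv_diff)
qed

lemma add_right:
  assumes "v \<in> V" "w \<in> V" "y \<in> V"
  shows "a y (\<lambda>x. v x + w x) = a y v + a y w"
  using add_left[OF assms] sym[OF assms(3) V_add[OF assms(1,2)]] sym[OF assms(3,1)] sym[OF assms(3,2)]
  by (simp only:)

lemma diff_right:
  assumes "v \<in> V" "w \<in> V" "y \<in> V"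
  shows "a y (\<lambda>x. v x - w x) = a y v - a y w"
  using diff_left[OF assms] sym[OF assms(3) V_diff[OF assms(1,2)]] sym[OF assms(3,1)] sym[OF assms(3,2)]
  by (simp only:)

lemma scale_right:
  assumes "v \<in> V" "y \<in> V"
  shows "a y (\<lambda>x. c * v x) = c * a y v"
  using scale_left[OF assms] sym[OF assms(2) V_scale[OF assms(1)]] sym[OF assms(2,1)]
  by (simp only:)

lemma quad_add:
  "v \<in> V \<Longrightarrow> w \<in> V \<Longrightarrow> a (\<lambda>x. v x + w x) (\<lambda>x. v x + w x) = a v v + 2 * a v w + a w w"
  by (simp add: add_left add_right V_add sym[of w v])

lemma quad_diff:
  "v \<in> V \<Longrightarrow> w \<in> V \<Longrightarrow> a (\<lambda>x. v x - w x) (\<lambda>x. v x - w x) = a v v - 2 * a v w + a w w"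
  by (simp add: diff_left diff_right V_diff sym[of w v])

lemma quad_scale: "v \<in> V \<Longrightarrow> a (\<lambda>x. c * v x) (\<lambda>x. c * v x) = c\<^sup>2 * a v v"
  by (simp add: scale_left scale_right V_scale power2_eq_square)

lemma nrm_scale: "v \<in> V \<Longrightarrow> nrm (\<lambda>x. c * v x) = \<bar>c\<bar> * nrm v"
  by (simp add: nrm_def quad_scale real_sqrt_mult)

text \<open>The form is only semidefinite, as elements of \<open>V\<close> are functions and not
  classes of functions equal almost everywhere. Besides the usual discriminant argument there is
  thus the case \<open>a w w = 0\<close>, in which the nonnegative expression is affine in
  \<open>t\<close> and its slope has to vanish.\<close>

lemma Cauchy_Schwarz:
  assumes "v \<in> V" "w \<in> V"
  shows "\<bar>a v w\<bar> \<le> nrm v * nrm w"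
proof -
  have *: "0 \<le> a v v + 2 * (t * a v w) + t\<^sup>2 * a w w" for t
    using nonneg[OF V_add[OF assms(1) V_scale[OF assms(2), of t]]] assms
    by (simp add: quad_add V_scale scale_right scale_left power2_eq_square mult.assoc)
  have "(a v w)\<^sup>2 \<le> a v v * a w w"
  proof (cases "a w w = 0")
    case True
    have "a v w = 0"
    proof (rule ccontr)
      assume n: "a v w \<noteq> 0"
      \<comment> \<open>This \<open>t\<close> makes the affine expression equal to -1.\<close>
      show False using *[of "- (a v v + 1) / (2 * a v w)"] n True by (simp add: field_simps)
    qed
    then show ?thesis using True by simp
  next
    case False
    then have p: "a w w > 0" using nonneg[OF assms(2)] by simp
    have "a v v + 2 * (- a v w / a w w * a v w) + (- a v w / a w w)\<^sup>2 * a w w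
        = a v v - (a v w)\<^sup>2 / a w w"
      using p by (simp add: field_simps power2_eq_square)
    with *[of "- a v w / a w w"] have "(a v w)\<^sup>2 / a w w \<le> a v v" by simp
    then show ?thesis using p by (simp add: field_simps)
  qed
  then have "sqrt ((a v w)\<^sup>2) \<le> sqrt (a v v * a w w)" by (rule real_sqrt_le_mono)
  then show ?thesis by (simp add: nrm_def real_sqrt_mult)
qed

lemma nrm_add_le:
  assumes "v \<in> V" "w \<in> V"
  shows "nrm (\<lambda>x. v x + w x) \<le> nrm v + nrm w"
proof (rule power2_le_imp_le)
  show "(nrm (\<lambda>x. v x + w x))\<^sup>2 \<le> (nrm v + nrm w)\<^sup>2"
    using Cauchy_Schwarz[OF assms] assms
    by (simp add: nrm_square V_add quad_add power2_sum)
qed (use assms nrm_nonneg in auto)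

lemma nrm_minus_commute: "v \<in> V \<Longrightarrow> w \<in> V \<Longrightarrow> nrm (\<lambda>x. v x - w x) = nrm (\<lambda>x. w x - v x)"
  by (simp add: nrm_def quad_diff sym)

lemma nrm_triangle:
  assumes "u \<in> V" "v \<in> V" "w \<in> V"
  shows "nrm (\<lambda>x. u x - w x) \<le> nrm (\<lambda>x. u x - v x) + nrm (\<lambda>x. v x - w x)"
  using nrm_add_le[OF V_diff[OF assms(1,2)] V_diff[OF assms(2,3)]] by simp

text \<open>An almost minimiser of \<open>a v v / 2 - \<phi> v\<close> represents \<open>\<phi>\<close> up to a small error; no completeness
  is needed.\<close>

lemma approx_Riesz:
  assumes X: "X \<subseteq> V" "X \<noteq> {}"
    and X_add: "\<And>v w. v \<in> X \<Longrightarrow> w \<in> X \<Longrightarrow> (\<lambda>x. v x + w x) \<in> X"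
    and X_scale: "\<And>v c. v \<in> X \<Longrightarrow> (\<lambda>x. c * v x) \<in> X"
    and \<phi>_add: "\<And>v w. v \<in> X \<Longrightarrow> w \<in> X \<Longrightarrow> \<phi> (\<lambda>x. v x + w x) = \<phi> v + \<phi> w"
    and \<phi>_scale: "\<And>v c. v \<in> X \<Longrightarrow> \<phi> (\<lambda>x. c * v x) = c * \<phi> v"
    and \<phi>_bound: "\<And>v. v \<in> X \<Longrightarrow> \<bar>\<phi> v\<bar> \<le> c * nrm v"
    and \<epsilon>: "\<epsilon> > 0"
  shows "\<exists>y\<in>X. \<forall>v\<in>X. \<bar>\<phi> v - a y v\<bar> \<le> \<epsilon> * nrm v"
proof -
  define J where "J v = a v v / 2 - \<phi> v" for v
  have bdd: "- (c\<^sup>2) / 2 \<le> J v" if "v \<in> X" for v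
  proof -
    have "a v v = (nrm v)\<^sup>2" using that X by (simp add: nrm_square subset_iff)
    moreover have "0 \<le> (nrm v - c)\<^sup>2" by simp
    ultimately show ?thesis using \<phi>_bound[OF that] by (simp add: J_def power2_diff mult.commute)
  qed
  have bb: "bdd_below (J ` X)" using bdd by (meson bdd_belowI2)
  obtain y where y: "y \<in> X" "J y < (INF v\<in>X. J v) + \<epsilon>\<^sup>2 / 2"
    using cInf_lessD[of "J ` X" "(INF v\<in>X. J v) + \<epsilon>\<^sup>2 / 2"] X(2) \<epsilon> by auto
  have yV: "y \<in> V" using y X by auto
  have "\<bar>\<phi> v - a y v\<bar> \<le> \<epsilon> * nrm v" if v: "v \<in> X" for v
  proof -
    have vV: "v \<in> V" using v X by auto
    define r where "r = \<phi> v - a y v"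
    \<comment> \<open>\<open>y\<close> minimises \<open>J\<close> up to \<epsilon>^2 / 2, so moving
      from \<open>y\<close> to y + t v cannot lower \<open>J\<close> by more than that.\<close>
    have *: "- (\<epsilon>\<^sup>2 / 2) \<le> - (t * r) + t\<^sup>2 * a v v / 2" for t
    proof -
      have "(INF v\<in>X. J v) \<le> J (\<lambda>x. y x + t * v x)"
        by (intro cINF_lower[OF bb] X_add X_scale y v)
      moreover have "J (\<lambda>x. y x + t * v x) = J y - t * r + t\<^sup>2 * a v v / 2"
        using y(1) v yV vV
        by (simp add: J_def quad_add V_scale scale_right scale_left \<phi>_add \<phi>_scale X_scale r_def field_simps power2_eq_square)
      ultimately show ?thesis using y(2) by simp
    qed
    show ?thesis
    proof (cases "nrm v = 0")
      case True
      then have "\<phi> v = 0" "a y v = 0"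
        using \<phi>_bound[OF v] Cauchy_Schwarz[OF yV vV] by simp_all
      then show ?thesis using True by simp
    next
      case False
      have p: "nrm v > 0" using False nrm_nonneg[OF vV] by simp
      \<comment> \<open>The step t = r / (nrm v)^2 minimises the right-hand side and turns the
        inequality into r^2 <= \<epsilon>^2 (nrm v)^2.\<close>
      have "- (\<epsilon>\<^sup>2 / 2) \<le> - (r / (nrm v)\<^sup>2 * r) + (r / (nrm v)\<^sup>2)\<^sup>2 * (nrm v)\<^sup>2 / 2"
        using *[of "r / (nrm v)\<^sup>2"] nrm_square[OF vV] by simp
      also have "\<dots> = - (r\<^sup>2 / (nrm v)\<^sup>2 / 2)"
        using p by (simp add: field_simps power2_eq_square)
      finally have "r\<^sup>2 \<le> (\<epsilon> * nrm v)\<^sup>2"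
        using p by (simp add: field_simps power_mult_distrib)
      then show ?thesis unfolding r_def using p \<epsilon> by (simp add: abs_le_square_iff[symmetric])
    qed
  qed
  then show ?thesis using y(1) by blast
qed

end

text \<open>The two analytic facts about H^1_0 on which the abstract argument rests, for the
  exponent \<open>k + 3\<close>. Weak convergence to 0 in \<open>rellich\<close> is expressed
  through integrals over measurable sets, so that neither dual spaces nor weak limits have to be
  formed.\<close>

locale energy_space = psd_form V a for V :: "('a \<Rightarrow> real) set" and a +
  fixes M :: "'a measure" and k :: nat and C :: real
  assumes finite_M: "finite_measure M"
    and C_nonneg: "0 \<le> C"
    and sobolev: "v \<in> V \<Longrightarrow> Lp_le M (k + 3) v (C * nrm v)"
    and rellich: "(\<And>j. w j \<in> V) \<Longrightarrow> (\<And>j. a (w j) (w j) \<le> 1) \<Longrightarrow>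
      (\<And>S. S \<in> sets M \<Longrightarrow> (\<lambda>j. LINT x|M. indicator S x * w j x) \<longlonglongrightarrow> 0) \<Longrightarrow>
      (\<lambda>j. LINT x|M. \<bar>w j x\<bar> ^ (k + 3)) \<longlonglongrightarrow> 0"
begin

definition C1 :: real where "C1 = 1 + measure M (space M)"

lemma C1_pos: "C1 > 0"
  by (simp add: C1_def add_pos_nonneg)

lemma Lp_le_one: "Lp_le M (k + 3) (\<lambda>x. 1) C1"
  using Lp_le_const[OF finite_M, of "k + 3" 1] by (simp add: C1_def)

lemma V_measurable: "v \<in> V \<Longrightarrow> v \<in> borel_measurable M"
  using sobolev by (simp add: Lp_le_def)

lemma integral_bound:
  assumes s: "Lp_le M (k + 3) s \<alpha>" "\<alpha> > 0" and x: "Lp_le M (k + 3) x \<beta>"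
    and y: "Lp_le M (k + 3) y \<gamma>" and w: "Lp_le M (k + 3) w \<delta>"
    and f: "f \<in> borel_measurable M"
    and bound: "\<And>t. t \<in> space M \<Longrightarrow> \<bar>f t\<bar> \<le> c * (\<bar>s t\<bar> ^ k * \<bar>x t\<bar> * \<bar>y t\<bar> * \<bar>w t\<bar>)"
    and c: "0 \<le> c"
  shows "integrable M f" and "\<bar>LINT t|M. f t\<bar> \<le> c * (4 * \<alpha> ^ k * \<beta> * \<gamma> * \<delta>)"
proof -
  let ?g = "\<lambda>t. c * (\<bar>s t\<bar> ^ k * \<bar>x t\<bar> * \<bar>y t\<bar> * \<bar>w t\<bar>)"
  have g: "integrable M ?g" using integral_mult_le_Lp(1)[OF s x y w] by simp
  show i: "integrable M f"
    by (rule Bochner_Integration.integrable_bound[OF g f])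
      (use bound in \<open>intro AE_I2, force\<close>)
  have "\<bar>LINT t|M. f t\<bar> \<le> (LINT t|M. \<bar>f t\<bar>)" by (rule integral_abs_bound)
  also have "\<dots> \<le> (LINT t|M. ?g t)" by (rule integral_mono) (use i g bound in auto)
  also have "\<dots> \<le> c * (4 * \<alpha> ^ k * \<beta> * \<gamma> * \<delta>)"
    unfolding integral_mult_right_zero by (intro mult_left_mono integral_mult_le_Lp(2)[OF s x y w] c)
  finally show "\<bar>LINT t|M. f t\<bar> \<le> c * (4 * \<alpha> ^ k * \<beta> * \<gamma> * \<delta>)" .
qed

text \<open>Despite the name the integral is not divided by the measure of \<open>S\<close>. These
  bounded linear functionals are the ones against which weak convergence is tested.\<close>

definition mean_on :: "'a set \<Rightarrow> ('a \<Rightarrow> real) \<Rightarrow> real" where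
  "mean_on S v = (LINT x|M. indicator S x * v x)"

lemma mean_on_bounded:
  assumes "S \<in> sets M" "v \<in> V"
  shows "integrable M (\<lambda>x. indicator S x * v x)"
    and "\<bar>mean_on S v\<bar> \<le> 4 * C1 ^ k * C1 * C1 * C * nrm v"
proof -
  note v = V_measurable[OF assms(2)]
  have m: "(\<lambda>x. indicator S x * v x) \<in> borel_measurable M" using assms(1) v by measurable
  have le: "\<bar>indicator S x * v x\<bar> \<le> 1 * (\<bar>1\<bar> ^ k * \<bar>1\<bar> * \<bar>1\<bar> * \<bar>v x\<bar>)" for x
    by (auto simp: indicator_def)
  show "integrable M (\<lambda>x. indicator S x * v x)"
    by (rule integral_bound(1)[OF Lp_le_one C1_pos Lp_le_one Lp_le_one sobolev[OF assms(2)] m le]) simp_all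
  have "\<bar>mean_on S v\<bar> \<le> 1 * (4 * C1 ^ k * C1 * C1 * (C * nrm v))"
    unfolding mean_on_def
    by (rule integral_bound(2)[OF Lp_le_one C1_pos Lp_le_one Lp_le_one sobolev[OF assms(2)] m le]) simp_all
  then show "\<bar>mean_on S v\<bar> \<le> 4 * C1 ^ k * C1 * C1 * C * nrm v" by (simp add: mult.assoc)
qed

lemma mean_on_add:
  "S \<in> sets M \<Longrightarrow> v \<in> V \<Longrightarrow> w \<in> V \<Longrightarrow> mean_on S (\<lambda>x. v x + w x) = mean_on S v + mean_on S w"
  unfolding mean_on_def distrib_left
  by (rule Bochner_Integration.integral_add) (auto intro: mean_on_bounded)

lemma mean_on_scale: "mean_on S (\<lambda>x. c * v x) = c * mean_on S v"
proof -
  have "(\<lambda>x. indicator S x * (c * v x)) = (\<lambda>x. c * (indicator S x * v x))" by auto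
  then show ?thesis by (simp add: mean_on_def)
qed

text \<open>After division by \<rho> the sequence is bounded in energy and its integrals over
  measurable sets tend to 0, so compactness applies; scaling back gives a bound relative to \<rho>.
  The majorant \<rho> in place of the norm itself is made for the dual errors, which are small
  relative to the sum of both error norms.\<close>

lemma compact_sequence:
  fixes e :: "nat \<Rightarrow> 'a \<Rightarrow> real"
  assumes e: "\<And>m. e m \<in> V" and \<rho>: "\<And>m. nrm (e m) \<le> \<rho> m"
    and means: "\<And>S \<epsilon>. S \<in> sets M \<Longrightarrow> \<epsilon> > 0 \<Longrightarrow> \<exists>m0. \<forall>m\<ge>m0. \<bar>mean_on S (e m)\<bar> \<le> \<epsilon> * \<rho> m"
    and \<epsilon>: "\<epsilon> > 0"
  shows "\<exists>m0. \<forall>m\<ge>m0. Lp_le M (k + 3) (e m) (\<epsilon> * \<rho> m)"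
proof -
  let ?p = "k + 3"
  have \<rho>0: "0 \<le> \<rho> m" for m using \<rho>[of m] nrm_nonneg[OF e[of m]] by simp
  \<comment> \<open>Division by 0 gives 0, so \<open>w m\<close> is the zero function wherever
    \<open>\<rho> m = 0\<close>.\<close>
  define w where "w m = (\<lambda>x. (1 / \<rho> m) * e m x)" for m
  have wV: "w m \<in> V" for m unfolding w_def by (rule V_scale[OF e])
  have "nrm (w m) \<le> 1" for m
    using \<rho>[of m] \<rho>0[of m] unfolding w_def nrm_scale[OF e] by (cases "\<rho> m = 0") (auto simp: divide_simps)
  then have w1: "a (w m) (w m) \<le> 1" for m
    unfolding nrm_def by (simp add: real_sqrt_le_1_iff)
  have lim: "(\<lambda>j. LINT x|M. indicator S x * w j x) \<longlonglongrightarrow> 0" if S: "S \<in> sets M" for S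
  proof (rule LIMSEQ_I)
    fix r :: real assume r: "0 < r"
    obtain m0 where m0: "\<And>m. m \<ge> m0 \<Longrightarrow> \<bar>mean_on S (e m)\<bar> \<le> r / 2 * \<rho> m"
      using means[OF S, of "r / 2"] r by auto
    have "\<bar>mean_on S (w m)\<bar> < r" if "m \<ge> m0" for m
    proof (cases "\<rho> m = 0")
      case True then show ?thesis using r by (simp add: w_def mean_on_def)
    next
      case False
      then have p: "\<rho> m > 0" using \<rho>0[of m] by simp
      have "\<bar>mean_on S (w m)\<bar> = \<bar>mean_on S (e m)\<bar> / \<rho> m"
        using p unfolding w_def mean_on_scale by (simp add: abs_mult)
      also have "\<dots> \<le> r / 2" using m0[OF that] p by (simp add: field_simps)
      finally show ?thesis using r by simp
    qed
    then show "\<exists>no. \<forall>n\<ge>no. norm ((LINT x|M. indicator S x * w n x) - 0) < r"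
      unfolding mean_on_def by auto
  qed
  have "(\<lambda>j. LINT x|M. \<bar>w j x\<bar> ^ ?p) \<longlonglongrightarrow> 0" by (rule rellich[OF wV w1 lim])
  then obtain m0 where m0: "\<And>m. m \<ge> m0 \<Longrightarrow> \<bar>LINT x|M. \<bar>w m x\<bar> ^ ?p\<bar> < \<epsilon> ^ ?p"
    using LIMSEQ_D[of _ 0 "\<epsilon> ^ ?p"] \<epsilon> by (metis diff_zero real_norm_def zero_less_power)
  have "Lp_le M ?p (e m) (\<epsilon> * \<rho> m)" if "m \<ge> m0" for m
  proof (cases "\<rho> m = 0")
    case True
    then have "nrm (e m) = 0" using \<rho>[of m] nrm_nonneg[OF e[of m]] by simp
    then show ?thesis using sobolev[OF e[of m]] True by simp
  next
    case False
    then have p: "\<rho> m > 0" using \<rho>0[of m] by simp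
    have "\<bar>e m x\<bar> ^ ?p = (\<rho> m) ^ ?p * \<bar>w m x\<bar> ^ ?p" for x
      using p by (simp add: w_def abs_mult power_divide del: power_Suc)
    then have "(LINT x|M. \<bar>e m x\<bar> ^ ?p) = (\<rho> m) ^ ?p * (LINT x|M. \<bar>w m x\<bar> ^ ?p)" by simp
    also have "\<dots> \<le> (\<rho> m) ^ ?p * \<epsilon> ^ ?p"
      using m0[OF that] p by (intro mult_left_mono) auto
    finally show ?thesis using sobolev[OF e[of m]] \<epsilon> p
      by (simp add: Lp_le_def power_mult_distrib mult.commute del: power_Suc)
  qed
  then show ?thesis by blast
qed

end

text \<open>The growth exponents are those that the four-factor Hoelder estimate can absorb: the
  derivative costs \<open>k + 1\<close> weights and is paired with two functions, its Lipschitz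
  constant costs \<open>k\<close> weights and is paired with three.\<close>

locale semilinear = energy_space V a M k C
  for V :: "('a \<Rightarrow> real) set" and a and M :: "'a measure" and k C +
  fixes b :: "'a \<Rightarrow> real \<Rightarrow> real" and R :: real
  assumes R_nonneg: "0 \<le> R"
    and b_measurable: "v \<in> borel_measurable M \<Longrightarrow> (\<lambda>x. b x (v x)) \<in> borel_measurable M"
    and b'_measurable: "v \<in> borel_measurable M \<Longrightarrow> (\<lambda>x. deriv (b x) (v x)) \<in> borel_measurable M"
    and b_deriv: "x \<in> space M \<Longrightarrow> (b x has_real_derivative deriv (b x) \<xi>) (at \<xi>)"
    and b'_nonneg: "x \<in> space M \<Longrightarrow> 0 \<le> deriv (b x) \<xi>"
    and b_zero: "x \<in> space M \<Longrightarrow> b x 0 = 0"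
    and b'_growth: "x \<in> space M \<Longrightarrow> \<bar>deriv (b x) \<xi>\<bar> \<le> R * (1 + \<bar>\<xi>\<bar>) ^ (k + 1)"
    and b'_lipschitz: "x \<in> space M \<Longrightarrow>
      \<bar>deriv (b x) \<xi> - deriv (b x) \<eta>\<bar> \<le> R * (1 + \<bar>\<xi>\<bar> + \<bar>\<eta>\<bar>) ^ k * \<bar>\<xi> - \<eta>\<bar>"
begin

text \<open>The intermediate point comes with two bounds: its size enters the weight, and its
  distance from \<xi> makes the remainder quadratic.\<close>

lemma b_diff_MVT:
  assumes "x \<in> space M"
  obtains \<zeta> where "b x \<xi> - b x \<eta> = deriv (b x) \<zeta> * (\<xi> - \<eta>)" "\<bar>\<zeta>\<bar> \<le> \<bar>\<xi>\<bar> + \<bar>\<eta>\<bar>"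
    "\<bar>\<xi> - \<zeta>\<bar> \<le> \<bar>\<xi> - \<eta>\<bar>"
proof (cases \<xi> \<eta> rule: linorder_cases)
  case less
  then obtain c where "\<xi> < c" "c < \<eta>" "b x \<eta> - b x \<xi> = (\<eta> - \<xi>) * deriv (b x) c"
    using MVT2[of \<xi> \<eta> "b x" "deriv (b x)"] b_deriv[OF assms] by blast
  then show ?thesis by (intro that[of c]) (auto simp: algebra_simps)
next
  case greater
  then obtain c where "\<eta> < c" "c < \<xi>" "b x \<xi> - b x \<eta> = (\<xi> - \<eta>) * deriv (b x) c"
    using MVT2[of \<eta> \<xi> "b x" "deriv (b x)"] b_deriv[OF assms] by blast
  then show ?thesis by (intro that[of c]) (auto simp: algebra_simps)
next
  case equal
  then show ?thesis by (intro that[of \<xi>]) auto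
qed

lemma b_lipschitz:
  assumes "x \<in> space M"
  shows "\<bar>b x \<xi> - b x \<eta>\<bar> \<le> R * (1 + \<bar>\<xi>\<bar> + \<bar>\<eta>\<bar>) ^ (k + 1) * \<bar>\<xi> - \<eta>\<bar>"
proof -
  obtain \<zeta> where z: "b x \<xi> - b x \<eta> = deriv (b x) \<zeta> * (\<xi> - \<eta>)" "\<bar>\<zeta>\<bar> \<le> \<bar>\<xi>\<bar> + \<bar>\<eta>\<bar>"
    using b_diff_MVT[OF assms, of \<xi> \<eta>] by metis
  have "\<bar>deriv (b x) \<zeta>\<bar> \<le> R * (1 + \<bar>\<zeta>\<bar>) ^ (k + 1)" by (rule b'_growth[OF assms])
  also have "\<dots> \<le> R * (1 + \<bar>\<xi>\<bar> + \<bar>\<eta>\<bar>) ^ (k + 1)"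
    using z R_nonneg by (intro mult_left_mono power_mono) auto
  finally show ?thesis unfolding z abs_mult by (intro mult_right_mono) auto
qed

text \<open>The Lipschitz bound for the derivative takes the place of a second derivative. The
  factor 2^k comes from 1 + |\<zeta>| + |\<xi>| <= 2 (1 + |\<xi>| + |\<eta>|).\<close>

lemma b_remainder:
  assumes "x \<in> space M"
  shows "\<bar>b x \<xi> - b x \<eta> - deriv (b x) \<xi> * (\<xi> - \<eta>)\<bar>
    \<le> R * 2 ^ k * (1 + \<bar>\<xi>\<bar> + \<bar>\<eta>\<bar>) ^ k * \<bar>\<xi> - \<eta>\<bar> * \<bar>\<xi> - \<eta>\<bar>"
proof -
  obtain \<zeta> where z: "b x \<xi> - b x \<eta> = deriv (b x) \<zeta> * (\<xi> - \<eta>)" "\<bar>\<zeta>\<bar> \<le> \<bar>\<xi>\<bar> + \<bar>\<eta>\<bar>"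
    "\<bar>\<xi> - \<zeta>\<bar> \<le> \<bar>\<xi> - \<eta>\<bar>"
    using b_diff_MVT[OF assms, of \<xi> \<eta>] by metis
  have "\<bar>deriv (b x) \<zeta> - deriv (b x) \<xi>\<bar> \<le> R * (1 + \<bar>\<zeta>\<bar> + \<bar>\<xi>\<bar>) ^ k * \<bar>\<zeta> - \<xi>\<bar>"
    by (rule b'_lipschitz[OF assms])
  also have "\<dots> \<le> R * (2 * (1 + \<bar>\<xi>\<bar> + \<bar>\<eta>\<bar>)) ^ k * \<bar>\<xi> - \<eta>\<bar>"
    using z R_nonneg by (intro mult_mono power_mono) auto
  finally have *: "\<bar>deriv (b x) \<zeta> - deriv (b x) \<xi>\<bar> \<le> R * 2 ^ k * (1 + \<bar>\<xi>\<bar> + \<bar>\<eta>\<bar>) ^ k * \<bar>\<xi> - \<eta>\<bar>"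
    by (simp only: power_mult_distrib mult.assoc)
  have "b x \<xi> - b x \<eta> - deriv (b x) \<xi> * (\<xi> - \<eta>) = (deriv (b x) \<zeta> - deriv (b x) \<xi>) * (\<xi> - \<eta>)"
    unfolding z by (simp add: algebra_simps)
  then show ?thesis using mult_right_mono[OF *, of "\<bar>\<xi> - \<eta>\<bar>"] by (simp add: abs_mult)
qed

text \<open>Norm bound for 1 + |u| + |v| in the exponent \<open>k + 3\<close> when the energy norms
  of u and v are at most \<open>r\<close> and \<open>s\<close>; the two factors 2 stem from applying
  the doubled triangle inequality twice.\<close>

definition weight :: "real \<Rightarrow> real \<Rightarrow> real" where
  "weight r s = 2 * (2 * (C1 + C * r) + C * s)"

lemma weight_pos: "0 \<le> r \<Longrightarrow> 0 \<le> s \<Longrightarrow> 0 < weight r s"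
  unfolding weight_def using C1_pos C_nonneg by (intro mult_pos_pos add_pos_nonneg) auto

lemma Lp_le_weight:
  assumes u: "u \<in> V" "nrm u \<le> r" and v: "v \<in> V" "nrm v \<le> s"
  shows "Lp_le M (k + 3) (\<lambda>x. 1 + \<bar>u x\<bar> + \<bar>v x\<bar>) (weight r s)"
proof -
  have "Lp_le M (k + 3) u (C * r)" "Lp_le M (k + 3) v (C * s)"
    using Lp_le_mono[OF sobolev] u v C_nonneg mult_left_mono by metis+
  then show ?thesis unfolding weight_def
    by (intro Lp_le_add Lp_le_abs Lp_le_one)
qed

section \<open>Hoelder bounds for the nonlinear terms\<close>

context
  fixes u v :: "'a \<Rightarrow> real" and r s :: real
  assumes u: "u \<in> V" "nrm u \<le> r" and v: "v \<in> V" "nrm v \<le> s"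
begin

lemma uv_measurable[measurable]:
  shows "u \<in> borel_measurable M" "v \<in> borel_measurable M"
    "(\<lambda>x. b x (u x)) \<in> borel_measurable M" "(\<lambda>x. b x (v x)) \<in> borel_measurable M"
    "(\<lambda>x. deriv (b x) (u x)) \<in> borel_measurable M" "(\<lambda>x. deriv (b x) (v x)) \<in> borel_measurable M"
  using V_measurable[OF u(1)] V_measurable[OF v(1)] b_measurable b'_measurable by auto

lemma weight_uv_pos: "0 < weight r s"
  using weight_pos[of r s] nrm_nonneg[OF u(1)] nrm_nonneg[OF v(1)] u(2) v(2) by simp

lemmas weight_bound = integral_bound[OF Lp_le_weight[OF u v] weight_uv_pos]

text \<open>The error enters through a bound \<beta> of its integral norm and not through
  \<open>nrm\<close>, because later \<beta> is small compared with the energy norm by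
  compactness.\<close>

lemma b_diff_bound:
  assumes e: "Lp_le M (k + 3) (\<lambda>x. u x - v x) \<beta>" and w: "w \<in> V"
  shows "integrable M (\<lambda>x. (b x (u x) - b x (v x)) * w x)"
    and "\<bar>LINT x|M. (b x (u x) - b x (v x)) * w x\<bar>
      \<le> R * (4 * weight r s ^ k * weight r s * \<beta> * (C * nrm w))"
proof -
  have m: "(\<lambda>x. (b x (u x) - b x (v x)) * w x) \<in> borel_measurable M"
    using V_measurable[OF w] by measurable
  have le: "\<bar>(b x (u x) - b x (v x)) * w x\<bar>
      \<le> R * (\<bar>1 + \<bar>u x\<bar> + \<bar>v x\<bar>\<bar> ^ k * \<bar>1 + \<bar>u x\<bar> + \<bar>v x\<bar>\<bar> * \<bar>u x - v x\<bar> * \<bar>w x\<bar>)"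
    if "x \<in> space M" for x
    using mult_right_mono[OF b_lipschitz[OF that, of "u x" "v x"], of "\<bar>w x\<bar>"]
    by (simp add: abs_mult mult_ac)
  show "integrable M (\<lambda>x. (b x (u x) - b x (v x)) * w x)"
    by (rule weight_bound(1)[OF Lp_le_weight[OF u v] e sobolev[OF w] m le R_nonneg])
  show "\<bar>LINT x|M. (b x (u x) - b x (v x)) * w x\<bar>
      \<le> R * (4 * weight r s ^ k * weight r s * \<beta> * (C * nrm w))"
    by (rule weight_bound(2)[OF Lp_le_weight[OF u v] e sobolev[OF w] m le R_nonneg])
qed

text \<open>\<open>v\<close> occurs in the weight only. Taking \<open>v\<close> as zero gives the
  bound for the linearised form, taking it as \<open>ul m\<close> gives the same weight as in the
  other nonlinear terms.\<close>

lemma b'_mult_bound: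
  assumes e: "Lp_le M (k + 3) e \<beta>" and w: "w \<in> V"
  shows "integrable M (\<lambda>x. deriv (b x) (u x) * e x * w x)"
    and "\<bar>LINT x|M. deriv (b x) (u x) * e x * w x\<bar>
      \<le> R * (4 * weight r s ^ k * weight r s * \<beta> * (C * nrm w))"
proof -
  have [measurable]: "e \<in> borel_measurable M" "w \<in> borel_measurable M"
    using V_measurable[OF w] e by (auto simp: Lp_le_def)
  have m: "(\<lambda>x. deriv (b x) (u x) * e x * w x) \<in> borel_measurable M" by measurable
  have le: "\<bar>deriv (b x) (u x) * e x * w x\<bar>
      \<le> R * (\<bar>1 + \<bar>u x\<bar> + \<bar>v x\<bar>\<bar> ^ k * \<bar>1 + \<bar>u x\<bar> + \<bar>v x\<bar>\<bar> * \<bar>e x\<bar> * \<bar>w x\<bar>)"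
    if "x \<in> space M" for x
  proof -
    have "\<bar>deriv (b x) (u x)\<bar> \<le> R * (1 + \<bar>u x\<bar>) ^ (k + 1)" by (rule b'_growth[OF that])
    also have "\<dots> \<le> R * (1 + \<bar>u x\<bar> + \<bar>v x\<bar>) ^ (k + 1)"
      using R_nonneg by (intro mult_left_mono power_mono) auto
    finally have "\<bar>deriv (b x) (u x)\<bar> * (\<bar>e x\<bar> * \<bar>w x\<bar>)
        \<le> R * (1 + \<bar>u x\<bar> + \<bar>v x\<bar>) ^ (k + 1) * (\<bar>e x\<bar> * \<bar>w x\<bar>)"
      by (rule mult_right_mono) simp
    then show ?thesis by (simp add: abs_mult mult_ac)
  qed
  show "integrable M (\<lambda>x. deriv (b x) (u x) * e x * w x)"
    by (rule weight_bound(1)[OF Lp_le_weight[OF u v] e sobolev[OF w] m le R_nonneg])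
  show "\<bar>LINT x|M. deriv (b x) (u x) * e x * w x\<bar>
      \<le> R * (4 * weight r s ^ k * weight r s * \<beta> * (C * nrm w))"
    by (rule weight_bound(2)[OF Lp_le_weight[OF u v] e sobolev[OF w] m le R_nonneg])
qed

text \<open>The remainder consumes two factors of the error, both estimated by the energy norm. This
  quadratic smallness does not rely on compactness; the compactness of the normalised errors is
  deduced with its help.\<close>

lemma b_remainder_bound:
  assumes w: "w \<in> V"
  shows "integrable M (\<lambda>x. (b x (u x) - b x (v x) - deriv (b x) (u x) * (u x - v x)) * w x)"
    and "\<bar>LINT x|M. (b x (u x) - b x (v x) - deriv (b x) (u x) * (u x - v x)) * w x\<bar>
      \<le> R * 2 ^ k * (4 * weight r s ^ k * (C * nrm (\<lambda>x. u x - v x)) * (C * nrm (\<lambda>x. u x - v x)) * (C * nrm w))"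
proof -
  let ?f = "\<lambda>x. (b x (u x) - b x (v x) - deriv (b x) (u x) * (u x - v x)) * w x"
  have m: "?f \<in> borel_measurable M" using V_measurable[OF w] by measurable
  have le: "\<bar>?f x\<bar> \<le> R * 2 ^ k * (\<bar>1 + \<bar>u x\<bar> + \<bar>v x\<bar>\<bar> ^ k * \<bar>u x - v x\<bar> * \<bar>u x - v x\<bar> * \<bar>w x\<bar>)"
    if "x \<in> space M" for x
    using mult_right_mono[OF b_remainder[OF that, of "u x" "v x"], of "\<bar>w x\<bar>"]
    by (simp add: abs_mult mult_ac)
  have R2: "0 \<le> R * 2 ^ k" using R_nonneg by simp
  note e = sobolev[OF V_diff[OF u(1) v(1)]]
  show "integrable M ?f" by (rule weight_bound(1)[OF e e sobolev[OF w] m le R2])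
  show "\<bar>LINT x|M. ?f x\<bar> \<le> R * 2 ^ k *
      (4 * weight r s ^ k * (C * nrm (\<lambda>x. u x - v x)) * (C * nrm (\<lambda>x. u x - v x)) * (C * nrm w))"
    by (rule weight_bound(2)[OF e e sobolev[OF w] m le R2])
qed

lemma b'_diff_bound:
  assumes e: "Lp_le M (k + 3) (\<lambda>x. u x - v x) \<beta>" and z: "z \<in> V" and w: "w \<in> V"
  shows "integrable M (\<lambda>x. (deriv (b x) (u x) - deriv (b x) (v x)) * z x * w x)"
    and "\<bar>LINT x|M. (deriv (b x) (u x) - deriv (b x) (v x)) * z x * w x\<bar>
      \<le> R * (4 * weight r s ^ k * \<beta> * (C * nrm z) * (C * nrm w))"
proof -
  let ?f = "\<lambda>x. (deriv (b x) (u x) - deriv (b x) (v x)) * z x * w x"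
  have m: "?f \<in> borel_measurable M" using V_measurable[OF w] V_measurable[OF z] by measurable
  have le: "\<bar>?f x\<bar> \<le> R * (\<bar>1 + \<bar>u x\<bar> + \<bar>v x\<bar>\<bar> ^ k * \<bar>u x - v x\<bar> * \<bar>z x\<bar> * \<bar>w x\<bar>)"
    if "x \<in> space M" for x
    using mult_right_mono[OF b'_lipschitz[OF that, of "u x" "v x"], of "\<bar>z x\<bar> * \<bar>w x\<bar>"]
    by (simp add: abs_mult mult_ac)
  show "integrable M ?f" by (rule weight_bound(1)[OF e sobolev[OF z] sobolev[OF w] m le R_nonneg])
  show "\<bar>LINT x|M. ?f x\<bar> \<le> R * (4 * weight r s ^ k * \<beta> * (C * nrm z) * (C * nrm w))"
    by (rule weight_bound(2)[OF e sobolev[OF z] sobolev[OF w] m le R_nonneg])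
qed

end

lemma zero_in_V: "(\<lambda>x. 0) \<in> V"
  using V_nonempty V_scale[of _ 0] by auto

lemma nrm_zero: "nrm (\<lambda>x. 0) = 0"
  using nrm_scale[OF zero_in_V, of 0] by simp

lemma b_integrable:
  assumes "v \<in> V" "w \<in> V"
  shows "integrable M (\<lambda>x. b x (v x) * w x)"
proof -
  have "integrable M (\<lambda>x. (b x (v x) - b x 0) * w x)"
    by (rule b_diff_bound(1)[OF assms(1) order_refl zero_in_V order_refl _ assms(2)])
      (use sobolev[OF assms(1)] in simp)
  then show ?thesis by (rule Bochner_Integration.integrable_cong[THEN iffD1, rotated -1]) (simp_all add: b_zero)
qed

lemma b'_integrable:
  assumes "u \<in> V" "v \<in> V" "w \<in> V"
  shows "integrable M (\<lambda>x. deriv (b x) (u x) * v x * w x)"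
  by (rule b'_mult_bound(1)[OF assms(1) order_refl zero_in_V order_refl sobolev[OF assms(2)] assms(3)])

text \<open>The potential of the reaction term, normalised at 0. It is selected as any
  antiderivative with this normalisation, so that differentiability is immediate and measurability
  in \<open>x\<close> is what remains to be argued.\<close>

definition B :: "'a \<Rightarrow> real \<Rightarrow> real" where
  "B x = (SOME g. g 0 = 0 \<and> (\<forall>t. (g has_real_derivative b x t) (at t)))"

lemma B_props:
  assumes "x \<in> space M"
  shows "B x 0 = 0" "\<And>t. (B x has_real_derivative b x t) (at t)"
proof -
  have cont: "isCont (b x) t" for t using b_deriv[OF assms] DERIV_isCont by blast
  obtain F where F: "\<And>t. (F has_vector_derivative b x t) (at t)"
    using einterval_antiderivative[of "- \<infinity>" "\<infinity>" "b x"] cont by auto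
  have "(\<lambda>t. F t - F 0) 0 = 0 \<and> (\<forall>t. ((\<lambda>t. F t - F 0) has_real_derivative b x t) (at t))"
    using F by (auto simp: has_real_derivative_iff_has_vector_derivative
        intro!: derivative_eq_intros)
  then have "B x 0 = 0 \<and> (\<forall>t. (B x has_real_derivative b x t) (at t))"
    unfolding B_def by (rule someI[where P = "\<lambda>g. g 0 = 0 \<and> (\<forall>t. (g has_real_derivative b x t) (at t))"])
  then show "B x 0 = 0" "\<And>t. (B x has_real_derivative b x t) (at t)" by auto
qed

lemma b_mono:
  assumes "x \<in> space M"
  shows "mono (b x)"
proof (rule monoI)
  fix s t :: real assume "s \<le> t"
  then show "b x s \<le> b x t"
    using DERIV_nonneg_imp_nondecreasing[of s t "b x"] b_deriv[OF assms] b'_nonneg[OF assms] by blast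
qed

lemma B_convex: "x \<in> space M \<Longrightarrow> b x s * (t - s) \<le> B x t - B x s"
  by (rule convex_antiderivative[OF b_mono B_props(2)])

text \<open>Measurability comes from the Riemann sums. Convexity, used at the points 0 and
  \<open>v x\<close>, gives 0 <= B(v) <= b(v) v, and the majorant is integrable.\<close>

lemma B_integrable:
  assumes v: "v \<in> V"
  shows "integrable M (\<lambda>x. B x (v x))"
proof (rule Bochner_Integration.integrable_bound[OF b_integrable[OF v v]])
  note [measurable] = V_measurable[OF v]
  show "(\<lambda>x. B x (v x)) \<in> borel_measurable M"
  proof (rule borel_measurable_LIMSEQ_real)
    fix x assume "x \<in> space M"
    then show "(\<lambda>N. \<Sum>i<N. b x (real i * v x / real N) * (v x / real N)) \<longlonglongrightarrow> B x (v x)"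
      by (intro riemann_sum_antiderivative b_mono b_zero B_props)
  next
    fix N
    have [measurable]: "(\<lambda>x. b x (real i * v x / real N)) \<in> borel_measurable M" for i
      by (rule b_measurable) measurable
    show "(\<lambda>x. \<Sum>i<N. b x (real i * v x / real N) * (v x / real N)) \<in> borel_measurable M"
      by measurable
  qed
  show "AE x in M. norm (B x (v x)) \<le> norm (b x (v x) * v x)"
  proof (rule AE_I2)
    fix x assume x: "x \<in> space M"
    have "0 \<le> B x (v x)" using B_convex[OF x, of 0 "v x"] by (simp add: b_zero[OF x] B_props[OF x])
    moreover have "B x (v x) \<le> b x (v x) * v x"
      using B_convex[OF x, of "v x" 0] by (simp add: B_props[OF x])
    ultimately show "norm (B x (v x)) \<le> norm (b x (v x) * v x)" by simp
  qed
qed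

lemma B_integral_nonneg: "v \<in> V \<Longrightarrow> 0 \<le> (LINT x|M. B x (v x))"
proof (rule integral_nonneg_AE, rule AE_I2)
  fix x assume x: "x \<in> space M"
  show "0 \<le> B x (v x)" using B_convex[OF x, of 0 "v x"] by (simp add: b_zero[OF x] B_props[OF x])
qed

end

section \<open>Nested Galerkin problems and the decay of their energies\<close>

locale galerkin = semilinear V a M k C b R
  for V :: "('a \<Rightarrow> real) set" and a and M :: "'a measure" and k C b R +
  fixes X :: "nat \<Rightarrow> ('a \<Rightarrow> real) set" and F G :: "('a \<Rightarrow> real) \<Rightarrow> real" and cF :: real
    and u z :: "'a \<Rightarrow> real" and ul zl :: "nat \<Rightarrow> 'a \<Rightarrow> real"
  assumes X_sub: "X l \<subseteq> V" and X_mono: "X l \<subseteq> X (Suc l)"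
    and X_add: "v \<in> X l \<Longrightarrow> w \<in> X l \<Longrightarrow> (\<lambda>x. v x + w x) \<in> X l"
    and X_scale: "v \<in> X l \<Longrightarrow> (\<lambda>x. c * v x) \<in> X l"
    and F_add: "v \<in> V \<Longrightarrow> w \<in> V \<Longrightarrow> F (\<lambda>x. v x + w x) = F v + F w"
    and F_bound: "v \<in> V \<Longrightarrow> \<bar>F v\<bar> \<le> cF * nrm v"
    and u_V: "u \<in> V" and z_V: "z \<in> V"
    and ul_X: "ul l \<in> X l" and zl_X: "zl l \<in> X l"
    and u_eq: "v \<in> V \<Longrightarrow> a u v + (LINT x|M. b x (u x) * v x) = F v"
    and ul_eq: "v \<in> X l \<Longrightarrow> a (ul l) v + (LINT x|M. b x (ul l x) * v x) = F v"
    and z_eq: "v \<in> V \<Longrightarrow> a z v + (LINT x|M. deriv (b x) (u x) * z x * v x) = G v"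
    and zl_eq: "v \<in> X l \<Longrightarrow> a (zl l) v + (LINT x|M. deriv (b x) (ul l x) * zl l x * v x) = G v"
    and zl_conv: "(\<lambda>l. nrm (\<lambda>x. z x - zl l x)) \<longlonglongrightarrow> 0"
begin

lemma X_le: "l \<le> m \<Longrightarrow> X l \<subseteq> X m"
  by (rule lift_Suc_mono_le[of X]) (rule X_mono)

lemma X_V: "v \<in> X l \<Longrightarrow> v \<in> V"
  using X_sub by blast

lemma X_diff:
  assumes "v \<in> X l" "w \<in> X l"
  shows "(\<lambda>x. v x - w x) \<in> X l"
proof -
  have "(\<lambda>x. v x + - 1 * w x) \<in> X l" by (intro X_add X_scale assms)
  then show ?thesis by (simp only: mult_minus1 add_uminus_conv_diff)
qed

lemma ul_V: "ul l \<in> V" and zl_V: "zl l \<in> V"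
  using X_V ul_X zl_X by auto

lemma ul_diff_X: "l \<le> m \<Longrightarrow> (\<lambda>x. ul m x - ul l x) \<in> X m"
  and zl_diff_X: "l \<le> m \<Longrightarrow> (\<lambda>x. zl m x - zl l x) \<in> X m"
  using X_le[of l m] ul_X zl_X by (auto intro: X_diff)

text \<open>The energy functional whose Euler equation is the primal problem.\<close>

definition energy :: "('a \<Rightarrow> real) \<Rightarrow> real" where
  "energy v = a v v / 2 + (LINT x|M. B x (v x)) - F v"

lemma energy_bounded_below: "v \<in> V \<Longrightarrow> - (cF\<^sup>2) / 2 \<le> energy v"
proof -
  assume v: "v \<in> V"
  have "0 \<le> (nrm v - cF)\<^sup>2" by simp
  then show ?thesis using F_bound[OF v] B_integral_nonneg[OF v] nrm_square[OF v]
    by (simp add: energy_def power2_diff mult.commute)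
qed

text \<open>Expansion about \<open>ul m\<close>: the increment lies in \<open>X m\<close>, so the
  discrete equation cancels the first-order terms, convexity of the potential gives its contribution
  the right sign, and the quadratic part remains.\<close>

lemma energy_decrease:
  assumes "l \<le> m"
  shows "(nrm (\<lambda>x. ul m x - ul l x))\<^sup>2 / 2 \<le> energy (ul l) - energy (ul m)"
proof -
  define w where "w = (\<lambda>x. ul l x - ul m x)"
  have wX: "w \<in> X m" unfolding w_def using assms X_le[of l m] ul_X by (intro X_diff) auto
  note wV = X_V[OF wX]
  have l: "ul l = (\<lambda>x. ul m x + w x)" by (simp add: w_def)
  have "(LINT x|M. b x (ul m x) * w x) \<le> (LINT x|M. B x (ul l x) - B x (ul m x))"
  proof (rule integral_mono)
    show "integrable M (\<lambda>x. b x (ul m x) * w x)" by (rule b_integrable[OF ul_V wV])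
    show "integrable M (\<lambda>x. B x (ul l x) - B x (ul m x))"
      by (intro Bochner_Integration.integrable_diff B_integrable ul_V)
  qed (use B_convex in \<open>simp add: w_def\<close>)
  also have "\<dots> = (LINT x|M. B x (ul l x)) - (LINT x|M. B x (ul m x))"
    by (intro Bochner_Integration.integral_diff B_integrable ul_V)
  finally have 1: "(LINT x|M. b x (ul m x) * w x) \<le> (LINT x|M. B x (ul l x)) - (LINT x|M. B x (ul m x))" .
  have 2: "a (ul l) (ul l) = a (ul m) (ul m) + 2 * a (ul m) w + a w w"
    unfolding l by (rule quad_add[OF ul_V wV])
  have 3: "F (ul l) = F (ul m) + F w" unfolding l by (rule F_add[OF ul_V wV])
  have "a w w / 2 \<le> energy (ul l) - energy (ul m)"
    using 1 2 3 ul_eq[OF wX] unfolding energy_def by linarith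
  moreover have "(nrm (\<lambda>x. ul m x - ul l x))\<^sup>2 = a w w"
    using nrm_minus_commute[OF ul_V ul_V, of m l] nrm_square[OF wV] by (simp add: w_def)
  ultimately show ?thesis by simp
qed

text \<open>The energies decrease and are bounded below, hence form a Cauchy sequence, and their
  differences dominate the squared distances. No limit function is formed, since \<open>V\<close> is
  not known to be complete.\<close>

lemma ul_Cauchy:
  assumes "\<epsilon> > 0"
  shows "\<exists>L. \<forall>l\<ge>L. \<forall>m\<ge>L. nrm (\<lambda>x. ul m x - ul l x) < \<epsilon>"
proof -
  have dec: "decseq (\<lambda>l. energy (ul l))"
  proof (rule decseq_SucI)
    fix l
    have "0 \<le> (nrm (\<lambda>x. ul (Suc l) x - ul l x))\<^sup>2 / 2" by simp
    also have "\<dots> \<le> energy (ul l) - energy (ul (Suc l))" by (rule energy_decrease) simp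
    finally show "energy (ul (Suc l)) \<le> energy (ul l)" by simp
  qed
  then obtain e where "(\<lambda>l. energy (ul l)) \<longlonglongrightarrow> e"
    using decseq_convergent[of "\<lambda>l. energy (ul l)" "- (cF\<^sup>2) / 2"] energy_bounded_below[OF ul_V] by metis
  then have "Cauchy (\<lambda>l. energy (ul l))" by (rule LIMSEQ_imp_Cauchy)
  then obtain L where L: "\<And>l m. l \<ge> L \<Longrightarrow> m \<ge> L \<Longrightarrow> \<bar>energy (ul l) - energy (ul m)\<bar> < \<epsilon>\<^sup>2 / 2"
    unfolding Cauchy_def dist_real_def using assms by (metis half_gt_zero zero_less_power)
  have *: "nrm (\<lambda>x. ul m x - ul l x) < \<epsilon>" if "l \<ge> L" "m \<ge> L" "l \<le> m" for l m
  proof (rule power2_less_imp_less)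
    show "(nrm (\<lambda>x. ul m x - ul l x))\<^sup>2 < \<epsilon>\<^sup>2"
      using energy_decrease[OF that(3)] L[OF that(1,2)] by linarith
  qed (use assms in simp)
  have "nrm (\<lambda>x. ul m x - ul l x) < \<epsilon>" if "l \<ge> L" "m \<ge> L" for l m
    using *[of l m] *[of m l] that nrm_minus_commute[OF ul_V ul_V, of m l] by (cases "l \<le> m") auto
  then show ?thesis by blast
qed

definition e :: "nat \<Rightarrow> 'a \<Rightarrow> real" where "e l = (\<lambda>x. u x - ul l x)"
definition E :: "nat \<Rightarrow> 'a \<Rightarrow> real" where "E l = (\<lambda>x. z x - zl l x)"

lemma e_V: "e l \<in> V" and E_V: "E l \<in> V"
  unfolding e_def E_def by (intro V_diff u_V z_V ul_V zl_V)+

lemma E_conv: "(\<lambda>l. nrm (E l)) \<longlonglongrightarrow> 0"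
  using zl_conv by (simp add: E_def[abs_def])

lemma e_split: "e l = (\<lambda>x. e m x + (ul m x - ul l x))"
  and E_split: "E l = (\<lambda>x. E m x + (zl m x - zl l x))"
  by (auto simp: e_def E_def)

text \<open>The error norms converge whether or not the errors tend to 0, because they inherit the
  Cauchy property of \<open>ul\<close>; the value of the limit decides between the two cases of the
  final argument.\<close>

lemma nrm_e_convergent: "convergent (\<lambda>l. nrm (e l))"
proof -
  have le: "nrm (e l) \<le> nrm (e m) + nrm (\<lambda>x. ul m x - ul l x)" for l m
    unfolding e_split[of l m] by (rule nrm_add_le[OF e_V V_diff[OF ul_V ul_V]])
  have "Cauchy (\<lambda>l. nrm (e l))"
    unfolding Cauchy_def dist_real_def
  proof (intro allI impI)
    fix \<epsilon> :: real assume "\<epsilon> > 0"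
    from ul_Cauchy[OF this] obtain L where
      L: "\<And>l m. l \<ge> L \<Longrightarrow> m \<ge> L \<Longrightarrow> nrm (\<lambda>x. ul m x - ul l x) < \<epsilon>" by blast
    have "\<bar>nrm (e m) - nrm (e n)\<bar> < \<epsilon>" if "m \<ge> L" "n \<ge> L" for m n
      using le[of m n] le[of n m] L[OF that] L[OF that(2,1)] by linarith
    then show "\<exists>M. \<forall>m\<ge>M. \<forall>n\<ge>M. \<bar>nrm (e m) - nrm (e n)\<bar> < \<epsilon>" by blast
  qed
  then show ?thesis by (simp add: Cauchy_convergent_iff)
qed

definition total :: "nat \<Rightarrow> real" where
  "total l = (nrm (e l))\<^sup>2 + (nrm (E l))\<^sup>2"

definition increment :: "nat \<Rightarrow> nat \<Rightarrow> real" where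
  "increment l m = (nrm (\<lambda>x. ul m x - ul l x))\<^sup>2 + (nrm (\<lambda>x. zl m x - zl l x))\<^sup>2"

text \<open>The primal part is the Cauchy property, which does not presuppose that \<open>ul\<close>
  converges to \<open>u\<close>; the dual part follows from the assumed convergence.\<close>

lemma increment_small:
  assumes "\<epsilon> > 0"
  shows "\<exists>L. \<forall>l\<ge>L. \<forall>m\<ge>L. increment l m < \<epsilon>"
proof -
  define s where "s = sqrt (\<epsilon> / 2)"
  have s: "s > 0" "s\<^sup>2 = \<epsilon> / 2" using assms by (auto simp: s_def)
  obtain L1 where L1: "\<And>l m. l \<ge> L1 \<Longrightarrow> m \<ge> L1 \<Longrightarrow> nrm (\<lambda>x. ul m x - ul l x) < s"
    using ul_Cauchy[OF s(1)] by blast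
  obtain L2 where L2: "\<And>l. l \<ge> L2 \<Longrightarrow> \<bar>nrm (E l)\<bar> < s / 2"
    using LIMSEQ_D[OF E_conv, of "s / 2"] s(1) by auto
  have "increment l m < \<epsilon>" if "l \<ge> max L1 L2" "m \<ge> max L1 L2" for l m
  proof -
    have "(nrm (\<lambda>x. ul m x - ul l x))\<^sup>2 < s\<^sup>2"
      using L1[of l m] that nrm_nonneg[OF V_diff[OF ul_V ul_V]] by (intro power_strict_mono) auto
    moreover have "nrm (\<lambda>x. zl m x - zl l x) \<le> nrm (E m) + nrm (E l)"
      using nrm_triangle[OF zl_V z_V zl_V, of m l] nrm_minus_commute[OF zl_V z_V, of m]
      by (simp add: E_def)
    then have "(nrm (\<lambda>x. zl m x - zl l x))\<^sup>2 < s\<^sup>2"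
      using L2[of l] L2[of m] that nrm_nonneg[OF V_diff[OF zl_V zl_V]] by (intro power_strict_mono) auto
    ultimately show ?thesis using s(2) by (simp add: increment_def)
  qed
  then show ?thesis by blast
qed

lemma quasi_orthogonality_no_convergence:
  assumes lim: "(\<lambda>l. nrm (e l)) \<longlonglongrightarrow> \<mu>" "\<mu> > 0" and \<delta>: "0 < \<delta>" "\<delta> < 1"
  shows "\<exists>l0. \<forall>l\<ge>l0. \<forall>j. (1 - \<delta>) * (total (l + j) + increment l (l + j)) \<le> total l"
proof -
  have "total \<longlonglongrightarrow> \<mu>\<^sup>2 + 0\<^sup>2"
    unfolding total_def[abs_def] by (intro tendsto_intros lim E_conv)
  \<comment> \<open>Three quantities may be off by \<epsilon>: both terms on the left and the one on
    the right. The gain \<delta> \<mu>^2 has to cover them.\<close>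
  moreover define \<epsilon> where "\<epsilon> = \<mu>\<^sup>2 * \<delta> / 4"
  have \<epsilon>: "\<epsilon> > 0" using lim \<delta> by (simp add: \<epsilon>_def)
  ultimately obtain L1 where L1: "\<And>l. l \<ge> L1 \<Longrightarrow> \<bar>total l - \<mu>\<^sup>2\<bar> < \<epsilon>"
    using LIMSEQ_D[of total "\<mu>\<^sup>2" \<epsilon>] by auto
  obtain L2 where L2: "\<And>l m. l \<ge> L2 \<Longrightarrow> m \<ge> L2 \<Longrightarrow> increment l m < \<epsilon>"
    using increment_small[OF \<epsilon>] by blast
  have "(1 - \<delta>) * (total (l + j) + increment l (l + j)) \<le> total l" if l: "l \<ge> max L1 L2" for l j
  proof -
    have "(1 - \<delta>) * (total (l + j) + increment l (l + j)) \<le> (1 - \<delta>) * (\<mu>\<^sup>2 + 2 * \<epsilon>)"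
      using L1[of "l + j"] L2[of l "l + j"] l \<delta> by (intro mult_left_mono) auto
    also have "\<dots> = \<mu>\<^sup>2 - \<mu>\<^sup>2 * \<delta> / 2 - \<mu>\<^sup>2 * \<delta>\<^sup>2 / 2"
      by (simp add: \<epsilon>_def field_simps power2_eq_square)
    also have "\<dots> \<le> \<mu>\<^sup>2 - \<epsilon>"
    proof -
      have "0 \<le> \<mu>\<^sup>2 * \<delta>" "0 \<le> \<mu>\<^sup>2 * \<delta>\<^sup>2" using \<delta> by simp_all
      then show ?thesis unfolding \<epsilon>_def by linarith
    qed
    also have "\<dots> \<le> total l" using L1[of l] l by auto
    finally show ?thesis .
  qed
  then show ?thesis by blast
qed

section \<open>Error equations and the form linearised at the exact solution\<close>

lemma e_eq:
  assumes "v \<in> X m"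
  shows "a (e m) v = - (LINT x|M. (b x (u x) - b x (ul m x)) * v x)"
proof -
  note v = X_V[OF assms]
  have "(LINT x|M. (b x (u x) - b x (ul m x)) * v x)
      = (LINT x|M. b x (u x) * v x) - (LINT x|M. b x (ul m x) * v x)"
    unfolding left_diff_distrib by (intro Bochner_Integration.integral_diff b_integrable u_V ul_V v)
  moreover have "a (e m) v = a u v - a (ul m) v"
    unfolding e_def by (intro diff_left u_V ul_V v)
  ultimately show ?thesis using u_eq[OF v] ul_eq[OF assms] by simp
qed

text \<open>The discrete dual problem is linearised at \<open>ul m\<close> and not at
  \<open>u\<close>, so with respect to the form linearised at \<open>u\<close> the dual error is
  Galerkin orthogonal only up to the term on the right.\<close>

lemma E_eq:
  assumes "v \<in> X m"
  shows "a (E m) v + (LINT x|M. deriv (b x) (u x) * E m x * v x)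
    = - (LINT x|M. (deriv (b x) (u x) - deriv (b x) (ul m x)) * zl m x * v x)"
proof -
  note v = X_V[OF assms]
  have "(LINT x|M. (deriv (b x) (u x) - deriv (b x) (ul m x)) * zl m x * v x)
      = (LINT x|M. deriv (b x) (u x) * zl m x * v x) - (LINT x|M. deriv (b x) (ul m x) * zl m x * v x)"
    unfolding left_diff_distrib by (intro Bochner_Integration.integral_diff b'_integrable u_V ul_V zl_V v)
  moreover have "(LINT x|M. deriv (b x) (u x) * E m x * v x)
      = (LINT x|M. deriv (b x) (u x) * z x * v x) - (LINT x|M. deriv (b x) (u x) * zl m x * v x)"
    unfolding E_def left_diff_distrib right_diff_distrib
    by (intro Bochner_Integration.integral_diff b'_integrable u_V z_V zl_V v)
  moreover have "a (E m) v = a z v - a (zl m) v"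
    unfolding E_def by (intro diff_left z_V zl_V v)
  ultimately show ?thesis using z_eq[OF v] zl_eq[OF assms] by simp
qed

text \<open>Linearisation at \<open>u\<close>, symmetric and semidefinite by monotonicity. Both
  error sequences are almost orthogonal to the discrete spaces in this form: the primal one up to a
  quadratic remainder, the dual one up to the coupling term.\<close>

definition aB :: "('a \<Rightarrow> real) \<Rightarrow> ('a \<Rightarrow> real) \<Rightarrow> real" where
  "aB v w = a v w + (LINT x|M. deriv (b x) (u x) * v x * w x)"

sublocale lin: psd_form V aB
proof
  show "V \<noteq> {}" by (rule V_nonempty)
next
  fix v w y :: "'a \<Rightarrow> real" assume v: "v \<in> V" and w: "w \<in> V" and y: "y \<in> V"
  have "(LINT x|M. deriv (b x) (u x) * (v x + w x) * y x)
      = (LINT x|M. deriv (b x) (u x) * v x * y x) + (LINT x|M. deriv (b x) (u x) * w x * y x)"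
    unfolding distrib_left distrib_right
    by (intro Bochner_Integration.integral_add b'_integrable u_V v w y)
  then show "aB (\<lambda>x. v x + w x) y = aB v y + aB w y"
    by (simp add: aB_def add_left v w y)
next
  fix v w assume v: "v \<in> V" and w: "w \<in> V"
  show "aB v w = aB w v" using sym[OF v w] by (simp add: aB_def mult_ac)
next
  fix v y c assume v: "v \<in> V" and y: "y \<in> V"
  have "(\<lambda>x. deriv (b x) (u x) * (c * v x) * y x) = (\<lambda>x. c * (deriv (b x) (u x) * v x * y x))"
    by (simp add: mult_ac)
  then show "aB (\<lambda>x. c * v x) y = c * aB v y"
    by (simp add: aB_def scale_left v y distrib_left)
next
  fix v assume v: "v \<in> V"
  have "0 \<le> (LINT x|M. deriv (b x) (u x) * v x * v x)"
    by (rule integral_nonneg_AE, rule AE_I2) (use b'_nonneg in \<open>simp add: mult.assoc\<close>)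
  then show "0 \<le> aB v v" using nonneg[OF v] by (simp add: aB_def)
qed (auto intro: V_add V_scale)

text \<open>Constant of the equivalence of the energy norm with the norm of the linearised form; the
  summand after 1 is the bound for the reaction part.\<close>

definition K :: real where
  "K = sqrt (1 + R * (4 * weight (nrm u) 0 ^ k * weight (nrm u) 0 * C * C))"

lemma weight_u_pos: "0 < weight (nrm u) 0"
  by (rule weight_pos[OF nrm_nonneg[OF u_V] order_refl])

lemma K_pos: "K > 0"
  unfolding K_def using R_nonneg C_nonneg weight_u_pos
  by (intro real_sqrt_gt_zero add_pos_nonneg mult_nonneg_nonneg) auto

lemma lin_nrm_ge: "v \<in> V \<Longrightarrow> nrm v \<le> lin.nrm v"
  unfolding nrm_def lin.nrm_def aB_def using b'_nonneg
  by (auto simp: mult.assoc intro!: integral_nonneg_AE AE_I2)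

lemma lin_nrm_le:
  assumes "v \<in> V"
  shows "lin.nrm v \<le> K * nrm v"
proof -
  have "\<bar>LINT x|M. deriv (b x) (u x) * v x * v x\<bar>
      \<le> R * (4 * weight (nrm u) 0 ^ k * weight (nrm u) 0 * (C * nrm v) * (C * nrm v))"
    by (rule b'_mult_bound(2)[OF u_V order_refl zero_in_V _ sobolev[OF assms] assms]) (simp add: nrm_zero)
  then have "aB v v \<le> (1 + R * (4 * weight (nrm u) 0 ^ k * weight (nrm u) 0 * C * C)) * (nrm v)\<^sup>2"
    unfolding aB_def nrm_square[OF assms, symmetric] by (simp add: algebra_simps power2_eq_square)
  then have "lin.nrm v \<le> sqrt ((1 + R * (4 * weight (nrm u) 0 ^ k * weight (nrm u) 0 * C * C)) * (nrm v)\<^sup>2)"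
    unfolding lin.nrm_def by (rule real_sqrt_le_mono)
  then show ?thesis using nrm_nonneg[OF assms] by (simp add: real_sqrt_mult K_def)
qed


text \<open>The errors lie in the closure of the union of the discrete spaces, so approximate Riesz
  representers with respect to the linearised form can be chosen discrete.\<close>

lemma riesz_on_closure:
  assumes y: "y \<in> V" and S: "S \<in> sets M" and \<epsilon>: "0 \<le> \<epsilon>"
    and bound: "\<And>v l. v \<in> X l \<Longrightarrow> \<bar>mean_on S v - aB y v\<bar> \<le> \<epsilon> * nrm v"
    and d: "d \<in> V" "\<And>j::nat. c j \<in> X (l j)" and lim: "(\<lambda>j. nrm (\<lambda>x. d x - c j x)) \<longlonglongrightarrow> 0"
  shows "\<bar>mean_on S d - aB y d\<bar> \<le> \<epsilon> * nrm d"
proof -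
  \<comment> \<open>\<open>Q\<close> bounds the effect of replacing \<open>d\<close> by a discrete
    approximation in both functionals and in the norm on the right-hand side.\<close>
  define Q where "Q = \<epsilon> + 4 * C1 ^ k * C1 * C1 * C + lin.nrm y * K"
  have *: "\<bar>mean_on S d - aB y d\<bar> \<le> \<epsilon> * nrm d + Q * nrm (\<lambda>x. d x - c j x)" for j
  proof -
    have cV: "c j \<in> V" using X_V[OF d(2)] .
    define r where "r = (\<lambda>x. d x - c j x)"
    have rV: "r \<in> V" unfolding r_def by (rule V_diff[OF d(1) cV])
    have dr: "d = (\<lambda>x. c j x + r x)" and cr: "c j = (\<lambda>x. d x - r x)" by (auto simp: r_def)
    have "mean_on S d = mean_on S (c j) + mean_on S r" "aB y d = aB y (c j) + aB y r"
      unfolding dr by (intro mean_on_add[OF S cV rV] lin.add_right[OF cV rV y])+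
    moreover have "\<bar>mean_on S r\<bar> \<le> 4 * C1 ^ k * C1 * C1 * C * nrm r"
      by (rule mean_on_bounded(2)[OF S rV])
    moreover have "\<bar>aB y r\<bar> \<le> lin.nrm y * K * nrm r"
      using lin.Cauchy_Schwarz[OF y rV] mult_left_mono[OF lin_nrm_le[OF rV] lin.nrm_nonneg[OF y]]
      by (simp add: mult.assoc)
    moreover have "\<epsilon> * nrm (c j) \<le> \<epsilon> * nrm d + \<epsilon> * nrm r"
    proof -
      have "nrm (c j) \<le> nrm d + nrm r"
        using nrm_add_le[OF d(1) V_scale[OF rV, of "- 1"]] nrm_scale[OF rV, of "- 1"]
        unfolding cr by simp
      then show ?thesis using mult_left_mono[OF _ \<epsilon>] by (simp add: distrib_left[symmetric])
    qed
    moreover note bound[OF d(2), of j]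
    ultimately have "\<bar>mean_on S d - aB y d\<bar> \<le> \<epsilon> * nrm d + Q * nrm r"
      unfolding Q_def distrib_right by linarith
    then show ?thesis by (simp add: r_def)
  qed
  have "(\<lambda>j. \<epsilon> * nrm d + Q * nrm (\<lambda>x. d x - c j x)) \<longlonglongrightarrow> \<epsilon> * nrm d + Q * 0"
    by (intro tendsto_intros lim)
  then show ?thesis using LIMSEQ_le_const[of _ "\<epsilon> * nrm d + Q * 0"] * by simp
qed

section \<open>Decay of the normalised errors when the primal approximations converge to the
  solution\<close>

context
  assumes e_conv: "(\<lambda>l. nrm (e l)) \<longlonglongrightarrow> 0"
begin

text \<open>Convergence of both sequences makes \<open>e m\<close> and \<open>E m\<close> limits of
  discrete differences between the levels m + j and m, so estimates on the union of the discrete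
  spaces carry over to them. A single discrete \<open>y\<close> serves all errors at once.\<close>

lemma riesz_errors:
  assumes S: "S \<in> sets M" and \<epsilon>: "\<epsilon> > 0"
  shows "\<exists>m1. \<exists>y\<in>X m1. \<forall>m. \<bar>mean_on S (e m) - aB y (e m)\<bar> \<le> \<epsilon> * nrm (e m)
    \<and> \<bar>mean_on S (E m) - aB y (E m)\<bar> \<le> \<epsilon> * nrm (E m)"
proof -
  let ?Y = "\<Union>l. X l"
  have YV: "?Y \<subseteq> V" using X_sub by auto
  \<comment> \<open>The tolerance \<epsilon> / K compensates the passage from the linearised norm
    back to the energy norm.\<close>
  have "\<exists>y\<in>?Y. \<forall>v\<in>?Y. \<bar>mean_on S v - aB y v\<bar> \<le> (\<epsilon> / K) * lin.nrm v"
  proof (rule lin.approx_Riesz[where c = "4 * C1 ^ k * C1 * C1 * C"])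
    show "?Y \<subseteq> V" by (rule YV)
    show "?Y \<noteq> {}" using ul_X by auto
    show "\<epsilon> / K > 0" using \<epsilon> K_pos by simp
    show "(\<lambda>x. v x + w x) \<in> ?Y" if "v \<in> ?Y" "w \<in> ?Y" for v w
    proof -
      from that obtain i j where "v \<in> X i" "w \<in> X j" by auto
      then have "v \<in> X (max i j)" "w \<in> X (max i j)" using X_le[of i "max i j"] X_le[of j "max i j"] by auto
      then show ?thesis using X_add by blast
    qed
    show "(\<lambda>x. c * v x) \<in> ?Y" if "v \<in> ?Y" for v c using that X_scale by auto
    show "mean_on S (\<lambda>x. v x + w x) = mean_on S v + mean_on S w" if "v \<in> ?Y" "w \<in> ?Y" for v w
      using that YV mean_on_add[OF S] by blast
    show "mean_on S (\<lambda>x. c * v x) = c * mean_on S v" for v c by (rule mean_on_scale)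
    show "\<bar>mean_on S v\<bar> \<le> 4 * C1 ^ k * C1 * C1 * C * lin.nrm v" if "v \<in> ?Y" for v
    proof -
      have v: "v \<in> V" using that YV by auto
      have "0 \<le> 4 * C1 ^ k * C1 * C1 * C" using C1_pos C_nonneg by simp
      then show ?thesis using mean_on_bounded(2)[OF S v] mult_left_mono[OF lin_nrm_ge[OF v]]
        by (meson order_trans)
    qed
  qed
  then obtain y m1 where y: "y \<in> X m1"
    and yb: "\<And>v l. v \<in> X l \<Longrightarrow> \<bar>mean_on S v - aB y v\<bar> \<le> (\<epsilon> / K) * lin.nrm v" by blast
  have bound: "\<bar>mean_on S v - aB y v\<bar> \<le> \<epsilon> * nrm v" if "v \<in> X l" for v l
  proof -
    have "(\<epsilon> / K) * lin.nrm v \<le> (\<epsilon> / K) * (K * nrm v)"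
      using lin_nrm_le[OF X_V[OF that]] \<epsilon> K_pos by (intro mult_left_mono) auto
    then show ?thesis using yb[OF that] K_pos by simp
  qed
  have "\<bar>mean_on S (e m) - aB y (e m)\<bar> \<le> \<epsilon> * nrm (e m)" for m
  proof (rule riesz_on_closure[OF X_V[OF y] S _ bound e_V])
    show "(\<lambda>x. ul (m + j) x - ul m x) \<in> X (m + j)" for j by (rule ul_diff_X) simp
    have "(\<lambda>x. e m x - (ul (m + j) x - ul m x)) = e (j + m)" for j by (auto simp: e_def add.commute)
    then show "(\<lambda>j. nrm (\<lambda>x. e m x - (ul (m + j) x - ul m x))) \<longlonglongrightarrow> 0"
      using LIMSEQ_ignore_initial_segment[OF e_conv, of m] by simp
  qed (use \<epsilon> in auto)
  moreover have "\<bar>mean_on S (E m) - aB y (E m)\<bar> \<le> \<epsilon> * nrm (E m)" for m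
  proof (rule riesz_on_closure[OF X_V[OF y] S _ bound E_V])
    show "(\<lambda>x. zl (m + j) x - zl m x) \<in> X (m + j)" for j by (rule zl_diff_X) simp
    have "(\<lambda>x. E m x - (zl (m + j) x - zl m x)) = E (j + m)" for j by (auto simp: E_def add.commute)
    then show "(\<lambda>j. nrm (\<lambda>x. E m x - (zl (m + j) x - zl m x))) \<longlonglongrightarrow> 0"
      using LIMSEQ_ignore_initial_segment[OF E_conv, of m] by simp
  qed (use \<epsilon> in auto)
  ultimately show ?thesis using y by blast
qed

text \<open>Weight for the pairs \<open>u\<close>, \<open>ul m\<close>, uniform in late
  \<open>m\<close> because then \<open>nrm (ul m) \<le> nrm u + 1\<close>.\<close>

definition W :: real where "W = weight (nrm u) (nrm u + 1)"

lemma W_pos: "W > 0"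
  unfolding W_def using nrm_nonneg[OF u_V] by (intro weight_pos) auto

lemma eventually_bounded:
  "\<exists>m0. \<forall>m\<ge>m0. nrm (ul m) \<le> nrm u + 1 \<and> nrm (zl m) \<le> nrm z + 1"
proof -
  obtain m1 m2 where m: "\<And>m. m \<ge> m1 \<Longrightarrow> \<bar>nrm (e m)\<bar> < 1" "\<And>m. m \<ge> m2 \<Longrightarrow> \<bar>nrm (E m)\<bar> < 1"
    using LIMSEQ_D[OF e_conv, of 1] LIMSEQ_D[OF E_conv, of 1] by auto
  have "nrm (ul m) \<le> nrm u + nrm (e m)" "nrm (zl m) \<le> nrm z + nrm (E m)" for m
    using nrm_add_le[OF u_V V_scale[OF e_V, of "- 1" m]] nrm_scale[OF e_V, of "- 1" m]
      nrm_add_le[OF z_V V_scale[OF E_V, of "- 1" m]] nrm_scale[OF E_V, of "- 1" m]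
    by (simp_all add: e_def E_def)
  then have "nrm (ul m) \<le> nrm u + 1 \<and> nrm (zl m) \<le> nrm z + 1" if "m \<ge> max m1 m2" for m
    using m[of m] that by (smt (verit) max.bounded_iff)
  then show ?thesis by blast
qed

text \<open>For a fixed discrete representer \<open>y\<close>, the linearised form at
  \<open>e m\<close> and \<open>y\<close> is minus the Taylor remainder tested with
  \<open>y\<close>, hence of second order in the error norm. As that norm tends to 0, every integral
  of \<open>e m\<close> over a measurable set is o(nrm (e m)), and compactness turns this into
  smallness in the integral norm.\<close>

lemma e_Lp_small:
  assumes \<epsilon>: "\<epsilon> > 0"
  shows "\<exists>m0. \<forall>m\<ge>m0. Lp_le M (k + 3) (e m) (\<epsilon> * nrm (e m))"
proof (rule compact_sequence[OF e_V order_refl _ \<epsilon>])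
  fix S and \<epsilon> :: real assume S: "S \<in> sets M" and \<epsilon>: "\<epsilon> > 0"
  obtain m1 y where y: "y \<in> X m1"
    and yb: "\<And>m. \<bar>mean_on S (e m) - aB y (e m)\<bar> \<le> \<epsilon> / 2 * nrm (e m)"
    using riesz_errors[OF S, of "\<epsilon> / 2"] \<epsilon> by auto
  obtain m2 where m2: "\<And>m. m \<ge> m2 \<Longrightarrow> nrm (ul m) \<le> nrm u + 1" using eventually_bounded by blast
  \<comment> \<open>Collects the constants of the remainder bound; divisions below are by
    \<open>Q + 1\<close> because \<open>Q\<close> can vanish.\<close>
  define Q where "Q = R * 2 ^ k * (4 * W ^ k * C * C * (C * nrm y))"
  have Q: "Q \<ge> 0" unfolding Q_def using R_nonneg W_pos C_nonneg nrm_nonneg[OF X_V[OF y]] by simp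
  obtain m3 where m3: "\<And>m. m \<ge> m3 \<Longrightarrow> \<bar>nrm (e m)\<bar> < \<epsilon> / 2 / (Q + 1)"
    using LIMSEQ_D[OF e_conv, of "\<epsilon> / 2 / (Q + 1)"] \<epsilon> Q by auto
  have "\<bar>mean_on S (e m)\<bar> \<le> \<epsilon> * nrm (e m)" if m: "m \<ge> max m1 (max m2 m3)" for m
  proof -
    have yX: "y \<in> X m" using y X_le[of m1 m] m by auto
    note yV = X_V[OF yX]
    \<comment> \<open>Symmetry puts the error into the first slot, where the Galerkin equation
      applies because \<open>y \<in> X m\<close>.\<close>
    have "aB y (e m) = aB (e m) y" by (rule lin.sym[OF yV e_V])
    also have "\<dots> = (LINT x|M. deriv (b x) (u x) * e m x * y x) - (LINT x|M. (b x (u x) - b x (ul m x)) * y x)"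
      unfolding aB_def e_eq[OF yX] by simp
    also have "\<dots> = - (LINT x|M. (b x (u x) - b x (ul m x) - deriv (b x) (u x) * (u x - ul m x)) * y x)"
    proof -
      have 1: "integrable M (\<lambda>x. (b x (u x) - b x (ul m x)) * y x)"
        unfolding left_diff_distrib
        by (intro Bochner_Integration.integrable_diff b_integrable u_V ul_V yV)
      have 2: "integrable M (\<lambda>x. deriv (b x) (u x) * e m x * y x)"
        by (rule b'_integrable[OF u_V e_V yV])
      have "(LINT x|M. (b x (u x) - b x (ul m x) - deriv (b x) (u x) * (u x - ul m x)) * y x)
          = (LINT x|M. (b x (u x) - b x (ul m x)) * y x - deriv (b x) (u x) * e m x * y x)"
        by (simp add: e_def left_diff_distrib)
      also have "\<dots> = (LINT x|M. (b x (u x) - b x (ul m x)) * y x) - (LINT x|M. deriv (b x) (u x) * e m x * y x)"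
        by (rule Bochner_Integration.integral_diff[OF 1 2])
      finally show ?thesis by simp
    qed
    finally have "\<bar>aB y (e m)\<bar> \<le> R * 2 ^ k * (4 * W ^ k * (C * nrm (e m)) * (C * nrm (e m)) * (C * nrm y))"
      using b_remainder_bound(2)[OF u_V order_refl ul_V m2 yV, of m] m
      by (simp add: W_def e_def)
    also have "\<dots> = (Q * nrm (e m)) * nrm (e m)" by (simp add: Q_def mult_ac)
    also have "\<dots> \<le> \<epsilon> / 2 * nrm (e m)"
    proof (rule mult_right_mono[OF _ nrm_nonneg[OF e_V]])
      have "Q * nrm (e m) \<le> (Q + 1) * nrm (e m)" using nrm_nonneg[OF e_V] by (intro mult_right_mono) auto
      also have "\<dots> \<le> \<epsilon> / 2" using m3[of m] m Q nrm_nonneg[OF e_V, of m] by (simp add: field_simps)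
      finally show "Q * nrm (e m) \<le> \<epsilon> / 2" .
    qed
    finally show ?thesis using yb[of m] by linarith
  qed
  then show "\<exists>m0. \<forall>m\<ge>m0. \<bar>mean_on S (e m)\<bar> \<le> \<epsilon> * nrm (e m)" by blast
qed

text \<open>One factor of the product is the primal error, which is small in the integral norm
  relative to its energy norm, and the discrete dual solutions are bounded.\<close>

lemma coupling_small:
  assumes \<epsilon>: "\<epsilon> > 0"
  shows "\<exists>m0. \<forall>m\<ge>m0. \<forall>w\<in>V.
    \<bar>LINT x|M. (deriv (b x) (u x) - deriv (b x) (ul m x)) * zl m x * w x\<bar> \<le> \<epsilon> * nrm (e m) * nrm w"
proof -
  define Q where "Q = R * (4 * W ^ k * (C * (nrm z + 1)) * C)"
  have Q: "Q \<ge> 0" unfolding Q_def using R_nonneg W_pos C_nonneg nrm_nonneg[OF z_V] by simp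
  obtain m1 where m1: "\<And>m. m \<ge> m1 \<Longrightarrow> Lp_le M (k + 3) (e m) (\<epsilon> / (Q + 1) * nrm (e m))"
    using e_Lp_small[of "\<epsilon> / (Q + 1)"] \<epsilon> Q by auto
  obtain m2 where m2: "\<And>m. m \<ge> m2 \<Longrightarrow> nrm (ul m) \<le> nrm u + 1 \<and> nrm (zl m) \<le> nrm z + 1"
    using eventually_bounded by blast
  have "\<bar>LINT x|M. (deriv (b x) (u x) - deriv (b x) (ul m x)) * zl m x * w x\<bar> \<le> \<epsilon> * nrm (e m) * nrm w"
    if m: "m \<ge> max m1 m2" and w: "w \<in> V" for m w
  proof -
    define q where "q = \<epsilon> / (Q + 1) * nrm (e m)"
    have q: "0 \<le> q" unfolding q_def using \<epsilon> Q nrm_nonneg[OF e_V] by simp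
    have nn: "0 \<le> nrm w" "0 \<le> nrm (e m)" using w e_V nrm_nonneg by auto
    have "\<bar>LINT x|M. (deriv (b x) (u x) - deriv (b x) (ul m x)) * zl m x * w x\<bar>
        \<le> R * (4 * W ^ k * q * (C * nrm (zl m)) * (C * nrm w))"
      unfolding W_def
      by (rule b'_diff_bound(2)[OF u_V order_refl ul_V _ _ zl_V w])
        (use m1[of m] m2[of m] m in \<open>auto simp: e_def q_def\<close>)
    also have "\<dots> \<le> R * (4 * W ^ k * q * (C * (nrm z + 1)) * (C * nrm w))"
      using m2[of m] m q R_nonneg C_nonneg W_pos nn
      by (intro mult_left_mono mult_right_mono mult_nonneg_nonneg) auto
    also have "\<dots> = Q * q * nrm w" by (simp add: Q_def mult_ac)
    also have "\<dots> \<le> (Q + 1) * q * nrm w" using q nn by (intro mult_right_mono) auto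
    also have "\<dots> = \<epsilon> * nrm (e m) * nrm w" using Q by (simp add: q_def)
    finally show ?thesis .
  qed
  then show ?thesis by blast
qed

text \<open>The linearised form at \<open>E m\<close> and a discrete \<open>y\<close> is minus the
  coupling term, whose size is governed by the primal error. This is why both error norms appear on
  the right.\<close>

lemma E_Lp_small:
  assumes \<epsilon>: "\<epsilon> > 0"
  shows "\<exists>m0. \<forall>m\<ge>m0. Lp_le M (k + 3) (E m) (\<epsilon> * (nrm (e m) + nrm (E m)))"
proof (rule compact_sequence[OF E_V _ _ \<epsilon>])
  show "nrm (E m) \<le> nrm (e m) + nrm (E m)" for m using nrm_nonneg[OF e_V] by simp
  fix S and \<epsilon> :: real assume S: "S \<in> sets M" and \<epsilon>: "\<epsilon> > 0"
  obtain m1 y where y: "y \<in> X m1"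
    and yb: "\<And>m. \<bar>mean_on S (E m) - aB y (E m)\<bar> \<le> \<epsilon> * nrm (E m)"
    using riesz_errors[OF S \<epsilon>] by auto
  have ny: "nrm y \<ge> 0" using nrm_nonneg[OF X_V[OF y]] .
  obtain m2 where m2: "\<And>m w. m \<ge> m2 \<Longrightarrow> w \<in> V \<Longrightarrow>
    \<bar>LINT x|M. (deriv (b x) (u x) - deriv (b x) (ul m x)) * zl m x * w x\<bar>
      \<le> \<epsilon> / (nrm y + 1) * nrm (e m) * nrm w"
    using coupling_small[of "\<epsilon> / (nrm y + 1)"] \<epsilon> ny by (auto simp: add_nonneg_pos)
  have "\<bar>mean_on S (E m)\<bar> \<le> \<epsilon> * (nrm (e m) + nrm (E m))" if m: "m \<ge> max m1 m2" for m
  proof -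
    have yX: "y \<in> X m" using y X_le[of m1 m] m by auto
    note yV = X_V[OF yX]
    have "aB y (E m) = aB (E m) y" by (rule lin.sym[OF yV E_V])
    then have "\<bar>aB y (E m)\<bar> \<le> \<epsilon> / (nrm y + 1) * nrm (e m) * nrm y"
      using E_eq[OF yX] m2[of m y] m yV by (simp add: aB_def)
    also have "\<dots> = \<epsilon> * nrm (e m) * (nrm y / (nrm y + 1))" by simp
    also have "\<dots> \<le> \<epsilon> * nrm (e m) * 1"
      using \<epsilon> ny nrm_nonneg[OF e_V] by (intro mult_left_mono) auto
    finally show ?thesis using yb[of m] by (simp add: distrib_left)
  qed
  then show "\<exists>m0. \<forall>m\<ge>m0. \<bar>mean_on S (E m)\<bar> \<le> \<epsilon> * (nrm (e m) + nrm (E m))" by blast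
qed

text \<open>The Galerkin equation expresses \<open>a (e m) w\<close> by the reaction difference,
  where the error can be measured in the integral norm; there it is small relative to its energy
  norm.\<close>

lemma e_almost_orthogonal:
  assumes \<epsilon>: "\<epsilon> > 0"
  shows "\<exists>m0. \<forall>m\<ge>m0. \<forall>w\<in>X m. \<bar>a (e m) w\<bar> \<le> \<epsilon> * nrm (e m) * nrm w"
proof -
  define Q where "Q = R * (4 * W ^ k * W * C)"
  have Q: "Q \<ge> 0" unfolding Q_def using R_nonneg W_pos C_nonneg by simp
  obtain m1 where m1: "\<And>m. m \<ge> m1 \<Longrightarrow> Lp_le M (k + 3) (e m) (\<epsilon> / (Q + 1) * nrm (e m))"
    using e_Lp_small[of "\<epsilon> / (Q + 1)"] \<epsilon> Q by auto
  obtain m2 where m2: "\<And>m. m \<ge> m2 \<Longrightarrow> nrm (ul m) \<le> nrm u + 1" using eventually_bounded by blast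
  have "\<bar>a (e m) w\<bar> \<le> \<epsilon> * nrm (e m) * nrm w" if m: "m \<ge> max m1 m2" and w: "w \<in> X m" for m w
  proof -
    let ?q = "\<epsilon> / (Q + 1) * nrm (e m)"
    note wV = X_V[OF w]
    have "\<bar>a (e m) w\<bar> \<le> R * (4 * W ^ k * W * ?q * (C * nrm w))"
      unfolding e_eq[OF w] abs_minus_cancel W_def
      by (rule b_diff_bound(2)[OF u_V order_refl ul_V _ _ wV])
        (use m1[of m] m2[of m] m in \<open>auto simp: e_def\<close>)
    also have "\<dots> = Q * (?q * nrm w)" by (simp add: Q_def mult_ac)
    also have "\<dots> \<le> (Q + 1) * (?q * nrm w)"
      using \<epsilon> Q nrm_nonneg[OF e_V] nrm_nonneg[OF wV] by (intro mult_right_mono) auto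
    also have "\<dots> = \<epsilon> * nrm (e m) * nrm w" using Q by simp
    finally show ?thesis .
  qed
  then show ?thesis by blast
qed

text \<open>Passing from the linearised form to \<open>a\<close> leaves two reaction terms: one
  contains \<open>E m\<close> in the integral norm, the other is the coupling. Each receives half of
  \<epsilon>.\<close>

lemma E_almost_orthogonal:
  assumes \<epsilon>: "\<epsilon> > 0"
  shows "\<exists>m0. \<forall>m\<ge>m0. \<forall>w\<in>X m. \<bar>a (E m) w\<bar> \<le> \<epsilon> * (nrm (e m) + nrm (E m)) * nrm w"
proof -
  define Q where "Q = R * (4 * W ^ k * W * C)"
  have Q: "Q \<ge> 0" unfolding Q_def using R_nonneg W_pos C_nonneg by simp
  obtain m1 where m1: "\<And>m. m \<ge> m1 \<Longrightarrow>
      Lp_le M (k + 3) (E m) (\<epsilon> / 2 / (Q + 1) * (nrm (e m) + nrm (E m)))"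
    using E_Lp_small[of "\<epsilon> / 2 / (Q + 1)"] \<epsilon> Q by auto
  obtain m2 where m2: "\<And>m. m \<ge> m2 \<Longrightarrow> nrm (ul m) \<le> nrm u + 1" using eventually_bounded by blast
  obtain m3 where m3: "\<And>m w. m \<ge> m3 \<Longrightarrow> w \<in> V \<Longrightarrow>
    \<bar>LINT x|M. (deriv (b x) (u x) - deriv (b x) (ul m x)) * zl m x * w x\<bar> \<le> \<epsilon> / 2 * nrm (e m) * nrm w"
    using coupling_small[of "\<epsilon> / 2"] \<epsilon> by auto
  have "\<bar>a (E m) w\<bar> \<le> \<epsilon> * (nrm (e m) + nrm (E m)) * nrm w"
    if m: "m \<ge> max m1 (max m2 m3)" and w: "w \<in> X m" for m w
  proof -
    let ?r = "nrm (e m) + nrm (E m)"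
    let ?q = "\<epsilon> / 2 / (Q + 1) * ?r"
    note wV = X_V[OF w]
    have nn: "0 \<le> nrm (e m)" "0 \<le> nrm (E m)" "0 \<le> nrm w" using nrm_nonneg e_V E_V wV by auto
    have "\<bar>LINT x|M. deriv (b x) (u x) * E m x * w x\<bar> \<le> R * (4 * W ^ k * W * ?q * (C * nrm w))"
      unfolding W_def
      by (rule b'_mult_bound(2)[OF u_V order_refl ul_V _ _ wV])
        (use m1[of m] m2[of m] m in auto)
    also have "\<dots> = Q * (?q * nrm w)" by (simp add: Q_def mult_ac)
    also have "\<dots> \<le> (Q + 1) * (?q * nrm w)"
      using \<epsilon> Q nn by (intro mult_right_mono) auto
    also have "\<dots> = \<epsilon> / 2 * ?r * nrm w"
    proof -
      have "Q + 1 \<noteq> 0" using Q by simp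
      then show ?thesis by (simp add: divide_simps)
    qed
    finally have 1: "\<bar>LINT x|M. deriv (b x) (u x) * E m x * w x\<bar> \<le> \<epsilon> / 2 * ?r * nrm w" .
    have 2: "\<epsilon> / 2 * nrm (e m) * nrm w \<le> \<epsilon> / 2 * ?r * nrm w"
      using \<epsilon> nn by (intro mult_right_mono mult_left_mono) auto
    have 3: "\<epsilon> / 2 * ?r * nrm w + \<epsilon> / 2 * ?r * nrm w = \<epsilon> * ?r * nrm w" by (simp add: algebra_simps)
    have "\<bar>LINT x|M. (deriv (b x) (u x) - deriv (b x) (ul m x)) * zl m x * w x\<bar>
        \<le> \<epsilon> / 2 * nrm (e m) * nrm w"
      using m3[of m w] m wV by simp
    with E_eq[OF w] 1 2 3 show ?thesis by linarith
  qed
  then show ?thesis by blast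
qed

text \<open>The error at level \<open>l\<close> is the error at level \<open>l + j\<close> plus an
  increment in the space of level \<open>l + j\<close>. The squares add up to the bracket on the
  left, and almost orthogonality at level \<open>l + j\<close> covers the mixed terms.\<close>

lemma quasi_orthogonality_convergence:
  assumes \<delta>: "0 < \<delta>"
  shows "\<exists>l0. \<forall>l\<ge>l0. \<forall>j. (1 - \<delta>) * (total (l + j) + increment l (l + j)) \<le> total l"
proof -
  obtain m1 where m1: "\<And>m w. m \<ge> m1 \<Longrightarrow> w \<in> X m \<Longrightarrow> \<bar>a (e m) w\<bar> \<le> \<delta> / 2 * nrm (e m) * nrm w"
    using e_almost_orthogonal[of "\<delta> / 2"] \<delta> by auto
  obtain m2 where m2: "\<And>m w. m \<ge> m2 \<Longrightarrow> w \<in> X m \<Longrightarrow>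
      \<bar>a (E m) w\<bar> \<le> \<delta> / 2 * (nrm (e m) + nrm (E m)) * nrm w"
    using E_almost_orthogonal[of "\<delta> / 2"] \<delta> by auto
  have "(1 - \<delta>) * (total (l + j) + increment l (l + j)) \<le> total l" if l: "l \<ge> max m1 m2" for l j
  proof -
    define m where "m = l + j"
    define w where "w = (\<lambda>x. ul m x - ul l x)"
    define w' where "w' = (\<lambda>x. zl m x - zl l x)"
    have wX: "w \<in> X m" "w' \<in> X m" unfolding w_def w'_def m_def by (simp_all add: ul_diff_X zl_diff_X)
    note wV = X_V[OF wX(1)] X_V[OF wX(2)]
    let ?p = "nrm (e m)" and ?q = "nrm (E m)" and ?r = "nrm w" and ?s = "nrm w'"
    have e1: "(nrm (e l))\<^sup>2 = ?p\<^sup>2 + 2 * a (e m) w + ?r\<^sup>2"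
    proof -
      have "e l = (\<lambda>x. e m x + w x)" unfolding w_def by (rule e_split)
      then have "a (e l) (e l) = a (e m) (e m) + 2 * a (e m) w + a w w"
        using quad_add[OF e_V wV(1), of m] by simp
      then show ?thesis by (simp only: nrm_square e_V wV)
    qed
    have e2: "(nrm (E l))\<^sup>2 = ?q\<^sup>2 + 2 * a (E m) w' + ?s\<^sup>2"
    proof -
      have "E l = (\<lambda>x. E m x + w' x)" unfolding w'_def by (rule E_split)
      then have "a (E l) (E l) = a (E m) (E m) + 2 * a (E m) w' + a w' w'"
        using quad_add[OF E_V wV(2), of m] by simp
      then show ?thesis by (simp only: nrm_square E_V wV)
    qed
    have "\<bar>a (e m) w\<bar> + \<bar>a (E m) w'\<bar> \<le> \<delta> / 2 * ?p * ?r + \<delta> / 2 * (?p + ?q) * ?s"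
      using m1[of m w] m2[of m w'] l wX by (intro add_mono) (auto simp: m_def)
    also have "\<dots> = \<delta> / 2 * (?p * ?r + ?p * ?s + ?q * ?s)" by (simp add: algebra_simps)
    also have "\<dots> \<le> \<delta> / 2 * (?p\<^sup>2 + ?q\<^sup>2 + ?r\<^sup>2 + ?s\<^sup>2)"
    proof (rule mult_left_mono)
      \<comment> \<open>The additional squares of \<open>?r\<close> and \<open>?q\<close> let each
        of the four squares occur exactly twice.\<close>
      have "0 \<le> (?p - ?r)\<^sup>2 + (?p - ?s)\<^sup>2 + (?q - ?s)\<^sup>2 + ?r\<^sup>2 + ?q\<^sup>2" by simp
      then show "?p * ?r + ?p * ?s + ?q * ?s \<le> ?p\<^sup>2 + ?q\<^sup>2 + ?r\<^sup>2 + ?s\<^sup>2"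
        by (simp add: power2_diff)
    qed (use \<delta> in simp)
    finally have "2 * (\<bar>a (e m) w\<bar> + \<bar>a (E m) w'\<bar>) \<le> \<delta> * (?p\<^sup>2 + ?q\<^sup>2 + ?r\<^sup>2 + ?s\<^sup>2)" by simp
    moreover have "total m + increment l m = ?p\<^sup>2 + ?q\<^sup>2 + ?r\<^sup>2 + ?s\<^sup>2"
      by (simp add: total_def increment_def w_def w'_def)
    moreover have "total l = ?p\<^sup>2 + ?q\<^sup>2 + ?r\<^sup>2 + ?s\<^sup>2 + 2 * a (e m) w + 2 * a (E m) w'"
      unfolding total_def e1 e2 by simp
    ultimately have "total m + increment l m - \<delta> * (total m + increment l m) \<le> total l"
      by (smt (verit))
    then show ?thesis unfolding m_def by (simp add: left_diff_distrib)
  qed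
  then show ?thesis by blast
qed

end

theorem quasi_orthogonality:
  assumes \<delta>: "0 < \<delta>" "\<delta> < 1"
  shows "\<exists>l0. \<forall>l\<ge>l0. \<forall>j.
    ((nrm (\<lambda>x. u x - ul (l + j) x))\<^sup>2 + (nrm (\<lambda>x. z x - zl (l + j) x))\<^sup>2) +
    ((nrm (\<lambda>x. ul (l + j) x - ul l x))\<^sup>2 + (nrm (\<lambda>x. zl (l + j) x - zl l x))\<^sup>2)
    \<le> 1 / (1 - \<delta>) * ((nrm (\<lambda>x. u x - ul l x))\<^sup>2 + (nrm (\<lambda>x. z x - zl l x))\<^sup>2)"
proof -
  obtain \<mu> where lim: "(\<lambda>l. nrm (e l)) \<longlonglongrightarrow> \<mu>"
    using nrm_e_convergent convergent_def by blast
  have "\<mu> \<ge> 0" using LIMSEQ_le_const[OF lim, of 0] nrm_nonneg[OF e_V] by auto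
  then consider "\<mu> = 0" | "\<mu> > 0" by linarith
  then obtain l0 where l0: "\<And>l j. l \<ge> l0 \<Longrightarrow> (1 - \<delta>) * (total (l + j) + increment l (l + j)) \<le> total l"
    using quasi_orthogonality_no_convergence[OF lim _ \<delta>] quasi_orthogonality_convergence[OF _ \<delta>(1)] lim
    by cases auto
  have "total (l + j) + increment l (l + j) \<le> 1 / (1 - \<delta>) * total l" if "l \<ge> l0" for l j
    using l0[OF that, of j] \<delta> by (simp add: field_simps)
  then show ?thesis unfolding total_def increment_def e_def E_def by blast
qed

end

section \<open>Smooth functions\<close>

lemma grad_eqI:
  assumes "(f has_derivative f') (at x)"
  shows "grad f x $ i = f' (axis i 1)"
  using frechet_derivative_at[OF assms] by (simp add: grad_def)

text \<open>\<open>grad\<close> records the derivative at the unit vectors, which determine it by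
  linearity.\<close>

lemma has_derivative_grad:
  assumes "f differentiable (at x)"
  shows "(f has_derivative (\<lambda>h. grad f x \<bullet> h)) (at x)"
proof -
  have d: "(f has_derivative frechet_derivative f (at x)) (at x)"
    using assms frechet_derivative_works by blast
  then have lin: "linear (frechet_derivative f (at x))"
    by (simp add: has_derivative_linear)
  have "frechet_derivative f (at x) h = grad f x \<bullet> h" for h
  proof -
    have "frechet_derivative f (at x) h = frechet_derivative f (at x) (\<Sum>i\<in>UNIV. h $ i *\<^sub>R axis i 1)"
      using basis_expansion[of h] by (simp add: scalar_mult_eq_scaleR)
    also have "\<dots> = grad f x \<bullet> h"
      by (simp add: linear_sum[OF lin] linear_cmul[OF lin] inner_vec_def grad_def mult.commute)
    finally show ?thesis .
  qed
  then have "frechet_derivative f (at x) = (\<lambda>h. grad f x \<bullet> h)" by auto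
  then show ?thesis using d by simp
qed

lemma grad_add:
  "f differentiable (at x) \<Longrightarrow> g differentiable (at x) \<Longrightarrow>
    grad (\<lambda>x. f x + g x) x = grad f x + grad g x"
  by (subst vec_eq_iff, intro allI, subst grad_eqI[OF has_derivative_add[OF has_derivative_grad has_derivative_grad]])
    (auto simp: inner_axis)

lemma grad_mult:
  "f differentiable (at x) \<Longrightarrow> g differentiable (at x) \<Longrightarrow>
    grad (\<lambda>x. f x * g x) x = f x *\<^sub>R grad g x + g x *\<^sub>R grad f x"
  by (subst vec_eq_iff, intro allI, subst grad_eqI[OF has_derivative_mult[OF has_derivative_grad has_derivative_grad]])
    (auto simp: inner_axis mult.commute)

lemma grad_const: "grad (\<lambda>x. c) x = 0"
  by (subst vec_eq_iff, intro allI, subst grad_eqI[OF has_derivative_const]) auto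

lemma Ck_Suc_D: "Ck (Suc k) f \<Longrightarrow> Ck k f"
proof (induction k arbitrary: f)
  case 0
  then show ?case
    by (simp add: continuous_at_imp_continuous_on differentiable_imp_continuous_within)
qed auto

lemma Ck_const: "Ck k (\<lambda>x. c)"
  by (induction k arbitrary: c) (auto simp: grad_const)

lemma Ck_add: "Ck k f \<Longrightarrow> Ck k g \<Longrightarrow> Ck k (\<lambda>x. f x + g x)"
  by (induction k arbitrary: f g) (auto simp: grad_add intro: continuous_intros)

text \<open>The product rule lowers the order of one factor only, so each undifferentiated factor
  has to be brought down to order \<open>k\<close> by monotonicity in the order.\<close>

lemma Ck_mult: "Ck k f \<Longrightarrow> Ck k g \<Longrightarrow> Ck k (\<lambda>x. f x * g x)"
proof (induction k arbitrary: f g)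
  case 0
  then show ?case by (auto intro: continuous_intros)
next
  case (Suc k)
  then show ?case
    using Ck_Suc_D[of k f] Ck_Suc_D[of k g] by (auto simp: grad_mult intro!: Ck_add)
qed

lemma Ck_coordinate: "Ck k (\<lambda>x::real^'n. x $ i)"
proof (cases k)
  case 0
  then show ?thesis by (simp add: continuous_on_component)
next
  case (Suc k')
  have d: "((\<lambda>x. x $ i) has_derivative (\<lambda>h. h $ i)) (at x)" for x :: "real^'n"
    by (rule bounded_linear_imp_has_derivative) (rule bounded_linear_vec_nth)
  have "grad (\<lambda>x::real^'n. x $ i) x $ j = (if i = j then 1 else 0)" for x j
    using grad_eqI[OF d] by (simp add: axis_def)
  then show ?thesis using d Ck_const by (auto simp: Suc differentiable_def)
qed

lemma Ck_prod: "finite I \<Longrightarrow> (\<And>i. i \<in> I \<Longrightarrow> Ck k (f i)) \<Longrightarrow> Ck k (\<lambda>x. \<Prod>i\<in>I. f i x)"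
  by (induction I rule: finite_induct) (auto intro: Ck_const Ck_mult)

section \<open>Test functions\<close>

lemma test_functionsI:
  assumes "\<And>k. Ck k \<phi>" "compact K" "K \<subseteq> U" "\<And>x. x \<notin> K \<Longrightarrow> \<phi> x = 0"
  shows "\<phi> \<in> test_functions U"
proof -
  have "{x. \<phi> x \<noteq> 0} \<subseteq> K" using assms(4) by auto
  then have "closure {x. \<phi> x \<noteq> 0} \<subseteq> K" using assms(2) by (simp add: closure_minimal compact_imp_closed)
  moreover have "compact (closure {x. \<phi> x \<noteq> 0})"
    using bounded_subset[OF compact_imp_bounded[OF assms(2)] \<open>{x. \<phi> x \<noteq> 0} \<subseteq> K\<close>] by (simp add: compact_closure)
  ultimately show ?thesis using assms by (auto simp: test_functions_def)
qed

lemma test_functions_Ck: "\<phi> \<in> test_functions U \<Longrightarrow> Ck k \<phi>"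
  by (simp add: test_functions_def)

lemma test_functions_differentiable: "\<phi> \<in> test_functions U \<Longrightarrow> \<phi> differentiable (at x)"
  using test_functions_Ck[of \<phi> U 1] by simp

lemma test_functions_continuous: "\<phi> \<in> test_functions U \<Longrightarrow> continuous_on UNIV \<phi>"
  using test_functions_Ck[of \<phi> U 0] by simp

lemma test_functions_support:
  assumes "\<phi> \<in> test_functions U"
  obtains K where "compact K" "K \<subseteq> U" "\<And>x. x \<notin> K \<Longrightarrow> \<phi> x = 0" "\<And>x. x \<notin> K \<Longrightarrow> grad \<phi> x = 0"
proof
  let ?K = "closure {x. \<phi> x \<noteq> 0}"
  show "compact ?K" "?K \<subseteq> U" using assms by (auto simp: test_functions_def)
  show "\<phi> x = 0" if "x \<notin> ?K" for x using that closure_subset[of "{x. \<phi> x \<noteq> 0}"] by auto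
  show "grad \<phi> x = 0" if "x \<notin> ?K" for x
  proof -
    have "((\<lambda>x. 0) has_derivative (\<lambda>h. 0)) (at x)" by simp
    then have "(\<phi> has_derivative (\<lambda>h. 0)) (at x)"
      by (rule has_derivative_transform_within_open[where s = "- ?K"])
        (use that closure_subset[of "{x. \<phi> x \<noteq> 0}"] in \<open>auto simp: open_Compl\<close>)
    then show ?thesis by (subst vec_eq_iff) (simp add: grad_eqI)
  qed
qed

lemma test_functions_outside: "\<phi> \<in> test_functions U \<Longrightarrow> x \<notin> U \<Longrightarrow> \<phi> x = 0"
  by (erule test_functions_support) blast

lemma test_functions_grad_outside: "\<phi> \<in> test_functions U \<Longrightarrow> x \<notin> U \<Longrightarrow> grad \<phi> x = 0"
  by (erule test_functions_support) blast

lemma test_functions_grad: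
  assumes "\<phi> \<in> test_functions U"
  shows "(\<lambda>x. grad \<phi> x $ i) \<in> test_functions U"
proof -
  obtain K where K: "compact K" "K \<subseteq> U" "\<And>x. x \<notin> K \<Longrightarrow> grad \<phi> x = 0"
    using test_functions_support[OF assms] by metis
  have "Ck k (\<lambda>x. grad \<phi> x $ i)" for k using test_functions_Ck[OF assms, of "Suc k"] by simp
  then show ?thesis by (rule test_functionsI[OF _ K(1,2)]) (simp add: K(3))
qed

lemma test_functions_add:
  assumes "\<phi> \<in> test_functions U" "\<psi> \<in> test_functions U"
  shows "(\<lambda>x. \<phi> x + \<psi> x) \<in> test_functions U"
proof -
  obtain K where K: "compact K" "K \<subseteq> U" "\<And>x. x \<notin> K \<Longrightarrow> \<phi> x = 0"
    using test_functions_support[OF assms(1)] by metis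
  obtain L where L: "compact L" "L \<subseteq> U" "\<And>x. x \<notin> L \<Longrightarrow> \<psi> x = 0"
    using test_functions_support[OF assms(2)] by metis
  show ?thesis
    by (rule test_functionsI[of _ "K \<union> L"])
      (use K L assms in \<open>auto intro: Ck_add test_functions_Ck\<close>)
qed

lemma test_functions_mult:
  assumes "\<phi> \<in> test_functions U" "\<And>k. Ck k \<psi>"
  shows "(\<lambda>x. \<psi> x * \<phi> x) \<in> test_functions U"
proof -
  obtain K where K: "compact K" "K \<subseteq> U" "\<And>x. x \<notin> K \<Longrightarrow> \<phi> x = 0"
    using test_functions_support[OF assms(1)] by metis
  show ?thesis
    by (rule test_functionsI[OF _ K(1,2)]) (use K assms in \<open>auto intro: Ck_mult test_functions_Ck\<close>)
qed

lemma test_functions_scale: "\<phi> \<in> test_functions U \<Longrightarrow> (\<lambda>x. c * \<phi> x) \<in> test_functions U"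
  by (rule test_functions_mult[OF _ Ck_const])

lemma test_functions_bounded:
  assumes "\<phi> \<in> test_functions U"
  obtains C where "C > 0" "\<And>x. \<bar>\<phi> x\<bar> \<le> C"
proof -
  obtain K where K: "compact K" "\<And>x. x \<notin> K \<Longrightarrow> \<phi> x = 0"
    using test_functions_support[OF assms] by metis
  have "compact (\<phi> ` K)"
    by (intro compact_continuous_image K(1) continuous_on_subset[OF test_functions_continuous[OF assms]]) simp
  then obtain B where "\<forall>y\<in>\<phi> ` K. norm y \<le> B"
    using compact_imp_bounded bounded_iff by blast
  then have B: "norm (\<phi> x) \<le> B" if "x \<in> K" for x using that by blast
  have "\<bar>\<phi> x\<bar> \<le> max 1 B" for x
    using B[of x] K(2)[of x] by (cases "x \<in> K") auto
  then show ?thesis using that[of "max 1 B"] by auto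
qed

lemma test_functions_measurable:
  assumes "\<phi> \<in> test_functions U"
  shows "\<phi> \<in> borel_measurable borel" "grad \<phi> \<in> borel_measurable borel"
proof -
  show "\<phi> \<in> borel_measurable borel"
    using test_functions_continuous[OF assms] by (rule borel_measurable_continuous_onI)
  have "continuous_on UNIV (\<lambda>x. grad \<phi> x $ i)" for i
    using test_functions_continuous[OF test_functions_grad[OF assms]] .
  then have "continuous_on UNIV (\<lambda>x. \<chi> i. grad \<phi> x $ i)" by (rule continuous_on_vec_lambda)
  then have "continuous_on UNIV (grad \<phi>)" by simp
  then show "grad \<phi> \<in> borel_measurable borel" by (rule borel_measurable_continuous_onI)
qed

lemma test_functions_grad_bounded:
  assumes "\<phi> \<in> test_functions U"
  obtains C where "C > 0" "\<And>x. norm (grad \<phi> x) \<le> C"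
proof -
  have "\<exists>C. \<forall>x. \<bar>grad \<phi> x $ i\<bar> \<le> C" for i
    using test_functions_bounded[OF test_functions_grad[OF assms, of i]] by metis
  then obtain C where C: "\<And>i x. \<bar>grad \<phi> x $ i\<bar> \<le> C i" by metis
  have "norm (grad \<phi> x) \<le> sum C UNIV" for x
    using norm_le_l1_cart[of "grad \<phi> x"] sum_mono[of UNIV "\<lambda>i. \<bar>grad \<phi> x $ i\<bar>" C] C by fastforce
  then have "norm (grad \<phi> x) \<le> max 1 (sum C UNIV)" for x by (simp add: le_max_iff_disj)
  then show ?thesis using that[of "max 1 (sum C UNIV)"] by auto
qed

section \<open>Bump functions\<close>

text \<open>The negative powers close the family under differentiation up to linear combinations, so
  that all orders of smoothness follow from one induction; \<open>bump 0\<close> is the standard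
  smooth function vanishing on the negative half-line.\<close>

definition bump :: "nat \<Rightarrow> real \<Rightarrow> real" where
  "bump n t = (if t > 0 then exp (- 1 / t) / t ^ n else 0)"

lemma bump_tendsto_0: "(bump n \<longlongrightarrow> 0) (at 0)"
proof -
  have "((\<lambda>x. inverse x ^ n / exp (inverse x)) \<longlongrightarrow> (0::real)) (at_right 0)"
    by (rule filterlim_compose[OF tendsto_power_div_exp_0 filterlim_inverse_at_top_right])
  moreover have "\<forall>\<^sub>F x in at_right 0. inverse x ^ n / exp (inverse x) = bump n x"
    by (rule eventually_mono[OF eventually_at_right_less[of 0]])
      (simp add: bump_def exp_minus field_simps)
  ultimately have "(bump n \<longlongrightarrow> 0) (at_right 0)" by (rule Lim_transform_eventually)
  moreover have "(bump n \<longlongrightarrow> 0) (at_left 0)"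
    by (rule Lim_transform_eventually[OF tendsto_const])
      (auto simp: bump_def eventually_at_filter)
  ultimately show ?thesis by (simp add: filterlim_split_at)
qed

lemma bump_deriv: "(bump n has_real_derivative bump (n + 2) t - real n * bump (n + 1) t) (at t)"
proof (cases t "0 :: real" rule: linorder_cases)
  case less
  have "((\<lambda>t. 0) has_real_derivative 0) (at t)" by simp
  then have "(bump n has_real_derivative 0) (at t)"
    by (rule has_field_derivative_transform_within_open[where S = "{..<0}"])
      (use less in \<open>auto simp: bump_def\<close>)
  then show ?thesis using less by (simp add: bump_def)
next
  case greater
  have "((\<lambda>t. exp (- 1 / t) / t ^ n) has_real_derivative bump (n + 2) t - real n * bump (n + 1) t) (at t)"
  proof -
    have e: "((\<lambda>t. exp (- 1 / t)) has_real_derivative exp (- 1 / t) * inverse t ^ 2) (at t)"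
      using greater by (auto intro!: derivative_eq_intros simp: power2_eq_square inverse_eq_divide)
    have i: "((\<lambda>t. inverse t ^ n) has_real_derivative - real n * inverse t ^ (n + 1)) (at t)"
      using DERIV_power[OF DERIV_inverse[of t UNIV], of n] greater
      by (cases n) (simp_all add: power2_eq_square algebra_simps)
    have "exp (- 1 / t) * (- real n * inverse t ^ (n + 1)) + exp (- 1 / t) * inverse t ^ 2 * inverse t ^ n
        = bump (n + 2) t - real n * bump (n + 1) t"
      using greater by (simp add: bump_def divide_inverse power_add power2_eq_square power_inverse algebra_simps)
    moreover have "(\<lambda>t::real. exp (- 1 / t) / t ^ n) = (\<lambda>t. exp (- 1 / t) * inverse t ^ n)"
      by (rule ext) (simp only: divide_inverse power_inverse)
    ultimately show ?thesis using DERIV_mult[OF e i] by (simp add: mult_ac)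
  qed
  then show ?thesis
    by (rule has_field_derivative_transform_within_open[where S = "{0<..}"])
      (use greater in \<open>auto simp: bump_def\<close>)
next
  case equal
  \<comment> \<open>At 0 the difference quotient of \<open>bump n\<close> is
    \<open>bump (n + 1)\<close>, which tends to 0.\<close>
  have "((\<lambda>h. (bump n (0 + h) - bump n 0) / h) \<longlongrightarrow> 0) (at 0)"
    by (rule Lim_transform_eventually[OF bump_tendsto_0[of "n + 1"]])
      (auto simp: bump_def eventually_at_filter field_simps)
  then have "(bump n has_real_derivative 0) (at 0)" by (simp add: DERIV_def)
  then show ?thesis using equal by (simp add: bump_def)
qed

text \<open>The induction over the order treats all \<open>n\<close> at once, because
  differentiation raises \<open>n\<close>.\<close>

lemma Ck_bump_compose:
  assumes "\<And>k. Ck k p"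
  shows "Ck k (\<lambda>x. bump n (p x))"
proof (induction k arbitrary: n)
  case 0
  have "continuous_on UNIV (bump n)"
    using bump_deriv DERIV_isCont continuous_at_imp_continuous_on by blast
  moreover have "continuous_on UNIV p" using assms[of 0] by simp
  ultimately show ?case
    using continuous_on_compose2[of UNIV "bump n" UNIV p] by simp
next
  case (Suc k)
  have p: "p differentiable (at x)" for x using assms[of 1] by simp
  have d: "((\<lambda>x. bump n (p x)) has_derivative
      (\<lambda>h. (grad p x \<bullet> h) * (bump (n + 2) (p x) - real n * bump (n + 1) (p x)))) (at x)" for x
    by (rule has_derivative_eq_rhs, rule DERIV_compose_FDERIV[OF bump_deriv has_derivative_grad[OF p]]) simp
  have g: "grad (\<lambda>x. bump n (p x)) x $ i
      = grad p x $ i * (bump (n + 2) (p x) + - real n * bump (n + 1) (p x))" for x i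
    using grad_eqI[OF d] by (simp add: inner_axis)
  have "Ck k (\<lambda>x. grad p x $ i)" for i using assms[of "Suc k"] by simp
  then have "Ck k (\<lambda>x. grad (\<lambda>x. bump n (p x)) x $ i)" for i
    unfolding g by (intro Ck_mult Ck_add Ck_const Suc.IH)
  then show ?case using d by (auto simp: differentiable_def)
qed

text \<open>The shift by one makes the support a compact subset of the open box.\<close>

definition box_bump :: "real^'d \<Rightarrow> real^'d \<Rightarrow> nat \<Rightarrow> real^'d \<Rightarrow> real" where
  "box_bump a b j x = (\<Prod>i\<in>UNIV. bump 0 (real j * ((x $ i - a $ i) * (b $ i - x $ i)) - 1))"

lemma bump_0_bounds: "0 \<le> bump 0 t" "bump 0 t \<le> 1"
  by (auto simp: bump_def)

lemma box_bump_bounds: "0 \<le> box_bump a b j x" "box_bump a b j x \<le> 1"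
  unfolding box_bump_def by (auto intro!: prod_nonneg prod_le_1 bump_0_bounds)

text \<open>Two negative factors would force b < x < a.\<close>

lemma in_interval_of_mult_pos:
  fixes a b x :: real
  assumes "0 < (x - a) * (b - x)" "a < b"
  shows "a < x \<and> x < b"
proof -
  consider "0 < x - a" "0 < b - x" | "x - a < 0" "b - x < 0"
    using assms(1) by (auto simp: zero_less_mult_iff)
  then show ?thesis using assms(2) by cases linarith+
qed

lemma box_bump_test_function:
  fixes a b :: "real^'d"
  assumes "\<And>i. a $ i < b $ i" "box a b \<subseteq> U"
  shows "box_bump a b j \<in> test_functions U"
proof -
  let ?K = "{x. \<forall>i. 1 \<le> real j * ((x $ i - a $ i) * (b $ i - x $ i))}"
  have box: "?K \<subseteq> box a b"
  proof
    fix x assume x: "x \<in> ?K"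
    have "a $ i < x $ i \<and> x $ i < b $ i" for i
    proof (rule in_interval_of_mult_pos[OF _ assms(1)])
      have "1 \<le> real j * ((x $ i - a $ i) * (b $ i - x $ i))" using x by simp
      then show "0 < (x $ i - a $ i) * (b $ i - x $ i)"
        by (smt (verit) mult_nonneg_nonpos of_nat_0_le_iff)
    qed
    then show "x \<in> box a b" by (simp add: mem_box_cart)
  qed
  have "closed ?K"
    by (intro closed_Collect_all closed_Collect_le continuous_intros)
  then have K: "compact ?K"
    using bounded_subset[OF bounded_box box] by (simp add: compact_eq_bounded_closed)
  show ?thesis
  proof (rule test_functionsI[OF _ K])
    show "?K \<subseteq> U" using box assms(2) by blast
    show "Ck k (box_bump a b j)" for k
      unfolding box_bump_def[abs_def]
    proof (rule Ck_prod[OF finite], rule Ck_bump_compose)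
      fix i k
      have "Ck k (\<lambda>x::real^'d. real j * ((x $ i + - a $ i) * (b $ i + - 1 * x $ i)) + - 1)"
        by (intro Ck_mult Ck_add Ck_const Ck_coordinate)
      then show "Ck k (\<lambda>x::real^'d. real j * ((x $ i - a $ i) * (b $ i - x $ i)) - 1)" by simp
    qed
    show "box_bump a b j x = 0" if "x \<notin> ?K" for x
    proof -
      have "\<exists>i. \<not> 1 \<le> real j * ((x $ i - a $ i) * (b $ i - x $ i))" using that by simp
      then obtain i where "\<not> 1 \<le> real j * ((x $ i - a $ i) * (b $ i - x $ i))" by blast
      then have "bump 0 (real j * ((x $ i - a $ i) * (b $ i - x $ i)) - 1) = 0" by (simp add: bump_def)
      then show ?thesis unfolding box_bump_def by (intro prod_zero) auto
    qed
  qed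
qed

lemma box_bump_limit:
  fixes a b x :: "real^'d"
  assumes "\<And>i. a $ i < b $ i"
  shows "(\<lambda>j. box_bump a b j x) \<longlonglongrightarrow> indicator (box a b) x"
proof (cases "x \<in> box a b")
  case True
  have "(\<lambda>j. bump 0 (real j * ((x $ i - a $ i) * (b $ i - x $ i)) - 1)) \<longlonglongrightarrow> 1" for i
  proof -
    define c where "c = (x $ i - a $ i) * (b $ i - x $ i)"
    have c: "c > 0" using True by (auto simp: c_def mem_box_cart)
    have lim: "filterlim (\<lambda>j. real j * c - 1) at_top sequentially"
      using filterlim_tendsto_add_at_top[OF tendsto_const[of "- 1"]
          filterlim_at_top_mult_tendsto_pos[OF tendsto_const[of c] c filterlim_real_sequentially]]
      by (simp add: mult.commute)
    have "(\<lambda>j. exp (- inverse (real j * c - 1))) \<longlonglongrightarrow> exp (- 0)"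
      by (intro tendsto_exp tendsto_minus tendsto_inverse_0_at_top lim)
    moreover have "\<forall>\<^sub>F j in sequentially. exp (- inverse (real j * c - 1)) = bump 0 (real j * c - 1)"
      by (rule eventually_mono[OF filterlim_at_top_dense[THEN iffD1, OF lim, rule_format, of 0]])
        (simp add: bump_def inverse_eq_divide)
    ultimately show ?thesis unfolding c_def[symmetric] by (simp add: Lim_transform_eventually)
  qed
  note lim = this
  have "(\<lambda>j. box_bump a b j x) \<longlonglongrightarrow> (\<Prod>i\<in>(UNIV::'d set). 1)"
    unfolding box_bump_def by (rule tendsto_prod) (rule lim)
  then show ?thesis using True by simp
next
  case False
  have "box_bump a b j x = 0" for j
  proof (rule test_functions_outside)
    show "box_bump a b j \<in> test_functions (box a b)" by (rule box_bump_test_function[OF assms order_refl])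
  qed (rule False)
  then show ?thesis using False by simp
qed

section \<open>Square integrable functions\<close>

lemma Lp2_iff:
  "f \<in> Lp 2 M \<longleftrightarrow> f \<in> borel_measurable M \<and> integrable M (\<lambda>x. (norm (f x))\<^sup>2)"
  unfolding Lp_def by (simp add: powr_numeral)

lemma Lp2_measurable: "f \<in> Lp 2 M \<Longrightarrow> f \<in> borel_measurable M"
  and Lp2_integrable_square: "f \<in> Lp 2 M \<Longrightarrow> integrable M (\<lambda>x. (norm (f x))\<^sup>2)"
  by (auto simp: Lp2_iff)

lemma norm_add_square_le:
  fixes x y :: "'a::real_normed_vector"
  shows "(norm (x + y))\<^sup>2 \<le> 2 * (norm x)\<^sup>2 + 2 * (norm y)\<^sup>2"
proof -
  have "(norm (x + y))\<^sup>2 \<le> (norm x + norm y)\<^sup>2" by (intro power_mono norm_triangle_ineq) simp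
  also have "\<dots> \<le> 2 * (norm x)\<^sup>2 + 2 * (norm y)\<^sup>2"
    using sum_squares_bound[of "norm x" "norm y"] by (simp add: power2_sum)
  finally show ?thesis .
qed

lemma Lp2_add:
  assumes f: "f \<in> Lp 2 M" and g: "g \<in> Lp 2 M"
  shows "(\<lambda>x. f x + g x) \<in> Lp 2 M"
    and "(LINT x|M. (norm (f x + g x))\<^sup>2) \<le> 2 * (LINT x|M. (norm (f x))\<^sup>2) + 2 * (LINT x|M. (norm (g x))\<^sup>2)"
proof -
  have [measurable]: "f \<in> borel_measurable M" "g \<in> borel_measurable M"
    and i[simp]: "integrable M (\<lambda>x. (norm (f x))\<^sup>2)" "integrable M (\<lambda>x. (norm (g x))\<^sup>2)"
    using f g by (auto simp: Lp2_iff)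
  have int: "integrable M (\<lambda>x. (norm (f x + g x))\<^sup>2)"
    by (rule Bochner_Integration.integrable_bound[of M "\<lambda>x. 2 * (norm (f x))\<^sup>2 + 2 * (norm (g x))\<^sup>2"])
      (use norm_add_square_le in auto)
  then show "(\<lambda>x. f x + g x) \<in> Lp 2 M" by (simp add: Lp2_iff)
  have "(LINT x|M. (norm (f x + g x))\<^sup>2) \<le> (LINT x|M. 2 * (norm (f x))\<^sup>2 + 2 * (norm (g x))\<^sup>2)"
    by (intro integral_mono int norm_add_square_le) simp
  then show "(LINT x|M. (norm (f x + g x))\<^sup>2) \<le> 2 * (LINT x|M. (norm (f x))\<^sup>2) + 2 * (LINT x|M. (norm (g x))\<^sup>2)"
    by simp
qed

lemma Lp2_scale:
  assumes f: "f \<in> Lp 2 M"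
  shows "(\<lambda>x. c *\<^sub>R f x) \<in> Lp 2 M"
  using assms by (auto simp: Lp2_iff power_mult_distrib)

lemma Lp2_scale_real: "f \<in> Lp 2 M \<Longrightarrow> (\<lambda>x. c * f x :: real) \<in> Lp 2 M"
  using Lp2_scale[of f M c] by simp

lemma Lp2_diff: "f \<in> Lp 2 M \<Longrightarrow> g \<in> Lp 2 M \<Longrightarrow> (\<lambda>x. f x - g x) \<in> Lp 2 M"
  using Lp2_add(1)[of f M "\<lambda>x. (- 1) *\<^sub>R g x"] Lp2_scale[of g M "- 1"] by simp

lemma Lp2_inner:
  assumes f: "f \<in> Lp 2 M" and g: "g \<in> Lp 2 M"
  shows "integrable M (\<lambda>x. f x \<bullet> g x)"
proof -
  have [measurable]: "f \<in> borel_measurable M" "g \<in> borel_measurable M"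
    and i[simp]: "integrable M (\<lambda>x. (norm (f x))\<^sup>2)" "integrable M (\<lambda>x. (norm (g x))\<^sup>2)"
    using f g by (auto simp: Lp2_iff)
  have "\<bar>f x \<bullet> g x\<bar> \<le> (norm (f x))\<^sup>2 + (norm (g x))\<^sup>2" for x
  proof -
    have "\<bar>f x \<bullet> g x\<bar> \<le> norm (f x) * norm (g x)" by (rule Cauchy_Schwarz_ineq2)
    also have "\<dots> \<le> 2 * norm (f x) * norm (g x)" by simp
    also have "\<dots> \<le> (norm (f x))\<^sup>2 + (norm (g x))\<^sup>2" by (rule sum_squares_bound)
    finally show ?thesis .
  qed
  then have "AE x in M. norm (f x \<bullet> g x) \<le> norm ((norm (f x))\<^sup>2 + (norm (g x))\<^sup>2)" by simp
  moreover have "integrable M (\<lambda>x. (norm (f x))\<^sup>2 + (norm (g x))\<^sup>2)" by simp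
  ultimately show ?thesis
    by (rule Bochner_Integration.integrable_bound[rotated 2]) measurable
qed

lemma Lp2_mult:
  fixes f g :: "'a \<Rightarrow> real"
  shows "f \<in> Lp 2 M \<Longrightarrow> g \<in> Lp 2 M \<Longrightarrow> integrable M (\<lambda>x. f x * g x)"
  using Lp2_inner[of f M g] by simp

lemma Lp2_component:
  fixes G :: "'a \<Rightarrow> real^'d"
  assumes "G \<in> Lp 2 M"
  shows "(\<lambda>x. G x $ i) \<in> Lp 2 M"
proof -
  have [measurable]: "G \<in> borel_measurable M" and i: "integrable M (\<lambda>x. (norm (G x))\<^sup>2)"
    using assms by (auto simp: Lp2_iff)
  have "(\<lambda>y::real^'d. y $ i) \<in> borel_measurable borel"
    by (intro borel_measurable_continuous_onI continuous_on_component continuous_on_id)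
  from measurable_compose[OF Lp2_measurable[OF assms] this]
  have [measurable]: "(\<lambda>x. G x $ i) \<in> borel_measurable M" .
  have "integrable M (\<lambda>x. (norm (G x $ i))\<^sup>2)"
  proof (rule Bochner_Integration.integrable_bound[OF i])
    show "AE x in M. norm ((norm (G x $ i))\<^sup>2) \<le> norm ((norm (G x))\<^sup>2)"
    proof (rule AE_I2)
      fix x show "norm ((norm (G x $ i))\<^sup>2) \<le> norm ((norm (G x))\<^sup>2)"
        using power_mono[OF component_le_norm_cart[of "G x" i], of 2] by simp
    qed
  qed measurable
  then show ?thesis by (simp add: Lp2_iff)
qed

lemma (in finite_measure) Lp2_bounded:
  assumes "f \<in> borel_measurable M" "\<And>x. norm (f x) \<le> C"
  shows "f \<in> Lp 2 M"
  unfolding Lp2_iff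
  by (intro conjI assms(1) integrable_const_bound[of _ "C\<^sup>2"])
    (use assms in \<open>auto intro!: AE_I2 power_mono\<close>)

lemma (in finite_measure) Lp2_integrable:
  fixes f :: "'a \<Rightarrow> real"
  assumes "f \<in> Lp 2 M"
  shows "integrable M f"
  using Lp2_mult[OF assms Lp2_bounded[of "\<lambda>x. 1" 1]] by simp

text \<open>Open boxes generate the Borel sets and are stable under intersection, and the sets on
  which the integral vanishes form a Dynkin system.\<close>

lemma AE_zero_of_box_integrals:
  fixes h' :: "'a::euclidean_space \<Rightarrow> real"
  assumes h'_int: "integrable lborel h'"
    and box0: "\<And>a b. (LINT x|lborel. indicator (box a b) x * h' x) = 0"
  shows "AE x in lborel. h' x = 0"
proof -
  have h': "h' \<in> borel_measurable lborel" using h'_int by simp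
  have int_A: "integrable lborel (\<lambda>x. indicator A x * h' x)" if "A \<in> sets borel" for A
    using integrable_mult_indicator[of A lborel h'] that h'_int by simp
  have all0: "(LINT x|lborel. indicator A x * h' x) = 0" if A: "A \<in> sets borel" for A
  proof -
    have "Int_stable (range (\<lambda>(a, b). box a b :: ('a) set))"
      by (auto simp: Int_stable_def box_Int_box)
    moreover have "(range (\<lambda>(a, b). box a b :: ('a) set)) \<subseteq> Pow UNIV" by auto
    moreover have "A \<in> sigma_sets UNIV (range (\<lambda>(a, b). box a b))"
      using A unfolding borel_eq_box by simp
    ultimately show ?thesis
    proof (induction rule: sigma_sets_induct_disjoint)
      case (basic A)
      then show ?case using box0 by auto
    next
      case empty
      then show ?case by simp
    next
      case (compl A)
      have Ab: "A \<in> sets borel" using compl(1) by (simp add: borel_eq_box)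
      \<comment> \<open>The integral over the whole space, used for complements, is the limit of the
        integrals over growing boxes.\<close>
      have lim: "(\<lambda>k. LINT x|lborel. indicator (box (- real k *\<^sub>R One) (real k *\<^sub>R One)) x * h' x)
          \<longlonglongrightarrow> (LINT x|lborel. h' x)"
      proof (rule integral_dominated_convergence[where w = "\<lambda>x. \<bar>h' x\<bar>"])
        show "AE x in lborel. (\<lambda>k. indicator (box (- real k *\<^sub>R One) (real k *\<^sub>R One)) x * h' x) \<longlonglongrightarrow> h' x"
        proof (rule AE_I2)
          fix x :: "'a"
          obtain N :: nat where N: "norm x < real N" using reals_Archimedean2 by blast
          have "x \<in> box (- real k *\<^sub>R One) (real k *\<^sub>R One)" if "k \<ge> N" for k
          proof -
            have "\<bar>x \<bullet> i\<bar> < real k" if "i \<in> Basis" for i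
              using Basis_le_norm[OF that, of x] N \<open>k \<ge> N\<close> by simp
            then show ?thesis by (auto simp: mem_box abs_less_iff) (smt (verit))+
          qed
          then have "\<forall>\<^sub>F k in sequentially. h' x = indicator (box (- real k *\<^sub>R One) (real k *\<^sub>R One)) x * h' x"
            unfolding eventually_sequentially by (intro exI[of _ N]) simp
          then show "(\<lambda>k. indicator (box (- real k *\<^sub>R One) (real k *\<^sub>R One)) x * h' x) \<longlonglongrightarrow> h' x"
            by (rule Lim_transform_eventually[OF tendsto_const])
        qed
      qed (use h'_int h' in \<open>auto simp: indicator_def\<close>)
      then have tot: "(LINT x|lborel. h' x) = 0" unfolding box0 by (simp add: LIMSEQ_const_iff)
      have "(LINT x|lborel. indicator (UNIV - A) x * h' x) = (LINT x|lborel. h' x - indicator A x * h' x)"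
        by (intro Bochner_Integration.integral_cong) (auto simp: indicator_def)
      also have "\<dots> = (LINT x|lborel. h' x) - (LINT x|lborel. indicator A x * h' x)"
        by (rule Bochner_Integration.integral_diff[OF h'_int int_A[OF Ab]])
      finally show ?case using tot compl by simp
    next
      case (union A)
      have Ab: "A i \<in> sets borel" for i using union(2) by (auto simp: borel_eq_box)
      have "(\<lambda>i. LINT x|lborel. indicator (\<Union>j<i. A j) x * h' x) \<longlonglongrightarrow> (LINT x|lborel. indicator (\<Union>i. A i) x * h' x)"
      proof (rule integral_dominated_convergence[where w = "\<lambda>x. \<bar>h' x\<bar>"])
        show "AE x in lborel. (\<lambda>i. indicator (\<Union>j<i. A j) x * h' x) \<longlonglongrightarrow> indicator (\<Union>i. A i) x * h' x"
          by (intro AE_I2 tendsto_mult tendsto_const LIMSEQ_indicator_UN)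
      qed (use h'_int h' Ab in \<open>auto simp: indicator_def\<close>)
      moreover have "(LINT x|lborel. indicator (\<Union>j<i. A j) x * h' x) = 0" for i
      proof -
        have "indicator (\<Union>j<i. A j) x * h' x = (\<Sum>j<i. indicator (A j) x * h' x)" for x
        proof -
          have "indicat_real (\<Union>j<i. A j) x = (\<Sum>j<i. indicat_real (A j) x)"
            by (rule indicator_UN_disjoint) (use union(1) in \<open>auto simp: disjoint_family_on_def\<close>)
          then show ?thesis by (simp only: sum_distrib_right)
        qed
        note eq = this
        have "(LINT x|lborel. indicator (\<Union>j<i. A j) x * h' x)
            = (\<Sum>j<i. LINT x|lborel. indicator (A j) x * h' x)"
          unfolding eq by (rule Bochner_Integration.integral_sum) (rule int_A[OF Ab])
        then show ?thesis using union(3) by simp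
      qed
      ultimately show ?case by (simp add: LIMSEQ_const_iff)
    qed
  qed
  show "AE x in lborel. h' x = 0"
  proof (rule sigma_finite_measure.density_zero[OF lborel.sigma_finite_measure_axioms h'_int])
    fix A :: "('a) set" assume "A \<in> sets lborel"
    then show "set_lebesgue_integral lborel A h' = 0"
      using all0[of A] by (simp add: set_lebesgue_integral_def)
  qed
qed

section \<open>Weak gradients on bounded open sets\<close>

locale bounded_open =
  fixes U :: "(real^'d) set"
  assumes open_U: "open U" and bounded_U: "bounded U"
begin

abbreviation M :: "(real^'d) measure" where "M \<equiv> lebesgue_on U"

lemma U_borel[measurable]: "U \<in> sets borel"
  using open_U by simp

lemma U_lebesgue: "U \<in> sets lebesgue"
  using U_borel by simp

lemma finite_measure_M: "finite_measure M"
  using lmeasurable_open[OF bounded_U open_U] by (rule finite_measure_lebesgue_on)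

sublocale finite_measure M
  by (rule finite_measure_M)

lemma borel_imp_M: "f \<in> borel_measurable borel \<Longrightarrow> f \<in> borel_measurable M"
  by (intro measurable_restrict_space1 measurable_completion) simp

text \<open>\<open>M\<close> restricts the completed measure, whereas Fubini's theorem and affine
  substitutions are carried out with \<open>lborel\<close>. Borel functions that vanish outside
  \<open>U\<close> can be moved between the two.\<close>

lemma integral_M_eq_lborel:
  fixes f :: "real^'d \<Rightarrow> real"
  assumes f: "f \<in> borel_measurable borel" and out: "\<And>x. x \<notin> U \<Longrightarrow> f x = 0"
  shows "(LINT x|M. f x) = (LINT x|lborel. f x)"
    and "integrable M f \<longleftrightarrow> integrable lborel f"
proof -
  have eq: "(\<lambda>x. indicat_real U x *\<^sub>R f x) = f" using out by (auto simp: indicator_def fun_eq_iff)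
  have fl: "f \<in> borel_measurable lborel" using f by simp
  show "(LINT x|M. f x) = (LINT x|lborel. f x)"
    using integral_restrict_space[of U lebesgue f] U_lebesgue eq integral_completion[OF fl] by simp
  show "integrable M f \<longleftrightarrow> integrable lborel f"
    using integrable_restrict_space[of U lebesgue f] U_lebesgue eq integrable_completion[OF fl] by simp
qed

lemma test_Lp2:
  assumes "\<phi> \<in> test_functions U"
  shows "\<phi> \<in> Lp 2 M" "grad \<phi> \<in> Lp 2 M"
proof -
  obtain C where "\<And>x. \<bar>\<phi> x\<bar> \<le> C" using test_functions_bounded[OF assms] by metis
  then show "\<phi> \<in> Lp 2 M"
    by (intro Lp2_bounded[of _ C] borel_imp_M test_functions_measurable[OF assms]) simp
  obtain C where "\<And>x. norm (grad \<phi> x) \<le> C" using test_functions_grad_bounded[OF assms] by metis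
  then show "grad \<phi> \<in> Lp 2 M"
    by (intro Lp2_bounded[of _ C] borel_imp_M test_functions_measurable[OF assms])
qed

text \<open>Smooth bumps supported in the box are bounded by 1 and converge to its indicator, so
  dominated convergence extends the hypothesis from test functions to boxes.\<close>

lemma box_integral_zero:
  fixes g :: "real^'d \<Rightarrow> real"
  assumes g: "integrable M g" and zero: "\<And>\<phi>. \<phi> \<in> test_functions U \<Longrightarrow> (LINT x|M. g x * \<phi> x) = 0"
    and box: "box a b \<subseteq> U"
  shows "(LINT x|M. g x * indicator (box a b) x) = 0"
proof (cases "\<forall>i. a $ i < b $ i")
  case True
  have gm[measurable]: "g \<in> borel_measurable M" using g by simp
  have t: "box_bump a b j \<in> test_functions U" for j
    using box_bump_test_function[OF _ box] True by blast
  note [measurable] = borel_imp_M[OF test_functions_measurable(1)[OF t]]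
  have [measurable]: "(\<lambda>x. indicat_real (box a b) x) \<in> borel_measurable M"
    by (rule borel_imp_M) measurable
  have "(\<lambda>j. LINT x|M. g x * box_bump a b j x) \<longlonglongrightarrow> (LINT x|M. g x * indicator (box a b) x)"
  proof (rule integral_dominated_convergence[where w = "\<lambda>x. \<bar>g x\<bar>"])
    show "AE x in M. (\<lambda>j. g x * box_bump a b j x) \<longlonglongrightarrow> g x * indicator (box a b) x"
      using True by (intro AE_I2 tendsto_mult tendsto_const box_bump_limit) blast
    show "AE x in M. norm (g x * box_bump a b j x) \<le> \<bar>g x\<bar>" for j
      using box_bump_bounds[of a b j] by (intro AE_I2) (simp add: abs_mult mult_left_le)
  qed (use g in auto)
  then have "(\<lambda>j. 0) \<longlonglongrightarrow> (LINT x|M. g x * indicator (box a b) x)"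
    using zero[OF t] by simp
  then show ?thesis by (simp add: LIMSEQ_const_iff)
next
  case False
  then obtain i where "\<not> a $ i < b $ i" by blast
  then have "x \<notin> box a b" for x unfolding mem_box_cart using less_trans by blast
  then have "box a b = {}" by blast
  then show ?thesis by simp
qed

text \<open>\<open>U\<close> is a countable union of open boxes, and on each of them the integrals
  over all smaller boxes vanish. As \<open>g\<close> is only Lebesgue measurable, the argument with
  boxes is applied to a Borel function equal to it almost everywhere.\<close>

lemma fundamental_lemma:
  fixes g :: "real^'d \<Rightarrow> real"
  assumes g: "integrable M g" and zero: "\<And>\<phi>. \<phi> \<in> test_functions U \<Longrightarrow> (LINT x|M. g x * \<phi> x) = 0"
  shows "AE x in M. g x = 0"
proof -
  have on_box: "AE x in lebesgue. x \<in> box c d \<longrightarrow> g x = 0" if cd: "box c d \<subseteq> U" for c d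
  proof -
    define h where "h x = indicator (box c d) x * g x" for x
    have "integrable lebesgue (\<lambda>x. indicator U x *\<^sub>R g x)"
      using g integrable_restrict_space[of U lebesgue g] U_lebesgue by simp
    then have "integrable lebesgue (\<lambda>x. indicator (box c d) x *\<^sub>R (indicator U x *\<^sub>R g x))"
      by (rule integrable_mult_indicator[rotated]) simp
    also have "(\<lambda>x. indicator (box c d) x *\<^sub>R (indicator U x *\<^sub>R g x)) = h"
      using cd by (auto simp: h_def indicator_def fun_eq_iff)
    finally have h: "integrable lebesgue h" .
    then obtain h' where h': "h' \<in> borel_measurable lborel" and ae: "AE x in lborel. h x = h' x"
      using completion_ex_borel_measurable_real[of h lborel] by auto
    have ae': "AE x in lebesgue. h x = h' x" using ae by (rule AE_completion)
    have hm': "h' \<in> borel_measurable lebesgue" using h' by (rule measurable_completion)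
    have "integrable lebesgue h'"
      using integrable_cong_AE[of h lebesgue h'] h hm' ae' by auto
    then have h'_int: "integrable lborel h'" using h' by (simp add: integrable_completion)
    have box0: "(LINT x|lborel. indicator (box a b) x * h' x) = 0" for a b
    proof -
      obtain a' b' where ab: "box a b \<inter> box c d = box a' b'" by (rule that, rule box_Int_box)
      have "(LINT x|lborel. indicator (box a b) x * h' x) = (LINT x|lebesgue. indicator (box a b) x * h' x)"
        using h' by (intro integral_completion[symmetric]) simp
      also have "\<dots> = (LINT x|lebesgue. indicator (box a b) x * h x)"
      proof (rule integral_cong_AE)
        show "(\<lambda>x. indicat_real (box a b) x * h' x) \<in> borel_measurable lebesgue"
          by (intro borel_measurable_times borel_measurable_indicator hm') simp
        show "(\<lambda>x. indicat_real (box a b) x * h x) \<in> borel_measurable lebesgue"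
          using h by (intro borel_measurable_times borel_measurable_indicator) auto
        show "AE x in lebesgue. indicat_real (box a b) x * h' x = indicator (box a b) x * h x"
          using ae' by eventually_elim simp
      qed
      also have "\<dots> = (LINT x|lebesgue. indicator U x *\<^sub>R (g x * indicator (box a' b') x))"
        using cd unfolding ab[symmetric]
        by (intro Bochner_Integration.integral_cong) (auto simp: h_def indicator_def)
      also have "\<dots> = (LINT x|M. g x * indicator (box a' b') x)"
        using integral_restrict_space[of U lebesgue "\<lambda>x. g x * indicator (box a' b') x"] U_lebesgue by simp
      also have "\<dots> = 0" by (rule box_integral_zero[OF g zero]) (use ab cd in blast)+
      finally show ?thesis .
    qed
    have "AE x in lborel. h' x = 0" by (rule AE_zero_of_box_integrals[OF h'_int box0])
    then have "AE x in lebesgue. h' x = 0" by (rule AE_completion)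
    with ae' show ?thesis
      by eventually_elim (auto simp: h_def indicator_def)
  qed
  obtain \<D> where D: "countable \<D>" "\<D> \<subseteq> Pow U" "\<And>X. X \<in> \<D> \<Longrightarrow> \<exists>a b. X = box a b" "\<Union>\<D> = U"
    using open_countable_Union_open_box[OF open_U] by metis
  have "AE x in lebesgue. \<forall>X\<in>\<D>. x \<in> X \<longrightarrow> g x = 0"
    unfolding AE_ball_countable[OF D(1)] using D(2,3) on_box by (metis PowD subsetD)
  then have "AE x in lebesgue. x \<in> U \<longrightarrow> g x = 0"
    by eventually_elim (use D(4) in blast)
  then show ?thesis using AE_restrict_space_iff[of U lebesgue] U_lebesgue by simp
qed


lemma test_lipschitz:
  assumes \<phi>: "\<phi> \<in> test_functions U"
  obtains L where "L > 0" "\<And>x y. \<bar>\<phi> x - \<phi> y\<bar> \<le> L * norm (x - y)"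
proof -
  obtain L where L: "L > 0" "\<And>x. norm (grad \<phi> x) \<le> L" using test_functions_grad_bounded[OF \<phi>] by metis
  have "norm (\<phi> x - \<phi> y) \<le> L * norm (x - y)" for x y
  proof (rule differentiable_bound[where S = UNIV and f' = "\<lambda>x h. grad \<phi> x \<bullet> h"])
    show "(\<phi> has_derivative (\<lambda>h. grad \<phi> x \<bullet> h)) (at x within UNIV)" for x
      using has_derivative_grad[OF test_functions_differentiable[OF \<phi>]] by simp
    show "onorm (\<lambda>h. grad \<phi> x \<bullet> h) \<le> L" for x
    proof (rule onorm_le)
      fix h
      have "norm (grad \<phi> x \<bullet> h) \<le> norm (grad \<phi> x) * norm h" by (simp add: Cauchy_Schwarz_ineq2)
      also have "\<dots> \<le> L * norm h" by (intro mult_right_mono L) simp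
      finally show "norm (grad \<phi> x \<bullet> h) \<le> L * norm h" .
    qed
  qed auto
  then show ?thesis using that[OF L(1)] by simp
qed

lemma integrable_test: "\<phi> \<in> test_functions U \<Longrightarrow> integrable lborel \<phi>"
  using integral_M_eq_lborel(2)[of \<phi>] Lp2_integrable[OF test_Lp2(1)] test_functions_measurable(1) test_functions_outside
  by blast

text \<open>Translation invariance makes the integrals of the difference quotients vanish.\<close>

lemma integral_partial_derivative:
  assumes \<phi>: "\<phi> \<in> test_functions U"
  shows "(LINT x|M. grad \<phi> x $ i) = 0"
proof -
  let ?e = "axis i 1 :: real^'d"
  define s where "s j x = (\<phi> ((1 / real (Suc j)) *\<^sub>R ?e + x) - \<phi> x) * real (Suc j)" for j x
  obtain L where L: "L > 0" "\<And>x y. \<bar>\<phi> x - \<phi> y\<bar> \<le> L * norm (x - y)" using test_lipschitz[OF \<phi>] by blast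
  obtain r where r: "\<And>x. x \<in> U \<Longrightarrow> norm x \<le> r" using bounded_U bounded_iff by metis
  have [measurable]: "\<phi> \<in> borel_measurable borel" by (rule test_functions_measurable(1)[OF \<phi>])
  have gm: "(\<lambda>x. grad \<phi> x $ i) \<in> borel_measurable borel"
    by (rule test_functions_measurable(1)[OF test_functions_grad[OF \<phi>]])
  have int: "integrable lborel \<phi>" by (rule integrable_test[OF \<phi>])
  have shift: "integrable lborel (\<lambda>x. \<phi> (c + x))" "(LINT x|lborel. \<phi> (c + x)) = (LINT x|lborel. \<phi> x)" for c
    using integrable_distr_eq[of "(+) c" lborel borel \<phi>] integral_distr[of "(+) c" lborel borel \<phi>] int
    by (simp_all add: lborel_distr_plus)
  have zero: "(LINT x|lborel. s j x) = 0" for j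
    unfolding s_def using shift int by simp
  \<comment> \<open>Steps of length at most 1 keep the support of the difference quotient in the
    ball of radius r + 1, and the Lipschitz constant bounds its values.\<close>
  have "(\<lambda>j. LINT x|lborel. s j x) \<longlonglongrightarrow> (LINT x|lborel. grad \<phi> x $ i)"
  proof (rule integral_dominated_convergence[where w = "\<lambda>x. indicator (cball 0 (r + 1)) x * L"])
    show "integrable lborel (\<lambda>x. indicator (cball 0 (r + 1)) x * L :: real)"
      by (intro integrable_mult_left integrable_real_indicator) (simp_all add: emeasure_lborel_cball_finite[unfolded infinity_ennreal_def])
    show "AE x in lborel. (\<lambda>j. s j x) \<longlonglongrightarrow> grad \<phi> x $ i"
    proof (rule AE_I2)
      fix x
      have d1: "(\<phi> has_derivative (\<lambda>h. grad \<phi> x \<bullet> h)) (at (0 *\<^sub>R ?e + x))"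
        using has_derivative_grad[OF test_functions_differentiable[OF \<phi>], of x] by simp
      have d2: "((\<lambda>t. t *\<^sub>R ?e + x) has_derivative (\<lambda>t. t *\<^sub>R ?e)) (at 0)"
        by (auto intro!: derivative_eq_intros)
      have "((\<lambda>t. \<phi> (t *\<^sub>R ?e + x)) has_derivative (\<lambda>t. grad \<phi> x \<bullet> (t *\<^sub>R ?e))) (at 0)"
        by (rule has_derivative_compose[OF d2 d1])
      note d = this
      have "((\<lambda>t. \<phi> (t *\<^sub>R ?e + x)) has_real_derivative grad \<phi> x $ i) (at 0)"
      proof -
        have "(\<lambda>t. grad \<phi> x \<bullet> (t *\<^sub>R ?e)) = (*) (grad \<phi> x $ i)"
          by (auto simp: fun_eq_iff inner_axis mult.commute)
        then show ?thesis using d by (simp only: has_field_derivative_def)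
      qed
      then have lim: "((\<lambda>h. (\<phi> (h *\<^sub>R ?e + x) - \<phi> x) / h) \<longlongrightarrow> grad \<phi> x $ i) (at 0)"
        by (simp add: DERIV_def)
      have "filterlim (\<lambda>j. 1 / real (Suc j)) (at 0) sequentially"
      proof -
        have "(\<lambda>j. 1 / real (Suc j)) \<longlonglongrightarrow> 0" by (rule LIMSEQ_Suc[OF lim_1_over_n])
        then show ?thesis by (simp add: filterlim_at)
      qed
      from filterlim_compose[OF lim this]
      show "(\<lambda>j. s j x) \<longlonglongrightarrow> grad \<phi> x $ i" by (simp add: s_def)
    qed
    show "AE x in lborel. norm (s j x) \<le> indicator (cball 0 (r + 1)) x * L" for j
    proof (rule AE_I2)
      fix x
      let ?t = "1 / real (Suc j)"
      have nt: "norm (?t *\<^sub>R ?e) = ?t" by (simp add: norm_axis_1)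
      show "norm (s j x) \<le> indicator (cball 0 (r + 1)) x * L"
      proof (cases "x \<in> cball 0 (r + 1)")
        case True
        have "\<bar>\<phi> (?t *\<^sub>R ?e + x) - \<phi> x\<bar> \<le> L * ?t" using L(2)[of "?t *\<^sub>R ?e + x" x] nt by simp
        then have "\<bar>\<phi> (?t *\<^sub>R ?e + x) - \<phi> x\<bar> * real (Suc j) \<le> L * ?t * real (Suc j)"
          by (intro mult_right_mono) auto
        then show ?thesis using True by (simp add: s_def abs_mult)
      next
        case False
        then have n: "norm x > r + 1" by simp
        have "norm x \<le> norm (?t *\<^sub>R ?e + x) + ?t"
          using norm_triangle_ineq4[of "?t *\<^sub>R ?e + x" "?t *\<^sub>R ?e"] nt by simp
        moreover have "?t \<le> 1" by simp
        ultimately have "norm x \<le> norm (?t *\<^sub>R ?e + x) + 1" by linarith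
        then have "\<not> norm (?t *\<^sub>R ?e + x) \<le> r" "\<not> norm x \<le> r" using n by linarith+
        then have "x \<notin> U" "?t *\<^sub>R ?e + x \<notin> U" using r by blast+
        then have "s j x = 0" by (simp add: s_def test_functions_outside[OF \<phi>])
        then show ?thesis using L(1) by simp
      qed
    qed
    show "s j \<in> borel_measurable lborel" for j unfolding s_def by measurable
  qed (use gm in simp)
  then have "(LINT x|lborel. grad \<phi> x $ i) = 0" unfolding zero by (simp add: LIMSEQ_const_iff)
  moreover have "(LINT x|M. grad \<phi> x $ i) = (LINT x|lborel. grad \<phi> x $ i)"
    by (rule integral_M_eq_lborel(1)[OF gm]) (simp add: test_functions_grad_outside[OF \<phi>])
  ultimately show ?thesis by simp
qed

text \<open>The derivative of the product of two test functions integrates to 0, which by the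
  product rule is integration by parts.\<close>

lemma test_weak_grad:
  assumes \<phi>: "\<phi> \<in> test_functions U"
  shows "is_weak_grad U \<phi> (grad \<phi>)"
  unfolding is_weak_grad_def
proof (intro ballI allI)
  fix \<psi> and i assume \<psi>: "\<psi> \<in> test_functions U"
  have "grad (\<lambda>x. \<phi> x * \<psi> x) x $ i = \<phi> x * grad \<psi> x $ i + grad \<phi> x $ i * \<psi> x" for x
    by (simp add: grad_mult test_functions_differentiable[OF \<phi>] test_functions_differentiable[OF \<psi>] mult.commute)
  then have "(LINT x|M. \<phi> x * grad \<psi> x $ i + grad \<phi> x $ i * \<psi> x) = 0"
    using integral_partial_derivative[OF test_functions_mult[OF \<psi> test_functions_Ck[OF \<phi>]], of i] by simp
  moreover have "integrable M (\<lambda>x. \<phi> x * grad \<psi> x $ i)" "integrable M (\<lambda>x. grad \<phi> x $ i * \<psi> x)"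
    by (intro Lp2_mult Lp2_component test_Lp2 \<phi> \<psi>)+
  ultimately show "(LINT x|M. \<phi> x * grad \<psi> x $ i) = - (LINT x|M. grad \<phi> x $ i * \<psi> x)"
    by simp
qed

lemma weak_grad_add:
  assumes "v \<in> Lp 2 M" "w \<in> Lp 2 M" "G \<in> Lp 2 M" "H \<in> Lp 2 M" "is_weak_grad U v G" "is_weak_grad U w H"
  shows "is_weak_grad U (\<lambda>x. v x + w x) (\<lambda>x. G x + H x)"
  unfolding is_weak_grad_def
proof (intro ballI allI)
  fix \<phi> and i assume \<phi>: "\<phi> \<in> test_functions U"
  note t = test_Lp2(1)[OF \<phi>] Lp2_component[OF test_Lp2(2)[OF \<phi>], of i]
  have "(LINT x|M. (v x + w x) * grad \<phi> x $ i) = (LINT x|M. v x * grad \<phi> x $ i) + (LINT x|M. w x * grad \<phi> x $ i)"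
    unfolding distrib_right by (intro Bochner_Integration.integral_add Lp2_mult assms t)
  moreover have "(LINT x|M. (G x + H x) $ i * \<phi> x) = (LINT x|M. G x $ i * \<phi> x) + (LINT x|M. H x $ i * \<phi> x)"
    unfolding distrib_right vector_add_component
    by (intro Bochner_Integration.integral_add Lp2_mult Lp2_component assms t)
  ultimately show "(LINT x|M. (v x + w x) * grad \<phi> x $ i) = - (LINT x|M. (G x + H x) $ i * \<phi> x)"
    using assms(5,6) \<phi> by (simp add: is_weak_grad_def)
qed

lemma weak_grad_scale:
  assumes "is_weak_grad U v G"
  shows "is_weak_grad U (\<lambda>x. c * v x) (\<lambda>x. c *\<^sub>R G x)"
  using assms by (simp add: is_weak_grad_def mult.assoc)

text \<open>Makes the choice in \<open>wgrad\<close> immaterial up to null sets; accordingly all its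
  computation rules are stated almost everywhere.\<close>

lemma weak_grad_unique:
  assumes G: "G \<in> Lp 2 M" and H: "H \<in> Lp 2 M" and g: "is_weak_grad U v G" and h: "is_weak_grad U v H"
  shows "AE x in M. G x = H x"
proof -
  have "AE x in M. G x $ i - H x $ i = 0" for i
  proof (rule fundamental_lemma)
    note l = Lp2_component[OF G, of i] Lp2_component[OF H, of i]
    show "integrable M (\<lambda>x. G x $ i - H x $ i)" by (rule Lp2_integrable[OF Lp2_diff[OF l]])
    fix \<phi> assume \<phi>: "\<phi> \<in> test_functions U"
    have "(LINT x|M. (G x $ i - H x $ i) * \<phi> x) = (LINT x|M. G x $ i * \<phi> x) - (LINT x|M. H x $ i * \<phi> x)"
      unfolding left_diff_distrib by (intro Bochner_Integration.integral_diff Lp2_mult l test_Lp2 \<phi>)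
    then show "(LINT x|M. (G x $ i - H x $ i) * \<phi> x) = 0"
      using g h \<phi> unfolding is_weak_grad_def by simp
  qed
  then have "AE x in M. \<forall>i. G x $ i - H x $ i = 0" by (simp add: AE_all_countable)
  then show ?thesis by eventually_elim (simp add: vec_eq_iff)
qed

section \<open>Rules for the chosen weak gradient, valid almost everywhere\<close>

lemma H1_D:
  assumes "v \<in> H1 U"
  shows "v \<in> Lp 2 M" "wgrad U v \<in> Lp 2 M" "is_weak_grad U v (wgrad U v)"
proof -
  have "\<exists>G. G \<in> Lp 2 M \<and> is_weak_grad U v G" using assms by (auto simp: H1_def)
  from someI_ex[OF this] show "wgrad U v \<in> Lp 2 M" "is_weak_grad U v (wgrad U v)"
    unfolding wgrad_def by auto
  show "v \<in> Lp 2 M" using assms by (simp add: H1_def)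
qed

lemma wgrad_AE:
  assumes "v \<in> Lp 2 M" "G \<in> Lp 2 M" "is_weak_grad U v G"
  shows "v \<in> H1 U" "AE x in M. wgrad U v x = G x"
proof -
  show v: "v \<in> H1 U" using assms by (auto simp: H1_def)
  show "AE x in M. wgrad U v x = G x"
    by (rule weak_grad_unique[OF H1_D(2)[OF v] assms(2) H1_D(3)[OF v] assms(3)])
qed

lemma H1_add:
  assumes v: "v \<in> H1 U" and w: "w \<in> H1 U"
  shows "(\<lambda>x. v x + w x) \<in> H1 U" "AE x in M. wgrad U (\<lambda>x. v x + w x) x = wgrad U v x + wgrad U w x"
  by (rule wgrad_AE[OF Lp2_add(1)[OF H1_D(1)[OF v] H1_D(1)[OF w]] Lp2_add(1)[OF H1_D(2)[OF v] H1_D(2)[OF w]]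
      weak_grad_add]; intro H1_D v w)+

lemma H1_scale:
  assumes v: "v \<in> H1 U"
  shows "(\<lambda>x. c * v x) \<in> H1 U" "AE x in M. wgrad U (\<lambda>x. c * v x) x = c *\<^sub>R wgrad U v x"
  by (rule wgrad_AE[OF Lp2_scale_real[OF H1_D(1)[OF v]] Lp2_scale[OF H1_D(2)[OF v]]
      weak_grad_scale[OF H1_D(3)[OF v]]])+

lemma test_H1:
  assumes "\<phi> \<in> test_functions U"
  shows "\<phi> \<in> H1 U" "AE x in M. wgrad U \<phi> x = grad \<phi> x"
  by (rule wgrad_AE[OF test_Lp2[OF assms] test_weak_grad[OF assms]])+

lemma H1_diff:
  assumes v: "v \<in> H1 U" and w: "w \<in> H1 U"
  shows "(\<lambda>x. v x - w x) \<in> H1 U" "AE x in M. wgrad U (\<lambda>x. v x - w x) x = wgrad U v x - wgrad U w x"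
proof -
  have eq: "(\<lambda>x. v x - w x) = (\<lambda>x. v x + - 1 * w x)" by auto
  show "(\<lambda>x. v x - w x) \<in> H1 U" unfolding eq by (intro H1_add H1_scale v w)
  show "AE x in M. wgrad U (\<lambda>x. v x - w x) x = wgrad U v x - wgrad U w x"
    unfolding eq using H1_add(2)[OF v H1_scale(1)[OF w, of "- 1"]] H1_scale(2)[OF w, of "- 1"]
    by eventually_elim simp
qed

text \<open>The Dirichlet energy without coefficient matrix, so that the Sobolev estimates concern
  the domain alone; ellipticity compares it with the form afterwards.\<close>

definition grad_energy :: "((real^'d) \<Rightarrow> real) \<Rightarrow> real" where
  "grad_energy v = (LINT x|M. (norm (wgrad U v x))\<^sup>2)"

lemma grad_energy_cong_AE:
  assumes "v \<in> H1 U" "G \<in> Lp 2 M" "AE x in M. wgrad U v x = G x"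
  shows "grad_energy v = (LINT x|M. (norm (G x))\<^sup>2)"
proof -
  note [measurable] = Lp2_measurable[OF H1_D(2)[OF assms(1)]] Lp2_measurable[OF assms(2)]
  show ?thesis unfolding grad_energy_def
    by (rule integral_cong_AE, measurable) (use assms(3) in \<open>eventually_elim, simp\<close>)
qed

lemma grad_energy_nonneg: "0 \<le> grad_energy v"
  by (simp add: grad_energy_def)

lemma grad_energy_add_le:
  assumes "v \<in> H1 U" "w \<in> H1 U"
  shows "grad_energy (\<lambda>x. v x + w x) \<le> 2 * grad_energy v + 2 * grad_energy w"
  using grad_energy_cong_AE[OF H1_add(1)[OF assms] Lp2_add(1)[OF H1_D(2)[OF assms(1)] H1_D(2)[OF assms(2)]] H1_add(2)[OF assms]]
    Lp2_add(2)[OF H1_D(2)[OF assms(1)] H1_D(2)[OF assms(2)]]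
  by (simp add: grad_energy_def)

lemma grad_energy_scale:
  assumes "v \<in> H1 U"
  shows "grad_energy (\<lambda>x. c * v x) = c\<^sup>2 * grad_energy v"
  using grad_energy_cong_AE[OF H1_scale(1)[OF assms] Lp2_scale[OF H1_D(2)[OF assms]] H1_scale(2)[OF assms]]
  by (simp add: grad_energy_def power_mult_distrib)

lemma grad_energy_minus_commute:
  assumes "v \<in> H1 U" "w \<in> H1 U"
  shows "grad_energy (\<lambda>x. v x - w x) = grad_energy (\<lambda>x. w x - v x)"
proof -
  have "(\<lambda>x. v x - w x) = (\<lambda>x. - 1 * (w x - v x))" by auto
  then show ?thesis using grad_energy_scale[OF H1_diff(1)[OF assms(2,1)], of "- 1"] by simp
qed

lemma grad_energy_test:
  assumes "\<phi> \<in> test_functions U"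
  shows "grad_energy \<phi> = (LINT x|M. (norm (grad \<phi> x))\<^sup>2)"
  by (rule grad_energy_cong_AE[OF test_H1(1)[OF assms] test_Lp2(2)[OF assms] test_H1(2)[OF assms]])

lemma H1_norm_square: "(H1_norm U v)\<^sup>2 = (LINT x|M. (v x)\<^sup>2) + grad_energy v"
  by (simp add: H1_norm_def grad_energy_def)

section \<open>Functions with zero boundary values as limits of test functions\<close>

lemma H10_H1: "v \<in> H10 U \<Longrightarrow> v \<in> H1 U"
  by (simp add: H10_def)

lemma H10_approx:
  assumes "v \<in> H10 U" "\<epsilon> > 0"
  obtains \<phi> where "\<phi> \<in> test_functions U" "(LINT x|M. (v x - \<phi> x)\<^sup>2) < \<epsilon>" "grad_energy (\<lambda>x. v x - \<phi> x) < \<epsilon>"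
proof -
  obtain \<phi> where \<phi>: "\<And>k::nat. \<phi> k \<in> test_functions U" "(\<lambda>k. H1_norm U (\<lambda>x. v x - \<phi> k x)) \<longlonglongrightarrow> 0"
    using assms(1) by (auto simp: H10_def)
  have "(\<lambda>k. (H1_norm U (\<lambda>x. v x - \<phi> k x))\<^sup>2) \<longlonglongrightarrow> 0\<^sup>2" by (intro tendsto_power \<phi>)
  then have "\<forall>\<^sub>F k in sequentially. (H1_norm U (\<lambda>x. v x - \<phi> k x))\<^sup>2 < \<epsilon>"
    by (rule order_tendstoD) (use assms(2) in simp)
  then obtain k where k: "(H1_norm U (\<lambda>x. v x - \<phi> k x))\<^sup>2 < \<epsilon>"
    by (meson eventually_happens trivial_limit_sequentially)
  have "0 \<le> (LINT x|M. (v x - \<phi> k x)\<^sup>2)" by simp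
  then show ?thesis using that[OF \<phi>(1)[of k]] k grad_energy_nonneg[of "\<lambda>x. v x - \<phi> k x"]
    unfolding H1_norm_square by linarith
qed

lemma H10_I:
  assumes v: "v \<in> H1 U" and
    approx: "\<And>\<epsilon>. \<epsilon> > 0 \<Longrightarrow> \<exists>\<phi>\<in>test_functions U.
      (LINT x|M. (v x - \<phi> x)\<^sup>2) \<le> \<epsilon> \<and> grad_energy (\<lambda>x. v x - \<phi> x) \<le> \<epsilon>"
  shows "v \<in> H10 U"
proof -
  have "\<forall>k. \<exists>\<phi>. \<phi> \<in> test_functions U \<and> (LINT x|M. (v x - \<phi> x)\<^sup>2) \<le> 1 / real (Suc k)
      \<and> grad_energy (\<lambda>x. v x - \<phi> x) \<le> 1 / real (Suc k)"
    using approx[of "1 / real (Suc k)" for k] by (simp add: Bex_def)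
  from choice[OF this] obtain \<phi> where \<phi>: "\<And>k. \<phi> k \<in> test_functions U"
    "\<And>k. (LINT x|M. (v x - \<phi> k x)\<^sup>2) \<le> 1 / real (Suc k)"
    "\<And>k. grad_energy (\<lambda>x. v x - \<phi> k x) \<le> 1 / real (Suc k)" by blast
  have "(\<lambda>k. sqrt (2 * (1 / real (Suc k)))) \<longlonglongrightarrow> sqrt (2 * 0)"
    by (intro tendsto_real_sqrt tendsto_mult tendsto_const LIMSEQ_Suc[OF lim_1_over_n])
  then have lim: "(\<lambda>k. sqrt (2 * (1 / real (Suc k)))) \<longlonglongrightarrow> 0" by (simp only: mult_zero_right real_sqrt_zero)
  have "(\<lambda>k. H1_norm U (\<lambda>x. v x - \<phi> k x)) \<longlonglongrightarrow> 0"
  proof (rule Lim_null_comparison[OF _ lim], rule always_eventually, rule allI)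
    fix k
    have "(H1_norm U (\<lambda>x. v x - \<phi> k x))\<^sup>2 \<le> 2 * (1 / real (Suc k))"
      unfolding H1_norm_square using \<phi>(2,3)[of k] by linarith
    then have "sqrt ((H1_norm U (\<lambda>x. v x - \<phi> k x))\<^sup>2) \<le> sqrt (2 * (1 / real (Suc k)))"
      by (rule real_sqrt_le_mono)
    then show "norm (H1_norm U (\<lambda>x. v x - \<phi> k x)) \<le> sqrt (2 * (1 / real (Suc k)))"
      by (simp only: real_sqrt_abs real_norm_def)
  qed
  then show ?thesis using v \<phi>(1) by (auto simp: H10_def)
qed

lemma H10_add:
  assumes v: "v \<in> H10 U" and w: "w \<in> H10 U"
  shows "(\<lambda>x. v x + w x) \<in> H10 U"
proof (rule H10_I)
  note v1 = H10_H1[OF v] and w1 = H10_H1[OF w]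
  show "(\<lambda>x. v x + w x) \<in> H1 U" by (rule H1_add(1)[OF v1 w1])
  fix \<epsilon> :: real assume \<epsilon>: "\<epsilon> > 0"
  obtain \<phi> where \<phi>: "\<phi> \<in> test_functions U" "(LINT x|M. (v x - \<phi> x)\<^sup>2) < \<epsilon> / 4" "grad_energy (\<lambda>x. v x - \<phi> x) < \<epsilon> / 4"
    using H10_approx[OF v, of "\<epsilon> / 4"] \<epsilon> by auto
  obtain \<psi> where \<psi>: "\<psi> \<in> test_functions U" "(LINT x|M. (w x - \<psi> x)\<^sup>2) < \<epsilon> / 4" "grad_energy (\<lambda>x. w x - \<psi> x) < \<epsilon> / 4"
    using H10_approx[OF w, of "\<epsilon> / 4"] \<epsilon> by auto
  note d = H1_diff(1)[OF v1 test_H1(1)[OF \<phi>(1)]] H1_diff(1)[OF w1 test_H1(1)[OF \<psi>(1)]]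
  have eq: "(\<lambda>x. v x + w x - (\<phi> x + \<psi> x)) = (\<lambda>x. (v x - \<phi> x) + (w x - \<psi> x))" by auto
  have "grad_energy (\<lambda>x. v x + w x - (\<phi> x + \<psi> x)) \<le> \<epsilon>"
    unfolding eq using grad_energy_add_le[OF d] \<phi>(3) \<psi>(3) by linarith
  moreover have "(LINT x|M. (v x + w x - (\<phi> x + \<psi> x))\<^sup>2) \<le> \<epsilon>"
  proof -
    have "(LINT x|M. (v x + w x - (\<phi> x + \<psi> x))\<^sup>2) = (LINT x|M. (norm ((v x - \<phi> x) + (w x - \<psi> x)))\<^sup>2)"
      by (intro Bochner_Integration.integral_cong) (auto simp: algebra_simps)
    also have "\<dots> \<le> 2 * (LINT x|M. (norm (v x - \<phi> x))\<^sup>2) + 2 * (LINT x|M. (norm (w x - \<psi> x))\<^sup>2)"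
      by (rule Lp2_add(2)[OF H1_D(1)[OF d(1)] H1_D(1)[OF d(2)]])
    finally show ?thesis using \<phi>(2) \<psi>(2) by simp
  qed
  ultimately show "\<exists>\<eta>\<in>test_functions U. (LINT x|M. (v x + w x - \<eta> x)\<^sup>2) \<le> \<epsilon> \<and> grad_energy (\<lambda>x. v x + w x - \<eta> x) \<le> \<epsilon>"
    by (intro bexI[OF _ test_functions_add[OF \<phi>(1) \<psi>(1)]] conjI)
qed

lemma H10_scale:
  assumes v: "v \<in> H10 U"
  shows "(\<lambda>x. c * v x) \<in> H10 U"
proof (rule H10_I)
  note v1 = H10_H1[OF v]
  show "(\<lambda>x. c * v x) \<in> H1 U" by (rule H1_scale(1)[OF v1])
  fix \<epsilon> :: real assume \<epsilon>: "\<epsilon> > 0"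
  \<comment> \<open>Dividing by c^2 + 1 instead of c^2 allows c = 0.\<close>
  define \<epsilon>' where "\<epsilon>' = \<epsilon> / (c\<^sup>2 + 1)"
  have c: "c\<^sup>2 + 1 > 0" by (simp add: add_nonneg_pos)
  have \<epsilon>': "\<epsilon>' > 0" using \<epsilon> c by (simp add: \<epsilon>'_def)
  have le: "c\<^sup>2 * x \<le> \<epsilon>" if "x < \<epsilon>'" "0 \<le> x" for x
  proof -
    have "c\<^sup>2 * x \<le> (c\<^sup>2 + 1) * \<epsilon>'" using that by (intro mult_mono) auto
    then show ?thesis using c by (simp add: \<epsilon>'_def)
  qed
  obtain \<phi> where \<phi>: "\<phi> \<in> test_functions U" "(LINT x|M. (v x - \<phi> x)\<^sup>2) < \<epsilon>'" "grad_energy (\<lambda>x. v x - \<phi> x) < \<epsilon>'"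
    using H10_approx[OF v \<epsilon>'] by auto
  note d = H1_diff(1)[OF v1 test_H1(1)[OF \<phi>(1)]]
  have eq: "(\<lambda>x. c * v x - c * \<phi> x) = (\<lambda>x. c * (v x - \<phi> x))" by (auto simp: algebra_simps)
  have "grad_energy (\<lambda>x. c * v x - c * \<phi> x) \<le> \<epsilon>"
    unfolding eq grad_energy_scale[OF d] by (rule le[OF \<phi>(3) grad_energy_nonneg])
  moreover have "(LINT x|M. (c * v x - c * \<phi> x)\<^sup>2) = c\<^sup>2 * (LINT x|M. (v x - \<phi> x)\<^sup>2)"
    by (simp add: right_diff_distrib[symmetric] power_mult_distrib)
  then have "(LINT x|M. (c * v x - c * \<phi> x)\<^sup>2) \<le> \<epsilon>" using le[OF \<phi>(2)] by simp
  ultimately show "\<exists>\<eta>\<in>test_functions U. (LINT x|M. (c * v x - \<eta> x)\<^sup>2) \<le> \<epsilon> \<and> grad_energy (\<lambda>x. c * v x - \<eta> x) \<le> \<epsilon>"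
    by (intro bexI[OF _ test_functions_scale[OF \<phi>(1), of c]] conjI)
qed

lemma zero_test_function: "(\<lambda>x. 0) \<in> test_functions U"
  by (rule test_functionsI[of _ "{}"]) (simp_all add: Ck_const)

lemma test_H10: "\<phi> \<in> test_functions U \<Longrightarrow> \<phi> \<in> H10 U"
proof (rule H10_I)
  assume \<phi>: "\<phi> \<in> test_functions U"
  show "\<phi> \<in> H1 U" by (rule test_H1(1)[OF \<phi>])
  fix \<epsilon> :: real assume "\<epsilon> > 0"
  then show "\<exists>\<psi>\<in>test_functions U. (LINT x|M. (\<phi> x - \<psi> x)\<^sup>2) \<le> \<epsilon> \<and> grad_energy (\<lambda>x. \<phi> x - \<psi> x) \<le> \<epsilon>"
    using grad_energy_scale[OF test_H1(1)[OF \<phi>], of 0] by (intro bexI[OF _ \<phi>]) simp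
qed

end

section \<open>The Poincare inequality on convex sets\<close>

lemma nn_integral_affine:
  fixes f :: "'a::euclidean_space \<Rightarrow> ennreal"
  assumes f: "f \<in> borel_measurable borel" and c: "c \<noteq> 0"
  shows "(\<integral>\<^sup>+x. f x \<partial>lborel) = ennreal (\<bar>c\<bar> ^ DIM('a)) * (\<integral>\<^sup>+x. f (t + c *\<^sub>R x) \<partial>lborel)"
proof -
  have "(\<integral>\<^sup>+x. f x \<partial>lborel) = (\<integral>\<^sup>+x. f x \<partial>density (distr lborel borel (\<lambda>x. t + c *\<^sub>R x)) (\<lambda>x. ennreal (\<bar>c\<bar> ^ DIM('a))))"
    using lborel_affine[OF c, of t] by simp
  also have "\<dots> = ennreal (\<bar>c\<bar> ^ DIM('a)) * (\<integral>\<^sup>+x. f (t + c *\<^sub>R x) \<partial>lborel)"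
    using f by (simp add: nn_integral_density nn_integral_distr nn_integral_cmult)
  finally show ?thesis .
qed

text \<open>The substitution has the Jacobian factor c^(-d), which is at most 2^d for c >=
  1/2.\<close>

lemma nn_integral_contract_le:
  fixes f :: "'a::euclidean_space \<Rightarrow> ennreal"
  assumes f: "f \<in> borel_measurable borel" and c: "1 / 2 \<le> c"
  shows "(\<integral>\<^sup>+x. f (t + c *\<^sub>R x) \<partial>lborel) \<le> 2 ^ DIM('a) * (\<integral>\<^sup>+x. f x \<partial>lborel)"
proof -
  have "1 \<le> 2 ^ DIM('a) * \<bar>c\<bar> ^ DIM('a)"
    using c one_le_power[of "2 * c" "DIM('a)"] by (simp add: power_mult_distrib)
  then have "1 \<le> ennreal (2 ^ DIM('a) * \<bar>c\<bar> ^ DIM('a))" using ennreal_leI by fastforce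
  also have "\<dots> = 2 ^ DIM('a) * ennreal (\<bar>c\<bar> ^ DIM('a))"
    by (simp add: ennreal_mult ennreal_power[symmetric])
  finally have "1 * (\<integral>\<^sup>+x. f (t + c *\<^sub>R x) \<partial>lborel)
      \<le> (2 ^ DIM('a) * ennreal (\<bar>c\<bar> ^ DIM('a))) * (\<integral>\<^sup>+x. f (t + c *\<^sub>R x) \<partial>lborel)"
    by (rule mult_right_mono) simp
  then show ?thesis using c by (subst nn_integral_affine[OF f, of c t]) (simp_all add: mult.assoc)
qed

text \<open>Jensen's inequality on the unit interval, obtained from the nonnegative variance of the
  derivative, whose mean is \<open>\<psi> 1 - \<psi> 0\<close>.\<close>

lemma square_increment_le:
  fixes \<psi> :: "real \<Rightarrow> real"
  assumes deriv: "\<And>t. (\<psi> has_real_derivative \<psi>' t) (at t)" and cont: "continuous_on UNIV \<psi>'"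
  shows "ennreal ((\<psi> 1 - \<psi> 0)\<^sup>2) \<le> (\<integral>\<^sup>+t. ennreal ((\<psi>' t)\<^sup>2) * indicator {0..1} t \<partial>lborel)"
proof -
  define c where "c = \<psi> 1 - \<psi> 0"
  have c': "isCont \<psi>' t" for t using cont by (simp add: continuous_on_eq_continuous_at)
  have m[measurable]: "\<psi>' \<in> borel_measurable borel" using cont by (rule borel_measurable_continuous_onI)
  have i1: "integrable lborel (\<lambda>t. \<psi>' t * indicator {0..1} t)"
    by (rule borel_integrable_atLeastAtMost) (rule c')
  have i2: "integrable lborel (\<lambda>t. (\<psi>' t)\<^sup>2 * indicator {0..1} t)"
    by (rule borel_integrable_atLeastAtMost) (intro continuous_intros c')
  have e1: "(LINT t|lborel. \<psi>' t * indicator {0..1} t) = c"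
    unfolding c_def by (rule integral_FTC_Icc_real) (use deriv c' in auto)
  have i3: "integrable lborel (\<lambda>t. indicator {0..1::real} t :: real)" by simp
  have "0 \<le> (LINT t|lborel. (\<psi>' t - c)\<^sup>2 * indicator {0..1} t)"
    by (rule integral_nonneg_AE) simp
  also have "(LINT t|lborel. (\<psi>' t - c)\<^sup>2 * indicator {0..1} t)
      = (LINT t|lborel. (\<psi>' t)\<^sup>2 * indicator {0..1} t - 2 * c * (\<psi>' t * indicator {0..1} t) + c\<^sup>2 * indicator {0..1} t)"
    by (intro Bochner_Integration.integral_cong refl) (auto simp: indicator_def power2_diff)
  also have "\<dots> = (LINT t|lborel. (\<psi>' t)\<^sup>2 * indicator {0..1} t) - 2 * c * c + c\<^sup>2"
    using i1 i2 i3 by (simp add: e1 del: integrable_mult_left_iff integrable_mult_right_iff)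
  finally have "c\<^sup>2 \<le> (LINT t|lborel. (\<psi>' t)\<^sup>2 * indicator {0..1} t)" by (simp add: power2_eq_square)
  then have "ennreal (c\<^sup>2) \<le> ennreal (LINT t|lborel. (\<psi>' t)\<^sup>2 * indicator {0..1} t)" by (rule ennreal_leI)
  also have "\<dots> = (\<integral>\<^sup>+t. ennreal ((\<psi>' t)\<^sup>2 * indicator {0..1} t) \<partial>lborel)"
    by (rule nn_integral_eq_integral[symmetric, OF i2]) simp
  also have "\<dots> = (\<integral>\<^sup>+t. ennreal ((\<psi>' t)\<^sup>2) * indicator {0..1} t \<partial>lborel)"
    by (intro nn_integral_cong) (simp add: indicator_def)
  finally show ?thesis unfolding c_def .
qed

text \<open>The increment of \<phi> is integrated along the segment from \<open>x\<close> to
  \<open>y\<close>, which stays in the convex set. At the position x + t (y - x) the substitution is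
  made in \<open>y\<close> if t >= 1/2 and in \<open>x\<close> otherwise, so the Jacobian factor
  never exceeds 2^d. The double integral avoids mean values and can be restricted to parts of the
  set.\<close>

lemma poincare_convex:
  fixes Q :: "(real^'d) set"
  assumes \<phi>: "\<phi> \<in> test_functions U" and Q: "convex Q" "Q \<in> sets borel"
    and diam: "\<And>x y. x \<in> Q \<Longrightarrow> y \<in> Q \<Longrightarrow> norm (x - y) \<le> D"
  shows "(\<integral>\<^sup>+x. \<integral>\<^sup>+y. ennreal ((\<phi> x - \<phi> y)\<^sup>2) * indicator Q y * indicator Q x \<partial>lborel \<partial>lborel)
    \<le> ennreal (D\<^sup>2) * 2 ^ CARD('d) * emeasure lborel Q * (\<integral>\<^sup>+x. ennreal ((norm (grad \<phi> x))\<^sup>2) * indicator Q x \<partial>lborel)"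
proof -
  define g where "g x = ennreal ((norm (grad \<phi> x))\<^sup>2) * indicator Q x" for x
  define I where "I = (\<integral>\<^sup>+x. g x \<partial>lborel)"
  note [measurable] = test_functions_measurable[OF \<phi>] Q(2)
  have gm[measurable]: "g \<in> borel_measurable borel" unfolding g_def by measurable
  have A: "ennreal ((\<phi> x - \<phi> y)\<^sup>2) * indicator Q y * indicator Q x
      \<le> ennreal (D\<^sup>2) * (\<integral>\<^sup>+t. g (x + t *\<^sub>R (y - x)) * indicator {0..1::real} t * indicator Q y * indicator Q x \<partial>lborel)"
    for x y
  proof (cases "x \<in> Q \<and> y \<in> Q")
    case True
    let ?z = "\<lambda>t. x + t *\<^sub>R (y - x)"
    have d: "((\<lambda>t. \<phi> (?z t)) has_real_derivative grad \<phi> (?z t) \<bullet> (y - x)) (at t)" for t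
    proof -
      have d1: "(\<phi> has_derivative (\<lambda>h. grad \<phi> (?z t) \<bullet> h)) (at (?z t))"
        by (rule has_derivative_grad[OF test_functions_differentiable[OF \<phi>]])
      have d2: "(?z has_derivative (\<lambda>h. h *\<^sub>R (y - x))) (at t)"
        by (auto intro!: derivative_eq_intros)
      have "((\<lambda>t. \<phi> (?z t)) has_derivative (\<lambda>h. grad \<phi> (?z t) \<bullet> (h *\<^sub>R (y - x)))) (at t)"
        by (rule has_derivative_compose[OF d2 d1])
      moreover have "(\<lambda>h. grad \<phi> (?z t) \<bullet> (h *\<^sub>R (y - x))) = (*) (grad \<phi> (?z t) \<bullet> (y - x))"
        by (auto simp: fun_eq_iff mult.commute)
      ultimately show ?thesis by (simp only: has_field_derivative_def)
    qed
    have "continuous_on UNIV (\<lambda>x. grad \<phi> x $ i)" for i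
      by (rule test_functions_continuous[OF test_functions_grad[OF \<phi>]])
    then have "continuous_on UNIV (\<lambda>x. \<chi> i. grad \<phi> x $ i)" by (rule continuous_on_vec_lambda)
    then have cg: "continuous_on UNIV (grad \<phi>)" by simp
    have c: "continuous_on UNIV (\<lambda>t. grad \<phi> (?z t) \<bullet> (y - x))"
      by (intro continuous_on_inner continuous_on_compose2[OF cg] continuous_intros) auto
    have "ennreal ((\<phi> x - \<phi> y)\<^sup>2) \<le> (\<integral>\<^sup>+t. ennreal ((grad \<phi> (?z t) \<bullet> (y - x))\<^sup>2) * indicator {0..1} t \<partial>lborel)"
      using square_increment_le[OF d c] by (simp add: power2_commute)
    also have "\<dots> \<le> (\<integral>\<^sup>+t. ennreal (D\<^sup>2) * (g (?z t) * indicator {0..1::real} t) \<partial>lborel)"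
    proof (rule nn_integral_mono)
      fix t :: real
      show "ennreal ((grad \<phi> (?z t) \<bullet> (y - x))\<^sup>2) * indicator {0..1} t \<le> ennreal (D\<^sup>2) * (g (?z t) * indicator {0..1} t)"
      proof (cases "t \<in> {0..1}")
        case t: True
        have "?z t = (1 - t) *\<^sub>R x + t *\<^sub>R y" by (simp add: algebra_simps)
        then have z: "?z t \<in> Q" using True t Q(1) by (simp add: convexD)
        have "\<bar>grad \<phi> (?z t) \<bullet> (y - x)\<bar> \<le> norm (grad \<phi> (?z t)) * norm (y - x)" by (rule Cauchy_Schwarz_ineq2)
        also have "\<dots> \<le> norm (grad \<phi> (?z t)) * D" using diam True by (intro mult_left_mono) auto
        finally have "\<bar>grad \<phi> (?z t) \<bullet> (y - x)\<bar>\<^sup>2 \<le> (norm (grad \<phi> (?z t)) * D)\<^sup>2"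
          by (rule power_mono) simp
        then have "(grad \<phi> (?z t) \<bullet> (y - x))\<^sup>2 \<le> D\<^sup>2 * (norm (grad \<phi> (?z t)))\<^sup>2"
          by (simp add: power_mult_distrib mult.commute)
        then show ?thesis using z t by (simp add: g_def ennreal_mult[symmetric] ennreal_leI)
      qed simp
    qed
    also have "\<dots> = ennreal (D\<^sup>2) * (\<integral>\<^sup>+t. g (?z t) * indicator {0..1::real} t \<partial>lborel)"
      by (rule nn_integral_cmult) measurable
    finally show ?thesis using True by simp
  qed (auto simp: indicator_def)
  \<comment> \<open>For fixed \<open>t\<close>, the substituted variable is integrated over the
    whole space and produces \<open>I\<close>, the other one over \<open>Q\<close> and produces its
    volume.\<close>
  have inner: "(\<integral>\<^sup>+x. \<integral>\<^sup>+y. g (x + t *\<^sub>R (y - x)) * indicator {0..1::real} t * indicator Q y * indicator Q x \<partial>lborel \<partial>lborel)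
      \<le> indicator {0..1} t * (2 ^ CARD('d) * emeasure lborel Q * I)" for t :: real
  proof -
    have swap: "(\<integral>\<^sup>+x. \<integral>\<^sup>+y. g (x + t *\<^sub>R (y - x)) * indicator Q y * indicator Q x \<partial>lborel \<partial>lborel)
        = (\<integral>\<^sup>+y. \<integral>\<^sup>+x. g (x + t *\<^sub>R (y - x)) * indicator Q y * indicator Q x \<partial>lborel \<partial>lborel)"
      by (rule lborel_pair.Fubini') measurable
    have const: "(\<integral>\<^sup>+x. (2 ^ CARD('d) * I) * indicator Q x \<partial>lborel) = 2 ^ CARD('d) * emeasure lborel Q * I"
      by (subst nn_integral_cmult_indicator) (simp_all add: mult_ac)
    have "(\<integral>\<^sup>+x. \<integral>\<^sup>+y. g (x + t *\<^sub>R (y - x)) * indicator Q y * indicator Q x \<partial>lborel \<partial>lborel)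
        \<le> 2 ^ CARD('d) * emeasure lborel Q * I" if t: "t \<in> {0..1}"
    proof (cases "1 / 2 \<le> t")
      case True
      have "(\<integral>\<^sup>+y. g (x + t *\<^sub>R (y - x)) * indicator Q y * indicator Q x \<partial>lborel) \<le> (2 ^ CARD('d) * I) * indicator Q x" for x
      proof -
        have "(\<integral>\<^sup>+y. g (x + t *\<^sub>R (y - x)) * indicator Q y * indicator Q x \<partial>lborel)
            \<le> (\<integral>\<^sup>+y. g (((1 - t) *\<^sub>R x) + t *\<^sub>R y) * indicator Q x \<partial>lborel)"
          by (intro nn_integral_mono) (auto simp: indicator_def algebra_simps)
        also have "\<dots> = (\<integral>\<^sup>+y. g (((1 - t) *\<^sub>R x) + t *\<^sub>R y) \<partial>lborel) * indicator Q x"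
          by (rule nn_integral_multc) measurable
        also have "\<dots> \<le> (2 ^ CARD('d) * I) * indicator Q x"
          using nn_integral_contract_le[OF gm True, of "(1 - t) *\<^sub>R x"] by (intro mult_right_mono) (simp_all add: I_def)
        finally show ?thesis .
      qed
      then show ?thesis using nn_integral_mono[of lborel _ "\<lambda>x. (2 ^ CARD('d) * I) * indicator Q x"] const by fastforce
    next
      case False
      have "(\<integral>\<^sup>+x. g (x + t *\<^sub>R (y - x)) * indicator Q y * indicator Q x \<partial>lborel) \<le> (2 ^ CARD('d) * I) * indicator Q y" for y
      proof -
        have "(\<integral>\<^sup>+x. g (x + t *\<^sub>R (y - x)) * indicator Q y * indicator Q x \<partial>lborel)
            \<le> (\<integral>\<^sup>+x. g ((t *\<^sub>R y) + (1 - t) *\<^sub>R x) * indicator Q y \<partial>lborel)"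
          by (intro nn_integral_mono) (auto simp: indicator_def algebra_simps)
        also have "\<dots> = (\<integral>\<^sup>+x. g ((t *\<^sub>R y) + (1 - t) *\<^sub>R x) \<partial>lborel) * indicator Q y"
          by (rule nn_integral_multc) measurable
        also have "\<dots> \<le> (2 ^ CARD('d) * I) * indicator Q y"
          using nn_integral_contract_le[OF gm, of "1 - t" "t *\<^sub>R y"] False by (intro mult_right_mono) (simp_all add: I_def)
        finally show ?thesis .
      qed
      then show ?thesis unfolding swap
        using nn_integral_mono[of lborel _ "\<lambda>x. (2 ^ CARD('d) * I) * indicator Q x"] const by fastforce
    qed
    then show ?thesis by (cases "t \<in> {0..1}") simp_all
  qed
  have "(\<integral>\<^sup>+x. \<integral>\<^sup>+y. ennreal ((\<phi> x - \<phi> y)\<^sup>2) * indicator Q y * indicator Q x \<partial>lborel \<partial>lborel)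
      \<le> (\<integral>\<^sup>+x. \<integral>\<^sup>+y. ennreal (D\<^sup>2) * (\<integral>\<^sup>+t. g (x + t *\<^sub>R (y - x)) * indicator {0..1::real} t * indicator Q y * indicator Q x \<partial>lborel) \<partial>lborel \<partial>lborel)"
    by (intro nn_integral_mono A)
  also have "\<dots> = ennreal (D\<^sup>2) * (\<integral>\<^sup>+x. \<integral>\<^sup>+y. \<integral>\<^sup>+t. g (x + t *\<^sub>R (y - x)) * indicator {0..1::real} t * indicator Q y * indicator Q x \<partial>lborel \<partial>lborel \<partial>lborel)"
    by (subst nn_integral_cmult, measurable)+
  also have "(\<integral>\<^sup>+x. \<integral>\<^sup>+y. \<integral>\<^sup>+t. g (x + t *\<^sub>R (y - x)) * indicator {0..1::real} t * indicator Q y * indicator Q x \<partial>lborel \<partial>lborel \<partial>lborel)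
      = (\<integral>\<^sup>+x. \<integral>\<^sup>+t. \<integral>\<^sup>+y. g (x + t *\<^sub>R (y - x)) * indicator {0..1::real} t * indicator Q y * indicator Q x \<partial>lborel \<partial>lborel \<partial>lborel)"
    by (intro nn_integral_cong lborel_pair.Fubini') measurable
  also have "\<dots> = (\<integral>\<^sup>+t. \<integral>\<^sup>+x. \<integral>\<^sup>+y. g (x + t *\<^sub>R (y - x)) * indicator {0..1::real} t * indicator Q y * indicator Q x \<partial>lborel \<partial>lborel \<partial>lborel)"
    by (rule lborel_pair.Fubini') measurable
  also have "\<dots> \<le> (\<integral>\<^sup>+t. indicator {0..1::real} t * (2 ^ CARD('d) * emeasure lborel Q * I) \<partial>lborel)"
    by (intro nn_integral_mono inner)
  also have "\<dots> = 2 ^ CARD('d) * emeasure lborel Q * I"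
    by (subst nn_integral_multc) simp_all
  finally show ?thesis unfolding I_def g_def by (simp add: mult_left_mono mult.assoc)
qed

section \<open>Dyadic averages\<close>

lemma vec_nth_measurable[measurable]: "(\<lambda>x::real^'d. x $ i) \<in> borel_measurable borel"
  by (intro borel_measurable_continuous_onI continuous_on_component continuous_on_id)

text \<open>The half-open dyadic cube of side 2^(-j) that contains \<open>x\<close>. Equality of
  floors makes membership symmetric and the cells of one level a partition, without any index
  set.\<close>

definition cell :: "nat \<Rightarrow> real^'d \<Rightarrow> (real^'d) set" where
  "cell j x = {y. \<forall>i. \<lfloor>2 ^ j * y $ i\<rfloor> = \<lfloor>2 ^ j * x $ i\<rfloor>}"

lemma cell_self: "x \<in> cell j x"
  by (simp add: cell_def)

lemma cell_sym: "y \<in> cell j x \<longleftrightarrow> x \<in> cell j y"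
  by (auto simp: cell_def)

lemma cell_Suc_subset: "cell (Suc j) x \<subseteq> cell j x"
proof
  fix y assume y: "y \<in> cell (Suc j) x"
  \<comment> \<open>The index of a coarse cell is the integer half of the index of a fine
    one.\<close>
  have half: "\<lfloor>2 ^ j * t\<rfloor> = \<lfloor>2 ^ Suc j * t\<rfloor> div 2" for t :: real
    using floor_divide_real_eq_div[of 2 "2 ^ Suc j * t"] by simp
  show "y \<in> cell j x" using y unfolding cell_def half by simp
qed

lemma mem_cell_iff:
  "y \<in> cell j x \<longleftrightarrow> (\<forall>i. of_int \<lfloor>2 ^ j * x $ i\<rfloor> / 2 ^ j \<le> y $ i \<and> y $ i < (of_int \<lfloor>2 ^ j * x $ i\<rfloor> + 1) / 2 ^ j)"
proof -
  have "\<lfloor>2 ^ j * t\<rfloor> = k \<longleftrightarrow> of_int k / 2 ^ j \<le> t \<and> t < (of_int k + 1) / 2 ^ j" for t :: real and k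
    by (simp add: floor_eq_iff field_simps)
  then show ?thesis by (simp add: cell_def)
qed

lemma convex_cell: "convex (cell j x)"
proof -
  have "cell j x = (\<Inter>i. {y. of_int \<lfloor>2 ^ j * x $ i\<rfloor> / 2 ^ j \<le> axis i 1 \<bullet> y} \<inter> {y. axis i 1 \<bullet> y < (of_int \<lfloor>2 ^ j * x $ i\<rfloor> + 1) / 2 ^ j})"
    by (auto simp: mem_cell_iff inner_axis')
  then show ?thesis
    by (simp add: convex_INT convex_Int convex_halfspace_lt convex_halfspace_ge[of _ "axis i 1" for i])
qed

lemma cell_measurable2[measurable]: "(\<lambda>p. snd p \<in> cell j (fst p)) \<in> measurable (borel \<Otimes>\<^sub>M borel) (count_space UNIV)"
  unfolding cell_def by measurable

lemma cell_borel[measurable]: "cell j x \<in> sets borel"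
  unfolding cell_def by measurable

text \<open>The l1 norm bounds the Euclidean norm, hence the factor d instead of its square
  root.\<close>

lemma cell_diam:
  fixes x :: "real^'d"
  assumes "a \<in> cell j x" "b \<in> cell j x"
  shows "norm (a - b) \<le> real CARD('d) / 2 ^ j"
proof -
  have "\<bar>(a - b) $ i\<bar> \<le> 1 / 2 ^ j" for i
  proof -
    define k where "k = real_of_int \<lfloor>2 ^ j * x $ i\<rfloor> / 2 ^ j"
    have "k \<le> a $ i" "a $ i < k + 1 / 2 ^ j" "k \<le> b $ i" "b $ i < k + 1 / 2 ^ j"
      using assms by (auto simp: mem_cell_iff k_def add_divide_distrib)
    then show ?thesis by (simp add: abs_le_iff)
  qed
  then have "(\<Sum>i\<in>UNIV. \<bar>(a - b) $ i\<bar>) \<le> (\<Sum>i\<in>(UNIV::'d set). 1 / 2 ^ j)" by (intro sum_mono)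
  then show ?thesis using norm_le_l1_cart[of "a - b"] by simp
qed

text \<open>The half-open cell lies between an open and a closed box of the same volume.\<close>

lemma emeasure_cell:
  fixes x :: "real^'d"
  shows "emeasure lborel (cell j x) = ennreal (1 / 2 ^ (j * CARD('d)))"
proof -
  define l where "l = (\<chi> i. real_of_int \<lfloor>2 ^ j * x $ i\<rfloor> / 2 ^ j)"
  define u where "u = (\<chi> i. (real_of_int \<lfloor>2 ^ j * x $ i\<rfloor> + 1) / 2 ^ j)"
  have sub: "box l u \<subseteq> cell j x" "cell j x \<subseteq> cbox l u"
    by (auto simp: mem_box_cart mem_cell_iff l_def u_def less_imp_le)
  have ul: "(u - l) \<bullet> b = 1 / 2 ^ j" if "b \<in> Basis" for b
    using that by (auto simp: Basis_vec_def u_def l_def inner_axis add_divide_distrib)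
  have le: "l \<bullet> b \<le> u \<bullet> b" if "b \<in> Basis" for b
    using ul[OF that] by (simp add: inner_diff_left) (smt (verit) divide_nonneg_nonneg zero_le_power)
  have v: "(\<Prod>b\<in>Basis. (u - l) \<bullet> b) = 1 / 2 ^ (j * CARD('d))"
    using ul by (simp add: power_divide power_mult)
  have "emeasure lborel (box l u) = ennreal (1 / 2 ^ (j * CARD('d)))" "emeasure lborel (cbox l u) = ennreal (1 / 2 ^ (j * CARD('d)))"
    using emeasure_lborel_box[OF le] emeasure_lborel_cbox[OF le] v by simp_all
  then show ?thesis
    using emeasure_mono[OF sub(1), of lborel] emeasure_mono[OF sub(2), of lborel] by simp
qed

lemma measure_cell:
  fixes x :: "real^'d"
  shows "measure lborel (cell j x) = 1 / 2 ^ (j * CARD('d))"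
  by (simp add: measure_def emeasure_cell)

text \<open>The conditional expectation with respect to the cells of level \<open>j\<close>; the
  power of 2 is the reciprocal volume of a cell.\<close>

definition cell_avg :: "nat \<Rightarrow> (real^'d \<Rightarrow> real) \<Rightarrow> real^'d \<Rightarrow> real" where
  "cell_avg j f x = 2 ^ (j * CARD('d)) * (LINT y|lborel. indicator (cell j x) y * f y)"

lemma cell_avg_measurable[measurable]:
  assumes [measurable]: "f \<in> borel_measurable borel"
  shows "cell_avg j f \<in> borel_measurable borel"
proof -
  have "(\<lambda>p. indicator (cell j (fst p)) (snd p) * f (snd p) :: real) \<in> borel_measurable (borel \<Otimes>\<^sub>M lborel)"
    by measurable
  then have "(\<lambda>x. LINT y|lborel. indicator (cell j x) y * f y) \<in> borel_measurable borel"
    using lborel.borel_measurable_lebesgue_integral[of "\<lambda>x y. indicator (cell j x) y * f y" borel]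
    by (simp add: case_prod_beta')
  then show ?thesis unfolding cell_avg_def by measurable
qed

text \<open>The mean of (f - c)^2 over a cell is the variance plus the squared distance of the
  average from c. The free constant \<open>c\<close> is later a value of the function, an average on
  a coarser level, or 0.\<close>

lemma cell_avg_Jensen:
  fixes f :: "real^'d \<Rightarrow> real"
  assumes f: "f \<in> borel_measurable borel" and bd: "\<And>x. \<bar>f x\<bar> \<le> B"
  shows "ennreal ((cell_avg j f x - c)\<^sup>2) \<le> ennreal (2 ^ (j * CARD('d))) * (\<integral>\<^sup>+y. ennreal ((f y - c)\<^sup>2) * indicator (cell j x) y \<partial>lborel)"
proof -
  define N where "N = (2::real) ^ (j * CARD('d))"
  define A where "A = cell_avg j f x"
  let ?Q = "cell j x"
  have N: "N > 0" by (simp add: N_def)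
  note [measurable] = f
  have fin: "emeasure lborel ?Q < \<infinity>" by (simp add: emeasure_cell)
  have int: "integrable lborel (\<lambda>y. indicator ?Q y * h y)" if [measurable]: "h \<in> borel_measurable borel" and "\<And>y. \<bar>h y\<bar> \<le> C" for h :: "real^'d \<Rightarrow> real" and C
  proof (rule Bochner_Integration.integrable_bound[of lborel "\<lambda>y. C * indicator ?Q y"])
    show "integrable lborel (\<lambda>y. C * indicator ?Q y)"
      using fin by (intro integrable_mult_right integrable_real_indicator) simp_all
    show "AE y in lborel. norm (indicator ?Q y * h y) \<le> norm (C * indicator ?Q y)"
      using that(2) by (intro AE_I2) (auto simp: indicator_def intro: order_trans[OF _ abs_ge_self])
  qed measurable
  have i1: "integrable lborel (\<lambda>y. indicator ?Q y * f y)" by (rule int[OF f bd])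
  have i2: "integrable lborel (\<lambda>y. indicator ?Q y * (f y)\<^sup>2)"
  proof (rule int)
    show "\<bar>(f y)\<^sup>2\<bar> \<le> B\<^sup>2" for y using power_mono[OF bd[of y], of 2] by simp
  qed measurable
  have i3: "integrable lborel (\<lambda>y. indicator ?Q y :: real)"
    using fin by (intro integrable_real_indicator) simp_all
  have m: "(LINT y|lborel. indicator ?Q y) = 1 / N" by (simp add: measure_cell N_def)
  have a: "(LINT y|lborel. indicator ?Q y * f y) = A / N" using N by (simp add: A_def cell_avg_def N_def)
  have expand: "(LINT y|lborel. indicator ?Q y * (f y - s)\<^sup>2)
      = (LINT y|lborel. indicator ?Q y * (f y)\<^sup>2) - 2 * s * (A / N) + s\<^sup>2 * (1 / N)" for s
  proof -
    have "(\<lambda>y. indicator ?Q y * (f y - s)\<^sup>2)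
        = (\<lambda>y. indicator ?Q y * (f y)\<^sup>2 - (2 * s) * (indicator ?Q y * f y) + s\<^sup>2 * indicator ?Q y)"
      by (auto simp: fun_eq_iff indicator_def power2_diff)
    then have "(LINT y|lborel. indicator ?Q y * (f y - s)\<^sup>2)
        = (LINT y|lborel. indicator ?Q y * (f y)\<^sup>2 - (2 * s) * (indicator ?Q y * f y) + s\<^sup>2 * indicator ?Q y)" by simp
    also have "\<dots> = (LINT y|lborel. indicator ?Q y * (f y)\<^sup>2) - (LINT y|lborel. (2 * s) * (indicator ?Q y * f y)) + (LINT y|lborel. s\<^sup>2 * indicator ?Q y)"
      by (subst Bochner_Integration.integral_add, intro Bochner_Integration.integrable_diff integrable_mult_right i1 i2,
          intro integrable_mult_right i3, subst Bochner_Integration.integral_diff, rule i2,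
          intro integrable_mult_right i1, rule refl)
    finally show ?thesis by (simp only: integral_mult_right_zero m a)
  qed
  have "0 \<le> (LINT y|lborel. indicator ?Q y * (f y - A)\<^sup>2)" by (intro integral_nonneg_AE AE_I2) simp
  moreover have "(A - c)\<^sup>2 / N = (- 2 * c * (A / N) + c\<^sup>2 * (1 / N)) - (- 2 * A * (A / N) + A\<^sup>2 * (1 / N))"
    using N by (simp add: field_simps power2_eq_square)
  ultimately have "(A - c)\<^sup>2 / N \<le> (LINT y|lborel. indicator ?Q y * (f y - c)\<^sup>2)"
    unfolding expand by linarith
  then have "(A - c)\<^sup>2 \<le> N * (LINT y|lborel. indicator ?Q y * (f y - c)\<^sup>2)"
    using N by (simp add: field_simps)
  then have "ennreal ((A - c)\<^sup>2) \<le> ennreal N * ennreal (LINT y|lborel. indicator ?Q y * (f y - c)\<^sup>2)"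
    using N by (simp add: ennreal_mult'[symmetric] ennreal_leI)
  also have "ennreal (LINT y|lborel. indicator ?Q y * (f y - c)\<^sup>2) = (\<integral>\<^sup>+y. ennreal (indicator ?Q y * (f y - c)\<^sup>2) \<partial>lborel)"
  proof (rule nn_integral_eq_integral[symmetric])
    show "integrable lborel (\<lambda>y. indicator ?Q y * (f y - c)\<^sup>2)"
    proof (rule int)
      show "\<bar>(f y - c)\<^sup>2\<bar> \<le> (B + \<bar>c\<bar>)\<^sup>2" for y
      proof -
        have "\<bar>f y - c\<bar> \<le> B + \<bar>c\<bar>" using bd[of y] by linarith
        from power_mono[OF this, of 2] show ?thesis by simp
      qed
    qed measurable
  qed (simp add: AE_I2)
  also have "\<dots> = (\<integral>\<^sup>+y. ennreal ((f y - c)\<^sup>2) * indicator ?Q y \<partial>lborel)"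
    by (intro nn_integral_cong) (simp add: indicator_def)
  finally show ?thesis by (simp add: A_def N_def)
qed

text \<open>Jensen's inequality on the child and then on the parent cell reduces the difference of
  averages to the double integral over the parent, where the Poincare inequality applies. The two
  normalising factors, the squared diameter, 2^d and the cell volume combine to the
  constant.\<close>

lemma cell_avg_diff_le:
  fixes \<phi> :: "real^'d \<Rightarrow> real"
  assumes \<phi>: "\<phi> \<in> test_functions U"
  shows "ennreal ((cell_avg (Suc j) \<phi> x - cell_avg j \<phi> x)\<^sup>2)
    \<le> ennreal (4 ^ CARD('d) * (real CARD('d))\<^sup>2 * 2 ^ (j * CARD('d)) / 4 ^ j) *
      (\<integral>\<^sup>+y. ennreal ((norm (grad \<phi> y))\<^sup>2) * indicator (cell j x) y \<partial>lborel)"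
proof -
  let ?d = "CARD('d)" and ?Q = "cell j x"
  define G where "G = (\<integral>\<^sup>+y. ennreal ((norm (grad \<phi> y))\<^sup>2) * indicator ?Q y \<partial>lborel)"
  obtain B where B: "\<And>x. \<bar>\<phi> x\<bar> \<le> B" using test_functions_bounded[OF \<phi>] by blast
  have [measurable]: "\<phi> \<in> borel_measurable borel" by (rule test_functions_measurable(1)[OF \<phi>])
  note J = cell_avg_Jensen[OF test_functions_measurable(1)[OF \<phi>] B]
  have a: "ennreal ((\<phi> y - cell_avg j \<phi> x)\<^sup>2) \<le> ennreal (2 ^ (j * ?d)) * (\<integral>\<^sup>+b. ennreal ((\<phi> y - \<phi> b)\<^sup>2) * indicator ?Q b \<partial>lborel)" for y
    using J[of j x "\<phi> y"] by (simp add: power2_commute)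
  have "ennreal ((cell_avg (Suc j) \<phi> x - cell_avg j \<phi> x)\<^sup>2)
      \<le> ennreal (2 ^ (Suc j * ?d)) * (\<integral>\<^sup>+y. ennreal ((\<phi> y - cell_avg j \<phi> x)\<^sup>2) * indicator (cell (Suc j) x) y \<partial>lborel)"
    by (rule J)
  also have "(\<integral>\<^sup>+y. ennreal ((\<phi> y - cell_avg j \<phi> x)\<^sup>2) * indicator (cell (Suc j) x) y \<partial>lborel)
      \<le> (\<integral>\<^sup>+y. ennreal (2 ^ (j * ?d)) * (\<integral>\<^sup>+b. ennreal ((\<phi> y - \<phi> b)\<^sup>2) * indicator ?Q b * indicator ?Q y \<partial>lborel) \<partial>lborel)"
  proof (rule nn_integral_mono)
    fix y
    show "ennreal ((\<phi> y - cell_avg j \<phi> x)\<^sup>2) * indicator (cell (Suc j) x) y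
        \<le> ennreal (2 ^ (j * ?d)) * (\<integral>\<^sup>+b. ennreal ((\<phi> y - \<phi> b)\<^sup>2) * indicator ?Q b * indicator ?Q y \<partial>lborel)"
    proof (cases "y \<in> cell (Suc j) x")
      case True
      then show ?thesis using cell_Suc_subset[of j x] a[of y] by (simp add: subset_iff)
    qed simp
  qed
  also have "\<dots> = ennreal (2 ^ (j * ?d)) * (\<integral>\<^sup>+y. \<integral>\<^sup>+b. ennreal ((\<phi> y - \<phi> b)\<^sup>2) * indicator ?Q b * indicator ?Q y \<partial>lborel \<partial>lborel)"
    by (rule nn_integral_cmult) measurable
  also have "(\<integral>\<^sup>+y. \<integral>\<^sup>+b. ennreal ((\<phi> y - \<phi> b)\<^sup>2) * indicator ?Q b * indicator ?Q y \<partial>lborel \<partial>lborel)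
      \<le> ennreal ((real ?d / 2 ^ j)\<^sup>2) * 2 ^ ?d * emeasure lborel ?Q * G"
    unfolding G_def by (rule poincare_convex[OF \<phi> convex_cell cell_borel cell_diam])
  finally have "ennreal ((cell_avg (Suc j) \<phi> x - cell_avg j \<phi> x)\<^sup>2)
      \<le> ennreal (2 ^ (Suc j * ?d)) * (ennreal (2 ^ (j * ?d)) * (ennreal ((real ?d / 2 ^ j)\<^sup>2) * 2 ^ ?d * emeasure lborel ?Q * G))"
    by (simp add: mult_left_mono)
  also have "\<dots> = ennreal (2 ^ (Suc j * ?d) * (2 ^ (j * ?d) * ((real ?d / 2 ^ j)\<^sup>2 * 2 ^ ?d * (1 / 2 ^ (j * ?d))))) * G"
  proof -
    have "(2::ennreal) ^ ?d = ennreal (2 ^ ?d)" by (simp add: ennreal_power[symmetric])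
    then show ?thesis unfolding emeasure_cell by (simp only: ennreal_mult'[symmetric] mult.assoc[symmetric] zero_le_power zero_le_numeral zero_le_power2 zero_le_divide_1_iff mult_nonneg_nonneg)
  qed
  also have "2 ^ (Suc j * ?d) * (2 ^ (j * ?d) * ((real ?d / 2 ^ j)\<^sup>2 * 2 ^ ?d * (1 / 2 ^ (j * ?d)))) = 4 ^ ?d * (real ?d)\<^sup>2 * 2 ^ (j * ?d) / 4 ^ j"
  proof -
    have "(4::real) ^ ?d = 2 ^ ?d * 2 ^ ?d" "(4::real) ^ j = 2 ^ j * 2 ^ j"
      by (simp_all add: power_mult_distrib[symmetric])
    then show ?thesis by (simp add: power_add power_divide power2_eq_square)
  qed
  finally show ?thesis unfolding G_def .
qed

lemma cell_measurable2'[measurable]: "(\<lambda>p. fst p \<in> cell j (snd p)) \<in> measurable (borel \<Otimes>\<^sub>M borel) (count_space UNIV)"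
  unfolding cell_def by measurable

text \<open>The largest ratio |x i| / w i dominates the weighted sum, and its power is one of the
  summands. The even exponent removes the absolute values.\<close>

lemma power_sum_le_sum_power:
  fixes x w :: "nat \<Rightarrow> real"
  assumes q: "q > 0" and w: "\<And>i. w i > 0" "(\<Sum>i<n. w i) \<le> 1"
  shows "(\<Sum>i<n. x i) ^ (2 * q) \<le> (\<Sum>i<n. (x i / w i) ^ (2 * q))"
proof (cases "n = 0")
  case True
  then show ?thesis using q by (simp add: zero_power)
next
  case False
  define r where "r i = \<bar>x i\<bar> / w i" for i
  obtain k where k: "k < n" "\<And>i. i < n \<Longrightarrow> r i \<le> r k"
  proof -
    have "Max (r ` {..<n}) \<in> r ` {..<n}" using False by (intro Max_in) auto
    then obtain k where "k < n" "r k = Max (r ` {..<n})" by auto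
    then show ?thesis by (intro that[of k]) auto
  qed
  have rk: "0 \<le> r k" using w(1)[of k] by (simp add: r_def)
  have "\<bar>\<Sum>i<n. x i\<bar> \<le> (\<Sum>i<n. \<bar>x i\<bar>)" by (rule sum_abs)
  also have "\<dots> = (\<Sum>i<n. w i * r i)"
  proof (rule sum.cong[OF refl])
    fix i show "\<bar>x i\<bar> = w i * r i" using w(1)[of i] by (simp add: r_def)
  qed
  also have "\<dots> \<le> (\<Sum>i<n. w i * r k)"
    using k(2) w(1) by (intro sum_mono mult_left_mono) (auto simp: less_imp_le)
  also have "\<dots> \<le> 1 * r k" unfolding sum_distrib_right[symmetric] by (rule mult_right_mono[OF w(2) rk])
  finally have "\<bar>\<Sum>i<n. x i\<bar> ^ (2 * q) \<le> r k ^ (2 * q)" by (intro power_mono) auto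
  also have "r k ^ (2 * q) = (x k / w k) ^ (2 * q)"
    unfolding r_def by (simp add: power_divide power_mult)
  also have "\<dots> \<le> (\<Sum>i<n. (x i / w i) ^ (2 * q))"
    by (rule member_le_sum) (use k in \<open>auto simp: power_mult\<close>)
  finally show ?thesis by (simp add: power_mult)
qed

lemma ennreal_power_even: "ennreal (x ^ (2 * q)) = ennreal (x\<^sup>2) ^ q"
  by (simp add: power_mult ennreal_power)

lemma even_power_add_le:
  fixes x y :: real
  shows "(x + y) ^ (2 * q) \<le> 2 ^ (2 * q) * (x ^ (2 * q) + y ^ (2 * q))"
  using abs_add_power_le[of x y "2 * q"] by (simp add: power_even_abs)

lemma ennreal_even_power_add_le:
  "ennreal ((x + y) ^ (2 * q)) \<le> ennreal (2 ^ (2 * q)) * (ennreal (x ^ (2 * q)) + ennreal (y ^ (2 * q)))"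
proof -
  have "ennreal ((x + y) ^ (2 * q)) \<le> ennreal (2 ^ (2 * q) * (x ^ (2 * q) + y ^ (2 * q)))"
    by (rule ennreal_leI[OF even_power_add_le])
  also have "\<dots> = ennreal (2 ^ (2 * q)) * (ennreal (x ^ (2 * q)) + ennreal (y ^ (2 * q)))"
    by (simp add: ennreal_mult' ennreal_plus power_mult)
  finally show ?thesis .
qed

section \<open>Embedding and compactness estimates for test functions\<close>

context bounded_open
begin

text \<open>The Dirichlet energy as an extended real over the whole space, so that Fubini's theorem
  and powers apply without integrability conditions.\<close>

definition test_energy :: "(real^'d \<Rightarrow> real) \<Rightarrow> ennreal" where
  "test_energy \<phi> = (\<integral>\<^sup>+x. ennreal ((norm (grad \<phi> x))\<^sup>2) \<partial>lborel)"

text \<open>Fubini's theorem and the symmetry of the cell relation: each \<open>y\<close> is counted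
  with the volume of its own cell.\<close>

lemma nn_integral_cell_integral:
  fixes h :: "real^'d \<Rightarrow> ennreal"
  assumes [measurable]: "h \<in> borel_measurable borel"
  shows "(\<integral>\<^sup>+x. \<integral>\<^sup>+y. h y * indicator (cell j x) y \<partial>lborel \<partial>lborel)
    = ennreal (1 / 2 ^ (j * CARD('d))) * (\<integral>\<^sup>+y. h y \<partial>lborel)"
proof -
  have "(\<integral>\<^sup>+x. \<integral>\<^sup>+y. h y * indicator (cell j x) y \<partial>lborel \<partial>lborel)
      = (\<integral>\<^sup>+y. \<integral>\<^sup>+x. h y * indicator (cell j x) y \<partial>lborel \<partial>lborel)"
    by (rule lborel_pair.Fubini') measurable
  also have "\<dots> = (\<integral>\<^sup>+y. h y * ennreal (1 / 2 ^ (j * CARD('d))) \<partial>lborel)"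
  proof (rule nn_integral_cong)
    fix y :: "real^'d"
    have "(\<integral>\<^sup>+x. h y * indicator (cell j x) y \<partial>lborel) = (\<integral>\<^sup>+x. h y * indicator (cell j y) x \<partial>lborel)"
      by (intro nn_integral_cong) (auto simp: indicator_def cell_sym)
    then show "(\<integral>\<^sup>+x. h y * indicator (cell j x) y \<partial>lborel) = h y * ennreal (1 / 2 ^ (j * CARD('d)))"
      by (simp add: nn_integral_cmult_indicator emeasure_cell)
  qed
  also have "\<dots> = ennreal (1 / 2 ^ (j * CARD('d))) * (\<integral>\<^sup>+y. h y \<partial>lborel)"
    by (simp add: nn_integral_multc mult.commute)
  finally show ?thesis .
qed

text \<open>The power of a cell integral is summed over the cells by bounding all but one factor by the
  full integral.\<close>

lemma nn_integral_cell_integral_power_le: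
  fixes h :: "real^'d \<Rightarrow> ennreal"
  assumes [measurable]: "h \<in> borel_measurable borel" and q: "q > 0"
  shows "(\<integral>\<^sup>+x. (\<integral>\<^sup>+y. h y * indicator (cell j x) y \<partial>lborel) ^ q \<partial>lborel)
    \<le> ennreal (1 / 2 ^ (j * CARD('d))) * (\<integral>\<^sup>+y. h y \<partial>lborel) ^ q"
proof -
  define I where "I = (\<integral>\<^sup>+y. h y \<partial>lborel)"
  obtain p where p: "q = Suc p" using q gr0_implies_Suc by blast
  have "(\<integral>\<^sup>+x. (\<integral>\<^sup>+y. h y * indicator (cell j x) y \<partial>lborel) ^ q \<partial>lborel)
      \<le> (\<integral>\<^sup>+x. I ^ p * (\<integral>\<^sup>+y. h y * indicator (cell j x) y \<partial>lborel) \<partial>lborel)"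
  proof (rule nn_integral_mono)
    fix x :: "real^'d"
    have "(\<integral>\<^sup>+y. h y * indicator (cell j x) y \<partial>lborel) \<le> I"
      unfolding I_def by (intro nn_integral_mono) (auto simp: indicator_def)
    then show "(\<integral>\<^sup>+y. h y * indicator (cell j x) y \<partial>lborel) ^ q
        \<le> I ^ p * (\<integral>\<^sup>+y. h y * indicator (cell j x) y \<partial>lborel)"
      unfolding p power_Suc2 by (intro mult_right_mono power_mono) simp_all
  qed
  also have "\<dots> = I ^ p * (\<integral>\<^sup>+x. \<integral>\<^sup>+y. h y * indicator (cell j x) y \<partial>lborel \<partial>lborel)"
    by (rule nn_integral_cmult) measurable
  also have "\<dots> = ennreal (1 / 2 ^ (j * CARD('d))) * I ^ q"
    unfolding nn_integral_cell_integral[OF assms(1)] I_def[symmetric] by (simp add: p mult_ac)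
  finally show ?thesis unfolding I_def .
qed

text \<open>The q-th power of the one-step constant times the cell volume scales like 2^j to the
  exponent d q - 2 q - d. The dimension condition says that this integer is at most -1; for d > 2
  this means that 2 q is strictly below the critical exponent 2 d / (d - 2).\<close>

lemma cell_avg_diff_power:
  assumes \<phi>: "\<phi> \<in> test_functions U" and q: "q > 0" and dim: "CARD('d) * q + 1 \<le> 2 * q + CARD('d)"
  shows "(\<integral>\<^sup>+x. ennreal ((cell_avg (Suc j) \<phi> x - cell_avg j \<phi> x) ^ (2 * q)) \<partial>lborel)
    \<le> ennreal ((4 ^ CARD('d) * (real CARD('d))\<^sup>2) ^ q / 2 ^ j) * test_energy \<phi> ^ q"
proof -
  let ?d = "CARD('d)"
  define c where "c = 4 ^ ?d * (real ?d)\<^sup>2 * 2 ^ (j * ?d) / 4 ^ j"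
  have c: "0 \<le> c" by (simp add: c_def)
  define h where "h y = ennreal ((norm (grad \<phi> y))\<^sup>2)" for y
  have hm[measurable]: "h \<in> borel_measurable borel"
    unfolding h_def using test_functions_measurable(2)[OF \<phi>] by measurable
  have "(\<integral>\<^sup>+x. ennreal ((cell_avg (Suc j) \<phi> x - cell_avg j \<phi> x) ^ (2 * q)) \<partial>lborel)
      \<le> (\<integral>\<^sup>+x. ennreal c ^ q * (\<integral>\<^sup>+y. h y * indicator (cell j x) y \<partial>lborel) ^ q \<partial>lborel)"
    unfolding ennreal_power_even power_mult_distrib[symmetric] c_def h_def
    by (intro nn_integral_mono power_mono cell_avg_diff_le[OF \<phi>]) simp
  also have "\<dots> = ennreal c ^ q * (\<integral>\<^sup>+x. (\<integral>\<^sup>+y. h y * indicator (cell j x) y \<partial>lborel) ^ q \<partial>lborel)"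
    by (rule nn_integral_cmult) measurable
  also have "\<dots> \<le> ennreal c ^ q * (ennreal (1 / 2 ^ (j * ?d)) * test_energy \<phi> ^ q)"
    using nn_integral_cell_integral_power_le[OF hm q] by (intro mult_left_mono) (simp_all add: test_energy_def h_def)
  also have "\<dots> = ennreal (c ^ q * (1 / 2 ^ (j * ?d))) * test_energy \<phi> ^ q"
  proof -
    have "ennreal (c ^ q * (1 / 2 ^ (j * ?d))) = ennreal (c ^ q) * ennreal (1 / 2 ^ (j * ?d))"
      using c by (intro ennreal_mult') simp
    then show ?thesis by (simp only: ennreal_power[OF c] mult.assoc)
  qed
  also have "\<dots> \<le> ennreal ((4 ^ ?d * (real ?d)\<^sup>2) ^ q / 2 ^ j) * test_energy \<phi> ^ q"
  proof (intro mult_right_mono ennreal_leI)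
    have "(2::real) ^ (j * (?d * q + 1)) \<le> 2 ^ (j * (2 * q + ?d))"
      using dim by (intro power_increasing mult_le_mono2) auto
    moreover have "(4::real) ^ (j * q) = 2 ^ (j * q * 2)" using power_mult[of "2::real" 2 "j * q"] by (simp add: mult.commute)
    ultimately have *: "(2::real) ^ (j * ?d * q) * 2 ^ j \<le> 4 ^ (j * q) * 2 ^ (j * ?d)"
      by (simp add: algebra_simps flip: power_add)
    have "c ^ q * (1 / 2 ^ (j * ?d)) = (4 ^ ?d * (real ?d)\<^sup>2) ^ q * (2 ^ (j * ?d * q) / (4 ^ (j * q) * 2 ^ (j * ?d)))"
      by (simp add: c_def power_mult_distrib power_divide power_mult)
    also have "\<dots> \<le> (4 ^ ?d * (real ?d)\<^sup>2) ^ q * (1 / 2 ^ j)"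
      using * by (intro mult_left_mono) (simp_all add: field_simps)
    finally show "c ^ q * (1 / 2 ^ (j * ?d)) \<le> (4 ^ ?d * (real ?d)\<^sup>2) ^ q / 2 ^ j" by simp
  qed simp
  finally show ?thesis .
qed

text \<open>On a cell, a Lipschitz function deviates from its value at \<open>x\<close> by at most L
  times the diameter, and Jensen's inequality transfers this to the average.\<close>

lemma cell_avg_tendsto:
  assumes \<phi>: "\<phi> \<in> test_functions U"
  shows "(\<lambda>j. cell_avg j \<phi> x) \<longlonglongrightarrow> \<phi> x"
proof -
  obtain L where L: "L > 0" "\<And>x y. \<bar>\<phi> x - \<phi> y\<bar> \<le> L * norm (x - y)" using test_lipschitz[OF \<phi>] by blast
  obtain B where B: "\<And>x. \<bar>\<phi> x\<bar> \<le> B" using test_functions_bounded[OF \<phi>] by blast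
  define c where "c = L * real CARD('d)"
  have "(cell_avg j \<phi> x - \<phi> x)\<^sup>2 \<le> (c * (1 / 2) ^ j)\<^sup>2" for j
  proof -
    let ?N = "(2::real) ^ (j * CARD('d))"
    have "ennreal ((cell_avg j \<phi> x - \<phi> x)\<^sup>2)
        \<le> ennreal ?N * (\<integral>\<^sup>+y. ennreal ((\<phi> y - \<phi> x)\<^sup>2) * indicator (cell j x) y \<partial>lborel)"
      by (rule cell_avg_Jensen[OF test_functions_measurable(1)[OF \<phi>] B])
    also have "\<dots> \<le> ennreal ?N * (\<integral>\<^sup>+y. ennreal ((c * (1 / 2) ^ j)\<^sup>2) * indicator (cell j x) y \<partial>lborel)"
    proof (intro mult_left_mono nn_integral_mono)
      fix y
      show "ennreal ((\<phi> y - \<phi> x)\<^sup>2) * indicator (cell j x) y \<le> ennreal ((c * (1 / 2) ^ j)\<^sup>2) * indicator (cell j x) y"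
      proof (cases "y \<in> cell j x")
        case True
        have "\<bar>\<phi> y - \<phi> x\<bar> \<le> L * norm (y - x)" by (rule L(2))
        also have "\<dots> \<le> L * (real CARD('d) / 2 ^ j)"
          using cell_diam[OF True cell_self] L(1) by (intro mult_left_mono) auto
        also have "\<dots> = c * (1 / 2) ^ j" by (simp add: c_def power_divide)
        finally have "\<bar>\<phi> y - \<phi> x\<bar>\<^sup>2 \<le> (c * (1 / 2) ^ j)\<^sup>2" by (rule power_mono) simp
        then show ?thesis using True by (simp add: ennreal_leI)
      qed simp
    qed simp
    also have "\<dots> = ennreal ?N * (ennreal ((c * (1 / 2) ^ j)\<^sup>2) * ennreal (1 / ?N))"
      by (simp only: nn_integral_cmult_indicator cell_borel sets_lborel emeasure_cell)
    also have "\<dots> = ennreal (?N * ((c * (1 / 2) ^ j)\<^sup>2 * (1 / ?N)))"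
      by (simp only: ennreal_mult'[symmetric] zero_le_power zero_le_numeral zero_le_power2)
    also have "?N * ((c * (1 / 2) ^ j)\<^sup>2 * (1 / ?N)) = (c * (1 / 2) ^ j)\<^sup>2" by simp
    finally show ?thesis by (simp only: ennreal_le_iff zero_le_power2)
  qed
  then have "\<bar>cell_avg j \<phi> x - \<phi> x\<bar> \<le> \<bar>c * (1 / 2) ^ j\<bar>" for j
    by (simp only: abs_le_square_iff)
  moreover have "0 \<le> c * (1 / 2) ^ j" for j using L(1) by (simp add: c_def)
  ultimately have bd: "\<bar>cell_avg j \<phi> x - \<phi> x\<bar> \<le> c * (1 / 2) ^ j" for j
    by (simp only: abs_of_nonneg)
  have "(\<lambda>j. (1 / 2 :: real) ^ j) \<longlonglongrightarrow> 0" by (rule LIMSEQ_realpow_zero) simp_all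
  from tendsto_mult_right_zero[OF this, of c]
  have lim: "(\<lambda>j. c * (1 / 2) ^ j) \<longlonglongrightarrow> 0" .
  have "(\<lambda>j. cell_avg j \<phi> x - \<phi> x) \<longlonglongrightarrow> 0"
    by (rule Lim_null_comparison[OF _ lim]) (simp only: real_norm_def bd eventually_True)
  then show ?thesis by (simp add: LIM_zero_iff)
qed

text \<open>The last factor is the constant of one dyadic step, the middle one undoes the
  normalisation of the weights in the telescoping sum, and 3 is the sum of the geometric series with
  ratio 2/3.\<close>

definition avg_const :: "nat \<Rightarrow> real" where
  "avg_const q = 3 * (8 * real q) ^ (2 * q) * (4 ^ CARD('d) * (real CARD('d))\<^sup>2) ^ q"

text \<open>The telescoping sum over the levels from \<open>J\<close> on is estimated with geometric
  weights that decay too slowly to destroy the gain of each step. Fatou's lemma passes from finite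
  sums to \<phi>.\<close>

lemma test_minus_avg_power:
  assumes \<phi>: "\<phi> \<in> test_functions U" and q: "q > 0" and dim: "CARD('d) * q + 1 \<le> 2 * q + CARD('d)"
  shows "(\<integral>\<^sup>+x. ennreal ((\<phi> x - cell_avg J \<phi> x) ^ (2 * q)) \<partial>lborel)
    \<le> ennreal (avg_const q / 2 ^ J) * test_energy \<phi> ^ q"
proof -
  let ?K = "(4 ^ CARD('d) * (real CARD('d))\<^sup>2) ^ q"
  \<comment> \<open>With this \<open>r\<close> the weights r^i / (8 q) sum to at most 1, and
    Bernoulli's inequality gives r^(2 q) >= 3/4. The i-th step then loses at most (4/3)^i against a
    gain of 2^(-i), which leaves (2/3)^i.\<close>
  define r where "r = 1 - 1 / (8 * real q)"
  have q1: "real q \<ge> 1" using q by simp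
  have r: "0 < r" "r < 1" using q1 by (auto simp: r_def field_simps)
  have rq: "3 / 4 \<le> r ^ (2 * q)"
    using Bernoulli_inequality[of "- 1 / (8 * real q)" "2 * q"] q1 by (simp add: r_def field_simps)
  define w where "w i = r ^ i / (8 * real q)" for i
  have w: "w i > 0" for i using r q1 by (simp add: w_def)
  have wsum: "(\<Sum>i<n. w i) \<le> 1" for n
  proof -
    have "(\<Sum>i<n. w i) = (\<Sum>i<n. r ^ i) / (8 * real q)" by (simp add: w_def sum_divide_distrib)
    also have "(\<Sum>i<n. r ^ i) = (1 - r ^ n) * (8 * real q)"
      using r q1 sum_gp_strict[of r n] by (simp add: r_def)
    also have "(1 - r ^ n) * (8 * real q) / (8 * real q) \<le> 1" using r q1 by simp
    finally show ?thesis .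
  qed
  define D where "D i x = cell_avg (Suc (J + i)) \<phi> x - cell_avg (J + i) \<phi> x" for i x
  have [measurable]: "\<phi> \<in> borel_measurable borel" by (rule test_functions_measurable(1)[OF \<phi>])
  have Dm[measurable]: "D i \<in> borel_measurable borel" for i unfolding D_def by measurable
  have tel: "cell_avg (J + n) \<phi> x - cell_avg J \<phi> x = (\<Sum>i<n. D i x)" for n x
    by (induction n) (auto simp: D_def)
  have part: "(\<integral>\<^sup>+x. ennreal ((cell_avg (J + n) \<phi> x - cell_avg J \<phi> x) ^ (2 * q)) \<partial>lborel)
      \<le> ennreal (avg_const q / 2 ^ J) * test_energy \<phi> ^ q" for n
  proof -
    have "(\<integral>\<^sup>+x. ennreal ((cell_avg (J + n) \<phi> x - cell_avg J \<phi> x) ^ (2 * q)) \<partial>lborel)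
        \<le> (\<integral>\<^sup>+x. (\<Sum>i<n. ennreal (1 / w i ^ (2 * q)) * ennreal (D i x ^ (2 * q))) \<partial>lborel)"
    proof (rule nn_integral_mono)
      fix x
      have "(\<Sum>i<n. D i x) ^ (2 * q) \<le> (\<Sum>i<n. (D i x / w i) ^ (2 * q))"
        by (rule power_sum_le_sum_power[OF q w wsum])
      also have "\<dots> = (\<Sum>i<n. 1 / w i ^ (2 * q) * D i x ^ (2 * q))" by (simp add: power_divide)
      finally have "ennreal ((\<Sum>i<n. D i x) ^ (2 * q)) \<le> ennreal (\<Sum>i<n. 1 / w i ^ (2 * q) * D i x ^ (2 * q))"
        by (rule ennreal_leI)
      also have "\<dots> = (\<Sum>i<n. ennreal (1 / w i ^ (2 * q) * D i x ^ (2 * q)))"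
        using w by (intro sum_ennreal[symmetric]) (simp add: power_mult less_imp_le)
      also have "\<dots> = (\<Sum>i<n. ennreal (1 / w i ^ (2 * q)) * ennreal (D i x ^ (2 * q)))"
        using w by (intro sum.cong refl ennreal_mult') (simp add: less_imp_le)
      finally show "ennreal ((cell_avg (J + n) \<phi> x - cell_avg J \<phi> x) ^ (2 * q))
          \<le> (\<Sum>i<n. ennreal (1 / w i ^ (2 * q)) * ennreal (D i x ^ (2 * q)))" unfolding tel .
    qed
    also have "\<dots> = (\<Sum>i<n. ennreal (1 / w i ^ (2 * q)) * (\<integral>\<^sup>+x. ennreal (D i x ^ (2 * q)) \<partial>lborel))"
      by (subst nn_integral_sum) (simp_all add: nn_integral_cmult)
    also have "\<dots> \<le> (\<Sum>i<n. ennreal ((8 * real q) ^ (2 * q) * ?K / 2 ^ J * (2 / 3) ^ i) * test_energy \<phi> ^ q)"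
    proof (rule sum_mono)
      fix i
      have wi: "1 / w i ^ (2 * q) * (?K / 2 ^ (J + i)) \<le> (8 * real q) ^ (2 * q) * ?K / 2 ^ J * (2 / 3) ^ i"
      proof -
        have "(3 / 4) ^ i \<le> r ^ (2 * q * i)"
          unfolding power_mult[of r "2 * q" i] using rq by (intro power_mono) auto
        then have "(1 / 2) ^ i / r ^ (2 * q * i) \<le> (1 / 2) ^ i / (3 / 4) ^ i"
          by (intro divide_left_mono) (use r in auto)
        also have "\<dots> = (2 / 3) ^ i" by (simp add: power_divide[symmetric])
        finally have *: "(1 / 2) ^ i / r ^ (2 * q * i) \<le> (2 / 3) ^ i" .
        have "w i ^ (2 * q) = r ^ (2 * q * i) / (8 * real q) ^ (2 * q)"
          by (simp add: w_def power_divide flip: power_mult) (simp add: mult.commute)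
        then have "1 / w i ^ (2 * q) * (?K / 2 ^ (J + i)) = (8 * real q) ^ (2 * q) * ?K / 2 ^ J * ((1 / 2) ^ i / r ^ (2 * q * i))"
          by (simp add: power_add power_divide)
        also have "\<dots> \<le> (8 * real q) ^ (2 * q) * ?K / 2 ^ J * (2 / 3) ^ i"
          by (intro mult_left_mono *) simp
        finally show ?thesis .
      qed
      have "ennreal (1 / w i ^ (2 * q)) * (\<integral>\<^sup>+x. ennreal (D i x ^ (2 * q)) \<partial>lborel)
          \<le> ennreal (1 / w i ^ (2 * q)) * (ennreal (?K / 2 ^ (J + i)) * test_energy \<phi> ^ q)"
        unfolding D_def by (intro mult_left_mono cell_avg_diff_power[OF \<phi> q dim]) simp
      also have "\<dots> = ennreal (1 / w i ^ (2 * q) * (?K / 2 ^ (J + i))) * test_energy \<phi> ^ q"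
        using w[of i] by (simp add: ennreal_mult'[symmetric] mult.assoc[symmetric])
      also have "\<dots> \<le> ennreal ((8 * real q) ^ (2 * q) * ?K / 2 ^ J * (2 / 3) ^ i) * test_energy \<phi> ^ q"
        by (intro mult_right_mono ennreal_leI wi) simp
      finally show "ennreal (1 / w i ^ (2 * q)) * (\<integral>\<^sup>+x. ennreal (D i x ^ (2 * q)) \<partial>lborel)
          \<le> ennreal ((8 * real q) ^ (2 * q) * ?K / 2 ^ J * (2 / 3) ^ i) * test_energy \<phi> ^ q" .
    qed
    also have "\<dots> = ennreal (\<Sum>i<n. (8 * real q) ^ (2 * q) * ?K / 2 ^ J * (2 / 3) ^ i) * test_energy \<phi> ^ q"
      by (simp add: sum_distrib_right[symmetric] sum_ennreal)
    also have "\<dots> \<le> ennreal (avg_const q / 2 ^ J) * test_energy \<phi> ^ q"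
    proof (intro mult_right_mono ennreal_leI)
      have "(\<Sum>i<n. (2 / 3 :: real) ^ i) \<le> 3" using sum_gp_strict[of "2 / 3 :: real" n] by simp
      then have "(8 * real q) ^ (2 * q) * ?K / 2 ^ J * (\<Sum>i<n. (2 / 3) ^ i) \<le> (8 * real q) ^ (2 * q) * ?K / 2 ^ J * 3"
        by (intro mult_left_mono) simp_all
      moreover have "(8 * real q) ^ (2 * q) * ?K / 2 ^ J * 3 = avg_const q / 2 ^ J"
        by (simp add: avg_const_def)
      ultimately show "(\<Sum>i<n. (8 * real q) ^ (2 * q) * ?K / 2 ^ J * (2 / 3) ^ i) \<le> avg_const q / 2 ^ J"
        by (simp only: sum_distrib_left[symmetric])
    qed simp
    finally show ?thesis .
  qed
  have "(\<integral>\<^sup>+x. ennreal ((\<phi> x - cell_avg J \<phi> x) ^ (2 * q)) \<partial>lborel)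
      = (\<integral>\<^sup>+x. liminf (\<lambda>n. ennreal ((cell_avg (J + n) \<phi> x - cell_avg J \<phi> x) ^ (2 * q))) \<partial>lborel)"
  proof (rule nn_integral_cong)
    fix x
    have "(\<lambda>n. cell_avg (J + n) \<phi> x) \<longlonglongrightarrow> \<phi> x"
      using LIMSEQ_ignore_initial_segment[OF cell_avg_tendsto[OF \<phi>, of x], of J] by (simp add: add.commute)
    then have "(\<lambda>n. ennreal ((cell_avg (J + n) \<phi> x - cell_avg J \<phi> x) ^ (2 * q))) \<longlonglongrightarrow> ennreal ((\<phi> x - cell_avg J \<phi> x) ^ (2 * q))"
      by (intro tendsto_ennrealI tendsto_power tendsto_diff tendsto_const)
    then show "ennreal ((\<phi> x - cell_avg J \<phi> x) ^ (2 * q)) = liminf (\<lambda>n. ennreal ((cell_avg (J + n) \<phi> x - cell_avg J \<phi> x) ^ (2 * q)))"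
      by (rule lim_imp_Liminf[OF trivial_limit_sequentially, symmetric])
  qed
  also have "\<dots> \<le> liminf (\<lambda>n. \<integral>\<^sup>+x. ennreal ((cell_avg (J + n) \<phi> x - cell_avg J \<phi> x) ^ (2 * q)) \<partial>lborel)"
    by (rule nn_integral_liminf) measurable
  also have "\<dots> \<le> ennreal (avg_const q / 2 ^ J) * test_energy \<phi> ^ q"
    using part by (intro Liminf_le) auto
  finally show ?thesis .
qed


lemma grad_measurable_borel: "\<phi> \<in> test_functions U \<Longrightarrow> (\<lambda>x. ennreal ((norm (grad \<phi> x))\<^sup>2)) \<in> borel_measurable borel"
  by (drule test_functions_measurable(2)) measurable

lemma nn_integral_M_eq_lborel:
  assumes f: "f \<in> borel_measurable borel" and out: "\<And>x. x \<notin> U \<Longrightarrow> f x = 0"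
  shows "(\<integral>\<^sup>+x. f x \<partial>M) = (\<integral>\<^sup>+x. f x \<partial>lborel)"
proof -
  have "(\<lambda>x. f x * indicator U x) = f" using out by (auto simp: fun_eq_iff indicator_def)
  then show ?thesis
    using nn_integral_restrict_space[of U lebesgue f] U_lebesgue by (simp add: nn_integral_completion)
qed

lemma test_energy_eq:
  assumes \<phi>: "\<phi> \<in> test_functions U"
  shows "test_energy \<phi> = ennreal (grad_energy \<phi>)"
proof -
  have "test_energy \<phi> = (\<integral>\<^sup>+x. ennreal ((norm (grad \<phi> x))\<^sup>2) \<partial>M)"
    unfolding test_energy_def
    by (rule nn_integral_M_eq_lborel[OF grad_measurable_borel[OF \<phi>], symmetric])
      (simp add: test_functions_grad_outside[OF \<phi>])
  also have "\<dots> = ennreal (LINT x|M. (norm (grad \<phi> x))\<^sup>2)"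
    by (rule nn_integral_eq_integral[OF Lp2_integrable_square[OF test_Lp2(2)[OF \<phi>]]]) simp
  finally show ?thesis by (simp add: grad_energy_test[OF \<phi>])
qed

text \<open>Test functions vanish on a unit ball \<open>W\<close> away from \<open>U\<close>. On a
  large ball containing both sets the Poincare inequality controls \<phi> itself, since \<phi> x -
  \<phi> y is \<phi> x for y in \<open>W\<close>.\<close>

lemma friedrichs_test:
  obtains K where "K \<ge> 0" "\<And>\<phi>. \<phi> \<in> test_functions U \<Longrightarrow>
    (\<integral>\<^sup>+x. ennreal ((\<phi> x)\<^sup>2) \<partial>lborel) \<le> ennreal K * test_energy \<phi>"
proof -
  obtain r where r: "r > 0" "\<And>x. x \<in> U \<Longrightarrow> norm x \<le> r" using bounded_U bounded_pos by metis
  \<comment> \<open>The unit ball around a point at distance r + 2 avoids the ball of radius r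
    around 0 and lies in the one of radius r + 4. Any coordinate direction will do.\<close>
  define c :: "real^'d" where "c = (r + 2) *\<^sub>R axis (SOME i. True) 1"
  have c: "norm c = r + 2" using r(1) by (simp add: c_def norm_axis_1)
  define Q where "Q = ball (0::real^'d) (r + 4)"
  define W where "W = ball c 1"
  have WQ: "W \<subseteq> Q" "W \<inter> U = {}" "U \<subseteq> Q"
  proof -
    show "W \<subseteq> Q"
    proof
      fix x assume "x \<in> W"
      then have "norm (c - x) < 1" by (simp add: W_def dist_norm)
      moreover have "norm x \<le> norm c + norm (c - x)" using norm_triangle_ineq4[of c "c - x"] by simp
      ultimately show "x \<in> Q" using c by (simp add: Q_def)
    qed
    have "norm x > r" if "x \<in> W" for x
    proof -
      have "norm (c - x) < 1" using that by (simp add: W_def dist_norm)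
      moreover have "norm c \<le> norm x + norm (c - x)" using norm_triangle_ineq[of x "c - x"] by simp
      ultimately show ?thesis using c by simp
    qed
    then show "W \<inter> U = {}" using r(2) by fastforce
    show "U \<subseteq> Q" using r(2) by (force simp: Q_def)
  qed
  define \<mu> where "\<mu> = measure lborel W"
  have \<mu>: "\<mu> > 0" unfolding \<mu>_def W_def by (rule content_ball_pos) simp
  have W: "emeasure lborel W = ennreal \<mu>" and Q: "emeasure lborel Q = ennreal (measure lborel Q)"
    unfolding \<mu>_def W_def Q_def by (simp_all add: emeasure_eq_ennreal_measure emeasure_lborel_ball_finite less_top[symmetric] emeasure_lborel_ball_finite[unfolded infinity_ennreal_def, THEN less_imp_neq])
  have mQ[measurable]: "Q \<in> sets borel" "W \<in> sets borel" by (auto simp: Q_def W_def)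
  define C where "C = (2 * (r + 4))\<^sup>2 * 2 ^ CARD('d) * measure lborel Q"
  have C: "C \<ge> 0" by (simp add: C_def)
  have "(\<integral>\<^sup>+x. ennreal ((\<phi> x)\<^sup>2) \<partial>lborel) \<le> ennreal (C / \<mu>) * test_energy \<phi>" if \<phi>: "\<phi> \<in> test_functions U" for \<phi>
  proof -
    have [measurable]: "\<phi> \<in> borel_measurable borel" by (rule test_functions_measurable(1)[OF \<phi>])
    define I where "I = (\<integral>\<^sup>+x. ennreal ((\<phi> x)\<^sup>2) \<partial>lborel)"
    have "ennreal \<mu> * I = (\<integral>\<^sup>+x. ennreal ((\<phi> x)\<^sup>2) * ennreal \<mu> \<partial>lborel)"
      unfolding I_def by (subst nn_integral_multc) (simp_all add: mult.commute)
    also have "\<dots> \<le> (\<integral>\<^sup>+x. \<integral>\<^sup>+y. ennreal ((\<phi> x - \<phi> y)\<^sup>2) * indicator Q y * indicator Q x \<partial>lborel \<partial>lborel)"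
    proof (rule nn_integral_mono)
      fix x
      show "ennreal ((\<phi> x)\<^sup>2) * ennreal \<mu> \<le> (\<integral>\<^sup>+y. ennreal ((\<phi> x - \<phi> y)\<^sup>2) * indicator Q y * indicator Q x \<partial>lborel)"
      proof (cases "x \<in> U")
        case True
        have "ennreal ((\<phi> x)\<^sup>2) * ennreal \<mu> = (\<integral>\<^sup>+y. ennreal ((\<phi> x)\<^sup>2) * indicator W y \<partial>lborel)"
          by (simp only: nn_integral_cmult_indicator mQ sets_lborel W)
        also have "\<dots> \<le> (\<integral>\<^sup>+y. ennreal ((\<phi> x - \<phi> y)\<^sup>2) * indicator Q y * indicator Q x \<partial>lborel)"
        proof (rule nn_integral_mono)
          fix y
          have "\<phi> y = 0" if "y \<in> W" using WQ(2) that test_functions_outside[OF \<phi>, of y] by blast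
          then show "ennreal ((\<phi> x)\<^sup>2) * indicator W y \<le> ennreal ((\<phi> x - \<phi> y)\<^sup>2) * indicator Q y * indicator Q x"
            using True WQ(1,3) by (auto simp: indicator_def)
        qed
        finally show ?thesis .
      qed (simp add: test_functions_outside[OF \<phi>])
    qed
    also have "\<dots> \<le> ennreal ((2 * (r + 4))\<^sup>2) * 2 ^ CARD('d) * emeasure lborel Q * (\<integral>\<^sup>+x. ennreal ((norm (grad \<phi> x))\<^sup>2) * indicator Q x \<partial>lborel)"
    proof (rule poincare_convex[OF \<phi>])
      show "convex Q" by (simp add: Q_def)
      fix x y assume "x \<in> Q" "y \<in> Q"
      then show "norm (x - y) \<le> 2 * (r + 4)"
        using norm_triangle_ineq4[of x y] by (simp add: Q_def)
    qed measurable
    also have "\<dots> \<le> ennreal ((2 * (r + 4))\<^sup>2) * 2 ^ CARD('d) * emeasure lborel Q * test_energy \<phi>"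
      unfolding test_energy_def by (intro mult_left_mono nn_integral_mono) (auto simp: indicator_def)
    also have "\<dots> = ennreal C * test_energy \<phi>"
    proof -
      have "(2::ennreal) ^ CARD('d) = ennreal (2 ^ CARD('d))" by (simp add: ennreal_power[symmetric])
      then show ?thesis unfolding Q C_def
        by (simp only: ennreal_mult' zero_le_power2 mult_nonneg_nonneg zero_le_power zero_le_numeral)
    qed
    finally have le: "ennreal \<mu> * I \<le> ennreal C * test_energy \<phi>" .
    have "I = ennreal (1 / \<mu>) * (ennreal \<mu> * I)"
      using \<mu> by (simp add: mult.assoc[symmetric] ennreal_mult'[symmetric])
    also have "\<dots> \<le> ennreal (1 / \<mu>) * (ennreal C * test_energy \<phi>)" by (intro mult_left_mono le) simp
    also have "\<dots> = ennreal (C / \<mu>) * test_energy \<phi>"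
      using \<mu> C by (simp add: mult.assoc[symmetric] ennreal_mult'[symmetric])
    finally show ?thesis unfolding I_def .
  qed
  then show ?thesis using \<mu> C by (intro that[of "C / \<mu>"]) auto
qed

lemma cell_avg_square_le:
  assumes \<phi>: "\<phi> \<in> test_functions U"
  shows "ennreal ((cell_avg j \<phi> x)\<^sup>2) \<le> ennreal (2 ^ (j * CARD('d))) * (\<integral>\<^sup>+y. ennreal ((\<phi> y)\<^sup>2) * indicator (cell j x) y \<partial>lborel)"
proof -
  obtain B where B: "\<And>x. \<bar>\<phi> x\<bar> \<le> B" using test_functions_bounded[OF \<phi>] by blast
  show ?thesis using cell_avg_Jensen[OF test_functions_measurable(1)[OF \<phi>] B, of j x 0] by simp
qed

lemma power_split_avg:
  assumes \<phi>: "\<phi> \<in> test_functions U"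
  shows "(\<integral>\<^sup>+x. ennreal (\<phi> x ^ (2 * q)) \<partial>lborel) \<le> ennreal (2 ^ (2 * q)) *
    ((\<integral>\<^sup>+x. ennreal ((\<phi> x - cell_avg J \<phi> x) ^ (2 * q)) \<partial>lborel) + (\<integral>\<^sup>+x. ennreal (cell_avg J \<phi> x ^ (2 * q)) \<partial>lborel))"
proof -
  have [measurable]: "\<phi> \<in> borel_measurable borel" by (rule test_functions_measurable(1)[OF \<phi>])
  have "(\<integral>\<^sup>+x. ennreal (\<phi> x ^ (2 * q)) \<partial>lborel) \<le> (\<integral>\<^sup>+x. ennreal (2 ^ (2 * q)) *
     (ennreal ((\<phi> x - cell_avg J \<phi> x) ^ (2 * q)) + ennreal (cell_avg J \<phi> x ^ (2 * q))) \<partial>lborel)"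
  proof (rule nn_integral_mono)
    fix x
    show "ennreal (\<phi> x ^ (2 * q)) \<le> ennreal (2 ^ (2 * q)) *
      (ennreal ((\<phi> x - cell_avg J \<phi> x) ^ (2 * q)) + ennreal (cell_avg J \<phi> x ^ (2 * q)))"
      using ennreal_even_power_add_le[of "\<phi> x - cell_avg J \<phi> x" "cell_avg J \<phi> x" q] by (simp only: diff_add_cancel)
  qed
  also have "\<dots> = ennreal (2 ^ (2 * q)) *
    ((\<integral>\<^sup>+x. ennreal ((\<phi> x - cell_avg J \<phi> x) ^ (2 * q)) \<partial>lborel) + (\<integral>\<^sup>+x. ennreal (cell_avg J \<phi> x ^ (2 * q)) \<partial>lborel))"
    by (subst nn_integral_cmult, measurable, subst nn_integral_add, measurable)
  finally show ?thesis .
qed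

text \<open>Splitting at level 0: the deviation from averages over unit cells is bounded by the
  telescoping estimate, the averages themselves by the Friedrichs inequality.\<close>

lemma sobolev_test:
  assumes q: "q > 0" and dim: "CARD('d) * q + 1 \<le> 2 * q + CARD('d)"
  obtains K where "K \<ge> 0" "\<And>\<phi>. \<phi> \<in> test_functions U \<Longrightarrow>
    (\<integral>\<^sup>+x. ennreal (\<phi> x ^ (2 * q)) \<partial>lborel) \<le> ennreal K * test_energy \<phi> ^ q"
proof -
  obtain KF where KF: "KF \<ge> 0" "\<And>\<phi>. \<phi> \<in> test_functions U \<Longrightarrow>
    (\<integral>\<^sup>+x. ennreal ((\<phi> x)\<^sup>2) \<partial>lborel) \<le> ennreal KF * test_energy \<phi>" using friedrichs_test by blast
  define K where "K = 2 ^ (2 * q) * (avg_const q + KF ^ q)"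
  have ac: "0 \<le> avg_const q" by (simp add: avg_const_def power_mult)
  have "(\<integral>\<^sup>+x. ennreal (\<phi> x ^ (2 * q)) \<partial>lborel) \<le> ennreal K * test_energy \<phi> ^ q" if \<phi>: "\<phi> \<in> test_functions U" for \<phi>
  proof -
    define h where "h y = ennreal ((\<phi> y)\<^sup>2)" for y
    have hm[measurable]: "h \<in> borel_measurable borel"
      unfolding h_def using test_functions_measurable(1)[OF \<phi>] by measurable
    have "(\<integral>\<^sup>+x. ennreal (cell_avg 0 \<phi> x ^ (2 * q)) \<partial>lborel) \<le> (\<integral>\<^sup>+x. (\<integral>\<^sup>+y. h y * indicator (cell 0 x) y \<partial>lborel) ^ q \<partial>lborel)"
      unfolding ennreal_power_even h_def using cell_avg_square_le[OF \<phi>, of 0]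
      by (intro nn_integral_mono power_mono) simp_all
    also have "\<dots> \<le> (\<integral>\<^sup>+y. h y \<partial>lborel) ^ q"
      using nn_integral_cell_integral_power_le[OF hm q, of 0] by simp
    also have "\<dots> \<le> (ennreal KF * test_energy \<phi>) ^ q"
      unfolding h_def by (intro power_mono KF(2)[OF \<phi>]) simp
    also have "\<dots> = ennreal (KF ^ q) * test_energy \<phi> ^ q"
      by (simp only: power_mult_distrib ennreal_power[OF KF(1)])
    finally have 1: "(\<integral>\<^sup>+x. ennreal (cell_avg 0 \<phi> x ^ (2 * q)) \<partial>lborel) \<le> ennreal (KF ^ q) * test_energy \<phi> ^ q" .
    have 2: "(\<integral>\<^sup>+x. ennreal ((\<phi> x - cell_avg 0 \<phi> x) ^ (2 * q)) \<partial>lborel) \<le> ennreal (avg_const q) * test_energy \<phi> ^ q"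
      using test_minus_avg_power[OF \<phi> q dim, of 0] by simp
    have "(\<integral>\<^sup>+x. ennreal (\<phi> x ^ (2 * q)) \<partial>lborel)
        \<le> ennreal (2 ^ (2 * q)) * (ennreal (avg_const q) * test_energy \<phi> ^ q + ennreal (KF ^ q) * test_energy \<phi> ^ q)"
      by (rule order_trans[OF power_split_avg[OF \<phi>, of q 0]]) (intro mult_left_mono add_mono 1 2, simp)
    also have "\<dots> = ennreal K * test_energy \<phi> ^ q"
    proof -
      have "ennreal K = ennreal (2 ^ (2 * q)) * (ennreal (avg_const q) + ennreal (KF ^ q))"
        using ac KF(1) unfolding K_def by (subst ennreal_mult') (simp_all add: ennreal_plus)
      then show ?thesis by (simp only: distrib_right mult.assoc)
    qed
    finally show ?thesis .
  qed
  moreover have "K \<ge> 0" using ac KF(1) by (simp add: K_def)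
  ultimately show ?thesis by (rule that[rotated])
qed

text \<open>The deviation from the averages of level \<open>J\<close> is small uniformly in
  \<open>k\<close> once \<open>J\<close> is large. For fixed \<open>J\<close> the averages tend to 0
  pointwise under a common integrable majorant.\<close>

lemma rellich_test:
  fixes \<phi> :: "nat \<Rightarrow> real^'d \<Rightarrow> real"
  assumes q: "q > 0" and dim: "CARD('d) * q + 1 \<le> 2 * q + CARD('d)"
    and \<phi>: "\<And>k. \<phi> k \<in> test_functions U" and B: "\<And>k. test_energy (\<phi> k) \<le> ennreal B"
    and lim: "\<And>j x. (\<lambda>k. LINT y|lborel. indicator (cell j x) y * \<phi> k y) \<longlonglongrightarrow> 0"
  shows "(\<lambda>k. \<integral>\<^sup>+x. ennreal (\<phi> k x ^ (2 * q)) \<partial>lborel) \<longlonglongrightarrow> 0"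
proof -
  obtain KF where KF: "KF \<ge> 0" "\<And>\<phi>. \<phi> \<in> test_functions U \<Longrightarrow>
    (\<integral>\<^sup>+x. ennreal ((\<phi> x)\<^sup>2) \<partial>lborel) \<le> ennreal KF * test_energy \<phi>" using friedrichs_test by blast
  obtain r where r: "r > 0" "\<And>x. x \<in> U \<Longrightarrow> norm x \<le> r" using bounded_U bounded_pos by metis
  note [measurable] = test_functions_measurable(1)[OF \<phi>]
  have avg0: "(\<lambda>k. \<integral>\<^sup>+x. ennreal (cell_avg J (\<phi> k) x ^ (2 * q)) \<partial>lborel) \<longlonglongrightarrow> (\<integral>\<^sup>+x. 0 \<partial>(lborel :: (real^'d) measure))" for J
  proof -
    \<comment> \<open>The averages vanish farther than one cell diameter from \<open>U\<close>,
      hence the enlarged radius; \<open>w\<close> bounds their powers through the Friedrichs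
      inequality.\<close>
    define \<rho> where "\<rho> = r + real CARD('d)"
    define w where "w = (ennreal (2 ^ (J * CARD('d))) * (ennreal KF * ennreal B)) ^ q"
    have [measurable]: "cball 0 \<rho> \<in> sets (borel :: (real^'d) measure)" by simp
    have wfin: "w < \<infinity>" by (simp add: w_def ennreal_mult_less_top power_less_top_ennreal)
    show ?thesis
    proof (rule nn_integral_dominated_convergence[where w = "\<lambda>x. w * indicator (cball 0 \<rho>) x"])
      show "(\<integral>\<^sup>+x. w * indicator (cball 0 \<rho>) x \<partial>(lborel :: (real^'d) measure)) < \<infinity>"
        using wfin emeasure_lborel_cball_finite[of "0::real^'d" \<rho>] by (simp add: nn_integral_cmult_indicator ennreal_mult_less_top)
      show "AE x in lborel. ennreal (cell_avg J (\<phi> k) x ^ (2 * q)) \<le> w * indicator (cball 0 \<rho>) x" for k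
      proof (rule AE_I2)
        fix x
        show "ennreal (cell_avg J (\<phi> k) x ^ (2 * q)) \<le> w * indicator (cball 0 \<rho>) x"
        proof (cases "x \<in> cball 0 \<rho>")
          case True
          have "ennreal ((cell_avg J (\<phi> k) x)\<^sup>2) \<le> ennreal (2 ^ (J * CARD('d))) * (\<integral>\<^sup>+y. ennreal ((\<phi> k y)\<^sup>2) * indicator (cell J x) y \<partial>lborel)"
            by (rule cell_avg_square_le[OF \<phi>])
          also have "\<dots> \<le> ennreal (2 ^ (J * CARD('d))) * (\<integral>\<^sup>+y. ennreal ((\<phi> k y)\<^sup>2) \<partial>lborel)"
            by (intro mult_left_mono nn_integral_mono) (auto simp: indicator_def)
          also have "\<dots> \<le> ennreal (2 ^ (J * CARD('d))) * (ennreal KF * ennreal B)"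
            by (intro mult_left_mono order_trans[OF KF(2)[OF \<phi>]] B) simp_all
          finally show ?thesis using True unfolding w_def ennreal_power_even by (simp add: power_mono)
        next
          case False
          have "y \<notin> U" if y: "y \<in> cell J x" for y
          proof
            assume "y \<in> U"
            then have "norm y \<le> r" by (rule r(2))
            moreover have "norm (x - y) \<le> real CARD('d) / 2 ^ J" by (rule cell_diam[OF cell_self y])
            moreover have "real CARD('d) / 2 ^ J \<le> real CARD('d)" by (simp add: divide_le_eq mult_le_cancel_left1)
            ultimately have "norm x \<le> r + real CARD('d)" using norm_triangle_ineq[of "x - y" y] by simp
            then show False using False by (simp add: \<rho>_def)
          qed
          then have "(\<lambda>y. indicator (cell J x) y * \<phi> k y) = (\<lambda>y. 0)"
            using test_functions_outside[OF \<phi>] by (auto simp: fun_eq_iff indicator_def)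
          then have "cell_avg J (\<phi> k) x = 0" by (simp add: cell_avg_def)
          then show ?thesis using q by (simp add: zero_power)
        qed
      qed
      show "AE x in lborel. (\<lambda>k. ennreal (cell_avg J (\<phi> k) x ^ (2 * q))) \<longlonglongrightarrow> 0"
      proof (rule AE_I2)
        fix x
        have "(\<lambda>k. cell_avg J (\<phi> k) x) \<longlonglongrightarrow> 0"
          unfolding cell_avg_def by (rule tendsto_mult_right_zero[OF lim])
        from tendsto_ennrealI[OF tendsto_power[OF this, of "2 * q"]]
        show "(\<lambda>k. ennreal (cell_avg J (\<phi> k) x ^ (2 * q))) \<longlonglongrightarrow> 0" using q by (simp add: zero_power)
      qed
    qed measurable
  qed
  show ?thesis
  proof (rule order_tendstoI)
    fix a :: ennreal assume a: "0 < a"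
    obtain \<epsilon> where \<epsilon>: "\<epsilon> > 0" "ennreal \<epsilon> < a"
    proof -
      obtain b where b: "0 < b" "b < a" using dense[OF a] by blast
      then obtain e where e: "b = ennreal e" "0 \<le> e" by (cases b) auto
      with b show ?thesis using that[of e] by simp
    qed
    define s where "s = 2 ^ (2 * q) * avg_const q * \<bar>B\<bar> ^ q"
    have s: "s \<ge> 0" by (simp add: s_def avg_const_def power_mult)
    obtain J where J: "s / 2 ^ J \<le> \<epsilon> / 2"
    proof -
      obtain J :: nat where "2 * s / \<epsilon> < 2 ^ J" using real_arch_pow[of 2 "2 * s / \<epsilon>"] by auto
      then show ?thesis using \<epsilon>(1) by (intro that[of J]) (simp add: field_simps)
    qed
    define t where "t = \<epsilon> / 2 / 2 ^ (2 * q)"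
    have t: "t > 0" using \<epsilon> by (simp add: t_def)
    have "\<forall>\<^sub>F k in sequentially. (\<integral>\<^sup>+x. ennreal (cell_avg J (\<phi> k) x ^ (2 * q)) \<partial>lborel) < ennreal t"
      by (rule order_tendstoD(2)[OF avg0]) (use t in simp)
    then show "\<forall>\<^sub>F k in sequentially. (\<integral>\<^sup>+x. ennreal (\<phi> k x ^ (2 * q)) \<partial>lborel) < a"
    proof eventually_elim
      case (elim k)
      have Bq: "test_energy (\<phi> k) ^ q \<le> ennreal (\<bar>B\<bar> ^ q)"
      proof -
        have "test_energy (\<phi> k) \<le> ennreal \<bar>B\<bar>" using order_trans[OF B ennreal_leI[OF abs_ge_self]] .
        then have "test_energy (\<phi> k) ^ q \<le> ennreal \<bar>B\<bar> ^ q" by (rule power_mono) simp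
        then show ?thesis by (simp add: ennreal_power)
      qed
      have "(\<integral>\<^sup>+x. ennreal (\<phi> k x ^ (2 * q)) \<partial>lborel)
          \<le> ennreal (2 ^ (2 * q)) * (ennreal (avg_const q / 2 ^ J) * test_energy (\<phi> k) ^ q + ennreal t)"
        by (rule order_trans[OF power_split_avg[OF \<phi>[of k], of q J]])
          (intro mult_left_mono add_mono test_minus_avg_power[OF \<phi> q dim] less_imp_le[OF elim], simp)
      also have "\<dots> \<le> ennreal (2 ^ (2 * q)) * (ennreal (avg_const q / 2 ^ J) * ennreal (\<bar>B\<bar> ^ q) + ennreal t)"
        by (intro mult_left_mono add_mono Bq order_refl) simp_all
      also have "\<dots> = ennreal (2 ^ (2 * q) * (avg_const q / 2 ^ J * \<bar>B\<bar> ^ q + t))"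
      proof -
        have *: "ennreal x * (ennreal y * ennreal z + ennreal t) = ennreal (x * (y * z + t))"
          if "0 \<le> x" "0 \<le> y" "0 \<le> z" for x y z
          using that t by (simp add: ennreal_mult' ennreal_plus)
        show ?thesis by (rule *) (simp_all add: avg_const_def power_mult)
      qed
      also have "2 ^ (2 * q) * (avg_const q / 2 ^ J * \<bar>B\<bar> ^ q + t) = s / 2 ^ J + \<epsilon> / 2"
        by (simp add: s_def t_def distrib_left)
      also have "ennreal (s / 2 ^ J + \<epsilon> / 2) \<le> ennreal \<epsilon>" using J by (intro ennreal_leI) linarith
      finally show ?case using \<epsilon>(2) by simp
    qed
  qed simp
qed

end

section \<open>Sobolev embedding and Rellich compactness\<close>

context bounded_open
begin

lemma H10_approx_seq:
  assumes v: "\<And>k. v k \<in> H10 U" and \<epsilon>: "\<And>k::nat. \<epsilon> k > 0"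
  obtains \<phi> where "\<And>k. \<phi> k \<in> test_functions U" "\<And>k. (LINT x|M. (v k x - \<phi> k x)\<^sup>2) < \<epsilon> k"
    "\<And>k. grad_energy (\<lambda>x. v k x - \<phi> k x) < \<epsilon> k"
proof -
  have "\<forall>k. \<exists>\<phi>. \<phi> \<in> test_functions U \<and> (LINT x|M. (v k x - \<phi> x)\<^sup>2) < \<epsilon> k \<and> grad_energy (\<lambda>x. v k x - \<phi> x) < \<epsilon> k"
  proof
    fix k
    obtain \<phi> where "\<phi> \<in> test_functions U" "(LINT x|M. (v k x - \<phi> x)\<^sup>2) < \<epsilon> k" "grad_energy (\<lambda>x. v k x - \<phi> x) < \<epsilon> k"
      using H10_approx[OF v[of k] \<epsilon>[of k]] by blast
    then show "\<exists>\<phi>. \<phi> \<in> test_functions U \<and> (LINT x|M. (v k x - \<phi> x)\<^sup>2) < \<epsilon> k \<and> grad_energy (\<lambda>x. v k x - \<phi> x) < \<epsilon> k"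
      by blast
  qed
  from choice[OF this] obtain \<phi> where "\<forall>k. \<phi> k \<in> test_functions U \<and> (LINT x|M. (v k x - \<phi> k x)\<^sup>2) < \<epsilon> k \<and> grad_energy (\<lambda>x. v k x - \<phi> k x) < \<epsilon> k"
    by blast
  then show ?thesis using that by blast
qed

lemma grad_energy_approx_le:
  assumes v: "v \<in> H1 U" and \<phi>: "\<phi> \<in> test_functions U" and le: "grad_energy (\<lambda>x. v x - \<phi> x) \<le> \<epsilon>"
  shows "grad_energy \<phi> \<le> 2 * grad_energy v + 2 * \<epsilon>"
proof -
  note \<phi>1 = test_H1(1)[OF \<phi>]
  have "grad_energy (\<lambda>x. v x + (\<phi> x - v x)) \<le> 2 * grad_energy v + 2 * grad_energy (\<lambda>x. \<phi> x - v x)"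
    by (rule grad_energy_add_le[OF v H1_diff(1)[OF \<phi>1 v]])
  then show ?thesis using le grad_energy_minus_commute[OF v \<phi>1] by simp
qed

text \<open>Approximating test functions converge almost everywhere along a subsequence, and Fatou's
  lemma transfers the estimate. With extended reals, integrability of the power of \<open>v\<close>
  comes out as a result.\<close>

lemma sobolev_H10_nn:
  assumes q: "q > 0" and dim: "CARD('d) * q + 1 \<le> 2 * q + CARD('d)"
  obtains K where "K \<ge> 0" "\<And>v. v \<in> H10 U \<Longrightarrow> (\<integral>\<^sup>+x. ennreal (v x ^ (2 * q)) \<partial>M) \<le> ennreal (K * grad_energy v ^ q)"
proof -
  obtain K where K: "K \<ge> 0" "\<And>\<phi>. \<phi> \<in> test_functions U \<Longrightarrow>
    (\<integral>\<^sup>+x. ennreal (\<phi> x ^ (2 * q)) \<partial>lborel) \<le> ennreal K * test_energy \<phi> ^ q"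
    using sobolev_test[OF q dim] by blast
  have "(\<integral>\<^sup>+x. ennreal (v x ^ (2 * q)) \<partial>M) \<le> ennreal (K * 2 ^ q * grad_energy v ^ q)" if v: "v \<in> H10 U" for v
  proof -
    note v1 = H10_H1[OF v]
    obtain \<phi> where \<phi>: "\<And>k. \<phi> k \<in> test_functions U" "\<And>k. (LINT x|M. (v x - \<phi> k x)\<^sup>2) < 1 / real (Suc k)"
      "\<And>k. grad_energy (\<lambda>x. v x - \<phi> k x) < 1 / real (Suc k)"
      by (rule H10_approx_seq[of "\<lambda>k. v" "\<lambda>k. 1 / real (Suc k)"]) (use v in auto)
    note d = H1_D(1)[OF H1_diff(1)[OF v1 test_H1(1)[OF \<phi>(1)]]]
    have inv0: "(\<lambda>k. 1 / real (Suc k)) \<longlonglongrightarrow> 0" by (rule LIMSEQ_Suc[OF lim_1_over_n])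
    \<comment> \<open>Squares converging to 0 in L^1 have a subsequence converging almost
      everywhere.\<close>
    have "(\<lambda>k. LINT x|M. norm ((v x - \<phi> k x)\<^sup>2)) \<longlonglongrightarrow> 0"
    proof (rule Lim_null_comparison[OF _ inv0], rule always_eventually, rule allI)
      fix k
      have "0 \<le> (LINT x|M. (v x - \<phi> k x)\<^sup>2)" by simp
      then show "norm (LINT x|M. norm ((v x - \<phi> k x)\<^sup>2)) \<le> 1 / real (Suc k)"
        using \<phi>(2)[of k] by (simp del: of_nat_Suc)
    qed
    moreover have "integrable M (\<lambda>x. (v x - \<phi> k x)\<^sup>2)" for k
      using Lp2_integrable_square[OF d[of k]] by simp
    ultimately obtain s where s: "strict_mono s" "AE x in M. (\<lambda>n. (v x - \<phi> (s n) x)\<^sup>2) \<longlonglongrightarrow> 0"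
      using tendsto_L1_AE_subseq[of M "\<lambda>k x. (v x - \<phi> k x)\<^sup>2"] by blast
    have ae: "AE x in M. ennreal (v x ^ (2 * q)) = liminf (\<lambda>n. ennreal (\<phi> (s n) x ^ (2 * q)))"
      using s(2)
    proof eventually_elim
      case (elim x)
      have "(\<lambda>n. sqrt ((v x - \<phi> (s n) x)\<^sup>2)) \<longlonglongrightarrow> sqrt 0" by (rule tendsto_real_sqrt[OF elim])
      then have "(\<lambda>n. \<bar>v x - \<phi> (s n) x\<bar>) \<longlonglongrightarrow> 0" by simp
      then have "(\<lambda>n. v x - \<phi> (s n) x) \<longlonglongrightarrow> 0" by (rule tendsto_rabs_zero_cancel)
      then have "(\<lambda>n. v x - (v x - \<phi> (s n) x)) \<longlonglongrightarrow> v x - 0" by (intro tendsto_diff tendsto_const)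
      then have "(\<lambda>n. \<phi> (s n) x) \<longlonglongrightarrow> v x" by simp
      then have "(\<lambda>n. ennreal (\<phi> (s n) x ^ (2 * q))) \<longlonglongrightarrow> ennreal (v x ^ (2 * q))"
        by (intro tendsto_ennrealI tendsto_power)
      then show ?case by (rule lim_imp_Liminf[OF trivial_limit_sequentially, symmetric])
    qed
    define c where "c k = K * (2 * grad_energy v + 2 * (1 / real (Suc k))) ^ q" for k
    have bound: "(\<integral>\<^sup>+x. ennreal (\<phi> k x ^ (2 * q)) \<partial>M) \<le> ennreal (c k)" for k
    proof -
      have "(\<integral>\<^sup>+x. ennreal (\<phi> k x ^ (2 * q)) \<partial>M) = (\<integral>\<^sup>+x. ennreal (\<phi> k x ^ (2 * q)) \<partial>lborel)"
      proof (rule nn_integral_M_eq_lborel)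
        show "(\<lambda>x. ennreal (\<phi> k x ^ (2 * q))) \<in> borel_measurable borel"
          using test_functions_measurable(1)[OF \<phi>(1)[of k]] by measurable
      qed (use q in \<open>simp add: test_functions_outside[OF \<phi>(1)] zero_power\<close>)
      also have "\<dots> \<le> ennreal K * ennreal (grad_energy (\<phi> k)) ^ q"
        using K(2)[OF \<phi>(1)[of k]] by (simp only: test_energy_eq[OF \<phi>(1)])
      also have "\<dots> = ennreal (K * grad_energy (\<phi> k) ^ q)"
        using K(1) grad_energy_nonneg by (simp add: ennreal_power ennreal_mult')
      also have "\<dots> \<le> ennreal (c k)"
        unfolding c_def using grad_energy_approx_le[OF v1 \<phi>(1) less_imp_le[OF \<phi>(3)], of k] K(1) grad_energy_nonneg[of "\<phi> k"]
        by (intro ennreal_leI mult_left_mono power_mono) simp_all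
      finally show ?thesis .
    qed
    have "c \<longlonglongrightarrow> K * (2 * grad_energy v + 2 * 0) ^ q"
      unfolding c_def by (intro tendsto_mult tendsto_power tendsto_add tendsto_const inv0)
    then have "(c \<circ> s) \<longlonglongrightarrow> K * (2 * grad_energy v + 2 * 0) ^ q" by (rule LIMSEQ_subseq_LIMSEQ[OF _ s(1)])
    then have climit: "(\<lambda>n. ennreal (c (s n))) \<longlonglongrightarrow> ennreal (K * (2 * grad_energy v + 2 * 0) ^ q)"
      unfolding comp_def by (rule tendsto_ennrealI)
    have [measurable]: "\<phi> k \<in> borel_measurable M" for k
      by (rule borel_imp_M[OF test_functions_measurable(1)[OF \<phi>(1)]])
    have "(\<integral>\<^sup>+x. ennreal (v x ^ (2 * q)) \<partial>M) = (\<integral>\<^sup>+x. liminf (\<lambda>n. ennreal (\<phi> (s n) x ^ (2 * q))) \<partial>M)"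
      by (rule nn_integral_cong_AE[OF ae])
    also have "\<dots> \<le> liminf (\<lambda>n. \<integral>\<^sup>+x. ennreal (\<phi> (s n) x ^ (2 * q)) \<partial>M)"
      by (rule nn_integral_liminf) measurable
    also have "\<dots> \<le> liminf (\<lambda>n. ennreal (c (s n)))"
      by (rule Liminf_mono) (simp add: bound)
    also have "\<dots> = ennreal (K * (2 * grad_energy v + 2 * 0) ^ q)"
      by (rule lim_imp_Liminf[OF trivial_limit_sequentially climit])
    finally show ?thesis by (simp add: power_mult_distrib mult.assoc)
  qed
  then show ?thesis using K(1) by (intro that[of "K * 2 ^ q"]) auto
qed

lemma sobolev_H10:
  assumes q: "q > 0" and dim: "CARD('d) * q + 1 \<le> 2 * q + CARD('d)"
  obtains K where "K \<ge> 0" "\<And>v. v \<in> H10 U \<Longrightarrow> integrable M (\<lambda>x. v x ^ (2 * q))"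
    "\<And>v. v \<in> H10 U \<Longrightarrow> (LINT x|M. v x ^ (2 * q)) \<le> K * grad_energy v ^ q"
proof -
  obtain K where K: "K \<ge> 0" "\<And>v. v \<in> H10 U \<Longrightarrow> (\<integral>\<^sup>+x. ennreal (v x ^ (2 * q)) \<partial>M) \<le> ennreal (K * grad_energy v ^ q)"
    using sobolev_H10_nn[OF q dim] by blast
  have nn: "0 \<le> t ^ (2 * q)" for t :: real by (simp add: power_mult)
  have int: "integrable M (\<lambda>x. v x ^ (2 * q))" if v: "v \<in> H10 U" for v
  proof (rule integrableI_nonneg)
    show "(\<lambda>x. v x ^ (2 * q)) \<in> borel_measurable M"
      using Lp2_measurable[OF H1_D(1)[OF H10_H1[OF v]]] by measurable
    show "(\<integral>\<^sup>+x. ennreal (v x ^ (2 * q)) \<partial>M) < \<infinity>"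
      using K(2)[OF v] by (simp add: le_less_trans)
  qed (simp add: nn)
  moreover have "(LINT x|M. v x ^ (2 * q)) \<le> K * grad_energy v ^ q" if v: "v \<in> H10 U" for v
  proof -
    have "ennreal (LINT x|M. v x ^ (2 * q)) \<le> ennreal (K * grad_energy v ^ q)"
      using K(2)[OF v] nn_integral_eq_integral[OF int[OF v]] by (simp add: nn)
    moreover have "0 \<le> K * grad_energy v ^ q" using K(1) grad_energy_nonneg by simp
    ultimately show ?thesis by (simp add: ennreal_le_iff)
  qed
  ultimately show ?thesis using K(1) by (intro that) auto
qed

text \<open>Each \<open>w k\<close> is a test function plus an error \<open>h k\<close> of vanishing
  energy. The embedding makes the high power of \<open>h k\<close> small, and the cell integrals of
  the test functions inherit the limit 0 because those of \<open>h k\<close> tend to 0 too.\<close>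

lemma rellich_H10:
  fixes w :: "nat \<Rightarrow> real^'d \<Rightarrow> real"
  assumes q: "q > 0" and dim: "CARD('d) * q + 1 \<le> 2 * q + CARD('d)"
    and w: "\<And>k. w k \<in> H10 U" and B: "\<And>k. grad_energy (w k) \<le> B"
    and lim: "\<And>S. S \<in> sets M \<Longrightarrow> (\<lambda>k. LINT x|M. indicator S x * w k x) \<longlonglongrightarrow> 0"
  shows "(\<lambda>k. LINT x|M. w k x ^ (2 * q)) \<longlonglongrightarrow> 0"
proof -
  \<comment> \<open>With the integral of h^2 below t^2 for t = 1 / (k + 1), the bound |h| <= t + h^2
    / t used below integrates to a multiple of t.\<close>
  define \<epsilon> where "\<epsilon> k = (1 / real (Suc k))\<^sup>2" for k
  have \<epsilon>: "\<epsilon> k > 0" "\<epsilon> k \<le> 1" for k by (auto simp: \<epsilon>_def power_le_one)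
  have inv0: "(\<lambda>k. 1 / real (Suc k)) \<longlonglongrightarrow> 0" by (rule LIMSEQ_Suc[OF lim_1_over_n])
  have eps0: "\<epsilon> \<longlonglongrightarrow> 0" using tendsto_power[OF inv0, of 2] by (simp add: \<epsilon>_def[abs_def])
  obtain \<phi> where \<phi>: "\<And>k. \<phi> k \<in> test_functions U" "\<And>k. (LINT x|M. (w k x - \<phi> k x)\<^sup>2) < \<epsilon> k"
    "\<And>k. grad_energy (\<lambda>x. w k x - \<phi> k x) < \<epsilon> k"
    by (rule H10_approx_seq[of w \<epsilon>, OF w \<epsilon>(1)], rule that)
  define h where "h k = (\<lambda>x. w k x - \<phi> k x)" for k
  have h10: "h k \<in> H10 U" for k
  proof -
    have "(\<lambda>x. w k x + - 1 * \<phi> k x) \<in> H10 U" by (intro H10_add H10_scale w test_H10 \<phi>)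
    then show ?thesis by (simp add: h_def)
  qed
  obtain K where K: "K \<ge> 0" "\<And>v. v \<in> H10 U \<Longrightarrow> integrable M (\<lambda>x. v x ^ (2 * q))"
    "\<And>v. v \<in> H10 U \<Longrightarrow> (LINT x|M. v x ^ (2 * q)) \<le> K * grad_energy v ^ q"
    using sobolev_H10[OF q dim] by blast
  have nn: "0 \<le> t ^ (2 * q)" for t :: real by (simp add: power_mult)
  have "(\<lambda>k. \<integral>\<^sup>+x. ennreal (\<phi> k x ^ (2 * q)) \<partial>lborel) \<longlonglongrightarrow> 0"
  proof (rule rellich_test[OF q dim \<phi>(1)])
    show "test_energy (\<phi> k) \<le> ennreal (2 * B + 2)" for k
      unfolding test_energy_eq[OF \<phi>(1)]
      using grad_energy_approx_le[OF H10_H1[OF w] \<phi>(1) less_imp_le[OF \<phi>(3)], of k] B[of k] \<epsilon>(2)[of k]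
      by (intro ennreal_leI) linarith
    fix j and x :: "real^'d"
    \<comment> \<open>Measurable sets of \<open>M\<close> are subsets of \<open>U\<close>, so the
      cell is cut down to \<open>U\<close>.\<close>
    let ?S = "cell j x \<inter> U"
    have S: "?S \<in> sets M" by (simp add: sets_restrict_space_iff U_lebesgue)
    have split: "(LINT y|lborel. indicator (cell j x) y * \<phi> k y)
        = (LINT y|M. indicator ?S y * w k y) - (LINT y|M. indicator ?S y * h k y)" for k
    proof -
      have "(LINT y|lborel. indicator (cell j x) y * \<phi> k y) = (LINT y|M. indicator (cell j x) y * \<phi> k y)"
      proof (rule integral_M_eq_lborel(1)[symmetric])
        show "(\<lambda>y. indicator (cell j x) y * \<phi> k y) \<in> borel_measurable borel"
          using test_functions_measurable(1)[OF \<phi>(1)[of k]] by measurable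
      qed (simp add: test_functions_outside[OF \<phi>(1)])
      also have "\<dots> = (LINT y|M. indicator ?S y * w k y - indicator ?S y * h k y)"
        by (intro Bochner_Integration.integral_cong refl) (auto simp: indicator_def h_def)
      also have "\<dots> = (LINT y|M. indicator ?S y * w k y) - (LINT y|M. indicator ?S y * h k y)"
      proof (rule Bochner_Integration.integral_diff)
        show "integrable M (\<lambda>y. indicator ?S y * w k y)" "integrable M (\<lambda>y. indicator ?S y * h k y)"
          using integrable_mult_indicator[OF S Lp2_integrable[OF H1_D(1)[OF H10_H1[OF w]]], of k]
            integrable_mult_indicator[OF S Lp2_integrable[OF H1_D(1)[OF H10_H1[OF h10]]], of k] by simp_all
      qed
      finally show ?thesis .
    qed
    have "(\<lambda>k. LINT y|M. indicator ?S y * h k y) \<longlonglongrightarrow> 0"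
    proof -
      define c where "c = (measure M (space M) + 1)"
      have bd: "norm (LINT y|M. indicator ?S y * h k y) \<le> c * (1 / real (Suc k))" for k
      proof -
        define t where "t = 1 / real (Suc k)"
        have t: "t > 0" by (simp add: t_def)
        have hL: "h k \<in> Lp 2 M" by (rule H1_D(1)[OF H10_H1[OF h10]])
        have i1: "integrable M (\<lambda>y. t + (h k y)\<^sup>2 / t)"
          using Lp2_integrable_square[OF hL] by simp
        have "norm (LINT y|M. indicator ?S y * h k y) \<le> (LINT y|M. norm (indicator ?S y * h k y))"
          by (rule integral_norm_bound)
        also have "\<dots> \<le> (LINT y|M. t + (h k y)\<^sup>2 / t)"
        proof (rule integral_mono)
          show "integrable M (\<lambda>y. norm (indicator ?S y * h k y))"
            using integrable_mult_indicator[OF S Lp2_integrable[OF hL]] by (simp add: integrable_norm)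
          fix y
          have "\<bar>h k y\<bar> \<le> t + (h k y)\<^sup>2 / t"
          proof -
            have "2 * (\<bar>h k y\<bar> * t) \<le> (h k y)\<^sup>2 + t * t"
              using sum_squares_bound[of "\<bar>h k y\<bar>" t] by (simp add: power2_eq_square[of t] mult.assoc)
            moreover have "0 \<le> \<bar>h k y\<bar> * t" using t by simp
            ultimately have "\<bar>h k y\<bar> * t \<le> t * t + (h k y)\<^sup>2" by linarith
            then show ?thesis using t by (simp add: field_simps)
          qed
          then show "norm (indicator ?S y * h k y) \<le> t + (h k y)\<^sup>2 / t"
            using t by (auto simp: indicator_def add_nonneg_nonneg)
        qed (rule i1)
        also have "\<dots> = t * measure M (space M) + (LINT y|M. (h k y)\<^sup>2) / t"
          using Lp2_integrable_square[OF hL] by simp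
        also have "\<dots> \<le> t * measure M (space M) + t\<^sup>2 / t"
          using \<phi>(2)[of k] t by (intro add_left_mono divide_right_mono) (simp_all add: h_def \<epsilon>_def t_def del: of_nat_Suc)
        also have "\<dots> = c * t" using t by (simp add: c_def power2_eq_square algebra_simps)
        finally show ?thesis by (simp only: t_def)
      qed
      show ?thesis
        by (rule Lim_null_comparison[OF _ tendsto_mult_right_zero[OF inv0, of c]]) (simp only: bd eventually_True)
    qed
    from tendsto_diff[OF lim[OF S] this]
    show "(\<lambda>k. LINT y|lborel. indicator (cell j x) y * \<phi> k y) \<longlonglongrightarrow> 0" unfolding split by simp
  qed
  moreover have "(\<integral>\<^sup>+x. ennreal (\<phi> k x ^ (2 * q)) \<partial>lborel) = ennreal (LINT x|M. \<phi> k x ^ (2 * q))" for k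
  proof -
    have "(\<integral>\<^sup>+x. ennreal (\<phi> k x ^ (2 * q)) \<partial>lborel) = (\<integral>\<^sup>+x. ennreal (\<phi> k x ^ (2 * q)) \<partial>M)"
    proof (rule nn_integral_M_eq_lborel[symmetric])
      show "(\<lambda>x. ennreal (\<phi> k x ^ (2 * q))) \<in> borel_measurable borel"
        using test_functions_measurable(1)[OF \<phi>(1)[of k]] by measurable
    qed (use q in \<open>simp add: test_functions_outside[OF \<phi>(1)] zero_power\<close>)
    also have "\<dots> = ennreal (LINT x|M. \<phi> k x ^ (2 * q))"
      by (rule nn_integral_eq_integral[OF K(2)[OF test_H10[OF \<phi>(1)]]]) (simp add: nn)
    finally show ?thesis .
  qed
  ultimately have "(\<lambda>k. ennreal (LINT x|M. \<phi> k x ^ (2 * q))) \<longlonglongrightarrow> ennreal 0" by simp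
  then have phi0: "(\<lambda>k. LINT x|M. \<phi> k x ^ (2 * q)) \<longlonglongrightarrow> 0"
    by (rule tendsto_ennrealD) (simp_all add: nn)
  have "(\<lambda>k. K * \<epsilon> k ^ q) \<longlonglongrightarrow> K * 0 ^ q" by (intro tendsto_mult tendsto_power tendsto_const eps0)
  then have h0: "(\<lambda>k. K * \<epsilon> k ^ q) \<longlonglongrightarrow> 0" using q by (simp add: zero_power)
  have bound: "norm (LINT x|M. w k x ^ (2 * q)) \<le> 2 ^ (2 * q) * (K * \<epsilon> k ^ q + (LINT x|M. \<phi> k x ^ (2 * q)))" for k
  proof -
    have pt: "w k x ^ (2 * q) \<le> 2 ^ (2 * q) * (h k x ^ (2 * q) + \<phi> k x ^ (2 * q))" for x
      using even_power_add_le[of "h k x" "\<phi> k x" q] by (simp add: h_def)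
    note i = K(2)[OF w, of k] K(2)[OF h10, of k] K(2)[OF test_H10[OF \<phi>(1)], of k]
    have "(LINT x|M. w k x ^ (2 * q)) \<le> (LINT x|M. 2 ^ (2 * q) * (h k x ^ (2 * q) + \<phi> k x ^ (2 * q)))"
      by (intro integral_mono i integrable_mult_right Bochner_Integration.integrable_add pt)
    also have "\<dots> = 2 ^ (2 * q) * ((LINT x|M. h k x ^ (2 * q)) + (LINT x|M. \<phi> k x ^ (2 * q)))"
      by (simp only: integral_mult_right_zero Bochner_Integration.integral_add[OF i(2,3)])
    also have "\<dots> \<le> 2 ^ (2 * q) * (K * \<epsilon> k ^ q + (LINT x|M. \<phi> k x ^ (2 * q)))"
    proof (intro mult_left_mono add_right_mono)
      have "grad_energy (h k) ^ q \<le> \<epsilon> k ^ q"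
        using \<phi>(3)[of k] grad_energy_nonneg by (intro power_mono) (simp_all add: h_def less_imp_le)
      then show "(LINT x|M. h k x ^ (2 * q)) \<le> K * \<epsilon> k ^ q"
        using K(3)[OF h10, of k] mult_left_mono[OF _ K(1)] by (meson order_trans)
    qed simp
    finally have "(LINT x|M. w k x ^ (2 * q)) \<le> 2 ^ (2 * q) * (K * \<epsilon> k ^ q + (LINT x|M. \<phi> k x ^ (2 * q)))" .
    moreover have "0 \<le> (LINT x|M. w k x ^ (2 * q))" by (simp add: nn)
    ultimately show ?thesis by simp
  qed
  have "(\<lambda>k. 2 ^ (2 * q) * (K * \<epsilon> k ^ q + (LINT x|M. \<phi> k x ^ (2 * q)))) \<longlonglongrightarrow> 2 ^ (2 * q) * (0 + 0)"
    by (intro tendsto_mult tendsto_add tendsto_const h0 phi0)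
  then have "(\<lambda>k. 2 ^ (2 * q) * (K * \<epsilon> k ^ q + (LINT x|M. \<phi> k x ^ (2 * q)))) \<longlonglongrightarrow> 0" by simp
  then show ?thesis by (rule Lim_null_comparison[rotated]) (simp only: bound eventually_True)
qed

end

section \<open>Symmetric matrices\<close>

lemma symmetric_inner:
  fixes B :: "real^'d^'d"
  assumes "transpose B = B"
  shows "(B *v x) \<bullet> y = (B *v y) \<bullet> x"
  by (metis assms dot_lmul_matrix inner_commute transpose_matrix_vector)

text \<open>Eigenvectors for different eigenvalues of a symmetric matrix are orthogonal, and an
  orthogonal family is finite. Finiteness is what gives \<open>Min\<close> in
  \<open>lambda_min\<close> its meaning.\<close>

lemma finite_eigenvalues:
  fixes B :: "real^'d^'d"
  assumes sym: "transpose B = B"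
  shows "finite (eigenvalues B)"
proof -
  define f where "f \<mu> = (SOME v. v \<noteq> 0 \<and> B *v v = \<mu> *\<^sub>R v)" for \<mu>
  have f: "f \<mu> \<noteq> 0" "B *v f \<mu> = \<mu> *\<^sub>R f \<mu>" if "\<mu> \<in> eigenvalues B" for \<mu>
  proof -
    have "\<exists>v. v \<noteq> 0 \<and> B *v v = \<mu> *\<^sub>R v" using that by (simp add: eigenvalues_def)
    from someI_ex[OF this] show "f \<mu> \<noteq> 0" "B *v f \<mu> = \<mu> *\<^sub>R f \<mu>" by (simp_all add: f_def)
  qed
  have orth: "f \<mu> \<bullet> f \<nu> = 0" if "\<mu> \<in> eigenvalues B" "\<nu> \<in> eigenvalues B" "\<mu> \<noteq> \<nu>" for \<mu> \<nu>
  proof -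
    have "\<mu> * (f \<mu> \<bullet> f \<nu>) = \<nu> * (f \<mu> \<bullet> f \<nu>)"
      using symmetric_inner[OF sym, of "f \<mu>" "f \<nu>"] f(2)[OF that(1)] f(2)[OF that(2)] by (simp add: inner_commute)
    then show ?thesis using that(3) by simp
  qed
  have "inj_on f (eigenvalues B)"
    by (rule inj_onI) (metis orth f(1) inner_eq_zero_iff)
  moreover have "pairwise orthogonal (f ` eigenvalues B)"
    by (auto simp: pairwise_def orthogonal_def intro: orth)
  then have "finite (f ` eigenvalues B)" by (rule pairwise_orthogonal_imp_finite)
  ultimately show ?thesis using finite_imageD by blast
qed

text \<open>A minimiser of the quadratic form on the unit sphere is an eigenvector: otherwise moving
  along the residual \<open>r\<close> would lower the Rayleigh quotient to first order. So the
  minimum is an eigenvalue and not below \<open>lambda_min B\<close>.\<close>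

lemma lambda_min_le:
  fixes B :: "real^'d^'d"
  assumes sym: "transpose B = B"
  shows "lambda_min B * (norm x)\<^sup>2 \<le> (B *v x) \<bullet> x"
proof -
  have "continuous_on (sphere 0 1) (\<lambda>x. (B *v x) \<bullet> x)"
    by (intro continuous_on_inner continuous_on_id linear_continuous_on) (simp add: matrix_vector_mul_bounded_linear)
  moreover have "axis undefined 1 \<in> sphere (0::real^'d) 1" by (simp add: norm_axis_1)
  ultimately obtain v where v: "norm v = 1" "\<And>x. norm x = 1 \<Longrightarrow> (B *v v) \<bullet> v \<le> (B *v x) \<bullet> x"
    using continuous_attains_inf[of "sphere (0::real^'d) 1" "\<lambda>x. (B *v x) \<bullet> x"]
    by (auto simp: compact_sphere)
  define \<mu> where "\<mu> = (B *v v) \<bullet> v"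
  have ge: "\<mu> * (norm x)\<^sup>2 \<le> (B *v x) \<bullet> x" for x
  proof (cases "x = 0")
    case False
    have "\<mu> \<le> (B *v ((1 / norm x) *\<^sub>R x)) \<bullet> ((1 / norm x) *\<^sub>R x)"
      unfolding \<mu>_def by (rule v(2)) (use False in simp)
    also have "\<dots> = ((B *v x) \<bullet> x) / (norm x)\<^sup>2"
      by (simp add: matrix_vector_mult_scaleR power2_eq_square)
    finally show ?thesis using False by (simp add: field_simps)
  qed simp
  define r where "r = B *v v - \<mu> *\<^sub>R v"
  define c where "c = (B *v r) \<bullet> r - \<mu> * (r \<bullet> r)"
  have c: "c \<ge> 0" using ge[of r] by (simp add: c_def power2_norm_eq_inner)
  define N where "N = r \<bullet> r"
  have *: "0 \<le> 2 * t * N + t\<^sup>2 * c" for t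
  proof -
    let ?y = "v + t *\<^sub>R r"
    have "0 \<le> (B *v ?y) \<bullet> ?y - \<mu> * (?y \<bullet> ?y)" using ge[of ?y] by (simp add: power2_norm_eq_inner)
    also have "\<dots> = ((B *v v) \<bullet> v - \<mu> * (v \<bullet> v)) + 2 * t * ((B *v v) \<bullet> r - \<mu> * (v \<bullet> r)) + t\<^sup>2 * c"
      using symmetric_inner[OF sym, of r v]
      by (simp add: matrix_vector_right_distrib matrix_vector_mult_scaleR inner_add_left inner_add_right
          c_def power2_eq_square algebra_simps inner_commute[of r v])
    also have "(B *v v) \<bullet> v - \<mu> * (v \<bullet> v) = 0"
      using v(1) by (simp add: \<mu>_def power2_norm_eq_inner[symmetric])
    also have "(B *v v) \<bullet> r - \<mu> * (v \<bullet> r) = N" by (simp add: N_def r_def inner_diff_left)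
    finally show ?thesis by simp
  qed
  have "N = 0"
  proof (rule ccontr)
    assume "N \<noteq> 0"
    then have N: "N > 0" by (simp add: N_def)
    \<comment> \<open>For this step length the linear gain 2 s N exceeds the quadratic loss s^2
      c.\<close>
    define s where "s = N / (c + 1)"
    have s: "s > 0" using N c by (simp add: s_def)
    have "0 \<le> s * (s * c - 2 * N)" using *[of "- s"] by (simp add: algebra_simps power2_eq_square)
    then have "2 * N \<le> s * c" using s by (simp add: zero_le_mult_iff)
    moreover have "s * c \<le> s * (c + 1)" using s by simp
    moreover have "s * (c + 1) = N" using c by (simp add: s_def)
    ultimately show False using N by linarith
  qed
  then have "B *v v = \<mu> *\<^sub>R v" by (simp add: N_def r_def)
  then have "\<mu> \<in> eigenvalues B" using v(1) unfolding eigenvalues_def by (intro CollectI exI[of _ v]) auto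
  then have "lambda_min B \<le> \<mu>" unfolding lambda_min_def by (rule Min_le[OF finite_eigenvalues[OF sym]])
  then have "lambda_min B * (norm x)\<^sup>2 \<le> \<mu> * (norm x)\<^sup>2" by (intro mult_right_mono) auto
  then show ?thesis using ge[of x] by linarith
qed

text \<open>The infimum of the smallest eigenvalues is an extended real; a positive real number
  strictly below it serves as ellipticity constant.\<close>

lemma assm_ELL_coercive:
  fixes A :: "real^'d \<Rightarrow> real^'d^'d"
  assumes "assm_ELL \<Omega> T0 A"
  obtains \<mu> where "\<mu> > 0" "\<And>x \<xi>. x \<in> \<Omega> \<Longrightarrow> \<mu> * (norm \<xi>)\<^sup>2 \<le> (A x *v \<xi>) \<bullet> \<xi>"
proof -
  have sym: "\<And>x. x \<in> \<Omega> \<Longrightarrow> transpose (A x) = A x" and pos: "0 < (INF x\<in>\<Omega>. ereal (lambda_min (A x)))"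
    using assms by (auto simp: assm_ELL_def Let_def)
  obtain \<mu> where \<mu>: "0 < ereal \<mu>" "ereal \<mu> < (INF x\<in>\<Omega>. ereal (lambda_min (A x)))"
    using ereal_dense2[OF pos] by blast
  show ?thesis
  proof
    show "\<mu> > 0" using \<mu>(1) by simp
    fix x and \<xi> :: "real^'d" assume x: "x \<in> \<Omega>"
    have "ereal \<mu> \<le> ereal (lambda_min (A x))"
      using less_le_trans[OF \<mu>(2) INF_lower[OF x]] by (simp add: less_imp_le)
    then have "\<mu> * (norm \<xi>)\<^sup>2 \<le> lambda_min (A x) * (norm \<xi>)\<^sup>2" by (intro mult_right_mono) auto
    then show "\<mu> * (norm \<xi>)\<^sup>2 \<le> (A x *v \<xi>) \<bullet> \<xi>" using lambda_min_le[OF sym[OF x]] by (rule order_trans)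
  qed
qed

section \<open>Growth of the reaction term\<close>

text \<open>\<open>v\<close> is the limit of its roundings down to multiples of 1 / (k + 1). These
  take countably many values, so their composition with \<open>g\<close> is measurable, and
  continuity in the second argument passes to the limit.\<close>

lemma Caratheodory_measurable:
  fixes g :: "'a \<Rightarrow> real \<Rightarrow> real"
  assumes meas: "\<And>\<xi>. (\<lambda>x. g x \<xi>) \<in> borel_measurable M"
    and cont: "\<And>x \<xi>. x \<in> space M \<Longrightarrow> isCont (g x) \<xi>" and v: "v \<in> borel_measurable M"
  shows "(\<lambda>x. g x (v x)) \<in> borel_measurable M"
proof (rule borel_measurable_LIMSEQ_real)
  note [measurable] = v
  show "(\<lambda>x. g x (real_of_int \<lfloor>real (Suc k) * v x\<rfloor> / real (Suc k))) \<in> borel_measurable M" for k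
    by (rule measurable_compose_countable[of "\<lambda>i x. g x (real_of_int i / real (Suc k))" M borel "\<lambda>x. \<lfloor>real (Suc k) * v x\<rfloor>"])
      (use meas in measurable)
  fix x assume x: "x \<in> space M"
  have inv0: "(\<lambda>k. 1 / real (Suc k)) \<longlonglongrightarrow> 0" by (rule LIMSEQ_Suc[OF lim_1_over_n])
  have "(\<lambda>k. real_of_int \<lfloor>real (Suc k) * v x\<rfloor> / real (Suc k) - v x) \<longlonglongrightarrow> 0"
  proof (rule Lim_null_comparison[OF _ inv0], rule always_eventually, rule allI)
    fix k
    define N where "N = real (Suc k)"
    have N: "N > 0" by (simp add: N_def)
    have "real_of_int \<lfloor>N * v x\<rfloor> / N - v x = (real_of_int \<lfloor>N * v x\<rfloor> - N * v x) / N"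
      using N by (simp add: field_simps)
    moreover have "\<bar>real_of_int \<lfloor>N * v x\<rfloor> - N * v x\<bar> \<le> 1" by linarith
    ultimately show "norm (real_of_int \<lfloor>real (Suc k) * v x\<rfloor> / real (Suc k) - v x) \<le> 1 / real (Suc k)"
      unfolding N_def[symmetric] using N by (simp add: divide_right_mono)
  qed
  then have "(\<lambda>k. real_of_int \<lfloor>real (Suc k) * v x\<rfloor> / real (Suc k)) \<longlonglongrightarrow> v x" by (simp only: LIM_zero_iff)
  then show "(\<lambda>k. g x (real_of_int \<lfloor>real (Suc k) * v x\<rfloor> / real (Suc k))) \<longlonglongrightarrow> g x (v x)"
    by (rule isCont_tendsto_compose[OF cont[OF x]])
qed

lemma one_plus_power_le:
  fixes t :: real
  assumes "0 \<le> t" "i \<le> j"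
  shows "1 + t ^ i \<le> 2 * (1 + t) ^ j"
proof -
  have "t ^ i \<le> (1 + t) ^ i" using assms by (intro power_mono) auto
  also have "\<dots> \<le> (1 + t) ^ j" using assms by (intro power_increasing) auto
  finally have "t ^ i \<le> (1 + t) ^ j" .
  moreover have "1 \<le> (1 + t) ^ j" using assms by (intro one_le_power) auto
  ultimately show ?thesis by linarith
qed

text \<open>The second derivative grows at most with the power n - 2 <= k and gives the Lipschitz
  constant by the mean value theorem, the first with n - 1 <= k + 1. The factor 2 comes from
  replacing 1 + t^i by 2 (1 + t)^j.\<close>

lemma reaction_growth:
  assumes CAR: "assm_CAR \<Omega> b" and x: "x \<in> \<Omega>" and n: "n \<ge> 2" "n \<le> k + 2" and R: "R > 0"
    and growth: "\<And>\<xi> j. j \<le> n \<Longrightarrow> \<bar>(deriv ^^ j) (b x) \<xi>\<bar> \<le> R * (1 + \<bar>\<xi>\<bar> ^ (n - j))"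
  shows "(b x has_real_derivative deriv (b x) \<xi>) (at \<xi>)"
    and "\<bar>deriv (b x) \<xi>\<bar> \<le> 2 * R * (1 + \<bar>\<xi>\<bar>) ^ (k + 1)"
    and "\<bar>deriv (b x) \<xi> - deriv (b x) \<eta>\<bar> \<le> 2 * R * (1 + \<bar>\<xi>\<bar> + \<bar>\<eta>\<bar>) ^ k * \<bar>\<xi> - \<eta>\<bar>"
proof -
  have d: "((deriv ^^ j) (b x) has_real_derivative (deriv ^^ Suc j) (b x) \<xi>) (at \<xi>)" for j \<xi>
    using CAR x DERIV_deriv_iff_real_differentiable by (simp add: assm_CAR_def)
  show "(b x has_real_derivative deriv (b x) \<xi>) (at \<xi>)" for \<xi> using d[of 0] by simp
  have d2: "(deriv (b x) has_real_derivative deriv (deriv (b x)) \<xi>) (at \<xi>)" for \<xi> using d[of 1] by simp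
  have "\<bar>deriv (b x) \<xi>\<bar> \<le> R * (1 + \<bar>\<xi>\<bar> ^ (n - 1))" using growth[of 1 \<xi>] n by simp
  also have "\<dots> \<le> R * (2 * (1 + \<bar>\<xi>\<bar>) ^ (k + 1))"
    using n R by (intro mult_left_mono one_plus_power_le) auto
  finally show "\<bar>deriv (b x) \<xi>\<bar> \<le> 2 * R * (1 + \<bar>\<xi>\<bar>) ^ (k + 1)" by simp
  have g2: "\<bar>deriv (deriv (b x)) \<zeta>\<bar> \<le> 2 * R * (1 + \<bar>\<xi>\<bar> + \<bar>\<eta>\<bar>) ^ k" if "\<bar>\<zeta>\<bar> \<le> \<bar>\<xi>\<bar> + \<bar>\<eta>\<bar>" for \<zeta> \<xi> \<eta>
  proof -
    have "\<bar>deriv (deriv (b x)) \<zeta>\<bar> \<le> R * (1 + \<bar>\<zeta>\<bar> ^ (n - 2))" using growth[of 2 \<zeta>] n by (simp add: numeral_2_eq_2)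
    also have "\<dots> \<le> R * (2 * (1 + \<bar>\<zeta>\<bar>) ^ k)"
      using n R by (intro mult_left_mono one_plus_power_le) auto
    also have "\<dots> \<le> R * (2 * (1 + \<bar>\<xi>\<bar> + \<bar>\<eta>\<bar>) ^ k)"
      using that R by (intro mult_left_mono power_mono) auto
    finally show ?thesis by simp
  qed
  have *: "\<bar>deriv (b x) \<xi> - deriv (b x) \<eta>\<bar> \<le> 2 * R * (1 + \<bar>\<xi>\<bar> + \<bar>\<eta>\<bar>) ^ k * \<bar>\<xi> - \<eta>\<bar>" if less: "\<xi> < \<eta>" for \<xi> \<eta>
  proof -
    obtain \<zeta> where z: "\<xi> < \<zeta>" "\<zeta> < \<eta>" "deriv (b x) \<eta> - deriv (b x) \<xi> = (\<eta> - \<xi>) * deriv (deriv (b x)) \<zeta>"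
      using MVT2[OF less, of "deriv (b x)" "deriv (deriv (b x))"] d2 by blast
    then have "\<bar>deriv (b x) \<xi> - deriv (b x) \<eta>\<bar> = \<bar>deriv (deriv (b x)) \<zeta>\<bar> * \<bar>\<xi> - \<eta>\<bar>"
      by (subst abs_minus_commute) (simp add: abs_mult abs_minus_commute mult.commute)
    also have "\<dots> \<le> 2 * R * (1 + \<bar>\<xi>\<bar> + \<bar>\<eta>\<bar>) ^ k * \<bar>\<xi> - \<eta>\<bar>"
      using z by (intro mult_right_mono g2) auto
    finally show ?thesis .
  qed
  show "\<bar>deriv (b x) \<xi> - deriv (b x) \<eta>\<bar> \<le> 2 * R * (1 + \<bar>\<xi>\<bar> + \<bar>\<eta>\<bar>) ^ k * \<bar>\<xi> - \<eta>\<bar>"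
    using *[of \<xi> \<eta>] *[of \<eta> \<xi>] by (cases \<xi> \<eta> rule: linorder_cases) (simp_all add: abs_minus_commute ac_simps)
qed

section \<open>Nested finite element spaces\<close>

text \<open>The only new vertex is the midpoint of an edge, which lies in the convex hull.
  Nonemptiness of the vertex list, on which \<open>hd\<close> and \<open>last\<close> depend, is
  passed on to the children.\<close>

lemma children_simp_set:
  assumes "fst T \<noteq> []" "T' \<in> children T"
  shows "fst T' \<noteq> []" "simp_set T' \<subseteq> simp_set T"
proof -
  let ?zs = "fst T" and ?mid = "midpoint (hd (fst T)) (last (fst T))"
  have mid: "?mid \<in> convex hull (set ?zs)"
    using closed_segment_subset_convex_hull[OF hull_inc hull_inc, of "hd ?zs" "set ?zs" "last ?zs"]
      midpoint_in_closed_segment assms(1) by auto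
  have sub: "set ?zs \<subseteq> convex hull (set ?zs)" by (rule hull_subset)
  let ?inner = "butlast (tl ?zs)"
  have inner: "set ?inner \<subseteq> set ?zs"
    using in_set_butlastD[of _ "tl ?zs"] list.set_sel(2)[OF assms(1)] by blast
  have td: "set (take (snd T) ?inner) \<subseteq> set ?zs" "set (drop (snd T) ?inner) \<subseteq> set ?zs"
    using inner set_take_subset[of "snd T" ?inner] set_drop_subset[of "snd T" ?inner] by blast+
  have ends: "hd ?zs \<in> set ?zs" "last ?zs \<in> set ?zs" using assms(1) by simp_all
  consider "fst T' = hd ?zs # ?mid # ?inner"
    | "fst T' = last ?zs # ?mid # take (snd T) ?inner @ rev (drop (snd T) ?inner)"
    using assms(2) by (auto simp: children_def Let_def)
  then have "set (fst T') \<subseteq> insert ?mid (set ?zs)"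
  proof cases
    case 1
    then have eq: "set (fst T') = insert (hd ?zs) (insert ?mid (set ?inner))" by simp
    show ?thesis unfolding eq insert_subset using inner ends by (simp add: subset_insertI2)
  next
    case 2
    then have "set (fst T') = insert (last ?zs) (insert ?mid (set (take (snd T) ?inner) \<union> set (drop (snd T) ?inner)))"
      by (simp only: list.set set_append set_rev)
    then show ?thesis using td ends by (simp only: insert_subset Un_subset_iff subset_insertI2 insert_iff simp_thms)
  qed
  then have "set (fst T') \<subseteq> convex hull (set ?zs)" using mid sub by blast
  then show "simp_set T' \<subseteq> simp_set T" unfolding simp_set_def
    by (intro hull_minimal convex_convex_hull)
  show "fst T' \<noteq> []" using assms(2) by (auto simp: children_def Let_def)
qed

text \<open>The meshes between two conforming ones may fail to be conforming, so the invariant is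
  limited to nonempty vertex lists and inclusion in an element of the initial mesh.\<close>

lemma bisections_simp_set:
  assumes "bisect_step\<^sup>*\<^sup>* M M'" "\<And>T. T \<in> M \<Longrightarrow> fst T \<noteq> []"
  shows "\<forall>T'\<in>M'. fst T' \<noteq> [] \<and> (\<exists>T\<in>M. simp_set T' \<subseteq> simp_set T)"
  using assms(1)
proof (induction rule: rtranclp_induct)
  case base
  then show ?case using assms(2) by blast
next
  case (step N N')
  obtain T where T: "T \<in> N" "N' = (N - {T}) \<union> children T" using step(2) by (auto simp: bisect_step_def)
  show ?case
  proof
    fix T' assume "T' \<in> N'"
    then consider "T' \<in> N" | "T' \<in> children T" using T(2) by blast
    then show "fst T' \<noteq> [] \<and> (\<exists>T\<in>M. simp_set T' \<subseteq> simp_set T)"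
    proof cases
      case 1 then show ?thesis using step(3) by blast
    next
      case 2
      obtain S where S: "S \<in> M" "simp_set T \<subseteq> simp_set S" and ne: "fst T \<noteq> []" using step(3) T(1) by blast
      show ?thesis using children_simp_set[OF ne 2] S by blast
    qed
  qed
qed

lemma simp_set_lebesgue: "simp_set T \<in> sets lebesgue"
proof -
  have "compact (simp_set T)" unfolding simp_set_def by (intro finite_imp_compact_convex_hull) simp
  then show ?thesis by (simp add: compact_imp_closed)
qed

lemma fem_space_mono:
  assumes "N \<in> nvb_refinements \<Omega> M" "conforming_mesh \<Omega> M"
  shows "fem_space \<Omega> m M \<subseteq> fem_space \<Omega> m N"
proof
  fix v assume v: "v \<in> fem_space \<Omega> m M"
  have ne: "fst T \<noteq> []" if "T \<in> M" for T
    using assms(2) that by (auto simp: conforming_mesh_def is_tsimplex_def)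
  have bis: "bisect_step\<^sup>*\<^sup>* M N" using assms(1) by (simp add: nvb_refinements_def)
  have N: "\<forall>T'\<in>N. \<exists>T\<in>M. simp_set T' \<subseteq> simp_set T"
    using bisections_simp_set[OF bis ne] by blast
  have "\<exists>p\<in>polys m. AE x in lebesgue_on (simp_set T'). v x = p x" if T': "T' \<in> N" for T'
  proof -
    obtain T where T: "T \<in> M" "simp_set T' \<subseteq> simp_set T" using N T' by blast
    obtain p where p: "p \<in> polys m" "AE x in lebesgue_on (simp_set T). v x = p x"
      using v T(1) by (auto simp: fem_space_def)
    have "AE x in lebesgue. x \<in> simp_set T \<longrightarrow> v x = p x"
      using p(2) simp_set_lebesgue[of T] by (simp add: AE_restrict_space_iff)
    then have "AE x in lebesgue. x \<in> simp_set T' \<longrightarrow> v x = p x" by eventually_elim (use T(2) in blast)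
    then have "AE x in lebesgue_on (simp_set T'). v x = p x"
      using simp_set_lebesgue[of T'] by (simp add: AE_restrict_space_iff)
    then show ?thesis using p(1) by blast
  qed
  then show "v \<in> fem_space \<Omega> m N" using v by (simp add: fem_space_def)
qed

lemma polys_add:
  assumes "p \<in> polys m" "r \<in> polys m"
  shows "(\<lambda>x. p x + r x) \<in> polys m"
proof -
  obtain c c' where "p = (\<lambda>x. \<Sum>\<alpha> | sum \<alpha> UNIV \<le> m. c \<alpha> * (\<Prod>i\<in>UNIV. (x $ i) ^ \<alpha> i))"
    "r = (\<lambda>x. \<Sum>\<alpha> | sum \<alpha> UNIV \<le> m. c' \<alpha> * (\<Prod>i\<in>UNIV. (x $ i) ^ \<alpha> i))"
    using assms by (auto simp: polys_def)
  then have "(\<lambda>x. p x + r x) = (\<lambda>x. \<Sum>\<alpha> | sum \<alpha> UNIV \<le> m. (c \<alpha> + c' \<alpha>) * (\<Prod>i\<in>UNIV. (x $ i) ^ \<alpha> i))"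
    by (simp add: distrib_right sum.distrib)
  then show ?thesis unfolding polys_def mem_Collect_eq by (rule exI[of _ "\<lambda>\<alpha>. c \<alpha> + c' \<alpha>"])
qed

lemma polys_scale:
  assumes "p \<in> polys m"
  shows "(\<lambda>x. s * p x) \<in> polys m"
proof -
  obtain c where "p = (\<lambda>x. \<Sum>\<alpha> | sum \<alpha> UNIV \<le> m. c \<alpha> * (\<Prod>i\<in>UNIV. (x $ i) ^ \<alpha> i))"
    using assms by (auto simp: polys_def)
  then have "(\<lambda>x. s * p x) = (\<lambda>x. \<Sum>\<alpha> | sum \<alpha> UNIV \<le> m. (s * c \<alpha>) * (\<Prod>i\<in>UNIV. (x $ i) ^ \<alpha> i))"
    by (simp add: sum_distrib_left mult.assoc)
  then show ?thesis unfolding polys_def mem_Collect_eq by (rule exI[of _ "\<lambda>\<alpha>. s * c \<alpha>"])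
qed

section \<open>The bilinear form and the load functional\<close>

lemma fem_space_add:
  assumes b: "bounded_open \<Omega>" and v: "v \<in> fem_space \<Omega> m M" and w: "w \<in> fem_space \<Omega> m M"
  shows "(\<lambda>x. v x + w x) \<in> fem_space \<Omega> m M"
proof -
  interpret bounded_open \<Omega> by (rule b)
  have "\<exists>p\<in>polys m. AE x in lebesgue_on (simp_set T). v x + w x = p x" if T: "T \<in> M" for T
  proof -
    obtain p where p: "p \<in> polys m" "AE x in lebesgue_on (simp_set T). v x = p x"
      using v T by (auto simp: fem_space_def)
    obtain r where r: "r \<in> polys m" "AE x in lebesgue_on (simp_set T). w x = r x"
      using w T by (auto simp: fem_space_def)
    have "AE x in lebesgue_on (simp_set T). v x + w x = p x + r x" using p(2) r(2) by eventually_elim simp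
    then show ?thesis by (rule bexI[OF _ polys_add[OF p(1) r(1)]])
  qed
  moreover have "(\<lambda>x. v x + w x) \<in> H10 \<Omega>" using v w by (intro H10_add) (simp_all add: fem_space_def)
  ultimately show ?thesis by (simp add: fem_space_def)
qed

lemma fem_space_scale:
  assumes b: "bounded_open \<Omega>" and v: "v \<in> fem_space \<Omega> m M"
  shows "(\<lambda>x. c * v x) \<in> fem_space \<Omega> m M"
proof -
  interpret bounded_open \<Omega> by (rule b)
  have "\<exists>p\<in>polys m. AE x in lebesgue_on (simp_set T). c * v x = p x" if T: "T \<in> M" for T
  proof -
    obtain p where p: "p \<in> polys m" "AE x in lebesgue_on (simp_set T). v x = p x"
      using v T by (auto simp: fem_space_def)
    have "AE x in lebesgue_on (simp_set T). c * v x = c * p x" using p(2) by eventually_elim simp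
    then show ?thesis by (rule bexI[OF _ polys_scale[OF p(1)]])
  qed
  moreover have "(\<lambda>x. c * v x) \<in> H10 \<Omega>" using v by (intro H10_scale) (simp add: fem_space_def)
  ultimately show ?thesis by (simp add: fem_space_def)
qed

text \<open>An instance of the abstract inequality for semidefinite forms, applied to the pointwise
  norms of \<open>f\<close> and \<open>g\<close> as real L^2 functions.\<close>

lemma Lp2_Cauchy_Schwarz:
  fixes f g :: "'a \<Rightarrow> 'b::euclidean_space"
  assumes f: "f \<in> Lp 2 M" and g: "g \<in> Lp 2 M"
  shows "\<bar>LINT x|M. f x \<bullet> g x\<bar> \<le> sqrt (LINT x|M. (norm (f x))\<^sup>2) * sqrt (LINT x|M. (norm (g x))\<^sup>2)"
proof -
  let ?f = "\<lambda>x. norm (f x)" and ?g = "\<lambda>x. norm (g x)"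
  have norms: "?f \<in> Lp 2 M" "?g \<in> Lp 2 M" using f g by (auto simp: Lp2_iff)
  interpret L2: psd_form "Lp 2 M :: ('a \<Rightarrow> real) set" "\<lambda>v w. LINT x|M. v x * w x"
  proof
    show "(Lp 2 M :: ('a \<Rightarrow> real) set) \<noteq> {}" using norms by auto
    fix v w y :: "'a \<Rightarrow> real" and c :: real
    assume v: "v \<in> Lp 2 M"
    show "(\<lambda>x. c * v x) \<in> Lp 2 M" by (rule Lp2_scale_real[OF v])
    show "0 \<le> (LINT x|M. v x * v x)" by (intro integral_nonneg_AE AE_I2) simp
    show "(LINT x|M. c * v x * y x) = c * (LINT x|M. v x * y x)" by (simp add: mult.assoc)
    assume w: "w \<in> Lp 2 M"
    show "(\<lambda>x. v x + w x) \<in> Lp 2 M" by (rule Lp2_add(1)[OF v w])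
    show "(LINT x|M. v x * w x) = (LINT x|M. w x * v x)" by (simp add: mult.commute)
    assume y: "y \<in> Lp 2 M"
    show "(LINT x|M. (v x + w x) * y x) = (LINT x|M. v x * y x) + (LINT x|M. w x * y x)"
      unfolding distrib_right by (intro Bochner_Integration.integral_add Lp2_mult v w y)
  qed
  have "\<bar>LINT x|M. f x \<bullet> g x\<bar> \<le> (LINT x|M. \<bar>f x \<bullet> g x\<bar>)" by (rule integral_abs_bound)
  also have "\<dots> \<le> (LINT x|M. ?f x * ?g x)"
    by (intro integral_mono integrable_abs Lp2_inner f g Lp2_mult norms Cauchy_Schwarz_ineq2)
  also have "\<dots> \<le> sqrt (LINT x|M. (?f x)\<^sup>2) * sqrt (LINT x|M. (?g x)\<^sup>2)"
    using L2.Cauchy_Schwarz[OF norms] by (simp add: L2.nrm_def power2_eq_square)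
  finally show ?thesis .
qed

context bounded_open
begin

text \<open>Expanded into entries: each entry of \<open>A\<close> is essentially bounded, so every
  summand is a product of two square integrable functions.\<close>

lemma Linf_matrix_integrable:
  fixes A :: "real^'d \<Rightarrow> real^'d^'d"
  assumes A: "A \<in> Linf M" and G: "G \<in> Lp 2 M" and H: "H \<in> Lp 2 M"
  shows "integrable M (\<lambda>x. (A x *v G x) \<bullet> H x)"
proof -
  obtain C where C: "AE x in M. norm (A x) \<le> C" and Am: "A \<in> borel_measurable M" using A by (auto simp: Linf_def)
  have Aij: "(\<lambda>x. A x $ i $ j) \<in> borel_measurable M" for i j
  proof -
    have "(\<lambda>B::real^'d^'d. B $ i $ j) \<in> borel_measurable borel"
      by (intro borel_measurable_continuous_onI continuous_intros)
    from measurable_compose[OF Am this] show ?thesis .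
  qed
  have Lij: "integrable M (\<lambda>x. A x $ i $ j * G x $ j * H x $ i)" for i j
  proof (rule Lp2_mult[OF _ Lp2_component[OF H]])
    note g = Lp2_component[OF G, of j]
    note [measurable] = Aij Lp2_measurable[OF g]
    have "integrable M (\<lambda>x. (norm (A x $ i $ j * G x $ j))\<^sup>2)"
    proof (rule Bochner_Integration.integrable_bound[OF integrable_mult_right[OF Lp2_integrable_square[OF g], of "C\<^sup>2"]])
      show "AE x in M. norm ((norm (A x $ i $ j * G x $ j))\<^sup>2) \<le> norm (C\<^sup>2 * (norm (G x $ j))\<^sup>2)"
        using C
      proof eventually_elim
        case (elim x)
        have "\<bar>A x $ i $ j\<bar> \<le> C"
          using component_le_norm_cart[of "A x $ i" j] Finite_Cartesian_Product.norm_nth_le[of "A x" i] elim by linarith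
        then have "\<bar>A x $ i $ j\<bar>\<^sup>2 \<le> C\<^sup>2" by (rule power_mono) simp
        then have "(A x $ i $ j)\<^sup>2 * (G x $ j)\<^sup>2 \<le> C\<^sup>2 * (G x $ j)\<^sup>2" by (intro mult_right_mono) simp_all
        then show ?case by (simp add: power_mult_distrib abs_mult)
      qed
    qed measurable
    then show "(\<lambda>x. A x $ i $ j * G x $ j) \<in> Lp 2 M" unfolding Lp2_iff by simp
  qed
  have "(A x *v G x) \<bullet> H x = (\<Sum>i\<in>UNIV. \<Sum>j\<in>UNIV. A x $ i $ j * G x $ j * H x $ i)" for x
    by (simp add: inner_vec_def matrix_vector_mult_def sum_distrib_right)
  then show ?thesis by (simp only:) (intro Bochner_Integration.integrable_sum Lij)
qed

text \<open>The chosen weak gradients respect linear operations almost everywhere only, so the form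
  is evaluated with another representative \<open>G\<close>.\<close>

lemma a_form_cong:
  fixes A :: "real^'d \<Rightarrow> real^'d^'d"
  assumes A: "A \<in> Linf M" and v: "v \<in> H1 U" and w: "w \<in> H1 U" and G: "G \<in> Lp 2 M"
    and ae: "AE x in M. wgrad U v x = G x"
  shows "a_form U A v w = (LINT x|M. (A x *v G x) \<bullet> wgrad U w x)"
  unfolding a_form_def
proof (rule integral_cong_AE)
  show "(\<lambda>x. (A x *v wgrad U v x) \<bullet> wgrad U w x) \<in> borel_measurable M"
    using Linf_matrix_integrable[OF A H1_D(2)[OF v] H1_D(2)[OF w]] by simp
  show "(\<lambda>x. (A x *v G x) \<bullet> wgrad U w x) \<in> borel_measurable M"
    using Linf_matrix_integrable[OF A G H1_D(2)[OF w]] by simp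
  show "AE x in M. (A x *v wgrad U v x) \<bullet> wgrad U w x = (A x *v G x) \<bullet> wgrad U w x"
    using ae by eventually_elim simp
qed

lemma a_form_psd:
  fixes A :: "real^'d \<Rightarrow> real^'d^'d"
  assumes A: "A \<in> Linf M" and sym: "\<And>x. x \<in> U \<Longrightarrow> transpose (A x) = A x"
    and \<mu>: "\<mu> > 0" "\<And>x \<xi>. x \<in> U \<Longrightarrow> \<mu> * (norm \<xi>)\<^sup>2 \<le> (A x *v \<xi>) \<bullet> \<xi>"
  shows "psd_form (H10 U) (a_form U A)" and "v \<in> H10 U \<Longrightarrow> \<mu> * grad_energy v \<le> a_form U A v v"
proof -
  show coerc: "\<mu> * grad_energy v \<le> a_form U A v v" if v: "v \<in> H10 U" for v
  proof -
    note g = H1_D(2)[OF H10_H1[OF v]]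
    have "(LINT x|M. \<mu> * (norm (wgrad U v x))\<^sup>2) \<le> a_form U A v v"
      unfolding a_form_def
      by (rule integral_mono[OF integrable_mult_right[OF Lp2_integrable_square[OF g]] Linf_matrix_integrable[OF A g g]])
        (use \<mu>(2) in simp)
    then show ?thesis by (simp add: grad_energy_def)
  qed
  show "psd_form (H10 U) (a_form U A)"
  proof
    show "H10 U \<noteq> {}" using test_H10[OF zero_test_function] by auto
    fix v w y and c :: real
    assume v: "v \<in> H10 U"
    show "(\<lambda>x. c * v x) \<in> H10 U" by (rule H10_scale[OF v])
    show "0 \<le> a_form U A v v"
      using coerc[OF v] \<mu>(1) grad_energy_nonneg[of v] by (smt (verit) mult_nonneg_nonneg)
    assume w: "w \<in> H10 U"
    show "(\<lambda>x. v x + w x) \<in> H10 U" by (rule H10_add[OF v w])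
    show "a_form U A v w = a_form U A w v"
      unfolding a_form_def by (rule Bochner_Integration.integral_cong[OF refl], rule symmetric_inner, rule sym) simp
    assume y: "y \<in> H10 U"
    note 1 = H10_H1[OF v] H10_H1[OF w] H10_H1[OF y]
    have "a_form U A (\<lambda>x. v x + w x) y = (LINT x|M. (A x *v (wgrad U v x + wgrad U w x)) \<bullet> wgrad U y x)"
      by (rule a_form_cong[OF A H1_add(1)[OF 1(1,2)] 1(3) Lp2_add(1)[OF H1_D(2)[OF 1(1)] H1_D(2)[OF 1(2)]] H1_add(2)[OF 1(1,2)]])
    then show "a_form U A (\<lambda>x. v x + w x) y = a_form U A v y + a_form U A w y"
      using Linf_matrix_integrable[OF A H1_D(2)[OF 1(1)] H1_D(2)[OF 1(3)]] Linf_matrix_integrable[OF A H1_D(2)[OF 1(2)] H1_D(2)[OF 1(3)]]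
      by (simp add: matrix_vector_right_distrib inner_add_left a_form_def)
  next
    fix v y and c :: real
    assume v: "v \<in> H10 U" and y: "y \<in> H10 U"
    note 1 = H10_H1[OF v] H10_H1[OF y]
    have "a_form U A (\<lambda>x. c * v x) y = (LINT x|M. (A x *v (c *\<^sub>R wgrad U v x)) \<bullet> wgrad U y x)"
      by (rule a_form_cong[OF A H1_scale(1)[OF 1(1)] 1(2) Lp2_scale[OF H1_D(2)[OF 1(1)]] H1_scale(2)[OF 1(1)]])
    then show "a_form U A (\<lambda>x. c * v x) y = c * a_form U A v y"
      by (simp add: matrix_vector_mult_scaleR a_form_def)
  qed
qed

lemma load_add:
  assumes f: "f \<in> Lp 2 M" and ff: "ff \<in> Lp 2 M" and v: "v \<in> H10 U" and w: "w \<in> H10 U"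
  shows "load U f ff (\<lambda>x. v x + w x) = load U f ff v + load U f ff w"
proof -
  note 1 = H10_H1[OF v] H10_H1[OF w]
  note s = H1_add[OF 1]
  have "(LINT x|M. ff x \<bullet> wgrad U (\<lambda>x. v x + w x) x) = (LINT x|M. ff x \<bullet> (wgrad U v x + wgrad U w x))"
  proof (rule integral_cong_AE)
    show "(\<lambda>x. ff x \<bullet> wgrad U (\<lambda>x. v x + w x) x) \<in> borel_measurable M"
      using Lp2_inner[OF ff H1_D(2)[OF s(1)]] by simp
    show "(\<lambda>x. ff x \<bullet> (wgrad U v x + wgrad U w x)) \<in> borel_measurable M"
      using Lp2_inner[OF ff Lp2_add(1)[OF H1_D(2)[OF 1(1)] H1_D(2)[OF 1(2)]]] by simp
    show "AE x in M. ff x \<bullet> wgrad U (\<lambda>x. v x + w x) x = ff x \<bullet> (wgrad U v x + wgrad U w x)"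
      using s(2) by eventually_elim simp
  qed
  then show ?thesis
    using Lp2_inner[OF ff H1_D(2)[OF 1(1)]] Lp2_inner[OF ff H1_D(2)[OF 1(2)]]
      Lp2_mult[OF f H1_D(1)[OF 1(1)]] Lp2_mult[OF f H1_D(1)[OF 1(2)]]
    by (simp add: load_def inner_add_right distrib_left)
qed

text \<open>The case q = 1 of the embedding bounds the L^2 norm by the gradient; Cauchy-Schwarz
  treats both parts of the functional.\<close>

lemma load_bound:
  assumes f: "f \<in> Lp 2 M" and ff: "ff \<in> Lp 2 M"
  obtains C where "C \<ge> 0" "\<And>v. v \<in> H10 U \<Longrightarrow> \<bar>load U f ff v\<bar> \<le> C * sqrt (grad_energy v)"
proof -
  obtain K where K: "K \<ge> 0" "\<And>v. v \<in> H10 U \<Longrightarrow> (LINT x|M. v x ^ (2 * 1)) \<le> K * grad_energy v ^ 1"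
  proof (rule sobolev_H10[of 1])
    fix K :: real
    assume "0 \<le> K" "\<And>v. v \<in> H10 U \<Longrightarrow> (LINT x|M. v x ^ (2 * 1)) \<le> K * grad_energy v ^ 1"
    then show thesis by (rule that)
  qed simp_all
  define C where "C = sqrt (LINT x|M. (norm (f x))\<^sup>2) * sqrt K + sqrt (LINT x|M. (norm (ff x))\<^sup>2)"
  have "\<bar>load U f ff v\<bar> \<le> C * sqrt (grad_energy v)" if v: "v \<in> H10 U" for v
  proof -
    note 1 = H10_H1[OF v]
    have "(LINT x|M. (norm (v x))\<^sup>2) \<le> K * grad_energy v" using K(2)[OF v] by simp
    from real_sqrt_le_mono[OF this]
    have le: "sqrt (LINT x|M. (norm (v x))\<^sup>2) \<le> sqrt K * sqrt (grad_energy v)"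
      by (simp only: real_sqrt_mult)
    have "\<bar>LINT x|M. f x \<bullet> v x\<bar> \<le> sqrt (LINT x|M. (norm (f x))\<^sup>2) * sqrt (LINT x|M. (norm (v x))\<^sup>2)"
      by (rule Lp2_Cauchy_Schwarz[OF f H1_D(1)[OF 1]])
    also have "\<dots> \<le> sqrt (LINT x|M. (norm (f x))\<^sup>2) * (sqrt K * sqrt (grad_energy v))"
      by (rule mult_left_mono[OF le]) simp
    finally have "\<bar>LINT x|M. f x * v x\<bar> \<le> sqrt (LINT x|M. (norm (f x))\<^sup>2) * (sqrt K * sqrt (grad_energy v))"
      by (simp only: inner_real_def)
    moreover have "\<bar>LINT x|M. ff x \<bullet> wgrad U v x\<bar> \<le> sqrt (LINT x|M. (norm (ff x))\<^sup>2) * sqrt (grad_energy v)"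
      unfolding grad_energy_def by (rule Lp2_Cauchy_Schwarz[OF ff H1_D(2)[OF 1]])
    ultimately show ?thesis unfolding load_def C_def distrib_right mult.assoc by linarith
  qed
  moreover have "C \<ge> 0" using K(1) by (simp add: C_def)
  ultimately show ?thesis by (rule that[rotated])
qed

text \<open>The exponent 2 q is written as \<open>2 * q - 3 + 3\<close> to match the abstract
  \<open>k + 3\<close>; q >= 2 makes the natural subtraction exact. \<open>C\<close> is the root
  that turns the bound for the power into a norm bound.\<close>

lemma energy_space_H10:
  fixes A :: "real^'d \<Rightarrow> real^'d^'d"
  assumes psd: "psd_form (H10 U) (a_form U A)" and \<mu>: "\<mu> > 0"
    and coerc: "\<And>v. v \<in> H10 U \<Longrightarrow> \<mu> * grad_energy v \<le> a_form U A v v"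
    and q: "q \<ge> 2" and dim: "CARD('d) * q + 1 \<le> 2 * q + CARD('d)"
  obtains C where "energy_space (H10 U) (a_form U A) M (2 * q - 3) C"
proof -
  interpret psd_form "H10 U" "a_form U A" by (rule psd)
  have q0: "q > 0" and p: "2 * q - 3 + 3 = 2 * q" using q by auto
  obtain K where K: "K \<ge> 0" "\<And>v. v \<in> H10 U \<Longrightarrow> integrable M (\<lambda>x. v x ^ (2 * q))"
    "\<And>v. v \<in> H10 U \<Longrightarrow> (LINT x|M. v x ^ (2 * q)) \<le> K * grad_energy v ^ q"
    by (rule sobolev_H10[OF q0 dim], rule that)
  have ge: "grad_energy v \<le> a_form U A v v / \<mu>" if "v \<in> H10 U" for v
    using coerc[OF that] \<mu> by (simp add: field_simps)
  define C where "C = root (2 * q) (K / \<mu> ^ q)"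
  have C: "C \<ge> 0" unfolding C_def by (rule real_root_pos_pos_le) (use K(1) \<mu> in simp)
  have Cq: "C ^ (2 * q) = K / \<mu> ^ q" using K(1) \<mu> q0 by (simp add: C_def)
  have even_abs: "\<bar>t\<bar> ^ (2 * q) = t ^ (2 * q)" for t :: real by (simp add: power_even_abs)
  have "energy_space (H10 U) (a_form U A) M (2 * q - 3) C"
  proof (intro energy_space.intro psd energy_space_axioms.intro)
    show "finite_measure M" by (rule finite_measure_M)
    show "0 \<le> C" by (rule C)
    show "Lp_le M (2 * q - 3 + 3) v (C * nrm v)" if v: "v \<in> H10 U" for v
    proof -
      have "(LINT x|M. \<bar>v x\<bar> ^ (2 * q)) \<le> K * grad_energy v ^ q" using K(3)[OF v] by (simp add: even_abs)
      also have "\<dots> \<le> K * (a_form U A v v / \<mu>) ^ q"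
        using K(1) ge[OF v] grad_energy_nonneg by (intro mult_left_mono power_mono) auto
      also have "\<dots> = (C * nrm v) ^ (2 * q)"
        unfolding power_mult_distrib Cq by (simp add: power_mult nrm_square[OF v] power_divide)
      finally show ?thesis unfolding p Lp_le_def
        using Lp2_measurable[OF H1_D(1)[OF H10_H1[OF v]]] K(2)[OF v] C nrm_nonneg[OF v] by (simp add: even_abs)
    qed
    fix w :: "nat \<Rightarrow> real^'d \<Rightarrow> real"
    assume w: "\<And>j. w j \<in> H10 U" and w1: "\<And>j. a_form U A (w j) (w j) \<le> 1"
      and lim: "\<And>S. S \<in> sets M \<Longrightarrow> (\<lambda>j. LINT x|M. indicator S x * w j x) \<longlonglongrightarrow> 0"
    have "grad_energy (w j) \<le> 1 / \<mu>" for j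
      using ge[OF w[of j]] w1[of j] \<mu> by (smt (verit) divide_right_mono)
    from rellich_H10[OF q0 dim w this lim]
    show "(\<lambda>j. LINT x|M. \<bar>w j x\<bar> ^ (2 * q - 3 + 3)) \<longlonglongrightarrow> 0" unfolding p even_abs .
  qed
  then show ?thesis by (rule that)
qed

end

section \<open>The model problem as an instance of the abstract Galerkin setting\<close>

theorem lemma30:
  fixes \<Omega> :: "(real^'d) set" and T0 :: "(real^'d) tsimplex set" and m :: nat
    and f g :: "real^'d \<Rightarrow> real" and ff gg :: "real^'d \<Rightarrow> real^'d"
    and A :: "real^'d \<Rightarrow> real^'d^'d" and b :: "real^'d \<Rightarrow> real \<Rightarrow> real"
    and u z :: "real^'d \<Rightarrow> real"
    and \<theta> :: real and Cmark :: ereal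
    and M :: "nat \<Rightarrow> (real^'d) tsimplex set" and ul zl :: "nat \<Rightarrow> real^'d \<Rightarrow> real"
    and \<delta> :: real
  assumes dim: "CARD('d) \<in> {1, 2, 3}"
    and domain: "bounded \<Omega>" "lipschitz_domain \<Omega>"
    and mesh0: "conforming_mesh \<Omega> T0"
    and degree: "m \<ge> 1"
    and data: "f \<in> Lp 2 (lebesgue_on \<Omega>)" "g \<in> Lp 2 (lebesgue_on \<Omega>)"
      "ff \<in> Lp 2 (lebesgue_on \<Omega>)" "gg \<in> Lp 2 (lebesgue_on \<Omega>)"
    and RHS: "assm_RHS \<Omega> T0 f ff g gg"
    and ELL: "assm_ELL \<Omega> T0 A"
    and CAR: "assm_CAR \<Omega> b"
    and MON: "assm_MON \<Omega> b"
    and CGC: "assm_CGC \<Omega> b"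
    and u: "primal_solution \<Omega> A b f ff (H10 \<Omega>) u"
    and z: "dual_solution \<Omega> A b g gg (H10 \<Omega>) u z"
    and params: "0 < \<theta>" "\<theta> \<le> 1" "1 \<le> Cmark"
    and run: "adaptive_run \<Omega> T0 m A b f ff g gg \<theta> Cmark M ul zl"
    and conv: "(\<lambda>l. norm_A \<Omega> A (\<lambda>x. z x - zl l x)) \<longlonglongrightarrow> 0"
    and delta: "0 < \<delta>" "\<delta> < 1"
  shows "\<exists>l0::nat. \<forall>l\<ge>l0. \<forall>k.
    ((norm_A \<Omega> A (\<lambda>x. u x - ul (l + k) x))\<^sup>2 + (norm_A \<Omega> A (\<lambda>x. z x - zl (l + k) x))\<^sup>2) +
    ((norm_A \<Omega> A (\<lambda>x. ul (l + k) x - ul l x))\<^sup>2 + (norm_A \<Omega> A (\<lambda>x. zl (l + k) x - zl l x))\<^sup>2)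
    \<le> 1 / (1 - \<delta>) *
      ((norm_A \<Omega> A (\<lambda>x. u x - ul l x))\<^sup>2 + (norm_A \<Omega> A (\<lambda>x. z x - zl l x))\<^sup>2)"
proof -
  have bo: "bounded_open \<Omega>"
    using domain by unfold_locales (simp_all add: lipschitz_domain_def)
  interpret dom: bounded_open \<Omega> by (rule bo)
  have A: "A \<in> Linf (lebesgue_on \<Omega>)" and A_sym: "\<And>x. x \<in> \<Omega> \<Longrightarrow> transpose (A x) = A x"
    using ELL by (auto simp: assm_ELL_def)
  obtain \<mu> where \<mu>: "\<mu> > 0" "\<And>x \<xi>. x \<in> \<Omega> \<Longrightarrow> \<mu> * (norm \<xi>)\<^sup>2 \<le> (A x *v \<xi>) \<bullet> \<xi>"
    by (rule assm_ELL_coercive[OF ELL], rule that)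
  have psd: "psd_form (H10 \<Omega>) (a_form \<Omega> A)"
    by (rule dom.a_form_psd(1)[OF A A_sym \<mu>])
  interpret psd_form "H10 \<Omega>" "a_form \<Omega> A" by (rule psd)
  have nrm: "nrm v = norm_A \<Omega> A v" for v by (simp add: nrm_def norm_A_def)
  have coerc: "\<mu> * dom.grad_energy v \<le> a_form \<Omega> A v v" if "v \<in> H10 \<Omega>" for v
    by (rule dom.a_form_psd(2)[OF A A_sym \<mu> that])
  obtain n R where n: "n \<ge> 2" "CARD('d) = 3 \<longrightarrow> n \<le> 3" and R: "R > 0"
    and growth: "\<And>x \<xi> j. x \<in> \<Omega> \<Longrightarrow> j \<le> n \<Longrightarrow> \<bar>(deriv ^^ j) (b x) \<xi>\<bar> \<le> R * (1 + \<bar>\<xi>\<bar> ^ (n - j))"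
    using CGC unfolding assm_CGC_def by blast
  \<comment> \<open>For d = 3 the dimension condition admits no q above 2; then k = 2 q - 3 = 1, and
    n <= k + 2 = 3. For d <= 2 every q is admissible, and q = n + 2 is large enough for n.\<close>
  define q where "q = (if CARD('d) = 3 then 2 else n + 2)"
  have q: "q \<ge> 2" "n \<le> 2 * q - 3 + 2" using n by (auto simp: q_def)
  have qdim: "CARD('d) * q + 1 \<le> 2 * q + CARD('d)" using dim by (auto simp: q_def)
  obtain C where es: "energy_space (H10 \<Omega>) (a_form \<Omega> A) (lebesgue_on \<Omega>) (2 * q - 3) C"
    by (rule dom.energy_space_H10[OF psd \<mu>(1) _ q(1) qdim], rule coerc) (assumption, rule that)
  \<comment> \<open>Membership of \<open>x\<close> is a premise both of the lemma and of
    \<open>growth\<close>, hence the repeated argument where these facts are used.\<close>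
  note reaction = reaction_growth[OF CAR _ n(1) q(2) R growth]
  have CAR_measurable: "(\<lambda>x. (deriv ^^ j) (b x) \<xi>) \<in> borel_measurable (lebesgue_on \<Omega>)" for j \<xi>
    using CAR by (simp add: assm_CAR_def)
  have CAR_cont: "isCont ((deriv ^^ j) (b x)) \<xi>" if "x \<in> \<Omega>" for j x \<xi>
    using CAR that by (simp add: assm_CAR_def differentiable_imp_continuous_within)
  obtain CF where CF: "CF \<ge> 0" "\<And>v. v \<in> H10 \<Omega> \<Longrightarrow> \<bar>load \<Omega> f ff v\<bar> \<le> CF * sqrt (dom.grad_energy v)"
    by (rule dom.load_bound[OF data(1,3)], rule that)
  have M0: "M 0 = T0" and sols: "primal_solution \<Omega> A b f ff (fem_space \<Omega> m (M l)) (ul l)"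
    "dual_solution \<Omega> A b g gg (fem_space \<Omega> m (M l)) (ul l) (zl l)"
    and ref: "M (Suc l) \<in> nvb_refinements \<Omega> (M l)" for l
    using run unfolding adaptive_run_def is_refine_def by blast+
  have conf: "conforming_mesh \<Omega> (M l)" for l
    by (induction l) (use M0 mesh0 ref in \<open>auto simp: nvb_refinements_def\<close>)
  \<comment> \<open>The constant 2 R comes from the growth estimate; dividing by the root of \<mu>
    converts the load bound from the Dirichlet energy to the energy norm.\<close>
  have "galerkin (H10 \<Omega>) (a_form \<Omega> A) (lebesgue_on \<Omega>) (2 * q - 3) C b (2 * R)
      (\<lambda>l. fem_space \<Omega> m (M l)) (load \<Omega> f ff) (load \<Omega> g gg) (CF / sqrt \<mu>) u z ul zl"
  proof (intro galerkin.intro semilinear.intro es semilinear_axioms.intro galerkin_axioms.intro)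
    show "0 \<le> 2 * R" using R by simp
    fix v :: "real^'d \<Rightarrow> real" assume v: "v \<in> borel_measurable (lebesgue_on \<Omega>)"
    show "(\<lambda>x. b x (v x)) \<in> borel_measurable (lebesgue_on \<Omega>)"
      by (rule Caratheodory_measurable[OF _ _ v]) (use CAR_measurable[of 0] CAR_cont[where j = 0] in simp_all)
    show "(\<lambda>x. deriv (b x) (v x)) \<in> borel_measurable (lebesgue_on \<Omega>)"
      by (rule Caratheodory_measurable[OF _ _ v]) (use CAR_measurable[of 1] CAR_cont[where j = 1] in simp_all)
  next
    fix x \<xi> \<eta> assume "x \<in> space (lebesgue_on \<Omega>)"
    then have x: "x \<in> \<Omega>" by simp
    show "(b x has_real_derivative deriv (b x) \<xi>) (at \<xi>)" by (rule reaction(1)[OF x x])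
    show "0 \<le> deriv (b x) \<xi>" "b x 0 = 0" using MON x by (auto simp: assm_MON_def)
    show "\<bar>deriv (b x) \<xi>\<bar> \<le> 2 * R * (1 + \<bar>\<xi>\<bar>) ^ (2 * q - 3 + 1)" by (rule reaction(2)[OF x x])
    show "\<bar>deriv (b x) \<xi> - deriv (b x) \<eta>\<bar> \<le> 2 * R * (1 + \<bar>\<xi>\<bar> + \<bar>\<eta>\<bar>) ^ (2 * q - 3) * \<bar>\<xi> - \<eta>\<bar>"
      by (rule reaction(3)[OF x x])
  next
    fix l
    show "fem_space \<Omega> m (M l) \<subseteq> H10 \<Omega>" by (auto simp: fem_space_def)
    show "fem_space \<Omega> m (M l) \<subseteq> fem_space \<Omega> m (M (Suc l))" by (rule fem_space_mono[OF ref conf])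
    show "ul l \<in> fem_space \<Omega> m (M l)" "zl l \<in> fem_space \<Omega> m (M l)"
      using sols[of l] by (auto simp: primal_solution_def dual_solution_def)
  next
    fix v w l c assume v: "v \<in> fem_space \<Omega> m (M l)"
    show "(\<lambda>x. c * v x) \<in> fem_space \<Omega> m (M l)" by (rule fem_space_scale[OF bo v])
    show "a_form \<Omega> A (ul l) v + (LINT x|lebesgue_on \<Omega>. b x (ul l x) * v x) = load \<Omega> f ff v"
      using sols(1)[of l] v by (simp add: primal_solution_def)
    show "a_form \<Omega> A (zl l) v + (LINT x|lebesgue_on \<Omega>. deriv (b x) (ul l x) * zl l x * v x) = load \<Omega> g gg v"
      using sols(2)[of l] v by (simp add: dual_solution_def)
    assume "w \<in> fem_space \<Omega> m (M l)"
    then show "(\<lambda>x. v x + w x) \<in> fem_space \<Omega> m (M l)" by (rule fem_space_add[OF bo v])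
  next
    fix v w assume v: "v \<in> H10 \<Omega>"
    show "a_form \<Omega> A u v + (LINT x|lebesgue_on \<Omega>. b x (u x) * v x) = load \<Omega> f ff v"
      using u v by (simp add: primal_solution_def)
    show "a_form \<Omega> A z v + (LINT x|lebesgue_on \<Omega>. deriv (b x) (u x) * z x * v x) = load \<Omega> g gg v"
      using z v by (simp add: dual_solution_def)
    show "\<bar>load \<Omega> f ff v\<bar> \<le> CF / sqrt \<mu> * nrm v"
    proof -
      have "sqrt (\<mu> * dom.grad_energy v) \<le> nrm v"
        unfolding nrm_def by (rule real_sqrt_le_mono[OF coerc[OF v]])
      then have "sqrt (dom.grad_energy v) \<le> nrm v / sqrt \<mu>"
        using \<mu>(1) by (simp add: real_sqrt_mult field_simps)
      then have "CF * sqrt (dom.grad_energy v) \<le> CF * (nrm v / sqrt \<mu>)"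
        by (rule mult_left_mono[OF _ CF(1)])
      then show ?thesis using CF(2)[OF v] by simp
    qed
    assume w: "w \<in> H10 \<Omega>"
    show "load \<Omega> f ff (\<lambda>x. v x + w x) = load \<Omega> f ff v + load \<Omega> f ff w"
      by (rule dom.load_add[OF data(1,3) v w])
  next
    show "u \<in> H10 \<Omega>" "z \<in> H10 \<Omega>" using u z by (auto simp: primal_solution_def dual_solution_def)
    show "(\<lambda>l. nrm (\<lambda>x. z x - zl l x)) \<longlonglongrightarrow> 0" unfolding nrm by (rule conv)
  qed
  from galerkin.quasi_orthogonality[OF this delta] show ?thesis unfolding nrm .
qed

end
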